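(* Let $Z \subseteq \mathbb{P}^n$ be a nonempty finite set of points and suppose that $D_0(\mathcal{A}_Z)$ has splitting type $(a_1,\ldots,a_n)$. Then for every fixed integer $d\ge 1$, $$\sum_{i=1}^n \max\{0,d-a_i\} \;\geq\; nd+1-\mathrm{Ex.C}(Z,d),$$ and the inequality is strict if and only if $Z$ admits very unexpected hypersurfaces in degree $d$.
   Context: $\mathbb{K}$ is an algebraically closed field of arbitrary characteristic and $n\ge 2$. $R=\mathbb{K}[X_0,\ldots,X_n]$ is the coordinate ring of $\mathbb{P}^n$, $S=\mathbb{K}[Y_0,\ldots,Y_n]$ is the coordinate ring of the dual projective space, and $[M]_d$ is the degree $d$ part of a graded module $M$. "Subspace" means linear subspace. Dual arrangement: for a finite set $Z\subseteq\mathbb{P}^n$, $\mathcal{A}_Z$ is the arrangement in the dual projective space consisting of the hyperplanes $\{\sum_i c_iY_i=0\}$ for $(c_0:\cdots:c_n)\in Z$. Derivations: for a hyperplane arrangement $\mathcal{A}$, $D(\mathcal{A})$ is the $S$-module of $\mathbb{K}$-linear derivations $\theta:S\to S$ with $\theta(I(H))\subseteq I(H)$ for all $H\in\mathcal{A}$, graded so that $\deg\theta=\deg\theta(\ell)$ for linear forms $\ell$. $\theta_e=\sum_i Y_i\,\partial/\partial Y_i$ and $D_0(\mathcal{A})=D(\mathcal{A})/S\theta_e$. Splitting type: for nonempty $\mathcal{A}$, the splitting type of $D_0(\mathcal{A})$ is the unique tuple of integers $0\le a_1\leq\cdots\leq a_n$ such that, for a general line $L$, the restriction to $L$ of the sheaf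 $\widetilde{D_0(\mathcal{A})}$ is isomorphic to $\bigoplus_{i=1}^n\mathcal{O}_L(-a_i)$. Very unexpected hypersurfaces (case of codimension $2$ and multiplicity $d-1$): let $Q\subseteq\mathbb{P}^n$ be a generic linear subspace of codimension $2$ (each condition below involving $Q$ is required to hold for $Q$ general). $Z$ admits very unexpected hypersurfaces in degree $d$ if there is a subset $U\subseteq Z$ such that (I) $[I(Z)\cap I(Q)^{d-1}]_d=[I(U)\cap I(Q)^{d-1}]_d$; (II) for every irreducible subvariety $X\subseteq\mathbb{P}^n$, $|U\cap X|\leq\dim_{\mathbb{K}}[I(Q)^{d-1}/(I(X)\cap I(Q)^{d-1})]_d$; (III) $\dim_{\mathbb{K}}[R/I(U)]_d>\dim_{\mathbb{K}}[I(Q)^{d-1}/(I(U)\cap I(Q)^{d-1})]_d$. $\mathrm{Ex.C}(Z,d)$ is the minimum of $\sum_{i=0}^s(d\dim H_i+1)$ over all finite collections $\{H_0,\ldots,H_s\}$ of nonempty linear subspaces of $\mathbb{P}^n$ with $Z\subseteq\bigcup_{i=0}^sH_i$. *)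

theory Defs
  imports
    "HOL-Analysis.Analysis"
    "HOL-Library.Poly_Mapping"
    "HOL-Library.Function_Algebras"
    "HOL-Computational_Algebra.Polynomial"
begin

text \<open>
  The finite index type \<open>'v\<close> plays the role of \<open>{0,...,n}\<close>, so projective \<open>n\<close>-space is
  the projective space of \<open>'k ^ 'v\<close> with \<open>CARD('v) = n + 1\<close>. Projective space and its dual share
  this model, as do their coordinate rings \<open>R\<close> and \<open>S\<close>; the pairing is \<open>\<Sum>i. c $ i * y $ i\<close>.
\<close>

section \<open>Polynomials\<close>

type_synonym ('v, 'k) mpoly = "('v \<Rightarrow>\<^sub>0 nat) \<Rightarrow>\<^sub>0 'k"

definition Const :: "'k \<Rightarrow> ('v, 'k::comm_ring_1) mpoly" where
  "Const c = Poly_Mapping.single 0 c"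

definition Var :: "'v \<Rightarrow> ('v, 'k::comm_ring_1) mpoly" where
  "Var i = Poly_Mapping.single (Poly_Mapping.single i 1) 1"

definition meval :: "('v, 'k::comm_ring_1) mpoly \<Rightarrow> ('v \<Rightarrow> 'k) \<Rightarrow> 'k" where
  "meval f x =
     (\<Sum>m\<in>Poly_Mapping.keys f. Poly_Mapping.lookup f m *
        (\<Prod>i\<in>Poly_Mapping.keys m. x i ^ Poly_Mapping.lookup m i))"

definition partial_deriv :: "'v \<Rightarrow> ('v, 'k::comm_ring_1) mpoly \<Rightarrow> ('v, 'k) mpoly" where
  "partial_deriv i f =
     (\<Sum>m\<in>Poly_Mapping.keys f. Poly_Mapping.single (m - Poly_Mapping.single i 1)
        (of_nat (Poly_Mapping.lookup m i) * Poly_Mapping.lookup f m))"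

text \<open>The degree is an integer, so that \<open>hom_part j = {0}\<close> for negative \<open>j\<close>.\<close>

definition hom_part :: "int \<Rightarrow> ('v::finite, 'k::comm_ring_1) mpoly set" where
  "hom_part j = {f. \<forall>m\<in>Poly_Mapping.keys f. int (\<Sum>i\<in>UNIV. Poly_Mapping.lookup m i) = j}"

definition ideal_generated :: "'a::comm_ring_1 set \<Rightarrow> 'a set" where
  "ideal_generated = module.span (*)"

global_interpretation mpoly_vs: vector_space "\<lambda>(c::'k::field) (p::('v, 'k) mpoly). Const c * p"
proof
  fix a b :: 'k and x :: "('v, 'k) mpoly"
  show "Const (a + b) * x = Const a * x + Const b * x"
    by (simp add: Const_def single_add distrib_right)
  show "Const a * (Const b * x) = Const (a * b) * x"
    by (simp add: Const_def mult_single mult.assoc[symmetric])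
  show "Const 1 * x = x"
    by (simp add: Const_def)
qed (rule distrib_left)

primrec ideal_power :: "'a::comm_ring_1 set \<Rightarrow> nat \<Rightarrow> 'a set" where
  "ideal_power I 0 = UNIV"
| "ideal_power I (Suc k) = ideal_generated {a * b | a b. a \<in> I \<and> b \<in> ideal_power I k}"

text \<open>
  The dimension of \<open>M / N\<close>, for subspaces \<open>N \<subseteq> M\<close> with finite-dimensional quotient: \<open>B\<close> is a set of
  representatives of a basis of the quotient.
\<close>

definition quot_dim :: "('v, 'k::field) mpoly set \<Rightarrow> ('v, 'k) mpoly set \<Rightarrow> nat" where
  "quot_dim M N = (THE r. \<exists>B. finite B \<and> card B = r \<and> B \<subseteq> M \<and>
     (\<forall>c. (\<Sum>b\<in>B. Const (c b) * b) \<in> N \<longrightarrow> (\<forall>b\<in>B. c b = 0)) \<and>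
     M \<subseteq> mpoly_vs.span (B \<union> N))"


section \<open>Projective space\<close>

text \<open>A point is the one-dimensional subspace consisting of its homogeneous coordinate vectors and 0.\<close>

definition proj_points :: "('k::field ^ 'v::finite) set set" where
  "proj_points = {P. vec.subspace P \<and> vec.dim P = 1}"

definition vanishes_at :: "('v, 'k) mpoly \<Rightarrow> ('k::field ^ 'v::finite) set \<Rightarrow> bool" where
  "vanishes_at f P \<longleftrightarrow> (\<forall>x\<in>P - {0}. meval f (($) x) = 0)"

text \<open>
  Vanishing at all coordinate vectors of a point makes this a homogeneous ideal over an infinite
  field.
\<close>

definition vanishing_ideal :: "('k::field ^ 'v::finite) set set \<Rightarrow> ('v, 'k) mpoly set" where
  "vanishing_ideal X = {f. \<forall>P\<in>X. vanishes_at f P}"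

definition zariski_closed :: "('k::field ^ 'v::finite) set set \<Rightarrow> bool" where
  "zariski_closed X \<longleftrightarrow> (\<exists>F. (\<forall>f\<in>F. \<exists>j. f \<in> hom_part j) \<and>
     X = {P \<in> proj_points. \<forall>f\<in>F. vanishes_at f P})"

definition irreducible_subvariety :: "('k::field ^ 'v::finite) set set \<Rightarrow> bool" where
  "irreducible_subvariety X \<longleftrightarrow> zariski_closed X \<and> X \<noteq> {} \<and>
     (\<forall>A B. zariski_closed A \<and> zariski_closed B \<and> X = A \<union> B \<longrightarrow> X = A \<or> X = B)"

text \<open>
  A linear subspace of projective space is given by a vector subspace \<open>W\<close>; its projective dimension
  is \<open>vec.dim W - 1\<close>.
\<close>

definition proj_set :: "('k::field ^ 'v::finite) set \<Rightarrow> ('k ^ 'v) set set" where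
  "proj_set W = {P \<in> proj_points. P \<subseteq> W}"

text \<open>
  \<open>general_subspace r P\<close>: \<open>P\<close> holds on a nonempty open subset of the Grassmannian of
  \<open>r\<close>-dimensional vector subspaces. The Grassmannian is the quotient of the space of
  \<open>r\<close>-frames \<open>b 0, ..., b (r - 1)\<close> by \<open>GL\<^sub>r\<close>, the quotient map being open; so it is the same to have
  \<open>P\<close> on the spans of the frames in a nonempty basic open set \<open>F \<noteq> 0\<close>. The entries of \<open>b\<close> from
  index \<open>r\<close> on are irrelevant: they can be specialised to constants in \<open>F\<close>.
\<close>

definition general_subspace :: "nat \<Rightarrow> (('k::field ^ 'v::finite) set \<Rightarrow> bool) \<Rightarrow> bool" where
  "general_subspace r P \<longleftrightarrow> (\<exists>F :: ('v \<times> nat, 'k) mpoly.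
     (\<exists>b :: nat \<Rightarrow> 'k ^ 'v. vec.dim (b ` {..<r}) = r \<and> meval F (\<lambda>(i, j). b j $ i) \<noteq> 0) \<and>
     (\<forall>b :: nat \<Rightarrow> 'k ^ 'v. vec.dim (b ` {..<r}) = r \<and> meval F (\<lambda>(i, j). b j $ i) \<noteq> 0 \<longrightarrow>
        P (vec.span (b ` {..<r}))))"


section \<open>Arrangements and derivations\<close>

definition dual_hyperplane :: "('k::field ^ 'v::finite) set \<Rightarrow> ('k ^ 'v) set set" where
  "dual_hyperplane P = {M \<in> proj_points. \<forall>c\<in>P. \<forall>y\<in>M. (\<Sum>i\<in>UNIV. c $ i * y $ i) = 0}"

definition dual_arrangement :: "('k::field ^ 'v::finite) set set \<Rightarrow> ('k ^ 'v) set set set" where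
  "dual_arrangement Z = dual_hyperplane ` Z"

definition derivation :: "(('v, 'k::comm_ring_1) mpoly \<Rightarrow> ('v, 'k) mpoly) \<Rightarrow> bool" where
  "derivation \<theta> \<longleftrightarrow> (\<forall>f g. \<theta> (f + g) = \<theta> f + \<theta> g) \<and> (\<forall>c f. \<theta> (Const c * f) = Const c * \<theta> f) \<and>
     (\<forall>f g. \<theta> (f * g) = f * \<theta> g + g * \<theta> f)"

definition log_derivations ::
    "('k::field ^ 'v::finite) set set set \<Rightarrow> (('v, 'k) mpoly \<Rightarrow> ('v, 'k) mpoly) set" where
  "log_derivations \<A> = {\<theta>. derivation \<theta> \<and>
     (\<forall>H\<in>\<A>. \<theta> ` vanishing_ideal H \<subseteq> vanishing_ideal H)}"

definition log_derivations_part ::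
    "('k::field ^ 'v::finite) set set set \<Rightarrow> int \<Rightarrow> (('v, 'k) mpoly \<Rightarrow> ('v, 'k) mpoly) set" where
  "log_derivations_part \<A> j = {\<theta> \<in> log_derivations \<A>. \<forall>l\<in>hom_part 1. \<theta> l \<in> hom_part j}"

definition euler_derivation :: "('v::finite, 'k::comm_ring_1) mpoly \<Rightarrow> ('v, 'k) mpoly" where
  "euler_derivation f = (\<Sum>i\<in>UNIV. Var i * partial_deriv i f)"


section \<open>Sheaves associated with graded modules\<close>

text \<open>
  All graded modules needed are subquotients of modules of functions \<open>'x \<Rightarrow> S\<close> with pointwise
  operations. A graded module \<open>M / N\<close> is given by the homogeneous parts \<open>M j\<close> of its numerator
  and by the submodule \<open>N\<close>.
\<close>

definition smul :: "'s::comm_ring_1 \<Rightarrow> ('x \<Rightarrow> 's) \<Rightarrow> 'x \<Rightarrow> 's" where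
  "smul s m = (\<lambda>x. s * m x)"

global_interpretation fun_mod: module "smul :: 's::comm_ring_1 \<Rightarrow> ('x \<Rightarrow> 's) \<Rightarrow> 'x \<Rightarrow> 's"
  by standard (simp_all only: smul_def fun_eq_iff plus_fun_apply distrib_left distrib_right
    mult.assoc mult_1_left simp_thms)

text \<open>
  For \<open>f\<close> homogeneous of degree \<open>e > 0\<close>, the sections over the basic open set \<open>D\<^sub>+(f)\<close> of the sheaf
  associated with \<open>M / N\<close> are the elements of degree 0 in the localisation of \<open>M / N\<close> at \<open>f\<close>.
  A pair \<open>(m, k)\<close> stands for \<open>m / f^k\<close>.
\<close>

definition fracs :: "(int \<Rightarrow> ('x \<Rightarrow> ('v, 'k::comm_ring_1) mpoly) set) \<Rightarrow> nat \<Rightarrow>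
    (('x \<Rightarrow> ('v, 'k) mpoly) \<times> nat) set" where
  "fracs M e = {(m, k). m \<in> M (int (k * e))}"

definition frac_eq :: "(int \<Rightarrow> ('x \<Rightarrow> ('v, 'k::comm_ring_1) mpoly) set) \<Rightarrow>
    ('x \<Rightarrow> ('v, 'k) mpoly) set \<Rightarrow> nat \<Rightarrow> ('v, 'k) mpoly \<Rightarrow>
    ((('x \<Rightarrow> ('v, 'k) mpoly) \<times> nat) \<times> (('x \<Rightarrow> ('v, 'k) mpoly) \<times> nat)) set" where
  "frac_eq M N e f = {((m, k), (m', k')). (m, k) \<in> fracs M e \<and> (m', k') \<in> fracs M e \<and>
     (\<exists>j. smul (f ^ j) (smul (f ^ k') m - smul (f ^ k) m') \<in> N)}"

definition sections :: "(int \<Rightarrow> ('x \<Rightarrow> ('v, 'k::comm_ring_1) mpoly) set) \<Rightarrow>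
    ('x \<Rightarrow> ('v, 'k) mpoly) set \<Rightarrow> nat \<Rightarrow> ('v, 'k) mpoly \<Rightarrow>
    (('x \<Rightarrow> ('v, 'k) mpoly) \<times> nat) set set" where
  "sections M N e f = fracs M e // frac_eq M N e f"

definition sec_add where
  "sec_add M N e f s t = (\<Union>(m, k)\<in>s. \<Union>(m', k')\<in>t.
     frac_eq M N e f `` {(smul (f ^ k') m + smul (f ^ k) m', k + k')})"

text \<open>Multiplication by \<open>r / f^l\<close>, where \<open>r\<close> has degree \<open>l * e\<close>.\<close>

definition sec_scale where
  "sec_scale M N e f r l s = (\<Union>(m, k)\<in>s. frac_eq M N e f `` {(smul r m, l + k)})"

text \<open>Restriction from \<open>D\<^sub>+(f)\<close> to \<open>D\<^sub>+(f * g)\<close>, where \<open>g\<close> has degree \<open>e'\<close>.\<close>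

definition sec_restrict where
  "sec_restrict M N e f e' g s =
     (\<Union>(m, k)\<in>s. frac_eq M N (e + e') (f * g) `` {(smul (g ^ k) m, k)})"

text \<open>
  An isomorphism of the sheaves of modules associated with \<open>M / N\<close> and \<open>M' / N'\<close>: a family of
  module isomorphisms over the basic open sets that is compatible with the restriction maps.
\<close>

definition sheaf_iso :: "(int \<Rightarrow> ('x \<Rightarrow> ('v::finite, 'k::comm_ring_1) mpoly) set) \<Rightarrow>
    ('x \<Rightarrow> ('v, 'k) mpoly) set \<Rightarrow> (int \<Rightarrow> ('y \<Rightarrow> ('v, 'k) mpoly) set) \<Rightarrow>
    ('y \<Rightarrow> ('v, 'k) mpoly) set \<Rightarrow> bool" where
  "sheaf_iso M N M' N' \<longleftrightarrow> (\<exists>\<phi>. \<forall>e>0. \<forall>f\<in>hom_part (int e).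
     bij_betw (\<phi> e f) (sections M N e f) (sections M' N' e f) \<and>
     (\<forall>s\<in>sections M N e f. \<forall>t\<in>sections M N e f.
        \<phi> e f (sec_add M N e f s t) = sec_add M' N' e f (\<phi> e f s) (\<phi> e f t)) \<and>
     (\<forall>s\<in>sections M N e f. \<forall>l. \<forall>r\<in>hom_part (int (l * e)).
        \<phi> e f (sec_scale M N e f r l s) = sec_scale M' N' e f r l (\<phi> e f s)) \<and>
     (\<forall>s\<in>sections M N e f. \<forall>e'. \<forall>g\<in>hom_part (int e').
        \<phi> (e + e') (f * g) (sec_restrict M N e f e' g s) =
        sec_restrict M' N' e f e' g (\<phi> e f s)))"

text \<open>
  The restriction to a closed subscheme with ideal \<open>I\<close> of the sheaf associated with a graded module
  \<open>E\<close> is the sheaf associated with \<open>E / I E\<close>. For \<open>E = D(\<A>) / S \<theta>\<^sub>e\<close> this is the quotient of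
  \<open>D(\<A>)\<close> by the following submodule.
\<close>

definition D0_restrict_rel :: "('k::field ^ 'v::finite) set set set \<Rightarrow> ('v, 'k) mpoly set \<Rightarrow>
    (('v, 'k) mpoly \<Rightarrow> ('v, 'k) mpoly) set" where
  "D0_restrict_rel \<A> I =
     fun_mod.span ({euler_derivation} \<union> {smul g \<theta> | g \<theta>. g \<in> I \<and> \<theta> \<in> log_derivations \<A>})"

text \<open>
  With \<open>S\<^sub>L = S / I\<close>, the sum of the sheaves \<open>O\<^sub>L(- a i)\<close>, \<open>i \<in> J\<close>, is associated with the direct sum
  of the shifted modules \<open>S\<^sub>L(- a i)\<close>, that is, with \<open>twist_sum J a\<close> modulo \<open>twist_rel J I\<close>.
\<close>

definition twist_sum :: "nat set \<Rightarrow> (nat \<Rightarrow> int) \<Rightarrow> int \<Rightarrow>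
    (nat \<Rightarrow> ('v::finite, 'k::comm_ring_1) mpoly) set" where
  "twist_sum J a j = {h. (\<forall>i\<in>J. h i \<in> hom_part (j - a i)) \<and> (\<forall>i. i \<notin> J \<longrightarrow> h i = 0)}"

definition twist_rel :: "nat set \<Rightarrow> ('v, 'k::comm_ring_1) mpoly set \<Rightarrow>
    (nat \<Rightarrow> ('v, 'k) mpoly) set" where
  "twist_rel J I = {h. (\<forall>i\<in>J. h i \<in> I) \<and> (\<forall>i. i \<notin> J \<longrightarrow> h i = 0)}"

text \<open>\<open>a 1, ..., a n\<close>, where \<open>n = CARD('v) - 1\<close>, is the splitting type of \<open>D\<^sub>0(\<A>)\<close>.\<close>

definition has_splitting_type ::
    "('k::field ^ 'v::finite) set set set \<Rightarrow> (nat \<Rightarrow> int) \<Rightarrow> bool" where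
  "has_splitting_type \<A> a \<longleftrightarrow>
     (\<forall>i\<in>{1..CARD('v) - 1}. 0 \<le> a i) \<and> mono_on {1..CARD('v) - 1} a \<and>
     general_subspace 2 (\<lambda>L.
       sheaf_iso (log_derivations_part \<A>) (D0_restrict_rel \<A> (vanishing_ideal (proj_set L)))
         (twist_sum {1..CARD('v) - 1} a)
         (twist_rel {1..CARD('v) - 1} (vanishing_ideal (proj_set L))))"


section \<open>Very unexpected hypersurfaces\<close>

text \<open>
  A subspace of codimension 2 in projective space corresponds to a vector subspace of dimension
  \<open>CARD('v) - 2\<close>. In the second condition the open set of admissible \<open>Q\<close> may depend on \<open>X\<close>;
  a single \<open>Q\<close> for all \<open>X\<close> would be too strong, because \<open>X\<close> could be an unexpected hypersurface
  for that \<open>Q\<close>.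
\<close>

definition very_unexpected :: "('k::field ^ 'v::finite) set set \<Rightarrow> nat \<Rightarrow> bool" where
  "very_unexpected Z d \<longleftrightarrow> (\<exists>U\<subseteq>Z.
     general_subspace (CARD('v) - 2) (\<lambda>Q.
       let J = ideal_power (vanishing_ideal (proj_set Q)) (d - 1) in
       vanishing_ideal Z \<inter> J \<inter> hom_part (int d) = vanishing_ideal U \<inter> J \<inter> hom_part (int d)) \<and>
     (\<forall>X. irreducible_subvariety X \<longrightarrow> general_subspace (CARD('v) - 2) (\<lambda>Q.
       let J = ideal_power (vanishing_ideal (proj_set Q)) (d - 1) in
       card (U \<inter> X) \<le>
         quot_dim (J \<inter> hom_part (int d)) (vanishing_ideal X \<inter> J \<inter> hom_part (int d)))) \<and>
     general_subspace (CARD('v) - 2) (\<lambda>Q.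
       let J = ideal_power (vanishing_ideal (proj_set Q)) (d - 1) in
       quot_dim (hom_part (int d)) (vanishing_ideal U \<inter> hom_part (int d)) >
         quot_dim (J \<inter> hom_part (int d)) (vanishing_ideal U \<inter> J \<inter> hom_part (int d))))"

definition Ex_C :: "('k::field ^ 'v::finite) set set \<Rightarrow> nat \<Rightarrow> nat" where
  "Ex_C Z d = (LEAST c. \<exists>\<H>. finite \<H> \<and> (\<forall>W\<in>\<H>. vec.subspace W \<and> W \<noteq> {0}) \<and>
     Z \<subseteq> (\<Union>W\<in>\<H>. proj_set W) \<and> c = (\<Sum>W\<in>\<H>. d * (vec.dim W - 1) + 1))"

end

theory Submission
  imports Defs
begin

text \<open>
  Let \<open>L\<close> be the line dual to \<open>Q\<close>. Sections of degree \<open>d - 1\<close> of the restriction of \<open>D\<^sub>0(\<A>\<^sub>Z)\<close> to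
  \<open>L\<close> come from vector fields on \<open>L\<close> that satisfy one condition for each point of \<open>Z\<close>, and these are the
  conditions that \<open>Z\<close> imposes on \<open>[I(Q)\<^sup>d\<^sup>-\<^sup>1]\<^sub>d\<close>. Hence the sum of the \<open>max 0 (d - a i)\<close> equals
  \<open>n * d + 1 - r\<close>, where \<open>r\<close> is the rank of \<open>Z\<close> on \<open>[I(Q)\<^sup>d\<^sup>-\<^sup>1]\<^sub>d\<close> for general \<open>Q\<close>.

  A linear subspace of dimension \<open>m\<close> has rank at most \<open>d * m + 1\<close>, and an irreducible variety spanning
  it has exactly this rank. So \<open>r \<le> Ex_C Z d\<close>. By Edmonds' theory of submodular functions, \<open>Ex_C\<close> is
  the rank function of the matroid of sets \<open>S\<close> with \<open>card (S \<inter> H) \<le> d * dim H + 1\<close> for all linear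
  subspaces \<open>H\<close>; independent sets of this matroid impose independent conditions on forms of degree
  \<open>d\<close>. If \<open>r < Ex_C Z d\<close>, a maximal independent set that contains a set of \<open>r\<close> points imposing
  independent conditions on \<open>[I(Q)\<^sup>d\<^sup>-\<^sup>1]\<^sub>d\<close> is the witness \<open>U\<close>. Conversely, for any witness the covering that
  attains \<open>Ex_C Z d\<close> gives \<open>r < card U \<le> Ex_C Z d\<close>.
\<close>

text \<open>The constant \<open>n * d + 1\<close> is a dimension count. In a chart of the line L, a
  vector field of degree \<open>d - 1\<close> is an (n+1)-tuple of polynomials of degree at most
  \<open>d - 1\<close>, which gives \<open>(n + 1) * d\<close> parameters. Tangency to the
  hyperplanes of \<open>Z\<close> at their points on L costs r of them, and the multiples of the
  Euler field, of dimension \<open>d - 1\<close>, are divided out. One frame \<open>b 0\<close>,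
  \<open>b 1\<close> serves both sides: L is its span and Q its annihilator. Every genericity
  statement thus becomes the nonvanishing of a polynomial in the entries of frames, and r is the
  largest rank over all frames. The obstacle on the sheaf side is that a tangent field on L is
  extended to a logarithmic derivation only after multiplication by a form of degree
  \<open>card Z - 1\<close>. Hence twisted global sections are handled as pairs of sections on two
  charts that agree on the overlap, where such factors cancel.\<close>

section \<open>Evaluation of polynomials\<close>

lemma poly_mapping_sum_single: "f = (\<Sum>m\<in>Poly_Mapping.keys f. Poly_Mapping.single m (Poly_Mapping.lookup f m))"
  by (rule poly_mapping_eqI)
    (simp add: lookup_sum lookup_single when_def in_keys_iff)

text \<open>Mapping the coefficients by \<open>h\<close> covers three uses at once: values at points
  (\<open>h\<close> the identity), substitution of polynomials (\<open>Const\<close>) and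
  restriction to parametrised lines (constant univariate polynomials).\<close>

definition geval :: "('k::comm_ring_1 \<Rightarrow> 'a::comm_ring_1) \<Rightarrow> ('v \<Rightarrow> 'a) \<Rightarrow> ('v, 'k) mpoly \<Rightarrow> 'a" where
  "geval h x f = (\<Sum>m\<in>Poly_Mapping.keys f. h (Poly_Mapping.lookup f m) *
     (\<Prod>i\<in>Poly_Mapping.keys m. x i ^ Poly_Mapping.lookup m i))"

definition is_ring_hom :: "('k::comm_ring_1 \<Rightarrow> 'a::comm_ring_1) \<Rightarrow> bool" where
  "is_ring_hom h \<longleftrightarrow> h 0 = 0 \<and> h 1 = 1 \<and> (\<forall>a b. h (a + b) = h a + h b) \<and> (\<forall>a b. h (a * b) = h a * h b)"

lemma meval_geval: "meval f x = geval (\<lambda>c. c) x f"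
  by (simp add: meval_def geval_def)

lemma is_ring_hom_id: "is_ring_hom (\<lambda>c. c)"
  by (simp add: is_ring_hom_def)

lemma is_ring_hom_Const: "is_ring_hom Const"
  by (simp add: is_ring_hom_def Const_def single_add mult_single)

lemma is_ring_hom_const_poly: "is_ring_hom (\<lambda>c::'k::comm_ring_1. [:c:])"
  by (simp add: is_ring_hom_def)

lemma Const_0 [simp]: "Const 0 = 0" and Const_1 [simp]: "Const 1 = 1"
  and Const_add: "Const (a + b) = Const a + Const b" and Const_mult: "Const (a * b) = Const a * Const b"
  by (simp_all add: Const_def single_add mult_single)

lemma Const_minus: "Const (- a) = - Const a"
  by (simp add: Const_def single_uminus)

definition mon :: "('v \<Rightarrow> 'a::comm_ring_1) \<Rightarrow> ('v \<Rightarrow>\<^sub>0 nat) \<Rightarrow> 'a" where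
  "mon x m = (\<Prod>i\<in>Poly_Mapping.keys m. x i ^ Poly_Mapping.lookup m i)"

lemma mon_superset:
  assumes "finite A" "Poly_Mapping.keys m \<subseteq> A"
  shows "mon x m = (\<Prod>i\<in>A. x i ^ Poly_Mapping.lookup m i)"
  unfolding mon_def by (rule prod.mono_neutral_left) (use assms in \<open>auto simp: in_keys_iff\<close>)

lemma mon_add: "mon x (m + n) = mon x m * mon x n"
proof -
  let ?A = "Poly_Mapping.keys m \<union> Poly_Mapping.keys n"
  have "mon x (m + n) = (\<Prod>i\<in>?A. x i ^ Poly_Mapping.lookup (m + n) i)"
    by (rule mon_superset) (auto simp: keys_add)
  also have "\<dots> = mon x m * mon x n"
    by (simp add: mon_superset[of ?A m] mon_superset[of ?A n] lookup_add power_add prod.distrib)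
  finally show ?thesis .
qed

context
  fixes h :: "'k::comm_ring_1 \<Rightarrow> 'a::comm_ring_1"
  assumes h: "is_ring_hom h"
begin

lemma h_simps: "h 0 = 0" "h 1 = 1" "h (a + b) = h a + h b" "h (a * b) = h a * h b"
  using h by (simp_all add: is_ring_hom_def)

lemma geval_superset:
  assumes "finite A" "Poly_Mapping.keys f \<subseteq> A"
  shows "geval h x f = (\<Sum>m\<in>A. h (Poly_Mapping.lookup f m) * mon x m)"
  unfolding geval_def mon_def
  by (rule sum.mono_neutral_left) (use assms in \<open>auto simp: in_keys_iff h_simps\<close>)

lemma geval_add: "geval h x (f + g) = geval h x f + geval h x g"
proof -
  let ?A = "Poly_Mapping.keys f \<union> Poly_Mapping.keys g"
  have "geval h x (f + g) = (\<Sum>m\<in>?A. h (Poly_Mapping.lookup (f + g) m) * mon x m)"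
    by (rule geval_superset) (auto simp: keys_add)
  also have "\<dots> = geval h x f + geval h x g"
    by (simp add: geval_superset[of ?A f] geval_superset[of ?A g] lookup_add h_simps
        distrib_right sum.distrib)
  finally show ?thesis .
qed

lemma geval_0 [simp]: "geval h x 0 = 0"
  by (simp add: geval_def)

lemma geval_sum: "geval h x (\<Sum>i\<in>A. f i) = (\<Sum>i\<in>A. geval h x (f i))"
  by (induction A rule: infinite_finite_induct) (simp_all add: geval_add)

lemma geval_single: "geval h x (Poly_Mapping.single m c) = h c * mon x m"
  by (cases "c = 0") (simp_all add: geval_def mon_def h_simps)

lemma geval_mult: "geval h x (f * g) = geval h x f * geval h x g"
proof -
  let ?s = "\<lambda>f m. Poly_Mapping.single m (Poly_Mapping.lookup f m)"
  have "f * g = (\<Sum>m\<in>Poly_Mapping.keys f. ?s f m) * (\<Sum>n\<in>Poly_Mapping.keys g. ?s g n)"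
    using poly_mapping_sum_single[of f] poly_mapping_sum_single[of g] by simp
  also have "\<dots> = (\<Sum>m\<in>Poly_Mapping.keys f. \<Sum>n\<in>Poly_Mapping.keys g.
      Poly_Mapping.single (m + n) (Poly_Mapping.lookup f m * Poly_Mapping.lookup g n))"
    by (simp add: sum_product mult_single)
  finally have "geval h x (f * g) = (\<Sum>m\<in>Poly_Mapping.keys f. \<Sum>n\<in>Poly_Mapping.keys g.
      (h (Poly_Mapping.lookup f m) * mon x m) * (h (Poly_Mapping.lookup g n) * mon x n))"
    by (simp add: geval_sum geval_single h_simps mon_add mult_ac)
  also have "\<dots> = geval h x f * geval h x g"
    by (simp add: sum_product[symmetric] geval_def mon_def)
  finally show ?thesis .
qed

lemma geval_Const: "geval h x (Const c) = h c"
  by (simp add: Const_def geval_single mon_def)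

lemma geval_1: "geval h x 1 = 1"
  using geval_Const[of x 1] by (simp add: h_simps)

lemma geval_Var: "geval h x (Var i) = x i"
  by (simp add: Var_def geval_single mon_def h_simps)

lemma geval_uminus: "geval h x (- f) = - geval h x f"
  using geval_add[of x f "- f"] by (simp add: eq_neg_iff_add_eq_0 add.commute)

lemma geval_diff: "geval h x (f - g) = geval h x f - geval h x g"
  using geval_add[of x f "- g"] by (simp add: geval_uminus)

lemma geval_power: "geval h x (f ^ k) = geval h x f ^ k"
  by (induction k) (simp_all add: geval_mult geval_1)

lemma geval_prod: "geval h x (\<Prod>i\<in>A. f i) = (\<Prod>i\<in>A. geval h x (f i))"
  by (induction A rule: infinite_finite_induct) (simp_all add: geval_mult geval_1)

lemmas geval_simps = geval_add geval_sum geval_mult geval_Const geval_1 geval_Var geval_uminus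
  geval_diff geval_power geval_prod

end

lemmas meval_simps = geval_simps[OF is_ring_hom_id, folded meval_geval]

lemma meval_0 [simp]: "meval 0 x = 0"
  by (simp add: meval_def)

lemma Var_power: "Var i ^ e = Poly_Mapping.single (Poly_Mapping.single i e) 1"
  by (induction e) (simp_all add: Var_def mult_single single_add[symmetric])

lemma single_eq_mon: "Poly_Mapping.single m c = Const c * (\<Prod>i\<in>Poly_Mapping.keys m. Var i ^ Poly_Mapping.lookup m i)"
proof -
  have *: "(\<Prod>i\<in>A. Var i ^ Poly_Mapping.lookup m i :: ('a, 'b) mpoly) =
    Poly_Mapping.single (\<Sum>i\<in>A. Poly_Mapping.single i (Poly_Mapping.lookup m i)) 1" for A
    by (induction A rule: infinite_finite_induct) (simp_all add: Var_power mult_single)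
  show ?thesis
    using poly_mapping_sum_single[of m] by (simp add: * Const_def mult_single)
qed

text \<open>Constants and variables generate the ring, so substitutions and derivations can be
  compared on generators instead of monomial by monomial.\<close>

lemma mpoly_induct [case_names Const Var add mult]:
  assumes C: "\<And>c. P (Const c)" and V: "\<And>i. P (Var i)"
    and add: "\<And>f g. P f \<Longrightarrow> P g \<Longrightarrow> P (f + g)" and mult: "\<And>f g. P f \<Longrightarrow> P g \<Longrightarrow> P (f * g)"
  shows "P f"
proof -
  have 0: "P 0" and 1: "P 1" using C[of 0] C[of 1] by simp_all
  have pw: "P (f ^ k)" if "P f" for f k
    using that by (induction k) (simp_all add: 1 mult)
  have pr: "P (\<Prod>i\<in>A. g i)" if "\<And>i. P (g i)" for g A
    by (induction A rule: infinite_finite_induct) (simp_all add: 1 mult that)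
  have single: "P (Poly_Mapping.single m c)" for m c
    unfolding single_eq_mon by (rule mult[OF C pr]) (rule pw[OF V])
  have "P (\<Sum>m\<in>A. Poly_Mapping.single m (Poly_Mapping.lookup f m))" for A
    by (induction A rule: infinite_finite_induct) (simp_all add: 0 add single)
  then show ?thesis using poly_mapping_sum_single[of f] by metis
qed

lemma meval_subst: "meval (geval Const q f) x = meval f (\<lambda>i. meval (q i) x)"
  by (induction f rule: mpoly_induct) (simp_all add: geval_simps[OF is_ring_hom_Const] meval_simps)

lemma poly_geval: "poly (geval (\<lambda>c. [:c:]) q f) t = meval f (\<lambda>i. poly (q i) t)"
  by (induction f rule: mpoly_induct) (simp_all add: geval_simps[OF is_ring_hom_const_poly] meval_simps)

text \<open>Euclid's trick: over a finite field, one plus the product of all \<open>X - a\<close>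
  would have no root.\<close>

lemma alg_closed_infinite: "infinite (UNIV :: 'k::alg_closed_field set)"
proof
  assume fin: "finite (UNIV :: 'k set)"
  define p where "p = (\<Prod>a\<in>(UNIV :: 'k set). [:- a, 1:]) + [:1:]"
  have "degree (\<Prod>a\<in>(UNIV :: 'k set). [:- a, 1:]) = card (UNIV :: 'k set)"
    by (subst degree_prod_eq_sum_degree) auto
  moreover have "card (UNIV :: 'k set) > 0" using fin by (simp add: card_gt_0_iff)
  ultimately have "degree p > 0" unfolding p_def
    by (subst degree_add_eq_left) auto
  then obtain x where "poly p x = 0" using alg_closed_imp_poly_has_root by blast
  moreover have "poly p x = 1" using fin
    by (auto simp: p_def poly_prod prod_zero_iff)
  ultimately show False by simp
qed

lemma poly_zero_infinite:
  fixes p :: "'k::alg_closed_field poly"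
  assumes "\<And>t. poly p t = 0"
  shows "p = 0"
  using poly_roots_finite[of p] assms alg_closed_infinite by auto

lemma avoid_roots:
  fixes P :: "'k::alg_closed_field poly set"
  assumes "finite P" "0 \<notin> P"
  shows "\<exists>t. \<forall>p\<in>P. poly p t \<noteq> 0"
proof -
  have "finite (\<Union>p\<in>P. {t. poly p t = 0})"
    using assms by (auto intro!: poly_roots_finite)
  then show ?thesis using alg_closed_infinite
    by (metis (mono_tags, lifting) UN_iff ex_new_if_finite mem_Collect_eq)
qed

text \<open>Kronecker's substitution turns distinct monomials of a finite set into distinct powers.\<close>

lemma separating_weights:
  fixes M :: "('v \<Rightarrow>\<^sub>0 nat) set"
  assumes "finite M" "finite V"
  shows "\<exists>w. \<forall>m\<in>M. \<forall>m'\<in>M. (\<Sum>i\<in>V. Poly_Mapping.lookup m i * w i) = (\<Sum>i\<in>V. Poly_Mapping.lookup m' i * w i) \<longrightarrow>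
    (\<forall>i\<in>V. Poly_Mapping.lookup m i = Poly_Mapping.lookup m' i)"
  using assms(2)
proof (induction V rule: finite_induct)
  case empty
  then show ?case by simp
next
  case (insert i V)
  then obtain w :: "'v \<Rightarrow> nat" where w: "\<And>m m'. m \<in> M \<Longrightarrow> m' \<in> M \<Longrightarrow> (\<Sum>i\<in>V. Poly_Mapping.lookup m i * w i) = (\<Sum>i\<in>V. Poly_Mapping.lookup m' i * w i) \<Longrightarrow>
    (\<forall>i\<in>V. Poly_Mapping.lookup m i = Poly_Mapping.lookup m' i)" by blast
  define s where "s m = (\<Sum>i\<in>V. Poly_Mapping.lookup m i * w i)" for m
  \<comment> \<open>\<open>C\<close> exceeds every \<open>s m\<close>, so the new weight is read in
    base \<open>C\<close>: its remainder is \<open>s m\<close> and its quotient is the exponent of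
    the new variable.\<close>
  define C where "C = Suc (\<Sum>m\<in>M. s m)"
  have sC: "s m < C" if "m \<in> M" for m
    using member_le_sum[of m M s] that assms(1) by (simp add: C_def)
  have dv: "(x * C + s m) div C = x" if "m \<in> M" for m x
    using sC[OF that] by (cases "C = 0") auto
  have s': "(\<Sum>j\<in>V. Poly_Mapping.lookup m j * (w(i := C)) j) = s m" for m
    unfolding s_def by (rule sum.cong) (use insert in auto)
  show ?case
  proof (intro exI[of _ "w(i := C)"] ballI impI)
    fix m m' j
    assume m: "m \<in> M" "m' \<in> M" and j: "j \<in> insert i V"
      and "(\<Sum>j\<in>insert i V. Poly_Mapping.lookup m j * (w(i := C)) j) = (\<Sum>j\<in>insert i V. Poly_Mapping.lookup m' j * (w(i := C)) j)"
    then have eq: "Poly_Mapping.lookup m i * C + s m = Poly_Mapping.lookup m' i * C + s m'"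
      using insert by (simp add: s' del: fun_upd_apply) simp
    from arg_cong[OF eq, of "\<lambda>x. x mod C"] have "s m = s m'" using sC m by simp
    moreover from arg_cong[OF eq, of "\<lambda>x. x div C"] have "Poly_Mapping.lookup m i = Poly_Mapping.lookup m' i"
      using dv m by simp
    ultimately show "Poly_Mapping.lookup m j = Poly_Mapping.lookup m' j"
      using w[OF m] j by (auto simp: s_def)
  qed
qed

text \<open>After replacing variable i by \<open>t ^ w i\<close>, the coefficients of
  \<open>f\<close> reappear, one for each power of t, in a univariate polynomial that vanishes on an
  infinite field.\<close>

lemma meval_zero_imp_zero:
  fixes f :: "('v::finite, 'k::alg_closed_field) mpoly"
  assumes "\<And>x. meval f x = 0"
  shows "f = 0"
proof (rule ccontr)
  assume "f \<noteq> 0"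
  then obtain m0 where m0: "m0 \<in> Poly_Mapping.keys f"
    by (metis all_not_in_conv in_keys_iff lookup_zero poly_mapping_eqI)
  obtain w :: "'v \<Rightarrow> nat" where w: "\<And>m m'. m \<in> Poly_Mapping.keys f \<Longrightarrow> m' \<in> Poly_Mapping.keys f \<Longrightarrow>
     (\<Sum>i\<in>UNIV. Poly_Mapping.lookup m i * w i) = (\<Sum>i\<in>UNIV. Poly_Mapping.lookup m' i * w i) \<Longrightarrow>
    (\<forall>i. Poly_Mapping.lookup m i = Poly_Mapping.lookup m' i)"
    using separating_weights[of "Poly_Mapping.keys f" UNIV] by auto
  define s where "s m = (\<Sum>i\<in>UNIV. Poly_Mapping.lookup m i * w i)" for m
  define p where "p = geval (\<lambda>c. [:c:]) (\<lambda>i. monom 1 (w i)) f"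
  have mon: "mon (\<lambda>i. monom 1 (w i)) m = (monom 1 (s m) :: 'k poly)" for m
  proof -
    have *: "(\<Prod>i\<in>A. monom 1 (w i) ^ Poly_Mapping.lookup m i :: 'k poly) = monom 1 (\<Sum>i\<in>A. Poly_Mapping.lookup m i * w i)" for A
      by (induction A rule: infinite_finite_induct) (simp_all add: monom_power mult_monom mult.commute)
    show ?thesis by (simp add: mon_superset[of UNIV] * s_def)
  qed
  have "p = 0" unfolding p_def by (rule poly_zero_infinite) (simp add: poly_geval assms)
  moreover have "coeff p (s m0) = (\<Sum>m\<in>Poly_Mapping.keys f. if m = m0 then Poly_Mapping.lookup f m else 0)"
    unfolding p_def geval_def mon_def[symmetric] mon coeff_sum
  proof (rule sum.cong)
    fix m assume m: "m \<in> Poly_Mapping.keys f"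
    then have "s m = s m0 \<longleftrightarrow> m = m0"
      using w[OF m m0] by (auto simp: s_def intro!: poly_mapping_eqI)
    then show "coeff ([:Poly_Mapping.lookup f m:] * monom 1 (s m)) (s m0) = (if m = m0 then Poly_Mapping.lookup f m else 0)"
      by simp
  qed simp
  ultimately show False using m0 by (simp add: in_keys_iff)
qed

section \<open>Homogeneous polynomials\<close>

definition mdeg :: "('v::finite \<Rightarrow>\<^sub>0 nat) \<Rightarrow> nat" where
  "mdeg m = (\<Sum>i\<in>UNIV. Poly_Mapping.lookup m i)"

lemma mdeg_add: "mdeg (m + n) = mdeg m + mdeg n"
  by (simp add: mdeg_def lookup_add sum.distrib)

lemma mdeg_0 [simp]: "mdeg 0 = 0"
  by (simp add: mdeg_def)

lemma mdeg_single [simp]: "mdeg (Poly_Mapping.single i k) = k"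
  by (simp add: mdeg_def lookup_single when_def)

lemma hom_part_iff: "f \<in> hom_part j \<longleftrightarrow> (\<forall>m\<in>Poly_Mapping.keys f. int (mdeg m) = j)"
  by (simp add: hom_part_def mdeg_def)

lemma hom_part_0 [simp]: "0 \<in> hom_part j"
  by (simp add: hom_part_iff)

lemma hom_part_add: "f \<in> hom_part j \<Longrightarrow> g \<in> hom_part j \<Longrightarrow> f + g \<in> hom_part j"
  using keys_add[of f g] by (auto simp: hom_part_iff)

lemma hom_part_sum: "(\<And>i. i \<in> A \<Longrightarrow> f i \<in> hom_part j) \<Longrightarrow> (\<Sum>i\<in>A. f i) \<in> hom_part j"
  by (induction A rule: infinite_finite_induct) (simp_all add: hom_part_add)

lemma hom_part_mult: "f \<in> hom_part j \<Longrightarrow> g \<in> hom_part k \<Longrightarrow> f * g \<in> hom_part (j + k)"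
  using keys_mult[of f g] by (fastforce simp: hom_part_iff mdeg_add)

lemma hom_part_single: "Poly_Mapping.single m c \<in> hom_part (int (mdeg m))"
  by (simp add: hom_part_iff)

lemma hom_part_Const: "Const c \<in> hom_part 0"
  by (simp add: hom_part_iff Const_def)

lemma hom_part_1: "1 \<in> hom_part 0"
  using hom_part_Const[of 1] by simp

lemma hom_part_scale: "f \<in> hom_part j \<Longrightarrow> Const c * f \<in> hom_part j"
  using hom_part_mult[OF hom_part_Const] by fastforce

lemma hom_part_uminus: "f \<in> hom_part j \<Longrightarrow> - f \<in> hom_part j"
  using hom_part_scale[of f j "-1"] by (simp add: Const_minus)

lemma hom_part_diff: "f \<in> hom_part j \<Longrightarrow> g \<in> hom_part j \<Longrightarrow> f - g \<in> hom_part j"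
  using hom_part_add[of f j "- g"] hom_part_uminus by fastforce

lemma hom_part_Var: "Var i \<in> hom_part 1"
  by (simp add: hom_part_iff Var_def)

lemma hom_part_power: "f \<in> hom_part j \<Longrightarrow> f ^ k \<in> hom_part (int k * j)"
proof (induction k)
  case (Suc k)
  then show ?case using hom_part_mult[of f j "f ^ k" "int k * j"] by (simp add: algebra_simps)
qed (simp add: hom_part_1)

lemma hom_part_power1: "f \<in> hom_part 1 \<Longrightarrow> f ^ k \<in> hom_part (int k)"
  using hom_part_power[of f 1 k] by simp

lemma hom_part_prod: "(\<And>i. i \<in> A \<Longrightarrow> f i \<in> hom_part 1) \<Longrightarrow> (\<Prod>i\<in>A. f i) \<in> hom_part (int (card A))"
proof (induction A rule: infinite_finite_induct)
  case (insert x A)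
  then show ?case using hom_part_mult[of "f x" 1 "prod f A" "int (card A)"] by simp
qed (simp_all add: hom_part_1)

lemma hom_part_neg: "j < 0 \<Longrightarrow> hom_part j = {0}"
proof -
  assume j: "j < 0"
  have "f = 0" if "f \<in> hom_part j" for f :: "('a::finite, 'b::comm_ring_1) mpoly"
  proof -
    have "Poly_Mapping.keys f = {}" using that j by (auto simp: hom_part_iff)
    then show ?thesis using poly_mapping_sum_single[of f] by simp
  qed
  then show ?thesis by auto
qed

lemma geval_hom_scale:
  assumes h: "is_ring_hom h" and f: "f \<in> hom_part (int k)"
  shows "geval h (\<lambda>i. c * x i) f = c ^ k * geval h x f"
proof -
  have m: "mon (\<lambda>i. c * x i) m = c ^ mdeg m * mon x m" for m
    by (simp add: mon_superset[of UNIV] power_mult_distrib prod.distrib mdeg_def power_sum)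
  show ?thesis
    unfolding geval_def mon_def[symmetric] m sum_distrib_left
    by (rule sum.cong) (use f in \<open>auto simp: hom_part_iff mult_ac\<close>)
qed

lemmas meval_hom_scale = geval_hom_scale[OF is_ring_hom_id, folded meval_geval]

text \<open>The homogeneous component of degree \<open>j\<close>.\<close>

definition hc :: "nat \<Rightarrow> ('v::finite, 'k::comm_ring_1) mpoly \<Rightarrow> ('v, 'k) mpoly" where
  "hc j f = (\<Sum>m\<in>{m \<in> Poly_Mapping.keys f. mdeg m = j}. Poly_Mapping.single m (Poly_Mapping.lookup f m))"

lemma lookup_hc: "Poly_Mapping.lookup (hc j f) m = (if mdeg m = j then Poly_Mapping.lookup f m else 0)"
  by (auto simp: hc_def lookup_sum lookup_single when_def in_keys_iff)

lemma hc_hom: "hc j f \<in> hom_part (int j)"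
  by (auto simp: hom_part_iff in_keys_iff lookup_hc split: if_splits)

lemma hc_add: "hc j (f + g) = hc j f + hc j g"
  by (rule poly_mapping_eqI) (simp add: lookup_hc lookup_add)

lemma hc_0 [simp]: "hc j 0 = 0"
  by (rule poly_mapping_eqI) (simp add: lookup_hc)

lemma hc_sum: "hc j (\<Sum>i\<in>A. f i) = (\<Sum>i\<in>A. hc j (f i))"
  by (induction A rule: infinite_finite_induct) (simp_all add: hc_add)

lemma hc_eq: "f \<in> hom_part (int k) \<Longrightarrow> hc j f = (if j = k then f else 0)"
  by (rule poly_mapping_eqI) (auto simp: lookup_hc hom_part_iff in_keys_iff)

text \<open>Clear for single monomials of \<open>f\<close>, hence in general. It serves to read off
  the degree \<open>d\<close> part of an ideal generated by forms.\<close>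

lemma hc_mult:
  assumes g: "g \<in> hom_part (int k)"
  shows "hc (j + k) (f * g) = hc j f * g"
proof -
  let ?s = "\<lambda>m. Poly_Mapping.single m (Poly_Mapping.lookup f m)"
  have f: "f = (\<Sum>m\<in>Poly_Mapping.keys f. ?s m)" by (rule poly_mapping_sum_single)
  have *: "hc (j + k) (?s m * g) = hc j (?s m) * g" for m
  proof -
    have "?s m * g \<in> hom_part (int (mdeg m + k))"
      using hom_part_mult[OF hom_part_single g] by simp
    then show ?thesis
      using hc_eq[OF hom_part_single, of j m "Poly_Mapping.lookup f m"] hc_eq[of "?s m * g" "mdeg m + k" "j + k"] by auto
  qed
  have "hc (j + k) ((\<Sum>m\<in>Poly_Mapping.keys f. ?s m) * g) = hc j (\<Sum>m\<in>Poly_Mapping.keys f. ?s m) * g"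
    by (simp only: sum_distrib_right hc_sum *)
  then show ?thesis using f by simp
qed

section \<open>The pairing and linear forms\<close>

definition dotp :: "'k::comm_ring_1 ^ 'v::finite \<Rightarrow> 'k ^ 'v \<Rightarrow> 'k" (infixl "\<odot>" 70) where
  "c \<odot> y = (\<Sum>i\<in>UNIV. c $ i * y $ i)"

lemma dotp_commute: "c \<odot> y = y \<odot> c"
  by (simp add: dotp_def mult.commute)

lemma dotp_add_right: "c \<odot> (x + y) = c \<odot> x + c \<odot> y"
  and dotp_add_left: "(x + y) \<odot> c = x \<odot> c + y \<odot> c"
  and dotp_diff_right: "c \<odot> (x - y) = c \<odot> x - c \<odot> y"
  and dotp_diff_left: "(x - y) \<odot> c = x \<odot> c - y \<odot> c"
  and dotp_scale_right: "c \<odot> (t *s x) = t * (c \<odot> x)"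
  and dotp_scale_left: "(t *s x) \<odot> c = t * (x \<odot> c)"
  and dotp_0_right [simp]: "c \<odot> 0 = 0" and dotp_0_left [simp]: "0 \<odot> c = 0"
  by (simp_all add: dotp_def algebra_simps sum.distrib sum_subtractf sum_distrib_left)

lemma dotp_sum_right: "c \<odot> (\<Sum>i\<in>A. f i) = (\<Sum>i\<in>A. c \<odot> f i)"
  by (induction A rule: infinite_finite_induct) (simp_all add: dotp_add_right)

lemma dotp_sum_left: "(\<Sum>i\<in>A. f i) \<odot> c = (\<Sum>i\<in>A. f i \<odot> c)"
  by (induction A rule: infinite_finite_induct) (simp_all add: dotp_add_left)

lemmas dotp_simps = dotp_add_right dotp_add_left dotp_diff_right dotp_diff_left
  dotp_scale_right dotp_scale_left dotp_sum_right dotp_sum_left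

definition Lin :: "'k::comm_ring_1 ^ 'v::finite \<Rightarrow> ('v, 'k) mpoly" where
  "Lin w = (\<Sum>i\<in>UNIV. Const (w $ i) * Var i)"

lemma hom_part_Lin: "Lin w \<in> hom_part 1"
  unfolding Lin_def by (intro hom_part_sum hom_part_scale hom_part_Var)

lemma meval_Lin: "meval (Lin w) (($) x) = w \<odot> x"
  by (simp add: Lin_def dotp_def meval_simps)

lemma Lin_add: "Lin (v + w) = Lin v + Lin w"
  and Lin_scale: "Lin (c *s w) = Const c * Lin w"
  by (simp_all add: Lin_def Const_add Const_mult distrib_right sum.distrib sum_distrib_left mult.assoc)

lemma Lin_0 [simp]: "Lin 0 = 0"
  by (simp add: Lin_def)

lemma Lin_axis: "Lin (axis i 1) = Var i"
proof -
  have "Lin (axis i 1) = (\<Sum>j\<in>UNIV. if j = i then Var j else 0 :: ('a, 'b) mpoly)"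
    unfolding Lin_def by (rule sum.cong) (auto simp: axis_def)
  then show ?thesis by simp
qed

lemma hom_part_1_Lin:
  fixes f :: "('v::finite, 'k::comm_ring_1) mpoly"
  assumes "f \<in> hom_part 1"
  obtains w where "f = Lin w"
proof -
  have "\<exists>w. f = Lin w"
  proof -
    have m: "\<exists>i. m = Poly_Mapping.single i 1" if "m \<in> Poly_Mapping.keys f" for m
    proof -
      have s: "(\<Sum>i\<in>UNIV. Poly_Mapping.lookup m i) = 1" using assms that unfolding hom_part_iff mdeg_def
        by (metis of_nat_eq_1_iff)
      then obtain i where i: "Poly_Mapping.lookup m i = 1" "\<And>j. j \<noteq> i \<Longrightarrow> Poly_Mapping.lookup m j = 0"
        using sum_eq_1_iff[of UNIV "Poly_Mapping.lookup m"] by auto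
      have "m = Poly_Mapping.single i 1"
        by (rule poly_mapping_eqI) (use i in \<open>auto simp: lookup_single when_def\<close>)
      then show ?thesis ..
    qed
    have "\<exists>w. (\<Sum>m\<in>A. Poly_Mapping.single m (Poly_Mapping.lookup f m)) = Lin w" if "finite A" "A \<subseteq> Poly_Mapping.keys f" for A
      using that
    proof (induction A rule: finite_induct)
      case empty
      then show ?case by (auto intro: exI[of _ 0])
    next
      case (insert m A)
      then obtain w where w: "(\<Sum>m\<in>A. Poly_Mapping.single m (Poly_Mapping.lookup f m)) = Lin w" by auto
      obtain i where i: "m = Poly_Mapping.single i 1" using m insert by auto
      have "Poly_Mapping.single m (Poly_Mapping.lookup f m) = Lin (Poly_Mapping.lookup f m *s axis i 1)"
        by (simp add: Lin_scale Lin_axis i Const_def Var_def mult_single)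
      then show ?case using insert w by (auto simp flip: Lin_add)
    qed
    from this[of "Poly_Mapping.keys f"] show ?thesis using poly_mapping_sum_single[of f] by simp
  qed
  then show thesis using that by blast
qed

lemma degree_geval_hom:
  fixes x y :: "'v::finite \<Rightarrow> 'k::field"
  assumes f: "f \<in> hom_part (int k)"
  shows "degree (geval (\<lambda>c. [:c:]) (\<lambda>i. [:x i, y i:]) f) \<le> k"
proof -
  have "degree (mon (\<lambda>i. [:x i, y i:]) m) \<le> mdeg m" for m
  proof -
    have "degree (mon (\<lambda>i. [:x i, y i:]) m) \<le> (\<Sum>i\<in>UNIV. degree ([:x i, y i:] ^ Poly_Mapping.lookup m i))"
      by (simp add: mon_superset[of UNIV] degree_prod_sum_le[of UNIV, unfolded o_def])
    also have "\<dots> \<le> (\<Sum>i\<in>UNIV. Poly_Mapping.lookup m i)"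
    proof (rule sum_mono)
      fix i
      have "degree ([:x i, y i:] ^ Poly_Mapping.lookup m i) \<le> degree [:x i, y i:] * Poly_Mapping.lookup m i"
        by (rule degree_power_le)
      also have "\<dots> \<le> Poly_Mapping.lookup m i" by simp
      finally show "degree ([:x i, y i:] ^ Poly_Mapping.lookup m i) \<le> Poly_Mapping.lookup m i" .
    qed
    finally show ?thesis by (simp add: mdeg_def)
  qed
  then show ?thesis unfolding geval_def mon_def[symmetric]
    using f by (intro degree_sum_le) (auto simp: hom_part_iff intro: order.trans)
qed

text \<open>Modulo the ideal \<open>I\<close>, substitution and the identity agree on generators,
  hence everywhere. With \<open>q\<close> a projection onto a linear subspace, membership in the
  ideal of that subspace reduces to the vanishing of the substituted polynomial.\<close>

lemma subst_diff:
  fixes f :: "('v, 'k::comm_ring_1) mpoly"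
  assumes I0: "0 \<in> I" and add: "\<And>f g. f \<in> I \<Longrightarrow> g \<in> I \<Longrightarrow> f + g \<in> I" and mult: "\<And>f g. f \<in> I \<Longrightarrow> g * f \<in> I"
    and v: "\<And>i. Var i - q i \<in> I"
  shows "f - geval Const q f \<in> I"
proof (induction f rule: mpoly_induct)
  case (Const c)
  then show ?case using I0 by (simp add: geval_simps[OF is_ring_hom_Const])
next
  case (Var i)
  then show ?case using v by (simp add: geval_simps[OF is_ring_hom_Const])
next
  case (add f g)
  then have "(f - geval Const q f) + (g - geval Const q g) \<in> I" by (rule assms(2))
  then show ?case by (simp add: geval_simps[OF is_ring_hom_Const] algebra_simps)
next
  case (mult f g)
  then have "g * (f - geval Const q f) + geval Const q f * (g - geval Const q g) \<in> I"
    using assms by blast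
  then show ?case by (simp add: geval_simps[OF is_ring_hom_Const] algebra_simps)
qed

section \<open>Polynomial functions of frames\<close>

text \<open>Regular functions of a frame, kept as functions so that closure under ring operations
  and composition needs no bookkeeping of variables.\<close>

definition polyfun :: "((nat \<Rightarrow> 'k::comm_ring_1 ^ 'v) \<Rightarrow> 'k) \<Rightarrow> bool" where
  "polyfun f \<longleftrightarrow> (\<exists>F :: ('v \<times> nat, 'k) mpoly. \<forall>b. f b = meval F (\<lambda>(i, j). b j $ i))"

lemma polyfun_const: "polyfun (\<lambda>b. c)"
  unfolding polyfun_def by (rule exI[of _ "Const c"]) (simp add: meval_simps)

lemma polyfun_coord: "polyfun (\<lambda>b. b j $ i)"
  unfolding polyfun_def by (rule exI[of _ "Var (i, j)"]) (simp add: meval_simps)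

lemma polyfun_add:
  assumes "polyfun f" "polyfun g"
  shows "polyfun (\<lambda>b. f b + g b)"
proof -
  obtain F G where "\<And>b. f b = meval F (\<lambda>(i, j). b j $ i)" "\<And>b. g b = meval G (\<lambda>(i, j). b j $ i)"
    using assms unfolding polyfun_def by blast
  then have "\<And>b. f b + g b = meval (F + G) (\<lambda>(i, j). b j $ i)" by (simp add: meval_simps)
  then show ?thesis unfolding polyfun_def by blast
qed

lemma polyfun_mult:
  assumes "polyfun f" "polyfun g"
  shows "polyfun (\<lambda>b. f b * g b)"
proof -
  obtain F G where "\<And>b. f b = meval F (\<lambda>(i, j). b j $ i)" "\<And>b. g b = meval G (\<lambda>(i, j). b j $ i)"
    using assms unfolding polyfun_def by blast
  then have "\<And>b. f b * g b = meval (F * G) (\<lambda>(i, j). b j $ i)" by (simp add: meval_simps)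
  then show ?thesis unfolding polyfun_def by blast
qed

lemma polyfun_diff:
  assumes "polyfun f" "polyfun g"
  shows "polyfun (\<lambda>b. f b - g b)"
proof -
  obtain F G where "\<And>b. f b = meval F (\<lambda>(i, j). b j $ i)" "\<And>b. g b = meval G (\<lambda>(i, j). b j $ i)"
    using assms unfolding polyfun_def by blast
  then have "\<And>b. f b - g b = meval (F - G) (\<lambda>(i, j). b j $ i)" by (simp add: meval_simps)
  then show ?thesis unfolding polyfun_def by blast
qed

lemma polyfun_sum: "(\<And>i. i \<in> A \<Longrightarrow> polyfun (f i)) \<Longrightarrow> polyfun (\<lambda>b. \<Sum>i\<in>A. f i b)"
  by (induction A rule: infinite_finite_induct) (simp_all add: polyfun_const polyfun_add)

lemma polyfun_prod: "(\<And>i. i \<in> A \<Longrightarrow> polyfun (f i)) \<Longrightarrow> polyfun (\<lambda>b. \<Prod>i\<in>A. f i b)"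
  by (induction A rule: infinite_finite_induct) (simp_all add: polyfun_const polyfun_mult)

lemma polyfun_power: "polyfun f \<Longrightarrow> polyfun (\<lambda>b. f b ^ k)"
  by (induction k) (simp_all add: polyfun_const polyfun_mult)

lemma polyfun_dotp: "(\<And>i. polyfun (\<lambda>b. f b $ i)) \<Longrightarrow> (\<And>i. polyfun (\<lambda>b. g b $ i)) \<Longrightarrow> polyfun (\<lambda>b. f b \<odot> g b)"
  unfolding dotp_def by (intro polyfun_sum polyfun_mult)

lemma polyfun_compose:
  assumes f: "polyfun f" and g: "\<And>j i. polyfun (\<lambda>b. g b j $ i)"
  shows "polyfun (\<lambda>b. f (g b))"
proof -
  obtain F where F: "\<And>b. f b = meval F (\<lambda>(i, j). b j $ i)" using f unfolding polyfun_def by blast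
  define G where "G = (\<lambda>(i, j). SOME G. \<forall>b. g b j $ i = meval G (\<lambda>(i, j). b j $ i))"
  have G: "g b j $ i = meval (G (i, j)) (\<lambda>(i, j). b j $ i)" for b i j
    unfolding G_def prod.case by (rule someI_ex[OF g[of j i, unfolded polyfun_def], THEN spec])
  have "f (g b) = meval (geval Const G F) (\<lambda>(i, j). b j $ i)" for b
  proof -
    have "(\<lambda>(i, j). g b j $ i) = (\<lambda>ij. meval (G ij) (\<lambda>(i, j). b j $ i))"
      by (rule ext) (auto simp only: split_paired_all prod.case G)
    then show ?thesis by (simp only: F[of "g b"] meval_subst)
  qed
  then show ?thesis unfolding polyfun_def by blast
qed

lemma polyfun_line:
  fixes f :: "(nat \<Rightarrow> 'k::field ^ 'v) \<Rightarrow> 'k"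
  assumes "polyfun f"
  obtains p where "\<And>t. poly p t = f (\<lambda>j. b j + t *s c j)"
proof -
  obtain F where F: "\<And>b. f b = meval F (\<lambda>(i, j). b j $ i)" using assms unfolding polyfun_def by blast
  show thesis
    by (rule that[of "geval (\<lambda>c. [:c:]) (\<lambda>(i, j). [:b j $ i, c j $ i:]) F"])
      (simp add: F poly_geval split_def)
qed

text \<open>Irreducibility of the space of frames: on the line joining \<open>b\<close> and
  \<open>c\<close> both functions restrict to nonzero univariate polynomials, and some parameter
  avoids the roots of both.\<close>

lemma polyfun_mult_nonzero:
  fixes f g :: "(nat \<Rightarrow> 'k::alg_closed_field ^ 'v) \<Rightarrow> 'k"
  assumes "polyfun f" "polyfun g" "f b \<noteq> 0" "g c \<noteq> 0"
  obtains e where "f e \<noteq> 0" "g e \<noteq> 0"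
proof -
  obtain p where p: "\<And>t. poly p t = f (\<lambda>j. b j + t *s (c j - b j))" using polyfun_line[OF assms(1)] by metis
  obtain q where q: "\<And>t. poly q t = g (\<lambda>j. b j + t *s (c j - b j))" using polyfun_line[OF assms(2)] by metis
  have "p \<noteq> 0" using p[of 0] assms(3) by auto
  moreover have "q \<noteq> 0" using q[of 1] assms(4) by auto
  ultimately obtain t where "poly p t \<noteq> 0" "poly q t \<noteq> 0" using avoid_roots[of "{p, q}"] by auto
  then show thesis using that p q by metis
qed

lemma polyfun_prod_nonzero:
  fixes f :: "'i \<Rightarrow> (nat \<Rightarrow> 'k::alg_closed_field ^ 'v) \<Rightarrow> 'k"
  assumes "finite A" "\<And>i. i \<in> A \<Longrightarrow> polyfun (f i)" "\<And>i. i \<in> A \<Longrightarrow> \<exists>b. f i b \<noteq> 0"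
  shows "\<exists>b. \<forall>i\<in>A. f i b \<noteq> 0"
  using assms
proof (induction A rule: finite_induct)
  case (insert i A)
  then obtain b where b: "\<forall>i\<in>A. f i b \<noteq> 0" by auto
  obtain c where c: "f i c \<noteq> 0" using insert.prems(2)[of i] by blast
  obtain e where "(\<Prod>i\<in>A. f i e) \<noteq> 0" "f i e \<noteq> 0"
    using polyfun_mult_nonzero[of "\<lambda>b. \<Prod>i\<in>A. f i b" "f i" b c] polyfun_prod[of A f] insert b c by auto
  then show ?case using insert(1) by (auto simp: prod_zero_iff)
qed simp

section \<open>Generic frames\<close>

text \<open>Vectors are functions on an arbitrary index set: coordinates in the case of frames, a
  variable with two exponents in the case of \<open>Jvec\<close>.\<close>

definition lin_indep_fam :: "nat \<Rightarrow> (nat \<Rightarrow> 'c \<Rightarrow> 'k::field) \<Rightarrow> bool" where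
  "lin_indep_fam r f \<longleftrightarrow> (\<forall>c. (\<forall>x. (\<Sum>i<r. c i * f i x) = 0) \<longrightarrow> (\<forall>i<r. c i = 0))"

lemma lin_indep_famI:
  "(\<And>c. (\<And>x. (\<Sum>i<r. c i * f i x) = 0) \<Longrightarrow> (\<forall>i<r. c i = 0)) \<Longrightarrow> lin_indep_fam r f"
  unfolding lin_indep_fam_def by blast

lemma lin_indep_famD:
  "lin_indep_fam r f \<Longrightarrow> (\<And>x. (\<Sum>i<r. c i * f i x) = 0) \<Longrightarrow> i < r \<Longrightarrow> c i = 0"
  unfolding lin_indep_fam_def by blast

text \<open>Fraction-free Gaussian elimination, with the last vector as pivot.\<close>

lemma lin_indep_open:
  fixes f :: "(nat \<Rightarrow> 'k::field ^ 'v) \<Rightarrow> nat \<Rightarrow> 'c \<Rightarrow> 'k"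
  assumes "\<And>i x. i < r \<Longrightarrow> polyfun (\<lambda>b. f b i x)" and "lin_indep_fam r (f b0)"
  shows "\<exists>\<Phi>. polyfun \<Phi> \<and> \<Phi> b0 \<noteq> 0 \<and> (\<forall>b. \<Phi> b \<noteq> 0 \<longrightarrow> lin_indep_fam r (f b))"
  using assms
proof (induction r arbitrary: f)
  case 0
  show ?case by (intro exI[of _ "\<lambda>b. 1"]) (simp add: polyfun_const lin_indep_fam_def)
next
  case (Suc r)
  have "\<exists>x0. f b0 r x0 \<noteq> 0"
  proof (rule ccontr)
    assume "\<nexists>x0. f b0 r x0 \<noteq> 0"
    then have "(\<Sum>i<Suc r. (if i = r then 1 else 0) * f b0 i x) = 0" for x by (simp add: if_distrib cong: if_cong)
    from lin_indep_famD[OF Suc.prems(2) this, of r] show False by simp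
  qed
  then obtain x0 where x0: "f b0 r x0 \<noteq> 0" ..
  \<comment> \<open>Cross-multiplication clears column \<open>x0\<close> without division, so the
    entries stay polynomial in \<open>b\<close>.\<close>
  define g where "g b i x = f b r x0 * f b i x - f b i x0 * f b r x" for b i x
  have sum_g: "(\<Sum>i<r. c i * g b i x) = (\<Sum>i<r. f b r x0 * c i * f b i x) - (\<Sum>i<r. c i * f b i x0) * f b r x" for b c x
    by (simp add: g_def sum_subtractf algebra_simps sum_distrib_left sum_distrib_right)
  have "lin_indep_fam r (g b0)"
  proof (rule lin_indep_famI)
    fix c assume c: "(\<Sum>i<r. c i * g b0 i x) = 0" for x
    \<comment> \<open>A relation among the reduced vectors, rewritten for the original ones; the
      last coefficient collects the subtracted multiples of the pivot vector.\<close>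
    define c' where "c' i = (if i = r then - (\<Sum>i<r. c i * f b0 i x0) else f b0 r x0 * c i)" for i
    have "(\<Sum>i<Suc r. c' i * f b0 i x) = 0" for x
      using c[of x] unfolding sum_g by (simp add: c'_def)
    from lin_indep_famD[OF Suc.prems(2) this] have "c' i = 0" if "i < r" for i using that by simp
    then show "\<forall>i<r. c i = 0" using x0 by (auto simp: c'_def)
  qed
  moreover have "polyfun (\<lambda>b. g b i x)" if "i < r" for i x
    unfolding g_def by (intro polyfun_diff polyfun_mult Suc.prems) (use that in auto)
  ultimately obtain \<Phi> where \<Phi>: "polyfun \<Phi>" "\<Phi> b0 \<noteq> 0" "\<And>b. \<Phi> b \<noteq> 0 \<Longrightarrow> lin_indep_fam r (g b)"
    using Suc.IH[of g] by blast
  show ?case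
  proof (intro exI[of _ "\<lambda>b. \<Phi> b * f b r x0"] conjI allI impI)
    show "polyfun (\<lambda>b. \<Phi> b * f b r x0)" by (intro polyfun_mult \<Phi> Suc.prems) simp
    show "\<Phi> b0 * f b0 r x0 \<noteq> 0" using \<Phi> x0 by simp
    fix b assume b: "\<Phi> b * f b r x0 \<noteq> 0"
    show "lin_indep_fam (Suc r) (f b)"
    proof (rule lin_indep_famI)
      fix c assume c: "(\<Sum>i<Suc r. c i * f b i x) = 0" for x
      have c1: "(\<Sum>i<r. c i * f b i x) = - c r * f b r x" for x
        using c[of x] by (simp add: eq_neg_iff_add_eq_0)
      have "(\<Sum>i<r. c i * g b i x) = 0" for x
      proof -
        have "(\<Sum>i<r. f b r x0 * c i * f b i x) = f b r x0 * (- c r * f b r x)"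
          by (simp only: c1[symmetric] sum_distrib_left mult.assoc)
        then show ?thesis unfolding sum_g c1 by simp
      qed
      then have 1: "c i = 0" if "i < r" for i using lin_indep_famD[OF \<Phi>(3)] b that by auto
      then have "c r * f b r x0 = 0" using c1[of x0] by simp
      then show "\<forall>i<Suc r. c i = 0" using 1 b by (auto simp: less_Suc_eq)
    qed
  qed
qed

definition frame :: "nat \<Rightarrow> (nat \<Rightarrow> 'k::field ^ 'v) \<Rightarrow> bool" where
  "frame r b \<longleftrightarrow> lin_indep_fam r (\<lambda>i x. b i $ x)"

lemma frame_def': "frame r b \<longleftrightarrow> (\<forall>c. (\<Sum>i<r. c i *s b i) = 0 \<longrightarrow> (\<forall>i<r. c i = 0))"
  by (simp add: frame_def lin_indep_fam_def vec_eq_iff)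

lemma frame_inj: assumes "frame r b" shows "inj_on b {..<r}"
proof
  fix i j assume ij: "i \<in> {..<r}" "j \<in> {..<r}" "b i = b j"
  show "i = j"
  proof (rule ccontr)
    assume ne: "i \<noteq> j"
    define c where "c k = (if k = i then 1 else if k = j then - 1 else 0 :: 'a)" for k
    have "(\<Sum>k<r. c k *s b k) = (\<Sum>k<r. (if k = i then b k else 0) + (if k = j then - b k else 0))"
      by (rule sum.cong) (use ne in \<open>auto simp: c_def\<close>)
    also have "\<dots> = 0" using ij by (simp add: sum.distrib)
    finally have "c i = 0" using assms ij unfolding frame_def' by blast
    then show False by (simp add: c_def)
  qed
qed

lemma frame_independent: assumes "frame r b" shows "vec.independent (b ` {..<r})"
proof
  assume "vec.dependent (b ` {..<r})"
  then obtain u where u: "\<exists>v\<in>b ` {..<r}. u v \<noteq> 0" "(\<Sum>v\<in>b ` {..<r}. u v *s v) = 0"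
    by (auto simp: vec.dependent_finite)
  have "(\<Sum>i<r. u (b i) *s b i) = 0" using u(2) by (simp add: sum.reindex[OF frame_inj[OF assms]])
  then have "\<forall>i<r. u (b i) = 0" using assms[unfolded frame_def', THEN spec, of "\<lambda>i. u (b i)"] by simp
  then show False using u(1) by auto
qed

lemma frameI: assumes "vec.independent (b ` {..<r})" "inj_on b {..<r}" shows "frame r b"
  unfolding frame_def'
proof (intro allI impI)
  fix c i assume c: "(\<Sum>i<r. c i *s b i) = 0" and i: "i < r"
  define u where "u v = c (the_inv_into {..<r} b v)" for v
  have ub: "u (b i) = c i" if "i < r" for i using that assms(2) by (simp add: u_def the_inv_into_f_f)
  have "(\<Sum>v\<in>b ` {..<r}. u v *s v) = 0"
    using c by (simp add: sum.reindex[OF assms(2)] ub)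
  then have "u (b i) = 0" using vec.independentD[OF assms(1) _ subset_refl, of u "b i"] i by auto
  then show "c i = 0" using ub i by simp
qed

lemma frame_iff_dim: "frame r b \<longleftrightarrow> vec.dim (b ` {..<r}) = r"
proof
  assume "frame r b"
  then show "vec.dim (b ` {..<r}) = r"
    using frame_inj[of r b] frame_independent[of r b] by (simp add: vec.dim_eq_card_independent card_image)
next
  assume d: "vec.dim (b ` {..<r}) = r"
  have "vec.dim (b ` {..<r}) \<le> card (b ` {..<r})" by (rule vec.dim_le_card) (auto intro: vec.span_base)
  moreover have "card (b ` {..<r}) \<le> r" using card_image_le[of "{..<r}" b] by simp
  ultimately have c: "card (b ` {..<r}) = r" using d by simp
  then have "inj_on b {..<r}" by (simp add: eq_card_imp_inj_on)
  moreover have "vec.independent (b ` {..<r})"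
    using vec.card_eq_dim[of "b ` {..<r}" "b ` {..<r}"] c d by (simp add: vec.span_superset)
  ultimately show "frame r b" by (rule frameI[rotated])
qed

lemma frame_exists:
  assumes "vec.subspace W" "vec.dim W = r"
  obtains b where "frame r b" "vec.span (b ` {..<r}) = W"
proof -
  obtain B where B: "B \<subseteq> W" "vec.independent B" "W \<subseteq> vec.span B" "card B = vec.dim W"
    using vec.basis_exists by blast
  have "finite B" using B vec.finiteI_independent by blast
  then obtain b where b: "bij_betw b {..<r} B" using B assms by (metis card_lessThan finite_same_card_bij finite_lessThan)
  then have im: "b ` {..<r} = B" by (simp add: bij_betw_def)
  have "frame r b" by (rule frameI) (use im B b in \<open>auto simp: bij_betw_def\<close>)
  moreover have "vec.span B = W" using B assms by (meson subset_antisym vec.span_minimal)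
  ultimately show thesis using that im by auto
qed

lemma frame_open:
  fixes g :: "(nat \<Rightarrow> 'k::field ^ 'v) \<Rightarrow> nat \<Rightarrow> 'k ^ 'w"
  assumes "\<And>j i. polyfun (\<lambda>b. g b j $ i)" "frame r (g b0)"
  shows "\<exists>\<Phi>. polyfun \<Phi> \<and> \<Phi> b0 \<noteq> 0 \<and> (\<forall>b. \<Phi> b \<noteq> 0 \<longrightarrow> frame r (g b))"
  unfolding frame_def by (rule lin_indep_open) (use assms in \<open>auto simp: frame_def\<close>)

section \<open>Functionals, dual vectors and annihilators\<close>

lemma exists_functional:
  fixes S :: "('k::field ^ 'v) set" and f :: "'k ^ 'v \<Rightarrow> 'k"
  assumes "vec.independent S"
  obtains e where "\<And>x. x \<in> S \<Longrightarrow> e \<odot> x = f x"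
proof -
  \<comment> \<open>Any coordinate will do: the functional is coordinate \<open>k\<close> of a
    vector-valued linear extension.\<close>
  define k :: 'v where "k = undefined"
  obtain g :: "'k ^ 'v \<Rightarrow> 'k ^ 'v" where g: "Vector_Spaces.linear (*s) (*s) g" "\<And>x. x \<in> S \<Longrightarrow> g x = f x *s axis k 1"
    using vec.linear_independent_extend[OF assms, of "\<lambda>x. f x *s axis k 1"] by blast
  have "row k (matrix g) \<odot> x = f x" if "x \<in> S" for x
  proof -
    have "row k (matrix g) \<odot> x = (matrix g *v x) $ k"
      by (simp add: dotp_def row_def matrix_vector_mult_def)
    also have "\<dots> = g x $ k" by (simp add: matrix_works[OF g(1)])
    also have "\<dots> = f x" using g(2)[OF that] by simp
    finally show ?thesis .
  qed
  then show thesis using that by blast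
qed

lemma exists_functional_separating:
  fixes x :: "'k::field ^ 'v"
  assumes "x \<notin> vec.span S"
  obtains e where "e \<odot> x = 1" "\<And>y. y \<in> S \<Longrightarrow> e \<odot> y = 0"
proof -
  obtain B where B: "B \<subseteq> S" "vec.independent B" "S \<subseteq> vec.span B"
    using vec.maximal_independent_subset[of S] by blast
  have "vec.span B = vec.span S" using B by (simp add: subset_antisym vec.span_mono vec.span_minimal)
  then have x: "x \<notin> vec.span B" using assms by simp
  then have ind: "vec.independent (insert x B)" using B vec.independent_insertI by blast
  obtain e where e: "\<And>y. y \<in> insert x B \<Longrightarrow> e \<odot> y = (if y = x then 1 else 0)" using exists_functional[OF ind, where f = "\<lambda>y. if y = x then 1 else 0"] by blast
  have "x \<notin> B" using x vec.span_base by blast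
  then have eB: "e \<odot> y = 0" if "y \<in> B" for y using e[of y] that by auto
  have "e \<odot> y = 0" if "y \<in> S" for y
  proof -
    have "y \<in> vec.span B" using that B by blast
    then show ?thesis by (induction rule: vec.span_induct_alt) (auto simp: dotp_simps eB)
  qed
  moreover have "e \<odot> x = 1" using e[of x] by simp
  ultimately show thesis using that by blast
qed

lemma frame_dual:
  fixes b :: "nat \<Rightarrow> 'k::field ^ 'v"
  assumes "frame r b"
  obtains e where "\<And>i j. i < r \<Longrightarrow> j < r \<Longrightarrow> e i \<odot> b j = (if i = j then 1 else 0)"
proof -
  have "\<exists>e. \<forall>j<r. e \<odot> b j = (if i = j then 1 else 0)" if "i < r" for i
  proof -
    obtain e where e: "\<And>x. x \<in> b ` {..<r} \<Longrightarrow> e \<odot> x = (if x = b i then 1 else 0)"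
      using exists_functional[OF frame_independent[OF assms], where f = "\<lambda>x. if x = b i then 1 else 0"] by blast
    have "e \<odot> b j = (if i = j then 1 else 0)" if "j < r" for j
      using e[of "b j"] that \<open>i < r\<close> frame_inj[OF assms] by (auto simp: inj_on_def)
    then show ?thesis by blast
  qed
  then obtain e where "\<forall>i<r. \<forall>j<r. e i \<odot> b j = (if i = j then 1 else 0)" by metis
  then show thesis using that by blast
qed

definition perp :: "nat \<Rightarrow> (nat \<Rightarrow> 'k::field ^ 'v) \<Rightarrow> ('k ^ 'v) set" where
  "perp r b = {x. \<forall>j<r. b j \<odot> x = 0}"

lemma subspace_perp: "vec.subspace (perp r b)"
  unfolding vec.subspace_def by (auto simp: perp_def dotp_simps)

text \<open>Vectors dual to the frame span a complement of the annihilator: subtracting the dual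
  expansion of a vector lands in \<open>perp r b\<close>, and a combination of dual vectors lying
  there has zero coefficients.\<close>

lemma dim_perp:
  fixes b :: "nat \<Rightarrow> 'k::field ^ 'v"
  assumes "frame r b"
  shows "vec.dim (perp r b) + r = CARD('v)"
proof -
  obtain e where e0: "\<And>i j. i < r \<Longrightarrow> j < r \<Longrightarrow> e i \<odot> b j = (if i = j then 1 else 0)"
    using frame_dual[OF assms] by blast
  have e: "b j \<odot> e i = (if i = j then 1 else 0)" if "i < r" "j < r" for i j using e0[OF that] by (simp add: dotp_commute)
  have fe: "frame r e" unfolding frame_def'
  proof (intro allI impI)
    fix c j assume c: "(\<Sum>i<r. c i *s e i) = 0" and j: "j < r"
    have "b j \<odot> (\<Sum>i<r. c i *s e i) = (\<Sum>i<r. if i = j then c i else 0)"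
      unfolding dotp_sum_right dotp_scale_right by (rule sum.cong) (use j e in auto)
    then show "c j = 0" using c j by simp
  qed
  let ?E = "vec.span (e ` {..<r})" and ?P = "perp r b"
  have "vec.dim {x + y |x y. x \<in> ?P \<and> y \<in> ?E} + vec.dim (?P \<inter> ?E) = vec.dim ?P + vec.dim ?E"
    by (rule vec.dim_sums_Int) (simp_all add: subspace_perp)
  moreover have "{x + y |x y. x \<in> ?P \<and> y \<in> ?E} = UNIV"
  proof -
    have "x \<in> {x + y |x y. x \<in> ?P \<and> y \<in> ?E}" for x
    proof -
      let ?y = "\<Sum>i<r. (b i \<odot> x) *s e i"
      have "b j \<odot> ?y = b j \<odot> x" if j: "j < r" for j
      proof -
        have "b j \<odot> ?y = (\<Sum>i<r. if i = j then b i \<odot> x else 0)"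
          unfolding dotp_sum_right dotp_scale_right by (rule sum.cong) (use j e in auto)
        then show ?thesis using j by simp
      qed
      then have "x - ?y \<in> ?P" by (simp add: perp_def dotp_simps)
      moreover have "?y \<in> ?E" by (intro vec.span_sum vec.span_scale vec.span_base) auto
      ultimately show ?thesis by (metis (mono_tags, lifting) diff_add_cancel mem_Collect_eq)
    qed
    then show ?thesis by blast
  qed
  moreover have "?P \<inter> ?E = {0}"
  proof -
    have "x = 0" if x: "x \<in> ?P" "x \<in> ?E" for x
    proof -
      have "x \<in> range (\<lambda>u. \<Sum>v\<in>e ` {..<r}. u v *s v)" using x(2) by (simp add: vec.span_finite)
      then obtain u where u: "x = (\<Sum>i<r. u (e i) *s e i)" by (auto simp: sum.reindex[OF frame_inj[OF fe]])
      have "u (e j) = 0" if j: "j < r" for j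
      proof -
        have "b j \<odot> x = (\<Sum>i<r. if i = j then u (e i) else 0)"
          unfolding u dotp_sum_right dotp_scale_right by (rule sum.cong) (use j e in auto)
        then show ?thesis using j x(1) by (simp add: perp_def)
      qed
      then show "x = 0" using u by simp
    qed
    then show ?thesis using vec.subspace_0[OF subspace_perp] vec.span_zero by blast
  qed
  ultimately show ?thesis using fe using vec_dim_card[where ?'n = 'v and ?'a = 'k]
    by (simp only: frame_iff_dim vec.dim_span) simp
qed

text \<open>In contrast to \<open>general_subspace\<close>, the property may refer to the frame
  itself, for instance to \<open>b 1\<close> not vanishing at a point, and not only to its
  span.\<close>

definition generic :: "nat \<Rightarrow> ((nat \<Rightarrow> 'k::field ^ 'v) \<Rightarrow> bool) \<Rightarrow> bool" where
  "generic r P \<longleftrightarrow> (\<exists>\<Phi>. polyfun \<Phi> \<and> (\<exists>b. frame r b \<and> \<Phi> b \<noteq> 0) \<and> (\<forall>b. frame r b \<and> \<Phi> b \<noteq> 0 \<longrightarrow> P b))"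

lemma general_subspace_generic: "general_subspace r P \<longleftrightarrow> generic r (\<lambda>b. P (vec.span (b ` {..<r})))"
proof -
  have "generic r Q \<longleftrightarrow> (\<exists>F. (\<exists>b. frame r b \<and> meval F (\<lambda>(i, j). b j $ i) \<noteq> 0) \<and>
     (\<forall>b. frame r b \<and> meval F (\<lambda>(i, j). b j $ i) \<noteq> 0 \<longrightarrow> Q b))"
    (is "_ \<longleftrightarrow> ?R Q") for Q :: "(nat \<Rightarrow> 'a ^ 'b) \<Rightarrow> bool"
  proof
    assume "generic r Q"
    then obtain \<Phi> where \<Phi>: "polyfun \<Phi>" "\<exists>b. frame r b \<and> \<Phi> b \<noteq> 0" "\<forall>b. frame r b \<and> \<Phi> b \<noteq> 0 \<longrightarrow> Q b"
      unfolding generic_def by blast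
    then obtain F where "\<Phi> = (\<lambda>b. meval F (\<lambda>(i, j). b j $ i))" unfolding polyfun_def by blast
    then show "?R Q" using \<Phi> by blast
  next
    assume "?R Q"
    then obtain F where F: "\<exists>b. frame r b \<and> meval F (\<lambda>(i, j). b j $ i) \<noteq> 0"
     "\<forall>b. frame r b \<and> meval F (\<lambda>(i, j). b j $ i) \<noteq> 0 \<longrightarrow> Q b" by blast
    have "polyfun (\<lambda>b. meval F (\<lambda>(i, j). b j $ i))" unfolding polyfun_def by blast
    then show "generic r Q" using F unfolding generic_def by blast
  qed
  then show ?thesis unfolding general_subspace_def frame_iff_dim[symmetric] by simp
qed

lemma generic_ex: "generic r P \<Longrightarrow> \<exists>b. frame r b \<and> P b"
  unfolding generic_def by blast

lemma generic_mono: "generic r P \<Longrightarrow> (\<And>b. frame r b \<Longrightarrow> P b \<Longrightarrow> Q b) \<Longrightarrow> generic r Q"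
  unfolding generic_def by blast

text \<open>Two nonempty open sets of frames meet. The function \<open>\<Theta>\<close> enters
  because the common point has to be a frame as well.\<close>

lemma generic_conj:
  fixes P Q :: "(nat \<Rightarrow> 'k::alg_closed_field ^ 'v) \<Rightarrow> bool"
  assumes "generic r P" "generic r Q"
  shows "generic r (\<lambda>b. P b \<and> Q b)"
proof -
  obtain \<Phi> b where \<Phi>: "polyfun \<Phi>" "frame r b" "\<Phi> b \<noteq> 0" "\<forall>b. frame r b \<and> \<Phi> b \<noteq> 0 \<longrightarrow> P b"
    using assms(1) unfolding generic_def by blast
  obtain \<Psi> c where \<Psi>: "polyfun \<Psi>" "frame r c" "\<Psi> c \<noteq> 0" "\<forall>b. frame r b \<and> \<Psi> b \<noteq> 0 \<longrightarrow> Q b"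
    using assms(2) unfolding generic_def by blast
  obtain \<Theta> where \<Theta>: "polyfun \<Theta>" "\<Theta> b \<noteq> 0" "\<And>b. \<Theta> b \<noteq> 0 \<Longrightarrow> frame r b"
    using frame_open[of "\<lambda>b. b" r b] \<Phi>(2) polyfun_coord by blast
  obtain e where e: "\<Phi> e * \<Theta> e \<noteq> 0" "\<Psi> e \<noteq> 0"
    using polyfun_mult_nonzero[OF polyfun_mult[OF \<Phi>(1) \<Theta>(1)] \<Psi>(1), of b c] \<Phi> \<Theta> \<Psi> by auto
  show ?thesis unfolding generic_def
    by (rule exI[of _ "\<lambda>b. \<Phi> b * \<Psi> b"], intro conjI exI[of _ e] polyfun_mult) (use \<Phi> \<Psi> \<Theta> e in auto)
qed

lemma generic_ball:
  fixes P :: "'i \<Rightarrow> (nat \<Rightarrow> 'k::alg_closed_field ^ 'v) \<Rightarrow> bool"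
  assumes "finite A" "\<And>i. i \<in> A \<Longrightarrow> generic r (P i)" "A \<noteq> {}"
  shows "generic r (\<lambda>b. \<forall>i\<in>A. P i b)"
  using assms(1,3,2)
proof (induction A rule: finite_ne_induct)
  case (insert i A)
  then have "generic r (\<lambda>b. P i b \<and> (\<forall>i\<in>A. P i b))" by (intro generic_conj) auto
  then show ?case by simp
qed simp

lemma frame_exists_le:
  assumes "r \<le> CARD('v)"
  shows "\<exists>b :: nat \<Rightarrow> 'k::field ^ 'v. frame r b"
proof -
  obtain b :: "nat \<Rightarrow> 'k ^ 'v" where "frame CARD('v) b"
    using frame_exists[of "UNIV :: ('k ^ 'v) set"] vec_dim_card by (metis vec.subspace_UNIV)
  moreover have "{..<r} \<subseteq> {..<CARD('v)}" using assms by auto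
  ultimately have "vec.independent (b ` {..<r})" "inj_on b {..<r}"
    using frame_independent frame_inj vec.independent_mono inj_on_subset image_mono by metis+
  then show ?thesis using frameI by blast
qed

lemma generic_nonzero:
  fixes \<Phi> :: "(nat \<Rightarrow> 'k::alg_closed_field ^ 'v) \<Rightarrow> 'k"
  assumes "polyfun \<Phi>" "\<Phi> b \<noteq> 0" "r \<le> CARD('v)"
  shows "generic r (\<lambda>b. \<Phi> b \<noteq> 0)"
proof -
  obtain c :: "nat \<Rightarrow> 'k ^ 'v" where c: "frame r c" using frame_exists_le assms by blast
  obtain \<Theta> where \<Theta>: "polyfun \<Theta>" "\<Theta> c \<noteq> 0" "\<And>b. \<Theta> b \<noteq> 0 \<Longrightarrow> frame r b"
    using frame_open[of "\<lambda>b. b" r c] c polyfun_coord by blast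
  obtain e where "\<Phi> e \<noteq> 0" "\<Theta> e \<noteq> 0" using polyfun_mult_nonzero[OF assms(1) \<Theta>(1) assms(2) \<Theta>(2)] by blast
  then show ?thesis unfolding generic_def using assms(1) \<Theta>(3) by blast
qed

text \<open>Gram-Schmidt orthogonalisation without division. It supplies functionals that vanish on
  the span of \<open>b\<close>, vary polynomially with \<open>b\<close>, and take prescribed values
  at \<open>b0\<close>.\<close>

lemma orthogonal_family:
  fixes b0 e :: "nat \<Rightarrow> 'k::field ^ 'v"
  assumes "\<And>i j. i < r \<Longrightarrow> j < r \<Longrightarrow> e i \<odot> b0 j = (if i = j then 1 else 0)"
  shows "\<exists>G :: (nat \<Rightarrow> 'k ^ 'v) \<Rightarrow> 'k ^ 'v \<Rightarrow> 'k ^ 'v. (\<forall>w i. polyfun (\<lambda>b. G b w $ i)) \<and>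
    (\<forall>w b. \<forall>j<r. G b w \<odot> b j = 0) \<and> (\<forall>w. (\<forall>j<r. w \<odot> b0 j = 0) \<longrightarrow> G b0 w = w)"
  using assms
proof (induction r)
  case 0
  show ?case by (rule exI[of _ "\<lambda>b w. w"]) (simp add: polyfun_const)
next
  case (Suc r)
  then obtain G :: "(nat \<Rightarrow> 'k ^ 'v) \<Rightarrow> 'k ^ 'v \<Rightarrow> 'k ^ 'v" where G: "\<And>w i. polyfun (\<lambda>b. G b w $ i)"
    "\<And>w b j. j < r \<Longrightarrow> G b w \<odot> b j = 0" "\<And>w. (\<forall>j<r. w \<odot> b0 j = 0) \<Longrightarrow> G b0 w = w" by auto
  \<comment> \<open>The combination is orthogonal to \<open>b r\<close> by construction and to the
    earlier vectors by induction. At \<open>b0\<close> the scaling factor is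
    \<open>e r \<odot> b0 r = 1\<close>, so nothing changes there.\<close>
  define H where "H b w = (G b (e r) \<odot> b r) *s G b w - (G b w \<odot> b r) *s G b (e r)" for b w
  have "polyfun (\<lambda>b. H b w $ i)" for w i
    unfolding H_def by (simp, intro polyfun_diff polyfun_mult G polyfun_dotp polyfun_coord)
  moreover have "H b w \<odot> b j = 0" if "j < Suc r" for b w j
    using that G(2) by (cases "j = r") (simp_all add: H_def dotp_simps)
  moreover have "H b0 w = w" if "\<forall>j<Suc r. w \<odot> b0 j = 0" for w
  proof -
    have "G b0 w = w" "G b0 (e r) = e r" using that Suc.prems by (auto intro!: G(3))
    then show ?thesis using that Suc.prems[of r r] by (simp add: H_def)
  qed
  ultimately show ?case by blast
qed

text \<open>Near a given frame of the subspace, elimination yields a frame \<open>B b\<close> of its annihilator whose entries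
  are polynomials in the entries of that frame.\<close>

lemma general_subspace_perp:
  fixes P :: "('k::alg_closed_field ^ 'v) set \<Rightarrow> bool"
  assumes "generic s (\<lambda>b. P (perp s b))" "s \<le> CARD('v)"
  shows "general_subspace (CARD('v) - s) P"
proof -
  let ?r = "CARD('v) - s"
  obtain \<Phi> \<beta> where \<Phi>: "polyfun \<Phi>" "frame s \<beta>" "\<Phi> \<beta> \<noteq> 0" "\<And>b. frame s b \<Longrightarrow> \<Phi> b \<noteq> 0 \<Longrightarrow> P (perp s b)"
    using assms(1) unfolding generic_def by blast
  have "vec.dim (perp s \<beta>) = ?r" using dim_perp[OF \<Phi>(2)] by simp
  then obtain b0 where b0: "frame ?r b0" "vec.span (b0 ` {..<?r}) = perp s \<beta>"
    using frame_exists subspace_perp by blast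
  obtain e where "\<And>i j. i < ?r \<Longrightarrow> j < ?r \<Longrightarrow> e i \<odot> b0 j = (if i = j then 1 else 0)"
    using frame_dual[OF b0(1)] by blast
  then obtain G :: "(nat \<Rightarrow> 'k ^ 'v) \<Rightarrow> 'k ^ 'v \<Rightarrow> 'k ^ 'v" where G: "\<And>w i. polyfun (\<lambda>b. G b w $ i)"
    "\<And>w b j. j < ?r \<Longrightarrow> G b w \<odot> b j = 0" "\<And>w. (\<forall>j<?r. w \<odot> b0 j = 0) \<Longrightarrow> G b0 w = w"
    using orthogonal_family[of ?r e b0] by blast
  \<comment> \<open>Entries from index \<open>s\<close> on do not affect \<open>perp s\<close>, but
    \<open>\<Phi>\<close> may depend on them; copying those of \<open>\<beta>\<close> yields
    \<open>B b0 = \<beta>\<close>.\<close>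
  define B where "B b j = (if j < s then G b (\<beta> j) else \<beta> j)" for b j
  have B: "polyfun (\<lambda>b. B b j $ i)" for j i
    by (cases "j < s") (simp_all add: B_def G polyfun_const)
  have "B b0 = \<beta>"
  proof
    fix j
    have "\<beta> j \<odot> b0 k = 0" if "j < s" "k < ?r" for k
    proof -
      have "b0 k \<in> perp s \<beta>" using b0(2) that by (metis vec.span_base imageI lessThan_iff)
      then show ?thesis using that by (simp add: perp_def)
    qed
    then show "B b0 j = \<beta> j" using G(3) by (simp add: B_def)
  qed
  then obtain \<Theta> where \<Theta>: "polyfun \<Theta>" "\<Theta> b0 \<noteq> 0" "\<And>b. \<Theta> b \<noteq> 0 \<Longrightarrow> frame s (B b)"
    using frame_open[of B s b0, OF B] \<Phi>(2) by auto
  have "generic ?r (\<lambda>b. P (vec.span (b ` {..<?r})))"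
    unfolding generic_def
  proof (intro exI[of _ "\<lambda>b. \<Phi> (B b) * \<Theta> b"] conjI allI impI exI[of _ b0])
    show "polyfun (\<lambda>b. \<Phi> (B b) * \<Theta> b)" by (rule polyfun_mult[OF polyfun_compose[OF \<Phi>(1), of B, OF B] \<Theta>(1)])
    show "frame ?r b0" by (rule b0)
    show "\<Phi> (B b0) * \<Theta> b0 \<noteq> 0" using \<Theta> \<Phi> \<open>B b0 = \<beta>\<close> by simp
    fix b assume b: "frame ?r b \<and> \<Phi> (B b) * \<Theta> b \<noteq> 0"
    then have fB: "frame s (B b)" using \<Theta> by auto
    \<comment> \<open>The inclusion is built into \<open>B\<close>; equality of dimensions turns it
      into an equality of subspaces.\<close>
    have "vec.span (b ` {..<?r}) \<subseteq> perp s (B b)"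
      using subspace_perp by (intro vec.span_minimal) (auto simp: perp_def B_def G)
    moreover have "vec.dim (vec.span (b ` {..<?r})) = vec.dim (perp s (B b))"
      using dim_perp[OF fB] b by (simp add: frame_iff_dim)
    ultimately have "vec.span (b ` {..<?r}) = perp s (B b)"
      using subspace_perp by (intro vec.subspace_dim_equal) auto
    then show "P (vec.span (b ` {..<?r}))" using \<Phi>(4)[OF fB] b by simp
  qed
  then show ?thesis by (simp add: general_subspace_generic)
qed

section \<open>Forms vanishing to high order along a subspace of codimension 2\<close>

abbreviation ev :: "('v::finite, 'k::comm_ring_1) mpoly \<Rightarrow> 'k ^ 'v \<Rightarrow> 'k" where
  "ev f x \<equiv> meval f (($) x)"

lemma ev_hom_scale: "f \<in> hom_part (int k) \<Longrightarrow> ev f (t *s x) = t ^ k * ev f x"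
proof -
  have "($) (t *s x) = (\<lambda>i. t * x $ i)" by (simp add: fun_eq_iff)
  then show "f \<in> hom_part (int k) \<Longrightarrow> ?thesis" using meval_hom_scale[of f k t "($) x"] by simp
qed

text \<open>Homogeneous coordinates of a point, chosen once and for all; whether a form vanishes
  does not depend on the choice.\<close>

definition rp :: "('k::field ^ 'v::finite) set \<Rightarrow> 'k ^ 'v" where
  "rp P = (SOME x. x \<in> P \<and> x \<noteq> 0)"

lemma rp:
  assumes "P \<in> proj_points"
  shows "rp P \<in> P" "rp P \<noteq> 0" "vec.span {rp P} = P"
proof -
  have P: "vec.subspace P" "vec.dim P = 1" using assms by (auto simp: proj_points_def)
  then have "\<exists>x. x \<in> P \<and> x \<noteq> 0"
    by (metis vec.dim_eq_0 subsetI singleton_iff zero_neq_one)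
  then show r: "rp P \<in> P" "rp P \<noteq> 0" unfolding rp_def by (metis (mono_tags, lifting) someI_ex)+
  show "vec.span {rp P} = P"
    by (rule vec.subspace_dim_equal) (use r P in \<open>auto simp: vec.span_minimal\<close>)
qed

lemma proj_point_iff: "P \<in> proj_points \<Longrightarrow> x \<in> P \<longleftrightarrow> (\<exists>t. x = t *s rp P)"
  using rp(3)[of P] by (auto simp: vec.span_singleton)

lemma span_in_proj_points: "x \<noteq> 0 \<Longrightarrow> vec.span {x} \<in> proj_points"
  by (auto simp: proj_points_def)

lemma rp_eq_imp_eq: "P \<in> proj_points \<Longrightarrow> P' \<in> proj_points \<Longrightarrow> rp P' \<in> P \<Longrightarrow> P = P'"
proof -
  assume a: "P \<in> proj_points" "P' \<in> proj_points" "rp P' \<in> P"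
  have P: "vec.subspace P" "vec.dim P = 1" "vec.subspace P'" "vec.dim P' = 1" using a by (auto simp: proj_points_def)
  have "P' \<subseteq> P" using vec.span_minimal[of "{rp P'}" P] a P rp(3)[OF a(2)] by simp
  then show "P = P'" using vec.subspace_dim_equal[of P' P] P by simp
qed

lemma vanishes_at_hom:
  assumes "P \<in> proj_points" "f \<in> hom_part (int d)"
  shows "vanishes_at f P \<longleftrightarrow> ev f (rp P) = 0"
  using rp[OF assms(1)] proj_point_iff[OF assms(1)] ev_hom_scale[OF assms(2)]
  by (auto simp: vanishes_at_def)

lemma vanishing_ideal_proj_set:
  "f \<in> vanishing_ideal (proj_set W) \<longleftrightarrow> (\<forall>x\<in>W. x \<noteq> 0 \<longrightarrow> ev f x = 0)" if W: "vec.subspace W"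
proof
  assume f: "f \<in> vanishing_ideal (proj_set W)"
  show "\<forall>x\<in>W. x \<noteq> 0 \<longrightarrow> ev f x = 0"
  proof (intro ballI impI)
    fix x assume x: "x \<in> W" "x \<noteq> 0"
    have "vec.span {x} \<in> proj_set W"
      using x span_in_proj_points vec.span_minimal[OF _ W, of "{x}"] by (auto simp: proj_set_def)
    then have "vanishes_at f (vec.span {x})" using f by (auto simp: vanishing_ideal_def)
    then show "ev f x = 0" using x vec.span_base[of x "{x}"] by (auto simp: vanishes_at_def)
  qed
qed (auto simp: vanishing_ideal_def proj_set_def vanishes_at_def)

text \<open>\<open>vanishing_ideal\<close> tests nonzero vectors only. Since
  \<open>ev f (t *s x)\<close> is a polynomial in \<open>t\<close>, vanishing for all nonzero
  \<open>t\<close> extends to the origin.\<close>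

lemma ev_zero_vector:
  fixes f :: "('v::finite, 'k::alg_closed_field) mpoly"
  assumes "x \<noteq> 0" "\<And>t. t \<noteq> 0 \<Longrightarrow> ev f (t *s x) = 0"
  shows "ev f 0 = 0"
proof -
  define p where "p = geval (\<lambda>c. [:c:]) (\<lambda>i. [:0, x $ i:]) f"
  have p: "poly p t = ev f (t *s x)" for t 
  proof -
    have "($) (t *s x) = (\<lambda>i. t * x $ i)" by (simp add: fun_eq_iff)
    then show ?thesis by (simp add: p_def poly_geval)
  qed
  have "p * [:0, 1:] = 0" by (rule poly_zero_infinite) (use p assms in \<open>auto simp: mult_eq_0_iff\<close>)
  then have "p = 0" by simp
  then show ?thesis using p[of 0] by (simp add: zero_vec_def)
qed

lemma ev_vanishing_subspace:
  fixes f :: "('v::finite, 'k::alg_closed_field) mpoly"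
  assumes "vec.subspace W" "W \<noteq> {0}" "f \<in> vanishing_ideal (proj_set W)" "x \<in> W"
  shows "ev f x = 0"
proof (cases "x = 0")
  case True
  obtain y where y: "y \<in> W" "y \<noteq> 0" using assms(1,2) vec.subspace_0 by blast
  have "ev f (t *s y) = 0" if "t \<noteq> 0" for t
    using assms(1,3) y that by (auto simp: vanishing_ideal_proj_set vec.subspace_scale)
  then show ?thesis using ev_zero_vector[OF y(2)] True by simp
qed (use assms vanishing_ideal_proj_set in auto)

text \<open>Substituting the projection onto the subspace changes \<open>f\<close> by a combination
  of the linear equations, and what remains vanishes everywhere. The bound on \<open>r\<close> keeps
  the subspace nonzero; otherwise its projective set is empty and constants vanish on it.\<close>

lemma vanishing_ideal_perp:
  fixes b :: "nat \<Rightarrow> 'k::alg_closed_field ^ 'v"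
  assumes b: "frame r b" and r: "r < CARD('v)"
  shows "f \<in> vanishing_ideal (proj_set (perp r b)) \<longleftrightarrow> (\<exists>g. f = (\<Sum>j<r. g j * Lin (b j)))"
proof
  assume f: "f \<in> vanishing_ideal (proj_set (perp r b))"
  obtain e where e: "\<And>i j. i < r \<Longrightarrow> j < r \<Longrightarrow> e i \<odot> b j = (if i = j then 1 else 0)"
    using frame_dual[OF b] by blast
  define I where "I = {f. \<exists>g. f = (\<Sum>j<r. g j * Lin (b j))}"
  \<comment> \<open>The coordinates of the projection onto \<open>perp r b\<close> along the dual
    vectors \<open>e j\<close>.\<close>
  define q where "q i = Var i - (\<Sum>j<r. Const (e j $ i) * Lin (b j))" for i
  have W: "perp r b \<noteq> {0}" using dim_perp[OF b] r by (metis add_cancel_left_left less_irrefl vec.dim_eq_0 subset_refl)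
  have "f - geval Const q f \<in> I"
  proof (rule subst_diff)
    show "0 \<in> I" unfolding I_def by (auto intro: exI[of _ "\<lambda>_. 0"])
    show "f + g \<in> I" if "f \<in> I" "g \<in> I" for f g
    proof -
      from that obtain u v where "f = (\<Sum>j<r. u j * Lin (b j))" "g = (\<Sum>j<r. v j * Lin (b j))" unfolding I_def by blast
      then have "f + g = (\<Sum>j<r. (u j + v j) * Lin (b j))" by (simp add: algebra_simps sum.distrib)
      then show ?thesis unfolding I_def by (intro CollectI exI[of _ "\<lambda>j. u j + v j"])
    qed
    show "g * f \<in> I" if "f \<in> I" for f g
    proof -
      from that obtain u where "f = (\<Sum>j<r. u j * Lin (b j))" unfolding I_def by blast
      then have "g * f = (\<Sum>j<r. (g * u j) * Lin (b j))" by (simp add: algebra_simps sum_distrib_left)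
      then show ?thesis unfolding I_def by (intro CollectI exI[of _ "\<lambda>j. g * u j"])
    qed
    show "Var i - q i \<in> I" for i unfolding I_def q_def by (auto intro: exI[of _ "\<lambda>j. Const (e j $ i)"])
  qed
  moreover have "geval Const q f = 0"
  proof (rule meval_zero_imp_zero)
    fix x :: "'v \<Rightarrow> 'k"
    define y where "y = (\<chi> i. x i)"
    have x: "x = ($) y" by (simp add: y_def fun_eq_iff)
    define z where "z = y - (\<Sum>j<r. (b j \<odot> y) *s e j)"
    have "z \<in> perp r b" unfolding perp_def
    proof (intro CollectI allI impI)
      fix j assume j: "j < r"
      have "b j \<odot> (\<Sum>i<r. (b i \<odot> y) *s e i) = (\<Sum>i<r. if i = j then b i \<odot> y else 0)"
        unfolding dotp_sum_right dotp_scale_right by (rule sum.cong) (use j e dotp_commute[of "b j"] in auto)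
      then show "b j \<odot> z = 0" using j by (simp add: z_def dotp_simps)
    qed
    then have "ev f z = 0" using ev_vanishing_subspace[OF subspace_perp W f] by blast
    moreover have "(\<lambda>i. meval (q i) x) = ($) z"
      by (simp add: fun_eq_iff q_def meval_simps z_def x meval_Lin mult.commute)
    ultimately show "meval (geval Const q f) x = 0" by (simp add: meval_subst)
  qed
  ultimately show "\<exists>g. f = (\<Sum>j<r. g j * Lin (b j))" by (simp add: I_def)
next
  assume "\<exists>g. f = (\<Sum>j<r. g j * Lin (b j))"
  then show "f \<in> vanishing_ideal (proj_set (perp r b))"
    unfolding vanishing_ideal_proj_set[OF subspace_perp] by (auto simp: meval_simps meval_Lin perp_def)
qed

section \<open>Powers of the ideal of a subspace of codimension 2\<close>

interpretation ring_mod: module "(*) :: 'a::comm_ring_1 \<Rightarrow> 'a \<Rightarrow> 'a"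
  by standard (simp_all add: algebra_simps)

declare ring_mod.scale_scale [simp del] mpoly_vs.scale_scale [simp del]

lemma ring_span_mult:
  fixes A B :: "'a::comm_ring_1 set"
  assumes "a \<in> ring_mod.span A" "b \<in> ring_mod.span B"
  shows "a * b \<in> ring_mod.span {x * y |x y. x \<in> A \<and> y \<in> B}"
  using assms(1)
proof (induction rule: ring_mod.span_induct_alt)
  case base
  show ?case by (simp add: ring_mod.span_zero)
next
  case (step c x y)
  have "x * b \<in> ring_mod.span {x * y |x y. x \<in> A \<and> y \<in> B}"
    using assms(2)
  proof (induction rule: ring_mod.span_induct_alt)
    case base
    show ?case by (simp add: ring_mod.span_zero)
  next
    case (step c' x' y')
    have "x * x' \<in> ring_mod.span {x * y |x y. x \<in> A \<and> y \<in> B}"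
      using step \<open>x \<in> A\<close> by (intro ring_mod.span_base) auto
    then have "c' * (x * x') + x * y' \<in> ring_mod.span {x * y |x y. x \<in> A \<and> y \<in> B}"
      using step(2) by (rule ring_mod.span_add[OF ring_mod.span_scale])
    then show ?case by (simp add: algebra_simps)
  qed
  then have "c * (x * b) + y * b \<in> ring_mod.span {x * y |x y. x \<in> A \<and> y \<in> B}"
    by (rule ring_mod.span_add[OF ring_mod.span_scale step(2)])
  then show ?case by (simp add: algebra_simps)
qed

lemma ideal_power_two:
  fixes u v :: "'a::comm_ring_1"
  assumes I: "I = ring_mod.span {u, v}"
  shows "ideal_power I k = ring_mod.span {u ^ i * v ^ j |i j. i + j = k}"
proof (induction k)
  case 0
  have "x \<in> ring_mod.span {u ^ i * v ^ j |i j. i + j = 0}" for x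
    using ring_mod.span_scale[OF ring_mod.span_base[of 1 "{u ^ i * v ^ j |i j. i + j = 0}"], of x] by simp
  then show ?case by auto
next
  case (Suc k)
  let ?T = "\<lambda>k. {u ^ i * v ^ j |i j. i + j = k}"
  have "ideal_power I (Suc k) = ring_mod.span {a * b |a b. a \<in> I \<and> b \<in> ring_mod.span (?T k)}"
    by (simp add: ideal_generated_def Suc)
  also have "\<dots> = ring_mod.span (?T (Suc k))"
  proof (rule subset_antisym; rule ring_mod.span_minimal)
    show "{a * b |a b. a \<in> I \<and> b \<in> ring_mod.span (?T k)} \<subseteq> ring_mod.span (?T (Suc k))"
    proof clarify
      fix a b assume "a \<in> I" "b \<in> ring_mod.span (?T k)"
      then have "a * b \<in> ring_mod.span {x * y |x y. x \<in> {u, v} \<and> y \<in> ?T k}"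
        using ring_span_mult I by blast
      moreover have "{x * y |x y. x \<in> {u, v} \<and> y \<in> ?T k} \<subseteq> ?T (Suc k)"
      proof clarify
        fix x y i j assume "x \<in> {u, v}" "k = i + j"
        then consider "x = u" | "x = v" by blast
        then show "\<exists>i' j'. x * (u ^ i * v ^ j) = u ^ i' * v ^ j' \<and> i' + j' = Suc (i + j)"
        proof cases
          case 1
          show ?thesis by (rule exI[of _ "Suc i"], rule exI[of _ j]) (simp add: 1 mult_ac)
        next
          case 2
          show ?thesis by (rule exI[of _ i], rule exI[of _ "Suc j"]) (simp add: 2 mult_ac)
        qed
      qed
      ultimately show "a * b \<in> ring_mod.span (?T (Suc k))" using ring_mod.span_mono by blast
    qed
    show "?T (Suc k) \<subseteq> ring_mod.span {a * b |a b. a \<in> I \<and> b \<in> ring_mod.span (?T k)}"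
    proof clarify
      fix i j assume ij: "i + j = Suc k"
      have uv: "u \<in> I" "v \<in> I" unfolding I by (auto intro: ring_mod.span_base)
      have "\<exists>a b. u ^ i * v ^ j = a * b \<and> a \<in> I \<and> b \<in> ?T k"
      proof (cases i)
        case 0
        show ?thesis by (rule exI[of _ v], rule exI[of _ "v ^ k"]) (use 0 ij uv in \<open>force simp: exI[of _ "0::nat"]\<close>)
      next
        case (Suc i')
        show ?thesis by (rule exI[of _ u], rule exI[of _ "u ^ i' * v ^ j"]) (use Suc ij uv in \<open>auto simp: mult_ac\<close>)
      qed
      then obtain a b where ab: "u ^ i * v ^ j = a * b" "a \<in> I" "b \<in> ?T k" by blast
      have "b \<in> ring_mod.span (?T k)" by (rule ring_mod.span_base[OF ab(3)])
      then have "a * b \<in> {a * b |a b. a \<in> I \<and> b \<in> ring_mod.span (?T k)}" using ab(2) by blast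
      then show "u ^ i * v ^ j \<in> ring_mod.span {a * b |a b. a \<in> I \<and> b \<in> ring_mod.span (?T k)}"
        unfolding ab(1) by (rule ring_mod.span_base)
    qed
  qed simp_all
  finally show ?case .
qed

text \<open>The degree \<open>d\<close> part of the power \<open>d - 1\<close> of the ideal of
  \<open>perp 2 b\<close>, given by generators so that its dependence on \<open>b\<close> is visible
  and so that it makes sense for every family \<open>b\<close>, frame or not.\<close>

definition Jf :: "(nat \<Rightarrow> 'k::field ^ 'v) \<Rightarrow> nat \<Rightarrow> ('v, 'k) mpoly set" where
  "Jf b d = mpoly_vs.span {Lin w * (Lin (b 0) ^ i * Lin (b 1) ^ j) |w i j. Suc (i + j) = d}"

lemma subspace_hom_part: "mpoly_vs.subspace (hom_part j :: ('v::finite, 'k::field) mpoly set)"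
  unfolding mpoly_vs.subspace_def by (auto simp: hom_part_add hom_part_scale)

lemma subspace_Jf: "mpoly_vs.subspace (Jf b d)"
  by (simp add: Jf_def)

lemma hom_part_Lin_powers: "Lin u ^ i * Lin v ^ j \<in> hom_part (int (i + j))"
  using hom_part_mult[OF hom_part_power1[OF hom_part_Lin] hom_part_power1[OF hom_part_Lin]] by simp

lemma Jf_subset_hom_part: "Jf b d \<subseteq> hom_part (int d)"
  unfolding Jf_def
proof (rule mpoly_vs.span_minimal[OF _ subspace_hom_part], clarify)
  fix w i j
  show "Lin w * (Lin (b 0) ^ i * Lin (b 1) ^ j) \<in> hom_part (int (Suc (i + j)))"
    using hom_part_mult[OF hom_part_Lin hom_part_Lin_powers] by (metis of_nat_Suc add.commute)
qed

text \<open>The generators of the power have degree \<open>d - 1\<close>, so only the linear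
  components of their coefficients contribute in degree \<open>d\<close>.\<close>

theorem ideal_power_eq_Jf:
  fixes b :: "nat \<Rightarrow> 'k::alg_closed_field ^ 'v"
  assumes b: "frame 2 b" and r: "2 < CARD('v)" and d: "d \<ge> 1"
  shows "ideal_power (vanishing_ideal (proj_set (perp 2 b))) (d - 1) \<inter> hom_part (int d) = Jf b d"
proof -
  let ?T = "{Lin (b 0) ^ i * Lin (b 1) ^ j |i j. i + j = d - 1}"
  have "vanishing_ideal (proj_set (perp 2 b)) = ring_mod.span {Lin (b 0), Lin (b 1)}"
  proof -
    have "(\<exists>g. f = (\<Sum>j<2. g j * Lin (b j))) \<longleftrightarrow> f \<in> ring_mod.span {Lin (b 0), Lin (b 1)}" for f
    proof
      assume "f \<in> ring_mod.span {Lin (b 0), Lin (b 1)}"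
      then obtain u where "f - u * Lin (b 0) \<in> ring_mod.span {Lin (b 1)}" by (auto simp: ring_mod.span_insert[of _ "{_}"])
      then obtain v where "f - u * Lin (b 0) = v * Lin (b 1)" by (auto simp: ring_mod.span_singleton)
      then have "f = u * Lin (b 0) + v * Lin (b 1)" by (simp add: diff_eq_eq add.commute)
      then show "\<exists>g. f = (\<Sum>j<2. g j * Lin (b j))"
        by (intro exI[of _ "\<lambda>j. if j = 0 then u else v"]) (simp add: numeral_2_eq_2)
    next
      assume "\<exists>g. f = (\<Sum>j<2. g j * Lin (b j))"
      then obtain g where "f = g (0::nat) * Lin (b 0) + g 1 * Lin (b 1)" by (auto simp: numeral_2_eq_2)
      moreover have "Lin (b j) \<in> ring_mod.span {Lin (b 0), Lin (b 1)}" if "j \<in> {0, 1}" for j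
        using that by (intro ring_mod.span_base) auto
      ultimately show "f \<in> ring_mod.span {Lin (b 0), Lin (b 1)}"
        using ring_mod.span_add ring_mod.span_scale by (metis insertCI)
    qed
    then show ?thesis using vanishing_ideal_perp[OF b r] by blast
  qed
  then have ip: "ideal_power (vanishing_ideal (proj_set (perp 2 b))) (d - 1) = ring_mod.span ?T"
    by (rule ideal_power_two)
  show ?thesis
  proof
    show "ideal_power (vanishing_ideal (proj_set (perp 2 b))) (d - 1) \<inter> hom_part (int d) \<subseteq> Jf b d"
    proof
      fix f assume "f \<in> ideal_power (vanishing_ideal (proj_set (perp 2 b))) (d - 1) \<inter> hom_part (int d)"
      then have f: "f \<in> ring_mod.span ?T" "hc d f = f" using ip by (auto simp: hc_eq)
      from f(1) have "hc d f \<in> Jf b d"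
      proof (induction rule: ring_mod.span_induct_alt)
        case base
        show ?case using mpoly_vs.subspace_0[OF subspace_Jf] by simp
      next
        case (step c x y)
        then obtain i j where x: "x = Lin (b 0) ^ i * Lin (b 1) ^ j" "i + j = d - 1" by blast
        have "hc d (c * x) = hc 1 c * x"
          using hc_mult[of x "d - 1" 1 c] hom_part_Lin_powers[of "b 0" i "b 1" j] x d by simp
        moreover have "hc 1 c \<in> hom_part 1" using hc_hom[of 1 c] by simp
        then obtain w where "hc 1 c = Lin w" using hom_part_1_Lin by blast
        ultimately have "hc d (c * x) = Lin w * (Lin (b 0) ^ i * Lin (b 1) ^ j) \<and> Suc (i + j) = d"
          using x d by simp
        then have "hc d (c * x) \<in> {Lin w * (Lin (b 0) ^ i * Lin (b 1) ^ j) |w i j. Suc (i + j) = d}" by blast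
        then have "hc d (c * x) \<in> Jf b d" unfolding Jf_def by (rule mpoly_vs.span_base)
        then show ?case using step by (simp add: hc_add mpoly_vs.subspace_add[OF subspace_Jf])
      qed
      then show "f \<in> Jf b d" using f by simp
    qed
    have "Jf b d \<subseteq> ring_mod.span ?T"
      unfolding Jf_def
    proof (rule mpoly_vs.span_minimal)
      show "{Lin w * (Lin (b 0) ^ i * Lin (b 1) ^ j) |w i j. Suc (i + j) = d} \<subseteq> ring_mod.span ?T"
      proof
        fix x assume "x \<in> {Lin w * (Lin (b 0) ^ i * Lin (b 1) ^ j) |w i j. Suc (i + j) = d}"
        then obtain w i j where x: "x = Lin w * (Lin (b 0) ^ i * Lin (b 1) ^ j)" "Suc (i + j) = d" by blast
        then have "i + j = d - 1" by simp
        then have "Lin (b 0) ^ i * Lin (b 1) ^ j \<in> ?T" by blast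
        then show "x \<in> ring_mod.span ?T"
          unfolding x(1) by (rule ring_mod.span_scale[OF ring_mod.span_base])
      qed
      show "mpoly_vs.subspace (ring_mod.span ?T)"
        unfolding mpoly_vs.subspace_def by (auto simp: ring_mod.span_zero intro: ring_mod.span_add ring_mod.span_scale)
    qed
    then show "Jf b d \<subseteq> ideal_power (vanishing_ideal (proj_set (perp 2 b))) (d - 1) \<inter> hom_part (int d)"
      using ip Jf_subset_hom_part by blast
  qed
qed

section \<open>Points imposing independent conditions\<close>

text \<open>Linear independence of the evaluations at the points of \<open>A\<close> as functionals
  on \<open>J\<close>, expressed by separating forms.\<close>

definition indep_on :: "('v::finite, 'k::field) mpoly set \<Rightarrow> ('k ^ 'v) set set \<Rightarrow> bool" where
  "indep_on J A \<longleftrightarrow> finite A \<and> (\<forall>P\<in>A. \<exists>F\<in>J. ev F (rp P) \<noteq> 0 \<and> (\<forall>P'\<in>A - {P}. ev F (rp P') = 0))"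

lemma indep_on_dual:
  assumes J: "mpoly_vs.subspace J" and A: "indep_on J A"
  obtains F where "\<And>P. P \<in> A \<Longrightarrow> F P \<in> J"
    "\<And>P P'. P \<in> A \<Longrightarrow> P' \<in> A \<Longrightarrow> ev (F P) (rp P') = (if P' = P then 1 else 0)"
proof -
  have "\<exists>F\<in>J. \<forall>P'\<in>A. ev F (rp P') = (if P' = P then 1 else 0)" if P: "P \<in> A" for P
  proof -
    obtain F where F: "F \<in> J" "ev F (rp P) \<noteq> 0" "\<forall>P'\<in>A - {P}. ev F (rp P') = 0"
      using A P unfolding indep_on_def by blast
    then have "Const (inverse (ev F (rp P))) * F \<in> J" using mpoly_vs.subspace_scale[OF J] by blast
    moreover have "\<forall>P'\<in>A. ev (Const (inverse (ev F (rp P))) * F) (rp P') = (if P' = P then 1 else 0)"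
      using F by (auto simp: meval_simps)
    ultimately show ?thesis by blast
  qed
  then obtain F where "\<forall>P\<in>A. F P \<in> J \<and> (\<forall>P'\<in>A. ev (F P) (rp P') = (if P' = P then 1 else 0))"
    by metis
  then show thesis using that[of F] by simp
qed

lemma indep_on_subset: "indep_on J A \<Longrightarrow> B \<subseteq> A \<Longrightarrow> indep_on J B"
  unfolding indep_on_def
proof (intro conjI ballI; elim conjE)
  fix P assume B: "B \<subseteq> A" "P \<in> B" and A: "\<forall>P\<in>A. \<exists>F\<in>J. ev F (rp P) \<noteq> 0 \<and> (\<forall>P'\<in>A - {P}. ev F (rp P') = 0)"
  then obtain F where "F \<in> J" "ev F (rp P) \<noteq> 0" "\<forall>P'\<in>A - {P}. ev F (rp P') = 0" by blast
  then show "\<exists>F\<in>J. ev F (rp P) \<noteq> 0 \<and> (\<forall>P'\<in>B - {P}. ev F (rp P') = 0)" using B by blast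
qed (rule finite_subset)

lemma indep_on_empty: "indep_on J {}"
  by (simp add: indep_on_def)

text \<open>Forms dual to the points stay linearly independent when replaced by elements of the span
  with the same values on \<open>A\<close>. Since only these values matter, \<open>J\<close> may be
  replaced by its restriction to a linear subspace.\<close>

lemma indep_on_card_le:
  fixes J :: "('v::finite, 'k::field) mpoly set"
  assumes J: "mpoly_vs.subspace J" and A: "indep_on J A" and B: "finite B"
    and agree: "\<And>F. F \<in> J \<Longrightarrow> \<exists>G\<in>mpoly_vs.span B. \<forall>P\<in>A. ev F (rp P) = ev G (rp P)"
  shows "card A \<le> card B"
proof -
  obtain F where F: "\<And>P. P \<in> A \<Longrightarrow> F P \<in> J"
    "\<And>P P'. P \<in> A \<Longrightarrow> P' \<in> A \<Longrightarrow> ev (F P) (rp P') = (if P' = P then 1 else 0)"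
    using indep_on_dual[OF J A] by blast
  have "\<forall>P\<in>A. \<exists>G. G \<in> mpoly_vs.span B \<and> (\<forall>P'\<in>A. ev (F P) (rp P') = ev G (rp P'))"
    using agree F(1) by blast
  from bchoice[OF this] obtain G where "\<forall>P\<in>A. G P \<in> mpoly_vs.span B \<and> (\<forall>P'\<in>A. ev (F P) (rp P') = ev (G P) (rp P'))" ..
  then have G: "\<And>P. P \<in> A \<Longrightarrow> G P \<in> mpoly_vs.span B"
    "\<And>P P'. P \<in> A \<Longrightarrow> P' \<in> A \<Longrightarrow> ev (G P) (rp P') = (if P' = P then 1 else 0)"
    using F(2) by auto
  have fin: "finite A" using A by (simp add: indep_on_def)
  have inj: "inj_on G A"
    by (rule inj_onI) (metis G(2) one_neq_zero)
  have "mpoly_vs.independent (G ` A)"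
  proof
    assume "mpoly_vs.dependent (G ` A)"
    then obtain u P where u: "P \<in> A" "u (G P) \<noteq> 0" "(\<Sum>g\<in>G ` A. Const (u g) * g) = 0"
      using fin by (auto simp: mpoly_vs.dependent_finite)
    have "0 = ev (\<Sum>g\<in>G ` A. Const (u g) * g) (rp P)" using u by simp
    also have "\<dots> = (\<Sum>P'\<in>A. if P' = P then u (G P') else 0)"
      unfolding sum.reindex[OF inj] meval_simps by (rule sum.cong) (use u G in \<open>auto simp: meval_simps\<close>)
    finally show False using u fin by simp
  qed
  then have "card (G ` A) \<le> card B"
    using mpoly_vs.independent_span_bound[OF B, of "G ` A"] G(1) by blast
  then show ?thesis using card_image[OF inj] by simp
qed

text \<open>\<open>F\<close> separates the new point, and a multiple of \<open>F\<close> corrects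
  each of the old separating forms there.\<close>

lemma indep_on_insert:
  assumes J: "mpoly_vs.subspace J" and A: "indep_on J A"
    and F: "F \<in> J" "\<And>P'. P' \<in> A \<Longrightarrow> ev F (rp P') = 0" "ev F (rp P) \<noteq> 0"
  shows "indep_on J (insert P A)"
  unfolding indep_on_def
proof (intro conjI ballI)
  show "finite (insert P A)" using A by (simp add: indep_on_def)
  fix Q assume Q: "Q \<in> insert P A"
  show "\<exists>F\<in>J. ev F (rp Q) \<noteq> 0 \<and> (\<forall>P'\<in>insert P A - {Q}. ev F (rp P') = 0)"
  proof (cases "Q = P")
    case True
    then show ?thesis using F by blast
  next
    case False
    then obtain G where G: "G \<in> J" "ev G (rp Q) \<noteq> 0" "\<forall>P'\<in>A - {Q}. ev G (rp P') = 0"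
      using A Q unfolding indep_on_def by blast
    let ?H = "G - Const (ev G (rp P) / ev F (rp P)) * F"
    have "?H \<in> J" by (intro mpoly_vs.subspace_diff mpoly_vs.subspace_scale J G F)
    moreover have "ev ?H (rp Q) \<noteq> 0" using G F Q False by (simp add: meval_simps)
    moreover have "\<forall>P'\<in>insert P A - {Q}. ev ?H (rp P') = 0" using G F by (auto simp: meval_simps)
    ultimately show ?thesis by blast
  qed
qed

lemma finite_mdeg: "finite {m :: 'v::finite \<Rightarrow>\<^sub>0 nat. mdeg m = d}"
proof -
  have "Poly_Mapping.lookup ` {m :: 'v \<Rightarrow>\<^sub>0 nat. mdeg m = d} \<subseteq> PiE UNIV (\<lambda>_. {..d})"
  proof clarify
    fix m :: "'v \<Rightarrow>\<^sub>0 nat"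
    have "Poly_Mapping.lookup m i \<le> mdeg m" for i
      unfolding mdeg_def by (rule member_le_sum) auto
    then show "Poly_Mapping.lookup m \<in> PiE UNIV (\<lambda>_. {..mdeg m})" by (auto simp: PiE_def extensional_def)
  qed
  then have "finite (Poly_Mapping.lookup ` {m :: 'v \<Rightarrow>\<^sub>0 nat. mdeg m = d})"
    by (rule finite_subset) (simp add: finite_PiE)
  then show ?thesis by (rule finite_imageD) (simp add: inj_on_def lookup_inject)
qed

lemma hom_part_finite_span:
  obtains B :: "('v::finite, 'k::field) mpoly set" where "finite B" "hom_part (int d) \<subseteq> mpoly_vs.span B"
proof
  let ?B = "(\<lambda>m. Poly_Mapping.single m 1) ` {m :: 'v \<Rightarrow>\<^sub>0 nat. mdeg m = d} :: ('v, 'k) mpoly set"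
  show "finite ?B" using finite_mdeg by blast
  show "hom_part (int d) \<subseteq> mpoly_vs.span ?B"
  proof
    fix f :: "('v, 'k) mpoly" assume f: "f \<in> hom_part (int d)"
    have "(\<Sum>m\<in>Poly_Mapping.keys f. Const (Poly_Mapping.lookup f m) * Poly_Mapping.single m 1) \<in> mpoly_vs.span ?B"
      by (intro mpoly_vs.span_sum mpoly_vs.span_scale mpoly_vs.span_base) (use f in \<open>auto simp: hom_part_iff\<close>)
    then show "f \<in> mpoly_vs.span ?B"
      using poly_mapping_sum_single[of f] by (simp add: Const_def mult_single)
  qed
qed

text \<open>Two bases of \<open>M / N\<close> have images under the projection \<open>f \<mapsto> \<Sum> f(x\<^sub>P) F\<^sub>P\<close> that are bases of
  the span of the dual forms \<open>F\<^sub>P\<close>.\<close>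

lemma quot_dim_eq_card:
  fixes J :: "('v::finite, 'k::field) mpoly set"
  assumes J: "mpoly_vs.subspace J" "J \<subseteq> hom_part (int d)" and X: "X \<subseteq> proj_points"
    and A: "A \<subseteq> X" "indep_on J A"
    and max: "\<And>F. F \<in> J \<Longrightarrow> (\<And>P. P \<in> A \<Longrightarrow> ev F (rp P) = 0) \<Longrightarrow> (\<forall>P\<in>X. ev F (rp P) = 0)"
  shows "quot_dim J (vanishing_ideal X \<inter> J) = card A"
proof -
  let ?N = "vanishing_ideal X \<inter> J"
  have fin: "finite A" using A by (simp add: indep_on_def)
  obtain F where F: "\<And>P. P \<in> A \<Longrightarrow> F P \<in> J"
    "\<And>P P'. P \<in> A \<Longrightarrow> P' \<in> A \<Longrightarrow> ev (F P) (rp P') = (if P' = P then 1 else 0)"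
    using indep_on_dual[OF J(1) A(2)] by blast
  have N: "f \<in> ?N \<longleftrightarrow> f \<in> J \<and> (\<forall>P\<in>A. ev f (rp P) = 0)" for f
  proof (cases "f \<in> J")
    case True
    then have f: "f \<in> hom_part (int d)" using J by blast
    have "f \<in> vanishing_ideal X \<longleftrightarrow> (\<forall>P\<in>X. ev f (rp P) = 0)"
      using X vanishes_at_hom[OF _ f] by (auto simp: vanishing_ideal_def)
    then show ?thesis using True max[OF True] A(1) by blast
  qed auto
  have inj: "inj_on F A" by (rule inj_onI) (metis F(2) one_neq_zero)
  define T where "T f = (\<Sum>P\<in>A. Const (ev f (rp P)) * F P)" for f
  have T_add: "T (f + g) = T f + T g" for f g by (simp add: T_def meval_simps Const_add distrib_right sum.distrib)
  have T_scale: "T (Const c * f) = Const c * T f" for c f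
    unfolding T_def sum_distrib_left by (rule sum.cong) (simp_all only: meval_simps Const_mult mult.assoc)
  have T_0: "T 0 = 0" by (simp add: T_def)
  have T_sum: "T (\<Sum>i\<in>I. f i) = (\<Sum>i\<in>I. T (f i))" for f :: "('v, 'k) mpoly \<Rightarrow> _" and I
    by (induction I rule: infinite_finite_induct) (simp_all add: T_add T_0)
  have evT: "ev (T f) (rp P) = ev f (rp P)" if P: "P \<in> A" for f P
  proof -
    have "ev (T f) (rp P) = (\<Sum>P'\<in>A. if P' = P then ev f (rp P') else 0)"
      unfolding T_def meval_simps by (rule sum.cong) (use P F in \<open>auto simp: meval_simps\<close>)
    then show ?thesis using P fin by simp
  qed
  have T_span: "T f \<in> mpoly_vs.span (F ` A)" for f
    unfolding T_def by (intro mpoly_vs.span_sum mpoly_vs.span_scale mpoly_vs.span_base) auto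
  have TJ: "T f \<in> J" for f
    unfolding T_def by (intro mpoly_vs.subspace_sum mpoly_vs.subspace_scale J F)
  have T_N: "T f = 0" if "f \<in> ?N" for f
    using that unfolding T_def N by (simp add: sum.neutral)
  have T_N': "f \<in> ?N" if "f \<in> J" "T f = 0" for f
    unfolding N using that evT[of _ f] by force
  have TF: "T (F P) = F P" if "P \<in> A" for P
  proof -
    have "T (F P) = (\<Sum>P'\<in>A. if P' = P then F P' else 0)"
      unfolding T_def by (rule sum.cong) (use that F in auto)
    then show ?thesis using that fin by simp
  qed
  have indF: "c P = 0" if "(\<Sum>P\<in>A. Const (c P) * F P) \<in> ?N" "P \<in> A" for c P
  proof -
    have "0 = ev (\<Sum>P\<in>A. Const (c P) * F P) (rp P)" using that unfolding N by simp
    also have "\<dots> = (\<Sum>P'\<in>A. if P' = P then c P' else 0)"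
      unfolding meval_simps by (rule sum.cong) (use that F in \<open>auto simp: meval_simps\<close>)
    finally show ?thesis using that fin by simp
  qed
  have N0: "0 \<in> ?N" unfolding N using mpoly_vs.subspace_0[OF J(1)] by simp
  have indF': "mpoly_vs.independent (F ` A)"
  proof
    assume "mpoly_vs.dependent (F ` A)"
    then obtain u P where "P \<in> A" "u (F P) \<noteq> 0" "(\<Sum>g\<in>F ` A. Const (u g) * g) = 0"
      using fin by (auto simp: mpoly_vs.dependent_finite)
    then show False using indF[of "\<lambda>P. u (F P)" P] N0 by (simp add: sum.reindex[OF inj])
  qed
  show ?thesis unfolding quot_dim_def
  proof (rule the_equality)
    show "\<exists>B. finite B \<and> card B = card A \<and> B \<subseteq> J \<and>
       (\<forall>c. (\<Sum>b\<in>B. Const (c b) * b) \<in> ?N \<longrightarrow> (\<forall>b\<in>B. c b = 0)) \<and> J \<subseteq> mpoly_vs.span (B \<union> ?N)"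
    proof (intro exI[of _ "F ` A"] conjI allI impI)
      show "finite (F ` A)" "card (F ` A) = card A" "F ` A \<subseteq> J" using fin inj F by (auto simp: card_image)
      show "\<forall>b\<in>F ` A. c b = 0" if "(\<Sum>b\<in>F ` A. Const (c b) * b) \<in> ?N" for c
        using that indF[of "\<lambda>P. c (F P)"] by (simp add: sum.reindex[OF inj])
      show "J \<subseteq> mpoly_vs.span (F ` A \<union> ?N)"
      proof
        fix f assume f: "f \<in> J"
        have "f - T f \<in> ?N" unfolding N using f TJ J by (auto simp: meval_simps evT intro: mpoly_vs.subspace_diff)
        then have "T f + (f - T f) \<in> mpoly_vs.span (F ` A \<union> ?N)"
          using T_span[of f] mpoly_vs.span_mono[of "F ` A" "F ` A \<union> ?N"]
          by (intro mpoly_vs.span_add) (auto intro: mpoly_vs.span_base)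
        then show "f \<in> mpoly_vs.span (F ` A \<union> ?N)" by simp
      qed
    qed
    fix r assume "\<exists>B. finite B \<and> card B = r \<and> B \<subseteq> J \<and>
       (\<forall>c. (\<Sum>b\<in>B. Const (c b) * b) \<in> ?N \<longrightarrow> (\<forall>b\<in>B. c b = 0)) \<and> J \<subseteq> mpoly_vs.span (B \<union> ?N)"
    then obtain B where B: "finite B" "card B = r" "B \<subseteq> J"
      "\<And>c. (\<Sum>b\<in>B. Const (c b) * b) \<in> ?N \<Longrightarrow> (\<forall>b\<in>B. c b = 0)" "J \<subseteq> mpoly_vs.span (B \<union> ?N)" by blast
    have B': "c b = 0" if "(\<Sum>b\<in>B. Const (c b) * T b) = 0" "b \<in> B" for c b
    proof -
      have "T (\<Sum>b\<in>B. Const (c b) * b) = 0" using that by (simp add: T_sum T_scale)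
      moreover have "(\<Sum>b\<in>B. Const (c b) * b) \<in> J"
        using B(3) by (intro mpoly_vs.subspace_sum mpoly_vs.subspace_scale J) auto
      ultimately show ?thesis using B(4) T_N' that(2) by blast
    qed
    have injT: "inj_on T B"
    proof (rule inj_onI, rule ccontr)
      fix b b' assume b: "b \<in> B" "b' \<in> B" "T b = T b'" "b \<noteq> b'"
      define c where "c x = (if x = b then 1 else if x = b' then - 1 else 0 :: 'k)" for x
      have "(\<Sum>x\<in>B. Const (c x) * T x) = (\<Sum>x\<in>B. (if x = b then T x else 0) + (if x = b' then - T x else 0))"
        by (rule sum.cong) (use b in \<open>auto simp: c_def Const_minus\<close>)
      also have "\<dots> = 0" using b B(1) by (simp add: sum.distrib)
      finally show False using B'[of c b] b by (simp add: c_def)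
    qed
    have "mpoly_vs.independent (T ` B)"
    proof
      assume "mpoly_vs.dependent (T ` B)"
      then obtain u b where "b \<in> B" "u (T b) \<noteq> 0" "(\<Sum>g\<in>T ` B. Const (u g) * g) = 0"
        using B(1) by (auto simp: mpoly_vs.dependent_finite)
      then show False using B'[of "\<lambda>b. u (T b)" b] by (simp add: sum.reindex[OF injT])
    qed
    then have le: "card (T ` B) \<le> card (F ` A)"
      using mpoly_vs.independent_span_bound[of "F ` A" "T ` B"] fin T_span by blast
    have "T f \<in> mpoly_vs.span (T ` B)" if "f \<in> mpoly_vs.span (B \<union> ?N)" for f
      using that
    proof (induction rule: mpoly_vs.span_induct_alt)
      case base
      show ?case by (simp add: T_0 mpoly_vs.span_zero)
    next
      case (step c x y)
      have "T x \<in> mpoly_vs.span (T ` B)"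
      proof (cases "x \<in> B")
        case True
        then show ?thesis by (intro mpoly_vs.span_base) blast
      next
        case False
        then have "T x = 0" using T_N step(1) by blast
        then show ?thesis by (simp add: mpoly_vs.span_zero)
      qed
      then show ?case unfolding T_add T_scale using step by (intro mpoly_vs.span_add mpoly_vs.span_scale)
    qed
    then have "F ` A \<subseteq> mpoly_vs.span (T ` B)" using TF F(1) B(5) by (metis (no_types, lifting) image_subsetI subsetD)
    then have "card (F ` A) \<le> card (T ` B)"
      using mpoly_vs.independent_span_bound[of "T ` B" "F ` A"] indF' B(1) by blast
    then show "r = card A" using le inj injT B(2) by (simp add: card_image)
  qed
qed

text \<open>\<open>X\<close> may be infinite; the size of independent subsets is bounded because the
  forms of degree \<open>d\<close> have a finite spanning set. A form vanishing on a largest such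
  subset but not on \<open>X\<close> would allow one more point.\<close>

lemma indep_on_basis:
  fixes J :: "('v::finite, 'k::field) mpoly set"
  assumes J: "mpoly_vs.subspace J" "J \<subseteq> hom_part (int d)"
  obtains A where "A \<subseteq> X" "indep_on J A" "\<And>B. B \<subseteq> X \<Longrightarrow> indep_on J B \<Longrightarrow> card B \<le> card A"
    "\<And>F. F \<in> J \<Longrightarrow> (\<And>P. P \<in> A \<Longrightarrow> ev F (rp P) = 0) \<Longrightarrow> (\<forall>P\<in>X. ev F (rp P) = 0)"
proof -
  obtain B0 :: "('v, 'k) mpoly set" where B0: "finite B0" "hom_part (int d) \<subseteq> mpoly_vs.span B0"
    using hom_part_finite_span by blast
  have bound: "card A \<le> card B0" if "indep_on J A" for A
    by (rule indep_on_card_le[OF J(1) that B0(1)]) (use J B0 in blast)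
  define S where "S = {A. A \<subseteq> X \<and> indep_on J A}"
  have "\<exists>A. A \<in> S \<and> (\<forall>B. B \<in> S \<longrightarrow> card B \<le> card A)"
    by (rule ex_has_greatest_nat[of "\<lambda>A. A \<in> S" "{}" card "Suc (card B0)"])
      (use bound in \<open>auto simp: S_def indep_on_empty less_Suc_eq_le\<close>)
  then obtain A where A: "A \<in> S" "\<And>B. B \<in> S \<Longrightarrow> card B \<le> card A" by blast
  show thesis
  proof
    show "A \<subseteq> X" "indep_on J A" using A by (auto simp: S_def)
    show "card B \<le> card A" if "B \<subseteq> X" "indep_on J B" for B using that A by (auto simp: S_def)
    fix F assume F: "F \<in> J" "\<And>P. P \<in> A \<Longrightarrow> ev F (rp P) = 0"
    show "\<forall>P\<in>X. ev F (rp P) = 0"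
    proof (rule ccontr)
      assume "\<not> (\<forall>P\<in>X. ev F (rp P) = 0)"
      then obtain P where P: "P \<in> X" "ev F (rp P) \<noteq> 0" by blast
      then have "insert P A \<in> S" using A(1) indep_on_insert[OF J(1) _ F] by (auto simp: S_def)
      moreover have "P \<notin> A" "finite A" using P F A by (auto simp: S_def indep_on_def)
      ultimately show False using A(2)[of "insert P A"] by simp
    qed
  qed
qed

lemma quot_dim_basis:
  fixes J :: "('v::finite, 'k::field) mpoly set"
  assumes J: "mpoly_vs.subspace J" "J \<subseteq> hom_part (int d)" and X: "X \<subseteq> proj_points"
  obtains A where "A \<subseteq> X" "indep_on J A" "quot_dim J (vanishing_ideal X \<inter> J) = card A"
    "\<And>B. B \<subseteq> X \<Longrightarrow> indep_on J B \<Longrightarrow> card B \<le> card A"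
    "\<And>F. F \<in> J \<Longrightarrow> (\<And>P. P \<in> A \<Longrightarrow> ev F (rp P) = 0) \<Longrightarrow> (\<forall>P\<in>X. ev F (rp P) = 0)"
proof -
  obtain A where A: "A \<subseteq> X" "indep_on J A" "\<And>B. B \<subseteq> X \<Longrightarrow> indep_on J B \<Longrightarrow> card B \<le> card A"
    "\<And>F. F \<in> J \<Longrightarrow> (\<And>P. P \<in> A \<Longrightarrow> ev F (rp P) = 0) \<Longrightarrow> (\<forall>P\<in>X. ev F (rp P) = 0)"
    using indep_on_basis[OF J, of X] by blast
  show thesis using that[OF A(1,2) quot_dim_eq_card[OF J X A(1,2,4)] A(3,4)] by blast
qed

text \<open>Independence of conditions on \<open>Jf b d\<close> means linear independence of vectors depending
  polynomially on \<open>b\<close>, so it is an open condition.\<close>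

definition Jvec :: "nat \<Rightarrow> (nat \<Rightarrow> ('k::field ^ 'v) set) \<Rightarrow> (nat \<Rightarrow> 'k ^ 'v) \<Rightarrow> nat \<Rightarrow> 'v \<times> nat \<times> nat \<Rightarrow> 'k" where
  "Jvec d p b k = (\<lambda>(s, i, j). if Suc (i + j) = d then rp (p k) $ s * ((b 0 \<odot> rp (p k)) ^ i * (b 1 \<odot> rp (p k)) ^ j) else 0)"

text \<open>Entry \<open>(s, i, j)\<close> is the value of
  \<open>Var s * (Lin (b 0) ^ i * Lin (b 1) ^ j)\<close> at the point. These forms span
  \<open>Jf b d\<close>, so a relation among the vectors is one among the evaluations.\<close>

lemma Jvec_relation:
  assumes c: "\<And>x. (\<Sum>k<r. c k * Jvec d p b k x) = 0" and F: "F \<in> Jf b d"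
  shows "(\<Sum>k<r. c k * ev F (rp (p k))) = 0"
  using F unfolding Jf_def
proof (induction rule: mpoly_vs.span_induct_alt)
  case base
  show ?case by simp
next
  case (step a x y)
  then obtain w i j where x: "x = Lin w * (Lin (b 0) ^ i * Lin (b 1) ^ j)" "Suc (i + j) = d" by blast
  have "(\<Sum>k<r. c k * ev x (rp (p k))) = (\<Sum>k<r. \<Sum>s\<in>UNIV. w $ s * (c k * Jvec d p b k (s, i, j)))"
  proof (rule sum.cong)
    fix k
    let ?y = "rp (p k)"
    let ?m = "(b 0 \<odot> ?y) ^ i * (b 1 \<odot> ?y) ^ j"
    have "ev x ?y = (\<Sum>s\<in>UNIV. w $ s * ?y $ s) * ?m" by (simp add: x(1) meval_simps meval_Lin dotp_def[of w])
    moreover have "Jvec d p b k (s, i, j) = ?y $ s * ?m" for s by (simp add: Jvec_def x(2))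
    ultimately show "c k * ev x ?y = (\<Sum>s\<in>UNIV. w $ s * (c k * Jvec d p b k (s, i, j)))"
      by (simp only: sum_distrib_left sum_distrib_right) (rule sum.cong, simp_all only: mult_ac)
  qed simp
  also have "\<dots> = (\<Sum>s\<in>UNIV. w $ s * (\<Sum>k<r. c k * Jvec d p b k (s, i, j)))"
    by (subst sum.swap) (simp add: sum_distrib_left)
  finally have "(\<Sum>k<r. c k * ev x (rp (p k))) = 0" using c by simp
  moreover have "(\<Sum>k<r. c k * ev (Const a * x + y) (rp (p k))) =
      a * (\<Sum>k<r. c k * ev x (rp (p k))) + (\<Sum>k<r. c k * ev y (rp (p k)))"
  proof -
    have "c k * ev (Const a * x + y) z = a * (c k * ev x z) + c k * ev y z" for k z
      by (simp only: meval_simps(1,3,4) distrib_left mult.left_commute)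
    then show ?thesis by (simp only: sum.distrib sum_distrib_left)
  qed
  ultimately show ?case using step by simp
qed

lemma indep_on_iff_Jvec:
  assumes p: "bij_betw p {..<r} A"
  shows "indep_on (Jf b d) A \<longleftrightarrow> lin_indep_fam r (Jvec d p b)"
proof
  have A: "A = p ` {..<r}" and inj: "inj_on p {..<r}" using p by (auto simp: bij_betw_def)
  assume ind: "indep_on (Jf b d) A"
  show "lin_indep_fam r (Jvec d p b)"
  proof (rule lin_indep_famI, intro allI impI)
    fix c k assume c: "\<And>x. (\<Sum>i<r. c i * Jvec d p b i x) = 0" and k: "k < r"
    obtain F where F: "F \<in> Jf b d" "ev F (rp (p k)) \<noteq> 0" "\<forall>P'\<in>A - {p k}. ev F (rp P') = 0"
      using ind k A unfolding indep_on_def by blast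
    have "0 = (\<Sum>i<r. c i * ev F (rp (p i)))" using Jvec_relation[OF c F(1)] by simp
    also have "\<dots> = (\<Sum>i<r. if i = k then c i * ev F (rp (p i)) else 0)"
    proof (rule sum.cong)
      fix i assume "i \<in> {..<r}"
      then have "i \<noteq> k \<longrightarrow> p i \<in> A - {p k}" using inj k by (auto simp: A inj_on_def)
      then show "c i * ev F (rp (p i)) = (if i = k then c i * ev F (rp (p i)) else 0)" using F(3) by auto
    qed simp
    also have "\<dots> = c k * ev F (rp (p k))" using k by simp
    finally show "c k = 0" using F by simp
  qed
next
  have A: "A = p ` {..<r}" and inj: "inj_on p {..<r}" using p by (auto simp: bij_betw_def)
  assume ind: "lin_indep_fam r (Jvec d p b)"
  obtain B where B: "B \<subseteq> A" "indep_on (Jf b d) B"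
    "\<And>F. F \<in> Jf b d \<Longrightarrow> (\<And>P. P \<in> B \<Longrightarrow> ev F (rp P) = 0) \<Longrightarrow> (\<forall>P\<in>A. ev F (rp P) = 0)"
    using indep_on_basis[OF subspace_Jf Jf_subset_hom_part, of A b d] by metis
  have "A \<subseteq> B"
  proof
    fix P assume PA: "P \<in> A"
    then obtain k where k: "k < r" "P = p k" using A by auto
    show "P \<in> B"
    proof (rule ccontr)
      assume P: "P \<notin> B"
      obtain F where F: "\<And>P. P \<in> B \<Longrightarrow> F P \<in> Jf b d"
        "\<And>P P'. P \<in> B \<Longrightarrow> P' \<in> B \<Longrightarrow> ev (F P) (rp P') = (if P' = P then 1 else 0)"
        using indep_on_dual[OF subspace_Jf B(2)] by blast
      have fin: "finite B" using B(2) by (simp add: indep_on_def)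
      \<comment> \<open>Values on the basis \<open>B\<close> determine the value at \<open>P\<close>
        by interpolation with the dual forms \<open>F Q\<close>; moving everything to one side gives
        a relation with coefficient 1 at \<open>P\<close>.\<close>
      define c where "c i = (if i = k then 1 else if p i \<in> B then - ev (F (p i)) (rp P) else 0)" for i
      have rel: "(\<Sum>i<r. c i * ev G (rp (p i))) = 0" if G: "G \<in> Jf b d" for G
      proof -
        let ?H = "G - (\<Sum>Q\<in>B. Const (ev G (rp Q)) * F Q)"
        have "?H \<in> Jf b d"
          by (intro mpoly_vs.subspace_diff mpoly_vs.subspace_sum mpoly_vs.subspace_scale subspace_Jf G F)
        moreover have "ev ?H (rp Q) = 0" if Q: "Q \<in> B" for Q
        proof -
          have "ev (\<Sum>Q\<in>B. Const (ev G (rp Q)) * F Q) (rp Q) = (\<Sum>Q'\<in>B. if Q' = Q then ev G (rp Q') else 0)"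
            unfolding meval_simps by (rule sum.cong) (use Q F in \<open>auto simp: meval_simps\<close>)
          then show ?thesis using Q fin by (simp add: meval_simps)
        qed
        ultimately have "ev ?H (rp P) = 0" using B(3) PA by blast
        then have GP: "ev G (rp P) = (\<Sum>Q\<in>B. ev G (rp Q) * ev (F Q) (rp P))" by (simp add: meval_simps)
        have "(\<Sum>i<r. c i * ev G (rp (p i))) = (\<Sum>i<r. (if i = k then ev G (rp P) else 0) +
            (if p i \<in> B then - (ev G (rp (p i)) * ev (F (p i)) (rp P)) else 0))"
          by (rule sum.cong) (use k P in \<open>auto simp: c_def\<close>)
        also have "\<dots> = ev G (rp P) + (\<Sum>i<r. if p i \<in> B then - (ev G (rp (p i)) * ev (F (p i)) (rp P)) else 0)"
          using k by (simp add: sum.distrib)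
        also have "(\<Sum>i<r. if p i \<in> B then - (ev G (rp (p i)) * ev (F (p i)) (rp P)) else 0) =
            (\<Sum>Q\<in>A. if Q \<in> B then - (ev G (rp Q) * ev (F Q) (rp P)) else 0)"
          unfolding A by (simp add: sum.reindex[OF inj])
        also have "\<dots> = - (\<Sum>Q\<in>B. ev G (rp Q) * ev (F Q) (rp P))"
          using B(1) A by (simp add: sum.If_cases Int_absorb1 sum_negf)
        finally show ?thesis using GP by simp
      qed
      have "(\<Sum>i<r. c i * Jvec d p b i x) = 0" for x
      proof -
        obtain s i j where x: "x = (s, i, j)" by (cases x)
        show ?thesis
        proof (cases "Suc (i + j) = d")
          case True
          have "Lin (axis s 1) * (Lin (b 0) ^ i * Lin (b 1) ^ j) \<in> Jf b d"
            unfolding Jf_def by (rule mpoly_vs.span_base) (use True in blast)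
          from rel[OF this] show ?thesis
            by (simp add: x Jvec_def True meval_simps meval_Lin Lin_axis)
        qed (simp add: x Jvec_def)
      qed
      from lin_indep_famD[OF ind this k(1)] show False by (simp add: c_def)
    qed
  qed
  then show "indep_on (Jf b d) A" using B by (simp add: subset_antisym)
qed

lemma indep_on_open:
  fixes b0 :: "nat \<Rightarrow> 'k::field ^ 'v"
  assumes "indep_on (Jf b0 d) A"
  shows "\<exists>\<Phi>. polyfun \<Phi> \<and> \<Phi> b0 \<noteq> 0 \<and> (\<forall>b. \<Phi> b \<noteq> 0 \<longrightarrow> indep_on (Jf b d) A)"
proof -
  have "finite A" using assms by (simp add: indep_on_def)
  then obtain p where p: "bij_betw p {..<card A} A" using ex_bij_betw_nat_finite atLeast0LessThan by metis
  have "polyfun (\<lambda>b. Jvec d p b k x)" for k x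
  proof -
    obtain s i j where x: "x = (s, i, j)" by (cases x)
    show ?thesis
      by (cases "Suc (i + j) = d")
        (simp_all add: x Jvec_def polyfun_const polyfun_mult polyfun_power polyfun_dotp polyfun_coord)
  qed
  then show ?thesis using lin_indep_open[of "card A" "Jvec d p" b0] assms
    unfolding indep_on_iff_Jvec[OF p] by blast
qed

section \<open>The matroid of Ex.C\<close>

definition lin_bound :: "nat \<Rightarrow> ('k::field ^ 'v) set \<Rightarrow> nat" where
  "lin_bound d W = d * (vec.dim W - 1) + 1"

definition C_indep :: "nat \<Rightarrow> ('k::field ^ 'v) set set \<Rightarrow> bool" where
  "C_indep d S \<longleftrightarrow> finite S \<and> (\<forall>W. vec.subspace W \<and> W \<noteq> {0} \<longrightarrow> card (S \<inter> proj_set W) \<le> lin_bound d W)"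

lemma dim_pos: "vec.subspace W \<Longrightarrow> W \<noteq> {0} \<Longrightarrow> vec.dim W \<ge> 1"
  by (metis One_nat_def Suc_leI gr0I subset_singletonD vec.dim_eq_0 vec.subspace_0 empty_iff)

lemma proj_setD: "P \<in> proj_set W \<Longrightarrow> rp P \<in> W \<and> rp P \<noteq> 0 \<and> P \<in> proj_points"
  using rp by (auto simp: proj_set_def)

lemma proj_set_iff: "vec.subspace W \<Longrightarrow> P \<in> proj_points \<Longrightarrow> P \<in> proj_set W \<longleftrightarrow> rp P \<in> W"
  using rp[of P] vec.span_minimal[of "{rp P}" W] by (auto simp: proj_set_def)

lemma Ex_C_le:
  assumes "finite H" "\<And>W. W \<in> H \<Longrightarrow> vec.subspace W \<and> W \<noteq> {0}" "Z \<subseteq> (\<Union>W\<in>H. proj_set W)"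
  shows "Ex_C Z d \<le> (\<Sum>W\<in>H. lin_bound d W)"
  unfolding Ex_C_def lin_bound_def by (rule Least_le) (use assms in blast)

lemma Ex_C_attained:
  fixes Z :: "('k::field ^ 'v) set set"
  assumes "Z \<subseteq> proj_points"
  obtains H where "finite H" "\<And>W. W \<in> H \<Longrightarrow> vec.subspace W \<and> W \<noteq> {0}" "Z \<subseteq> (\<Union>W\<in>H. proj_set W)"
    "Ex_C Z d = (\<Sum>W\<in>H. lin_bound d W)"
proof -
  let ?P = "\<lambda>c. \<exists>\<H>. finite \<H> \<and> (\<forall>W\<in>\<H>. vec.subspace W \<and> W \<noteq> {0}) \<and>
     Z \<subseteq> (\<Union>W\<in>\<H>. proj_set W) \<and> c = (\<Sum>W\<in>\<H>. d * (vec.dim W - 1) + 1)"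
  have "(UNIV :: ('k ^ 'v) set) \<noteq> {0}"
  proof
    assume "(UNIV :: ('k ^ 'v) set) = {0}"
    then have "(axis undefined 1 :: 'k ^ 'v) = 0" by blast
    then show False by (simp add: axis_eq_0_iff)
  qed
  then have "?P (\<Sum>W\<in>{UNIV :: ('k ^ 'v) set}. d * (vec.dim W - 1) + 1)"
    using assms by (intro exI[of _ "{UNIV}"]) (auto simp: proj_set_def)
  then have "?P (Ex_C Z d)" unfolding Ex_C_def by (rule LeastI)
  then show thesis using that unfolding lin_bound_def by blast
qed

definition tight :: "nat \<Rightarrow> ('k::field ^ 'v) set set \<Rightarrow> ('k ^ 'v) set \<Rightarrow> bool" where
  "tight d U W \<longleftrightarrow> vec.subspace W \<and> W \<noteq> {0} \<and> card (U \<inter> proj_set W) = lin_bound d W"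

text \<open>For subspaces with a common point \<open>lin_bound\<close> is modular, as the dimension
  is, while the number of points of \<open>U\<close> is supermodular. Two equalities therefore force
  equality for the sum.\<close>

lemma tight_sum:
  fixes U :: "('k::field ^ 'v) set set"
  assumes U: "C_indep d U" "U \<subseteq> proj_points" and W: "tight d U W1" "tight d U W2"
    and P: "P \<in> proj_set W1" "P \<in> proj_set W2"
  shows "tight d U {x + y |x y. x \<in> W1 \<and> y \<in> W2}"
proof -
  let ?S = "{x + y |x y. x \<in> W1 \<and> y \<in> W2}" and ?I = "W1 \<inter> W2"
  have fin: "finite U" using U by (simp add: C_indep_def)
  have sub: "vec.subspace W1" "vec.subspace W2" "W1 \<noteq> {0}" "W2 \<noteq> {0}" using W by (auto simp: tight_def)
  have S: "vec.subspace ?S" using sub vec.subspace_sums by blast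
  have I: "vec.subspace ?I" using sub vec.subspace_inter by blast
  have WS: "W1 \<subseteq> ?S" "W2 \<subseteq> ?S"
    using vec.subspace_0[OF sub(1)] vec.subspace_0[OF sub(2)] by force+
  have x: "rp P \<in> ?I" "rp P \<noteq> 0" using P proj_setD by auto
  then have I0: "?I \<noteq> {0}" and S0: "?S \<noteq> {0}" using WS by auto
  have dim: "vec.dim ?S + vec.dim ?I = vec.dim W1 + vec.dim W2" by (rule vec.dim_sums_Int[OF sub(1,2)])
  \<comment> \<open>The common point makes the intersection nonzero, so none of the subtractions
    \<open>dim - 1\<close> is truncated.\<close>
  have eq: "lin_bound d ?S + lin_bound d ?I = lin_bound d W1 + lin_bound d W2"
  proof -
    have "vec.dim ?S - 1 + (vec.dim ?I - 1) = vec.dim W1 - 1 + (vec.dim W2 - 1)"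
      using dim dim_pos[OF S S0] dim_pos[OF I I0] dim_pos[OF sub(1,3)] dim_pos[OF sub(2,4)] by linarith
    then have "d * (vec.dim ?S - 1) + d * (vec.dim ?I - 1) = d * (vec.dim W1 - 1) + d * (vec.dim W2 - 1)"
      by (simp flip: distrib_left)
    then show ?thesis by (simp add: lin_bound_def)
  qed
  have inter: "(U \<inter> proj_set W1) \<inter> (U \<inter> proj_set W2) = U \<inter> proj_set ?I" by (auto simp: proj_set_def)
  have union: "(U \<inter> proj_set W1) \<union> (U \<inter> proj_set W2) \<subseteq> U \<inter> proj_set ?S" using WS by (auto simp: proj_set_def)
  have "card (U \<inter> proj_set W1) + card (U \<inter> proj_set W2) =
      card ((U \<inter> proj_set W1) \<union> (U \<inter> proj_set W2)) + card (U \<inter> proj_set ?I)"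
    using card_Un_Int[of "U \<inter> proj_set W1" "U \<inter> proj_set W2"] fin inter by simp
  also have "\<dots> \<le> card (U \<inter> proj_set ?S) + card (U \<inter> proj_set ?I)"
    using card_mono[OF _ union] fin by simp
  finally have "lin_bound d W1 + lin_bound d W2 \<le> card (U \<inter> proj_set ?S) + card (U \<inter> proj_set ?I)"
    using W by (simp add: tight_def)
  moreover have "card (U \<inter> proj_set ?I) \<le> lin_bound d ?I" "card (U \<inter> proj_set ?S) \<le> lin_bound d ?S"
    using U(1) I I0 S S0 unfolding C_indep_def by blast+
  ultimately have "card (U \<inter> proj_set ?S) = lin_bound d ?S" using eq by linarith
  then show ?thesis using S S0 by (simp add: tight_def)
qed

text \<open>The maximal tight subspaces meet in 0, so they form a covering of \<open>Z\<close> of cost \<open>card U\<close>.\<close>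

lemma C_indep_maximal:
  fixes Z :: "('k::field ^ 'v) set set"
  assumes Z: "finite Z" "Z \<subseteq> proj_points" and A: "A \<subseteq> Z" "C_indep d A"
  obtains U where "A \<subseteq> U" "U \<subseteq> Z" "C_indep d U" "Ex_C Z d \<le> card U"
proof -
  let ?Q = "\<lambda>U. A \<subseteq> U \<and> U \<subseteq> Z \<and> C_indep d U"
  have "\<exists>U. ?Q U \<and> (\<forall>V. ?Q V \<longrightarrow> card V \<le> card U)"
    by (rule ex_has_greatest_nat[of ?Q A card "Suc (card Z)"])
      (use A Z in \<open>auto simp: less_Suc_eq_le intro: card_mono\<close>)
  then obtain U where U: "A \<subseteq> U" "U \<subseteq> Z" "C_indep d U" and max: "\<And>V. ?Q V \<Longrightarrow> card V \<le> card U" by blast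
  have fin: "finite U" using U Z finite_subset by blast
  have UP: "U \<subseteq> proj_points" using U Z by blast
  \<comment> \<open>A single point has bound 1 and is itself a tight subspace, so every point of
    \<open>U\<close> lies in a tight subspace of largest dimension.\<close>
  have sing: "tight d U u" if u: "u \<in> U" for u
  proof -
    have up: "u \<in> proj_points" using u UP by blast
    have "U \<inter> proj_set u = {u}"
    proof -
      have "P = u" if "P \<in> U" "P \<subseteq> u" for P
        using rp_eq_imp_eq[OF up, of P] rp(1)[of P] that UP by blast
      then show ?thesis using u up by (auto simp: proj_set_def)
    qed
    moreover have "u \<noteq> {0}" using rp[OF up] by auto
    moreover have "vec.subspace u" "vec.dim u = 1" using up by (auto simp: proj_points_def)
    ultimately show ?thesis by (simp add: tight_def lin_bound_def)
  qed
  define T where "T u W \<longleftrightarrow> tight d U W \<and> u \<in> proj_set W" for u W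
  have "\<exists>W. T u W \<and> (\<forall>W'. T u W' \<longrightarrow> vec.dim W' \<le> vec.dim W)" if u: "u \<in> U" for u
  proof (rule ex_has_greatest_nat[of "T u" u vec.dim "Suc CARD('v)"])
    show "T u u" using sing[OF u] u UP by (auto simp: T_def proj_set_def)
    show "\<forall>W. T u W \<longrightarrow> vec.dim W < Suc CARD('v)"
      using vec.dim_subset_UNIV vec.dimension_def card_cart_basis by (metis less_Suc_eq_le dim_subset_UNIV_cart_gen)
  qed
  then obtain H where H: "\<And>u. u \<in> U \<Longrightarrow> T u (H u)" "\<And>u W. u \<in> U \<Longrightarrow> T u W \<Longrightarrow> vec.dim W \<le> vec.dim (H u)"
    by metis
  \<comment> \<open>A tight subspace that meets \<open>H u\<close> has a tight sum with it, and
    maximality of the dimension makes the sum equal to \<open>H u\<close>.\<close>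
  have absorb: "W \<subseteq> H u" if u: "u \<in> U" and W: "tight d U W" and P: "P \<in> proj_set W" "P \<in> proj_set (H u)" for u W P
  proof -
    let ?S = "{x + y |x y. x \<in> W \<and> y \<in> H u}"
    have Hu: "tight d U (H u)" "u \<in> proj_set (H u)" using H(1)[OF u] by (auto simp: T_def)
    have sub: "vec.subspace W" "vec.subspace (H u)" using W Hu by (auto simp: tight_def)
    have S: "tight d U ?S" by (rule tight_sum[OF U(3) UP W Hu(1) P])
    have WS: "W \<subseteq> ?S" "H u \<subseteq> ?S"
      using vec.subspace_0[OF sub(1)] vec.subspace_0[OF sub(2)] by force+
    then have "T u ?S" using S Hu(2) by (auto simp: T_def proj_set_def)
    then have "vec.dim ?S \<le> vec.dim (H u)" using H(2)[OF u] by blast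
    moreover have "vec.subspace ?S" using S by (simp add: tight_def)
    ultimately have "H u = ?S" using WS(2) sub(2) by (intro vec.subspace_dim_equal) assumption+
    then show ?thesis using WS(1) by (simp only:)
  qed
  let ?F = "H ` U"
  have disj: "(U \<inter> proj_set (H u)) \<inter> (U \<inter> proj_set (H v)) = {}" if uv: "u \<in> U" "v \<in> U" "H u \<noteq> H v" for u v
  proof (rule ccontr)
    assume "(U \<inter> proj_set (H u)) \<inter> (U \<inter> proj_set (H v)) \<noteq> {}"
    then obtain P where "P \<in> proj_set (H u)" "P \<in> proj_set (H v)" by blast
    then have "H u \<subseteq> H v" "H v \<subseteq> H u" using absorb H(1) uv(1,2) unfolding T_def by blast+
    then show False using uv by blast
  qed
  have cover: "Z \<subseteq> (\<Union>W\<in>?F. proj_set W)"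
  proof
    fix P assume P: "P \<in> Z"
    show "P \<in> (\<Union>W\<in>?F. proj_set W)"
    proof (cases "P \<in> U")
      case True
      then show ?thesis using H(1) by (auto simp: T_def)
    next
      case False
      \<comment> \<open>Adding \<open>P\<close> breaks the bound of some \<open>W\<close>. Such a
        \<open>W\<close> contains \<open>P\<close> and is already tight for \<open>U\<close>; as it
        contains a point of \<open>U\<close>, it is absorbed by a member of the covering.\<close>
      then have "\<not> ?Q (insert P U)" using max[of "insert P U"] fin by auto
      then have "\<not> C_indep d (insert P U)" using U P by blast
      then obtain W where W: "vec.subspace W" "W \<noteq> {0}" "card (insert P U \<inter> proj_set W) > lin_bound d W"
        using fin unfolding C_indep_def by (auto simp: not_le)
      have le: "card (U \<inter> proj_set W) \<le> lin_bound d W" using U(3) W unfolding C_indep_def by blast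
      have PW: "P \<in> proj_set W"
      proof (rule ccontr)
        assume "P \<notin> proj_set W"
        then have "insert P U \<inter> proj_set W = U \<inter> proj_set W" by blast
        then show False using W(3) le by simp
      qed
      then have "insert P U \<inter> proj_set W = insert P (U \<inter> proj_set W)" by blast
      then have "card (insert P U \<inter> proj_set W) \<le> Suc (card (U \<inter> proj_set W))"
        by (simp add: card_insert_if fin)
      then have t: "tight d U W" using W le by (simp add: tight_def)
      then have "card (U \<inter> proj_set W) > 0" by (simp add: tight_def lin_bound_def)
      then obtain u where u: "u \<in> U" "u \<in> proj_set W" by (metis IntE card_gt_0_iff ex_in_conv)
      then have "u \<in> proj_set (H u)" using H(1) by (simp add: T_def)
      then have "W \<subseteq> H u" using absorb[OF u(1) t u(2)] by blast
      then show ?thesis using PW u(1) by (auto simp: proj_set_def)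
    qed
  qed
  have "Ex_C Z d \<le> (\<Sum>W\<in>?F. lin_bound d W)"
    by (rule Ex_C_le) (use fin H(1) cover in \<open>auto simp: T_def tight_def\<close>)
  also have "\<dots> = (\<Sum>W\<in>?F. card (U \<inter> proj_set W))"
    by (rule sum.cong) (use H(1) in \<open>auto simp: T_def tight_def\<close>)
  also have "\<dots> = card (\<Union>W\<in>?F. U \<inter> proj_set W)"
    by (rule card_UN_disjoint[symmetric]) (use fin disj in auto)
  also have "\<dots> \<le> card U" by (rule card_mono) (use fin in auto)
  finally show thesis using that U by blast
qed

text \<open>Rado's argument: a minimal family of admissible colours consists of singletons, since otherwise
  submodularity allows one of two colours to be removed.\<close>

lemma submodular_partition:
  fixes f :: "'a set \<Rightarrow> nat"
  assumes A: "finite A"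
    and submod: "\<And>X Y. X \<subseteq> A \<Longrightarrow> Y \<subseteq> A \<Longrightarrow> f (X \<union> Y) + f (X \<inter> Y) \<le> f X + f Y"
    and mono: "\<And>X Y. X \<subseteq> Y \<Longrightarrow> Y \<subseteq> A \<Longrightarrow> f X \<le> f Y"
    and f0: "f {} = 0"
    and bound: "\<And>J. J \<subseteq> A \<Longrightarrow> card J \<le> d * f J"
  shows "\<exists>c. (\<forall>a\<in>A. c a < d) \<and> card A \<le> (\<Sum>j<d. f {a \<in> A. c a = j})"
proof -
  \<comment> \<open>\<open>C a\<close> is the set of colours still allowed for \<open>a\<close>, and
    \<open>good\<close> is a Hall-Rado condition with \<open>f\<close> in place of
    cardinality.\<close>
  define \<Phi> where "\<Phi> C J = (\<Sum>j<d. f {a \<in> J. j \<in> C a})" for C :: "'a \<Rightarrow> nat set" and J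
  define good where "good C \<longleftrightarrow> (\<forall>a\<in>A. C a \<subseteq> {..<d}) \<and> (\<forall>J. J \<subseteq> A \<longrightarrow> card J \<le> \<Phi> C J)" for C
  have "good (\<lambda>_. {..<d})" using bound by (simp add: good_def \<Phi>_def)
  then obtain C where C: "good C" and min: "\<And>D. good D \<Longrightarrow> (\<Sum>a\<in>A. card (C a)) \<le> (\<Sum>a\<in>A. card (D a))"
    using ex_has_least_nat[of good _ "\<lambda>C. \<Sum>a\<in>A. card (C a)"] by blast
  have fin: "finite (C a)" if "a \<in> A" for a using C that finite_subset unfolding good_def by blast
  have le1: "\<exists>x. C a \<subseteq> {x}" if a: "a \<in> A" for a
  proof (rule ccontr)
    assume neg: "\<nexists>x. C a \<subseteq> {x}"
    then obtain x where x: "x \<in> C a" by blast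
    then obtain y where y: "y \<in> C a" "y \<noteq> x" using neg by blast
    \<comment> \<open>Minimality of the total number of allowed colours: deleting a colour of
      \<open>a\<close> violates the condition on some set, and that set must contain
      \<open>a\<close>.\<close>
    have fails: "\<exists>J. J \<subseteq> A \<and> a \<in> J \<and> card J > \<Phi> (C(a := C a - {z})) J" if z: "z \<in> C a" for z
    proof -
      let ?D = "C(a := C a - {z})"
      have "(\<Sum>b\<in>A. card (?D b)) < (\<Sum>b\<in>A. card (C b))"
      proof (rule sum_strict_mono_ex1[OF A])
        show "\<forall>b\<in>A. card (?D b) \<le> card (C b)" using fin by (auto intro: card_mono)
        show "\<exists>b\<in>A. card (?D b) < card (C b)"
          using a card_Diff1_less[OF fin[OF a] z] by (intro bexI[of _ a]) (simp_all only: fun_upd_same)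
      qed
      then have "\<not> good ?D" using min by (meson not_less)
      moreover have "\<forall>b\<in>A. ?D b \<subseteq> {..<d}" using C by (auto simp: good_def)
      ultimately obtain J where J: "J \<subseteq> A" "card J > \<Phi> ?D J" by (auto simp: good_def not_le)
      have "a \<in> J"
      proof (rule ccontr)
        assume "a \<notin> J"
        then have "{b \<in> J. j \<in> ?D b} = {b \<in> J. j \<in> C b}" for j by auto
        then have "\<Phi> ?D J = \<Phi> C J" unfolding \<Phi>_def by simp
        then show False using J C unfolding good_def by (metis not_le)
      qed
      then show ?thesis using J by blast
    qed
    obtain J where J: "J \<subseteq> A" "a \<in> J" "card J > \<Phi> (C(a := C a - {x})) J" using fails[OF x] by blast
    obtain K where K: "K \<subseteq> A" "a \<in> K" "card K > \<Phi> (C(a := C a - {y})) K" using fails[OF y(1)] by blast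
    \<comment> \<open>The point \<open>a\<close> lies in both sets and loses a different colour in
      each, so the union sees all colours of \<open>C\<close>, whereas the intersection is
      controlled only away from \<open>a\<close>.\<close>
    define X where "X j = {b \<in> J. j \<in> (C(a := C a - {x})) b}" for j
    define Y where "Y j = {b \<in> K. j \<in> (C(a := C a - {y})) b}" for j
    have XA: "X j \<subseteq> A" "Y j \<subseteq> A" for j using J K by (auto simp: X_def Y_def)
    have un: "X j \<union> Y j = {b \<in> J \<union> K. j \<in> C b}" for j
      using x y J K by (auto simp: X_def Y_def split: if_splits)
    have int: "{b \<in> J \<inter> K - {a}. j \<in> C b} \<subseteq> X j \<inter> Y j" for j
      by (auto simp: X_def Y_def)
    have "card J + card K = card (J \<union> K) + card (J \<inter> K)"
      by (rule card_Un_Int) (use J K A finite_subset in auto)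
    \<comment> \<open>Leaving out \<open>a\<close> costs one, but the two strict inequalities
      together gain two.\<close>
    also have "card (J \<inter> K) = Suc (card (J \<inter> K - {a}))"
      using J K finite_subset[OF J(1) A] by (intro card_Suc_Diff1[symmetric]) auto
    also have "card (J \<union> K) + Suc (card (J \<inter> K - {a})) \<le> Suc (\<Phi> C (J \<union> K) + \<Phi> C (J \<inter> K - {a}))"
    proof -
      have "card (J \<union> K) \<le> \<Phi> C (J \<union> K)" "card (J \<inter> K - {a}) \<le> \<Phi> C (J \<inter> K - {a})"
        using C J K unfolding good_def by (meson Un_least Diff_subset Int_lower1 order_trans)+
      then show ?thesis by simp
    qed
    also have "\<Phi> C (J \<union> K) + \<Phi> C (J \<inter> K - {a}) \<le> (\<Sum>j<d. f (X j) + f (Y j))"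
      unfolding \<Phi>_def sum.distrib[symmetric]
    proof (rule sum_mono)
      fix j
      have "f {b \<in> J \<union> K. j \<in> C b} + f {b \<in> J \<inter> K - {a}. j \<in> C b} \<le> f (X j \<union> Y j) + f (X j \<inter> Y j)"
        unfolding un[symmetric] by (intro add_mono order_refl mono int) (use XA in blast)
      also have "\<dots> \<le> f (X j) + f (Y j)" by (rule submod[OF XA])
      finally show "f {b \<in> J \<union> K. j \<in> C b} + f {b \<in> J \<inter> K - {a}. j \<in> C b} \<le> f (X j) + f (Y j)" .
    qed
    finally have "card J + card K \<le> Suc (\<Phi> (C(a := C a - {x})) J + \<Phi> (C(a := C a - {y})) K)"
      by (simp add: X_def Y_def \<Phi>_def sum.distrib)
    then show False using J K by linarith
  qed
  have ne: "C a \<noteq> {}" if a: "a \<in> A" for a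
  proof
    assume e: "C a = {}"
    have "{b \<in> {a}. j \<in> C b} = {}" for j using e by auto
    then have "\<Phi> C {a} = 0" unfolding \<Phi>_def by (simp only: f0 sum.neutral_const)
    moreover have "card {a} \<le> \<Phi> C {a}" using C a unfolding good_def by blast
    ultimately show False by simp
  qed
  have "\<exists>x. C a = {x}" if "a \<in> A" for a using le1[OF that] ne[OF that] by blast
  then obtain c where c: "\<And>a. a \<in> A \<Longrightarrow> C a = {c a}" by metis
  have "card A \<le> \<Phi> C A" using C unfolding good_def by blast
  also have "\<dots> = (\<Sum>j<d. f {a \<in> A. c a = j})"
    unfolding \<Phi>_def by (intro sum.cong refl arg_cong[of _ _ f]) (use c in auto)
  finally have "card A \<le> (\<Sum>j<d. f {a \<in> A. c a = j})" .
  moreover have "\<forall>a\<in>A. c a < d" using C c unfolding good_def by (metis insert_subset lessThan_iff)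
  ultimately show ?thesis by blast
qed

text \<open>Contract \<open>u\<close>: then \<open>f J\<close> is the rank of \<open>J\<close>
  modulo \<open>rp u\<close>, and the bounds read \<open>card J \<le> d * f J\<close>. So the other
  points split into \<open>d\<close> classes, each independent modulo \<open>u\<close>. Each class
  lies in a hyperplane missing \<open>u\<close>, and the product of these \<open>d\<close> linear
  forms separates \<open>u\<close> from the rest.\<close>

lemma C_indep_imp_indep_on:
  fixes S :: "('k::field ^ 'v) set set"
  assumes S: "C_indep d S" "S \<subseteq> proj_points"
  shows "indep_on (hom_part (int d)) S"
  unfolding indep_on_def
proof (intro conjI ballI)
  show finS: "finite S" using S by (simp add: C_indep_def)
  fix u assume u: "u \<in> S"
  define A where "A = S - {u}"
  define V where "V J = vec.span (insert (rp u) (rp ` J))" for J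
  define f where "f J = vec.dim (V J) - 1" for J
  have fin: "finite A" using finS by (simp add: A_def)
  have up: "u \<in> proj_points" and AP: "A \<subseteq> proj_points" using u S by (auto simp: A_def)
  have uV: "rp u \<in> V J" for J by (simp add: V_def vec.span_base)
  have V0: "V J \<noteq> {0}" for J using uV[of J] rp(2)[OF up] by blast
  have Vs: "vec.subspace (V J)" for J by (simp add: V_def)
  have dimV: "vec.dim (V J) = Suc (f J)" for J using dim_pos[OF Vs V0, of J] by (simp add: f_def)
  have Vmono: "V I \<subseteq> V J" if "I \<subseteq> J" for I J unfolding V_def by (rule vec.span_mono) (use that in auto)
  have f_mono: "f I \<le> f J" if "I \<subseteq> J" for I J
    unfolding f_def by (intro diff_le_mono vec.dim_subset Vmono that)
  have "\<exists>c. (\<forall>a\<in>A. c a < d) \<and> card A \<le> (\<Sum>j<d. f {a \<in> A. c a = j})"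
  proof (rule submodular_partition[OF fin])
    fix I J
    have "V (I \<union> J) = {x + y |x y. x \<in> V I \<and> y \<in> V J}" (is "_ = ?R")
    proof
      have "vec.subspace ?R" using vec.subspace_sums Vs by blast
      moreover have "V I \<subseteq> ?R" "V J \<subseteq> ?R" using vec.subspace_0[OF Vs] by force+
      moreover have "insert (rp u) (rp ` (I \<union> J)) \<subseteq> V I \<union> V J" unfolding V_def by (auto intro: vec.span_base)
      ultimately show "V (I \<union> J) \<subseteq> ?R" unfolding V_def[of "I \<union> J"] by (intro vec.span_minimal) auto
      show "?R \<subseteq> V (I \<union> J)" using Vmono[of I "I \<union> J"] Vmono[of J "I \<union> J"] vec.subspace_add[OF Vs] by blast
    qed
    then have "vec.dim (V (I \<union> J)) + vec.dim (V I \<inter> V J) = vec.dim (V I) + vec.dim (V J)"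
      using vec.dim_sums_Int[OF Vs Vs] by simp
    moreover have "vec.dim (V (I \<inter> J)) \<le> vec.dim (V I \<inter> V J)"
      using Vmono by (intro vec.dim_subset) auto
    ultimately show "f (I \<union> J) + f (I \<inter> J) \<le> f I + f J" unfolding dimV by linarith
  next
    show "f {} = 0" using rp(2)[OF up] by (simp add: f_def V_def)
  next
    fix J assume J: "J \<subseteq> A"
    have "insert u J \<subseteq> S \<inter> proj_set (V J)"
    proof
      fix P assume P: "P \<in> insert u J"
      then have "P \<in> S" using J u by (auto simp: A_def)
      moreover have "rp P \<in> V J" using P unfolding V_def by (auto intro: vec.span_base)
      ultimately show "P \<in> S \<inter> proj_set (V J)" using proj_set_iff[OF Vs] S(2) by blast
    qed
    \<comment> \<open>Counting \<open>u\<close> along with \<open>J\<close> uses up the summand 1 of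
      \<open>lin_bound\<close>.\<close>
    then have "card (insert u J) \<le> card (S \<inter> proj_set (V J))" using finS by (intro card_mono) auto
    also have "\<dots> \<le> lin_bound d (V J)" using S(1) Vs V0 unfolding C_indep_def by blast
    finally show "card J \<le> d * f J"
      using subsetD[OF J, of u] finite_subset[OF J fin]
      by (cases "u \<in> J") (simp_all add: lin_bound_def dimV A_def)
  qed (rule f_mono)
  then obtain c where c: "\<forall>a\<in>A. c a < d" "card A \<le> (\<Sum>j<d. f {a \<in> A. c a = j})" by blast
  let ?I = "\<lambda>j. {a \<in> A. c a = j}"
  have fI: "f (?I j) \<le> card (?I j)" for j
  proof -
    have "vec.dim (V (?I j)) \<le> card (insert (rp u) (rp ` ?I j))"
      unfolding V_def vec.dim_span by (rule vec.dim_le_card) (use fin in \<open>auto intro: vec.span_base\<close>)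
    also have "\<dots> \<le> Suc (card (?I j))"
      using card_insert_le_m1 card_image_le[of "?I j" rp] fin by (simp add: card_insert_if)
    finally show ?thesis by (simp add: dimV)
  qed
  have sumI: "(\<Sum>j<d. card (?I j)) = card A"
  proof -
    have "(\<Sum>j<d. card (?I j)) = card (\<Union>j<d. ?I j)" by (rule card_UN_disjoint[symmetric]) (use fin in auto)
    also have "(\<Union>j<d. ?I j) = A" using c(1) by auto
    finally show ?thesis .
  qed
  \<comment> \<open>The classes together have \<open>card A\<close> points and at least that much
    rank, so none of them can lose rank.\<close>
  have eq: "f (?I j) = card (?I j)" if j: "j < d" for j
  proof (rule ccontr)
    assume "f (?I j) \<noteq> card (?I j)"
    then have "f (?I j) < card (?I j)" using fI[of j] by linarith
    then have "(\<Sum>j<d. f (?I j)) < (\<Sum>j<d. card (?I j))"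
      using fI j by (intro sum_strict_mono_ex1) auto
    then show False using c(2) sumI by simp
  qed
  have "\<exists>e. e \<odot> rp u = 1 \<and> (\<forall>a\<in>?I j. e \<odot> rp a = 0)" if j: "j < d" for j
  proof -
    have "rp u \<notin> vec.span (rp ` ?I j)"
    proof
      assume "rp u \<in> vec.span (rp ` ?I j)"
      then have "V (?I j) = vec.span (rp ` ?I j)" unfolding V_def by (rule vec.span_redundant)
      then have "vec.dim (V (?I j)) \<le> card (rp ` ?I j)"
        using fin by (simp add: vec.dim_le_card vec.span_superset)
      also have "\<dots> \<le> card (?I j)" by (rule card_image_le) (use fin in auto)
      finally show False using eq[OF j] by (simp add: dimV)
    qed
    then obtain e where "e \<odot> rp u = 1" "\<And>y. y \<in> rp ` ?I j \<Longrightarrow> e \<odot> y = 0"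
      using exists_functional_separating by blast
    then show ?thesis by blast
  qed
  then have "\<forall>j. \<exists>e. j < d \<longrightarrow> e \<odot> rp u = 1 \<and> (\<forall>a\<in>?I j. e \<odot> rp a = 0)" by blast
  from choice[OF this] obtain e where "\<forall>j. j < d \<longrightarrow> e j \<odot> rp u = 1 \<and> (\<forall>a\<in>?I j. e j \<odot> rp a = 0)" ..
  then have e: "\<And>j. j < d \<Longrightarrow> e j \<odot> rp u = 1" "\<And>j a. j < d \<Longrightarrow> a \<in> ?I j \<Longrightarrow> e j \<odot> rp a = 0" by blast+
  let ?F = "\<Prod>j<d. Lin (e j)"
  show "\<exists>F\<in>hom_part (int d). ev F (rp u) \<noteq> 0 \<and> (\<forall>P'\<in>S - {u}. ev F (rp P') = 0)"
  proof (intro bexI[of _ ?F] conjI ballI)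
    show "?F \<in> hom_part (int d)" using hom_part_prod[of "{..<d}" "\<lambda>j. Lin (e j)", OF hom_part_Lin] by simp
    show "ev ?F (rp u) \<noteq> 0" using e(1) by (simp add: meval_simps meval_Lin)
    fix P assume "P \<in> S - {u}"
    then have "P \<in> A" by (simp add: A_def)
    then have "e (c P) \<odot> rp P = 0" "c P < d" using e(2)[of "c P" P] c(1) by auto
    then show "ev ?F (rp P) = 0" by (auto simp: meval_simps meval_Lin intro!: prod_zero bexI[of _ "c P"])
  qed
qed

section \<open>Conditions imposed on linear subspaces\<close>

text \<open>With \<open>e\<close> running over functionals that together with \<open>b 0\<close> span the dual of \<open>W\<close>, the
  restriction of \<open>Jf b d\<close> to \<open>W\<close> is spanned by the \<open>e * (b 0)\<^sup>i * (b 1)\<^sup>j\<close> and \<open>(b 0)\<^sup>d\<close>.\<close>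

lemma indep_on_linear_card_le:
  fixes b :: "nat \<Rightarrow> 'k::field ^ 'v"
  assumes W: "vec.subspace W" and x: "x \<in> W" "b 0 \<odot> x \<noteq> 0"
    and A: "indep_on (Jf b d) A" "A \<subseteq> proj_set W"
  shows "card A \<le> lin_bound d W"
proof -
  define x0 where "x0 = inverse (b 0 \<odot> x) *s x"
  have x0: "x0 \<in> W" "b 0 \<odot> x0 = 1" using x W by (auto simp: x0_def vec.subspace_scale dotp_simps)
  define W1 where "W1 = {y \<in> W. b 0 \<odot> y = 0}"
  obtain B where B: "B \<subseteq> W1" "vec.independent B" "W1 \<subseteq> vec.span B"
    using vec.maximal_independent_subset[of W1] by blast
  have finB: "finite B" using B(2) vec.finiteI_independent by blast
  have spB: "b 0 \<odot> y = 0" if "y \<in> vec.span B" for y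
    using that by (induction rule: vec.span_induct_alt) (use B(1) in \<open>auto simp: dotp_simps W1_def\<close>)
  then have x0B: "x0 \<notin> vec.span B" using x0 by fastforce
  then have ind: "vec.independent (insert x0 B)" using B(2) vec.independent_insertI by blast
  have x0B': "x0 \<notin> B" using x0B vec.span_base by blast
  have "card (insert x0 B) \<le> vec.dim W"
    using vec.independent_card_le_dim[OF _ ind, of W] B(1) x0 by (auto simp: W1_def)
  then have cardB: "card B \<le> vec.dim W - 1" using finB x0B' by simp
  \<comment> \<open>For \<open>\<beta>\<close> in the basis \<open>B\<close> of the kernel of
    \<open>b 0\<close> on \<open>W\<close>, \<open>e \<beta>\<close> is the corresponding
    coordinate, extended by 0 to \<open>x0\<close>; together with \<open>b 0\<close> these are
    coordinates on \<open>W\<close>.\<close>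
  have "\<forall>\<beta>. \<exists>e. \<forall>y\<in>insert x0 B. e \<odot> y = (if y = \<beta> then 1 else 0)"
  proof
    fix \<beta>
    show "\<exists>e. \<forall>y\<in>insert x0 B. e \<odot> y = (if y = \<beta> then 1 else 0)"
      by (rule exists_functional[OF ind, where f = "\<lambda>y. if y = \<beta> then 1 else 0"]) (rule exI, rule ballI)
  qed
  from choice[OF this] obtain e where e0: "\<forall>\<beta>. \<forall>y\<in>insert x0 B. e \<beta> \<odot> y = (if y = \<beta> then 1 else 0)" ..
  have e: "e \<beta> \<odot> y = (if y = \<beta> then 1 else 0)" if "y \<in> insert x0 B" for \<beta> y
    by (rule e0[THEN spec, THEN bspec, OF that])
  have decomp: "w \<odot> y = (w \<odot> x0) * (b 0 \<odot> y) + (\<Sum>\<beta>\<in>B. (w \<odot> \<beta>) * (e \<beta> \<odot> y))" if y: "y \<in> W" for w y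
  proof -
    define z where "z = y - (b 0 \<odot> y) *s x0"
    have zW: "z \<in> W1" using y x0 W by (auto simp: z_def W1_def dotp_simps vec.subspace_diff vec.subspace_scale)
    then have z: "z \<in> vec.span B" using B by blast
    have "w \<odot> z = (\<Sum>\<beta>\<in>B. (w \<odot> \<beta>) * (e \<beta> \<odot> z))" using z
    proof (induction rule: vec.span_induct_alt)
      case (step c x y)
      have "(\<Sum>\<beta>\<in>B. (w \<odot> \<beta>) * (e \<beta> \<odot> x)) = (\<Sum>\<beta>\<in>B. if \<beta> = x then w \<odot> x else 0)"
        by (rule sum.cong) (use e step(1) in auto)
      then have "(\<Sum>\<beta>\<in>B. (w \<odot> \<beta>) * (e \<beta> \<odot> x)) = w \<odot> x" using step(1) finB by simp
      moreover have "(\<Sum>\<beta>\<in>B. (w \<odot> \<beta>) * (e \<beta> \<odot> (c *s x + y))) =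
          c * (\<Sum>\<beta>\<in>B. (w \<odot> \<beta>) * (e \<beta> \<odot> x)) + (\<Sum>\<beta>\<in>B. (w \<odot> \<beta>) * (e \<beta> \<odot> y))"
        by (simp add: dotp_simps distrib_left sum.distrib sum_distrib_left mult.left_commute)
      ultimately show ?case using step by (simp add: dotp_simps)
    qed simp
    moreover have "e \<beta> \<odot> z = e \<beta> \<odot> y" if "\<beta> \<in> B" for \<beta>
      using e[of x0 \<beta>] that x0B' by (auto simp: z_def dotp_simps)
    ultimately have "w \<odot> z = (\<Sum>\<beta>\<in>B. (w \<odot> \<beta>) * (e \<beta> \<odot> y))" by simp
    moreover have "w \<odot> y = w \<odot> z + (b 0 \<odot> y) * (w \<odot> x0)" by (simp add: z_def dotp_simps)
    ultimately show ?thesis by (simp add: mult.commute)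
  qed
  define g where "g = (\<lambda>(\<beta>, i). Lin (e \<beta>) * (Lin (b 0) ^ i * Lin (b 1) ^ (d - 1 - i)))"
  define G where "G = insert (Lin (b 0) ^ d) (g ` (B \<times> {..<d}))"
  define R where "R = {F. \<exists>H\<in>mpoly_vs.span G. \<forall>y\<in>W. ev F y = ev H y}"
  have R_cong: "F \<in> R" if "F' \<in> R" "\<And>y. y \<in> W \<Longrightarrow> ev F y = ev F' y" for F F'
    using that unfolding R_def by auto
  have R_sub: "mpoly_vs.subspace R"
    unfolding mpoly_vs.subspace_def
  proof (intro conjI allI ballI)
    show "0 \<in> R" unfolding R_def by (intro CollectI bexI[of _ 0] mpoly_vs.span_zero) simp
    show "F + F' \<in> R" if FF: "F \<in> R" "F' \<in> R" for F F'
    proof -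
      obtain H H' where "H \<in> mpoly_vs.span G" "\<forall>y\<in>W. ev F y = ev H y" "H' \<in> mpoly_vs.span G" "\<forall>y\<in>W. ev F' y = ev H' y"
        using FF unfolding R_def by blast
      then have "H + H' \<in> mpoly_vs.span G \<and> (\<forall>y\<in>W. ev (F + F') y = ev (H + H') y)"
        by (simp add: mpoly_vs.span_add meval_simps)
      then show ?thesis unfolding R_def by blast
    qed
    show "Const c * F \<in> R" if FF: "F \<in> R" for F c
    proof -
      obtain H where "H \<in> mpoly_vs.span G" "\<forall>y\<in>W. ev F y = ev H y" using FF unfolding R_def by blast
      then have "Const c * H \<in> mpoly_vs.span G \<and> (\<forall>y\<in>W. ev (Const c * F) y = ev (Const c * H) y)"
        by (simp add: mpoly_vs.span_scale meval_simps)
      then show ?thesis unfolding R_def by blast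
    qed
  qed
  have gR: "Lin (e \<beta>) * (Lin (b 0) ^ i * Lin (b 1) ^ j) \<in> R" if "\<beta> \<in> B" "Suc (i + j) = d" for \<beta> i j
  proof -
    have "Lin (e \<beta>) * (Lin (b 0) ^ i * Lin (b 1) ^ j) = g (\<beta>, i)" using that(2) by (auto simp: g_def)
    moreover have "g (\<beta>, i) \<in> G" using that unfolding G_def by (intro insertI2 imageI) auto
    ultimately have "Lin (e \<beta>) * (Lin (b 0) ^ i * Lin (b 1) ^ j) \<in> mpoly_vs.span G" by (simp add: mpoly_vs.span_base)
    then show ?thesis unfolding R_def by blast
  qed
  \<comment> \<open>On \<open>W\<close> the factor \<open>w\<close> is a combination of
    \<open>b 0\<close> and the \<open>e \<beta>\<close>, so only the form with one more power of
    \<open>b 0\<close> remains to be treated.\<close>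
  have step: "Lin w * (Lin (b 0) ^ i * Lin (b 1) ^ j) \<in> R"
    if ij: "Suc (i + j) = d" and R: "Lin (b 0) ^ Suc i * Lin (b 1) ^ j \<in> R" for w i j
  proof (rule R_cong)
    let ?m = "Lin (b 0) ^ i * Lin (b 1) ^ j"
    show "Const (w \<odot> x0) * (Lin (b 0) ^ Suc i * Lin (b 1) ^ j) + (\<Sum>\<beta>\<in>B. Const (w \<odot> \<beta>) * (Lin (e \<beta>) * ?m)) \<in> R"
      by (intro mpoly_vs.subspace_add[OF R_sub] mpoly_vs.subspace_scale[OF R_sub] mpoly_vs.subspace_sum[OF R_sub] R gR ij)
    fix y assume "y \<in> W"
    from decomp[OF this, of w]
    show "ev (Lin w * ?m) y = ev (Const (w \<odot> x0) * (Lin (b 0) ^ Suc i * Lin (b 1) ^ j) + (\<Sum>\<beta>\<in>B. Const (w \<odot> \<beta>) * (Lin (e \<beta>) * ?m))) y"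
      by (simp add: meval_simps meval_Lin distrib_right sum_distrib_right mult.assoc)
  qed
  \<comment> \<open>Factors \<open>b 1\<close> are traded for \<open>b 0\<close> one at a time,
    which ends at \<open>Lin (b 0) ^ d\<close>. This one form accounts for the summand 1 of
    \<open>lin_bound\<close>.\<close>
  have pow: "Lin (b 0) ^ Suc i * Lin (b 1) ^ j \<in> R" if "Suc (i + j) = d" for i j
    using that
  proof (induction j arbitrary: i)
    case 0
    then show ?case unfolding R_def G_def by (auto intro!: bexI[of _ "Lin (b 0) ^ d"] mpoly_vs.span_base)
  next
    case (Suc j)
    have "Lin (b 0) ^ Suc (Suc i) * Lin (b 1) ^ j \<in> R" by (rule Suc.IH) (use Suc.prems in simp)
    then have "Lin (b 1) * (Lin (b 0) ^ Suc i * Lin (b 1) ^ j) \<in> R" using step[of "Suc i" j] Suc.prems by simp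
    then show ?case by (simp add: mult_ac)
  qed
  have JR: "Jf b d \<subseteq> R"
    unfolding Jf_def by (rule mpoly_vs.span_minimal[OF _ R_sub]) (use step pow in blast)
  have "card A \<le> card G"
  proof (rule indep_on_card_le[OF subspace_Jf A(1)])
    show "finite G" using finB by (simp add: G_def)
    fix F assume "F \<in> Jf b d"
    then have "F \<in> R" using JR by blast
    then obtain H where "H \<in> mpoly_vs.span G" "\<forall>y\<in>W. ev F y = ev H y" unfolding R_def by blast
    then show "\<exists>H\<in>mpoly_vs.span G. \<forall>P\<in>A. ev F (rp P) = ev H (rp P)" using A(2) proj_setD by blast
  qed
  also have "\<dots> \<le> Suc (card (g ` (B \<times> {..<d})))" unfolding G_def by (simp add: card_insert_if finB)
  also have "\<dots> \<le> Suc (card B * d)"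
    using card_image_le[of "B \<times> {..<d}" g] finB by (simp add: card_cartesian_product)
  also have "\<dots> \<le> lin_bound d W" using cardB by (simp add: lin_bound_def mult.commute)
  finally show ?thesis .
qed

section \<open>Conditions imposed on irreducible subvarieties\<close>

lemma zariski_closed_points: "zariski_closed X \<Longrightarrow> X \<subseteq> proj_points"
  unfolding zariski_closed_def by blast

lemma zariski_closed_zero_locus:
  assumes "zariski_closed X" "f \<in> hom_part j"
  shows "zariski_closed {P \<in> X. vanishes_at f P}"
proof -
  obtain F where F: "\<forall>f\<in>F. \<exists>j. f \<in> hom_part j" "X = {P \<in> proj_points. \<forall>f\<in>F. vanishes_at f P}"
    using assms(1) unfolding zariski_closed_def by blast
  have "\<forall>f\<in>insert f F. \<exists>j. f \<in> hom_part j" using F(1) assms(2) by blast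
  moreover have "{P \<in> X. vanishes_at f P} = {P \<in> proj_points. \<forall>f\<in>insert f F. vanishes_at f P}" using F(2) by blast
  ultimately show ?thesis unfolding zariski_closed_def by blast
qed

text \<open>Otherwise the zero loci of the two forms would cover \<open>X\<close> by proper closed
  subsets.\<close>

lemma irreducible_two_forms:
  assumes X: "irreducible_subvariety X" and f: "f \<in> hom_part (int i)" "g \<in> hom_part (int j)"
    and P: "P \<in> X" "ev f (rp P) \<noteq> 0" and Q: "Q \<in> X" "ev g (rp Q) \<noteq> 0"
  shows "\<exists>P\<in>X. ev f (rp P) \<noteq> 0 \<and> ev g (rp P) \<noteq> 0"
proof (rule ccontr)
  assume neg: "\<not> ?thesis"
  have XP: "X \<subseteq> proj_points" and c: "zariski_closed X"
    using X zariski_closed_points by (auto simp: irreducible_subvariety_def)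
  let ?A = "{P \<in> X. vanishes_at f P}" and ?B = "{P \<in> X. vanishes_at g P}"
  have "X = ?A \<union> ?B" using neg vanishes_at_hom[OF _ f(1)] vanishes_at_hom[OF _ f(2)] XP by blast
  moreover have "zariski_closed ?A" "zariski_closed ?B" using zariski_closed_zero_locus[OF c] f by blast+
  ultimately have "X = ?A \<or> X = ?B" using X unfolding irreducible_subvariety_def by blast
  then show False
  proof
    assume "X = ?A"
    then have "vanishes_at f P" using P by blast
    then show False using vanishes_at_hom[OF _ f(1), of P] P XP by blast
  next
    assume "X = ?B"
    then have "vanishes_at g Q" using Q by blast
    then show False using vanishes_at_hom[OF _ f(2), of Q] Q XP by blast
  qed
qed

lemma irreducible_avoid:
  fixes X :: "('k::field ^ 'v) set set"
  assumes X: "irreducible_subvariety X" and "finite \<Xi>" "\<And>\<xi>. \<xi> \<in> \<Xi> \<Longrightarrow> \<exists>P\<in>X. \<xi> \<odot> rp P \<noteq> 0"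
  shows "\<exists>P\<in>X. \<forall>\<xi>\<in>\<Xi>. \<xi> \<odot> rp P \<noteq> 0"
  using assms(2,3)
proof (induction \<Xi> rule: finite_induct)
  case empty
  then show ?case using X by (auto simp: irreducible_subvariety_def)
next
  case (insert \<xi> \<Xi>)
  obtain P where P: "P \<in> X" "\<forall>\<xi>\<in>\<Xi>. \<xi> \<odot> rp P \<noteq> 0" using insert by blast
  obtain Q where Q: "Q \<in> X" "\<xi> \<odot> rp Q \<noteq> 0" using insert.prems by blast
  have h: "(\<Prod>\<xi>\<in>\<Xi>. Lin \<xi>) \<in> hom_part (int (card \<Xi>))" by (rule hom_part_prod) (rule hom_part_Lin)
  have h1: "Lin \<xi> \<in> hom_part (int 1)" using hom_part_Lin by simp
  have evp: "ev (\<Prod>\<xi>\<in>\<Xi>. Lin \<xi>) x \<noteq> 0 \<longleftrightarrow> (\<forall>\<xi>\<in>\<Xi>. \<xi> \<odot> x \<noteq> 0)" for x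
    using insert(1) by (auto simp: meval_simps meval_Lin)
  obtain P' where "P' \<in> X" "ev (Lin \<xi>) (rp P') \<noteq> 0" "ev (\<Prod>\<xi>\<in>\<Xi>. Lin \<xi>) (rp P') \<noteq> 0"
    using irreducible_two_forms[OF X h1 h Q(1) _ P(1)] P(2) Q(2) evp meval_Lin by metis
  then have "P' \<in> X \<and> (\<forall>\<eta>\<in>insert \<xi> \<Xi>. \<eta> \<odot> rp P' \<noteq> 0)" using evp meval_Lin by (metis insert_iff)
  then show ?case by blast
qed

text \<open>Take a point outside each of two closed pieces and join them by a line. Polynomials
  witnessing this are nonzero on the line, so at some point of it neither vanishes.\<close>

lemma irreducible_proj_set:
  fixes W :: "('k::alg_closed_field ^ 'v) set"
  assumes W: "vec.subspace W" "W \<noteq> {0}"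
  shows "irreducible_subvariety (proj_set W)"
  unfolding irreducible_subvariety_def
proof (intro conjI allI impI)
  show "proj_set W \<noteq> {}"
  proof -
    obtain x where x: "x \<in> W" "x \<noteq> 0" using W vec.subspace_0 by blast
    then have "vec.span {x} \<in> proj_set W"
      using span_in_proj_points vec.span_minimal[OF _ W(1), of "{x}"] by (auto simp: proj_set_def)
    then show ?thesis by blast
  qed
  show "zariski_closed (proj_set W)"
    unfolding zariski_closed_def
  proof (intro exI[of _ "{Lin w |w. \<forall>x\<in>W. w \<odot> x = 0}"] conjI)
    show "\<forall>f\<in>{Lin w |w. \<forall>x\<in>W. w \<odot> x = 0}. \<exists>j. f \<in> hom_part j" using hom_part_Lin by blast
    show "proj_set W = {P \<in> proj_points. \<forall>f\<in>{Lin w |w. \<forall>x\<in>W. w \<odot> x = 0}. vanishes_at f P}" (is "_ = ?R")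
    proof
      show "proj_set W \<subseteq> ?R" by (auto simp: proj_set_def vanishes_at_def meval_Lin)
      show "?R \<subseteq> proj_set W"
      proof
        fix P assume P: "P \<in> ?R"
        then have PP: "P \<in> proj_points" by blast
        have "rp P \<in> W"
        proof (rule ccontr)
          assume "rp P \<notin> W"
          then have "rp P \<notin> vec.span W" using W(1) by (metis vec.span_eq_iff)
          then obtain e where e: "e \<odot> rp P = 1" "\<And>y. y \<in> W \<Longrightarrow> e \<odot> y = 0" using exists_functional_separating by blast
          then have "vanishes_at (Lin e) P" using P by blast
          then show False using rp[OF PP] e(1) by (auto simp: vanishes_at_def meval_Lin)
        qed
        then show "P \<in> proj_set W" using proj_set_iff[OF W(1) PP] by simp
      qed
    qed
  qed
  fix A B assume AB: "zariski_closed A \<and> zariski_closed B \<and> proj_set W = A \<union> B"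
  show "proj_set W = A \<or> proj_set W = B"
  proof (rule ccontr)
    assume "\<not> ?thesis"
    then obtain P Q where P: "P \<in> proj_set W" "P \<notin> A" and Q: "Q \<in> proj_set W" "Q \<notin> B" using AB by blast
    have vanish: "\<exists>f x. x \<in> W \<and> x \<noteq> 0 \<and> ev f x \<noteq> 0 \<and> (\<forall>P\<in>C. vanishes_at f P)"
      if C: "zariski_closed C" and R: "R \<in> proj_set W" "R \<notin> C" for C R
    proof -
      obtain F where "C = {P \<in> proj_points. \<forall>f\<in>F. vanishes_at f P}" using C unfolding zariski_closed_def by blast
      then obtain f where "f \<in> F" "\<not> vanishes_at f R" "\<forall>P\<in>C. vanishes_at f P" using R by (auto simp: proj_set_def)
      then show ?thesis using R unfolding vanishes_at_def proj_set_def by blast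
    qed
    obtain f x where f: "x \<in> W" "x \<noteq> 0" "ev f x \<noteq> 0" "\<forall>P\<in>A. vanishes_at f P" using vanish[of A P] P AB by blast
    obtain g y where g: "y \<in> W" "y \<noteq> 0" "ev g y \<noteq> 0" "\<forall>P\<in>B. vanishes_at g P" using vanish[of B Q] Q AB by blast
    \<comment> \<open>A third polynomial on the line, whose nonvanishing keeps the chosen vector
      away from 0.\<close>
    obtain e where e: "e \<odot> x = 1" using exists_functional_separating[of x "{}"] f(2) by auto
    let ?l = "\<lambda>t. x + t *s (y - x)"
    define line where "line h = geval (\<lambda>c. [:c:]) (\<lambda>i. [:x $ i, (y - x) $ i:]) h" for h
    have line: "poly (line h) t = ev h (?l t)" for h t
    proof -
      have "($) (?l t) = (\<lambda>i. poly [:x $ i, (y - x) $ i:] t)" by (simp add: fun_eq_iff algebra_simps)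
      then show ?thesis by (simp only: line_def poly_geval)
    qed
    have "line f \<noteq> 0" "line (Lin e) \<noteq> 0" using line[of f 0] line[of "Lin e" 0] f e by (auto simp: meval_Lin)
    moreover have "line g \<noteq> 0" using line[of g 1] g by auto
    ultimately obtain t where t: "poly (line f) t \<noteq> 0" "poly (line (Lin e)) t \<noteq> 0" "poly (line g) t \<noteq> 0"
      using avoid_roots[of "{line f, line (Lin e), line g}"] by auto
    let ?z = "?l t"
    have z: "?z \<noteq> 0" using t(2) by (auto simp: line meval_Lin)
    have zW: "?z \<in> W" using f g W(1) by (intro vec.subspace_add vec.subspace_scale vec.subspace_diff)
    have "vec.span {?z} \<in> proj_set W"
      using z zW span_in_proj_points vec.span_minimal[OF _ W(1), of "{?z}"] by (auto simp: proj_set_def)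
    then have "vec.span {?z} \<in> A \<or> vec.span {?z} \<in> B" using AB by blast
    moreover have "?z \<in> vec.span {?z} - {0}" using z vec.span_base by blast
    ultimately have "ev f ?z = 0 \<or> ev g ?z = 0" using f(4) g(4) unfolding vanishes_at_def by blast
    then show False using t by (simp add: line)
  qed
qed

lemma Jf_mult_Lin: "F \<in> Jf b d \<Longrightarrow> Lin (b 0) * F \<in> Jf b (Suc d)"
  unfolding Jf_def
proof (induction rule: mpoly_vs.span_induct_alt)
  case base
  then show ?case by (simp add: mpoly_vs.span_zero)
next
  case (step c x y)
  let ?S = "{Lin w * (Lin (b 0) ^ i * Lin (b 1) ^ j) |w i j. Suc (i + j) = Suc d}"
  obtain w i j where x: "x = Lin w * (Lin (b 0) ^ i * Lin (b 1) ^ j)" "Suc (i + j) = d" using step(1) by blast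
  have "Lin (b 0) * x = Lin w * (Lin (b 0) ^ Suc i * Lin (b 1) ^ j)" by (simp add: x(1) mult_ac)
  moreover have "Suc (Suc i + j) = Suc d" using x(2) by simp
  ultimately have "Lin (b 0) * x \<in> ?S" by blast
  then have "Const c * (Lin (b 0) * x) + Lin (b 0) * y \<in> mpoly_vs.span ?S"
    by (rule mpoly_vs.span_add[OF mpoly_vs.span_scale[OF mpoly_vs.span_base] step(2)])
  then show ?case by (simp add: algebra_simps)
qed

lemma polyfun_b0: "polyfun (\<lambda>b :: nat \<Rightarrow> 'k::comm_ring_1 ^ 'v. b j \<odot> x)"
  by (intro polyfun_dotp polyfun_coord polyfun_const)

text \<open>Hyperplanes spanned by points of \<open>X\<close> are dense: a hyperplane \<open>\<eta>\<close> containing \<open>r\<close> independent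
  points moves in a pencil \<open>\<eta> + t \<zeta>\<close> with the same points, whose members not in the closed set to be
  avoided meet \<open>X\<close> in further points.\<close>

lemma spanned_hyperplane:
  fixes X :: "('k::alg_closed_field ^ 'v) set set" and b :: "nat \<Rightarrow> 'k ^ 'v"
  assumes X: "irreducible_subvariety X" and \<Phi>: "polyfun \<Phi>" "\<Phi> b \<noteq> 0"
    and b1: "\<exists>P\<in>X. b 1 \<odot> rp P \<noteq> 0" and r: "r < vec.dim (rp ` X)"
  shows "\<exists>\<eta> D. \<Phi> (b(0 := \<eta>)) \<noteq> 0 \<and> D \<subseteq> rp ` X \<and> vec.independent D \<and> card D = r \<and>
    (\<forall>x\<in>D. \<eta> \<odot> x = 0 \<and> b 1 \<odot> x \<noteq> 0)"
  using r
proof (induction r)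
  case 0
  have "vec.independent ({} :: ('k ^ 'v) set)" by (rule vec.independent_empty)
  then show ?case using \<Phi>(2) by (intro exI[of _ "b 0"] exI[of _ "{}"]) simp
next
  case (Suc r)
  then obtain \<eta> D where D: "\<Phi> (b(0 := \<eta>)) \<noteq> 0" "D \<subseteq> rp ` X" "vec.independent D" "card D = r"
    "\<And>x. x \<in> D \<Longrightarrow> \<eta> \<odot> x = 0" "\<And>x. x \<in> D \<Longrightarrow> b 1 \<odot> x \<noteq> 0"
    using Suc_lessD by blast
  obtain B where B: "D \<subseteq> B" "B \<subseteq> rp ` X" "vec.independent B" "rp ` X \<subseteq> vec.span B"
    using vec.maximal_independent_subset_extend[OF D(2,3)] by blast
  have finB: "finite B" using B(3) vec.finiteI_independent by blast
  have "card B = vec.dim (rp ` X)" by (rule vec.basis_card_eq_dim[OF B(2,4,3)])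
  \<comment> \<open>\<open>Suc r\<close> is still below the dimension, so two spare basis vectors
    remain, which leaves a choice for the direction of the pencil.\<close>
  then have "card (B - D) \<ge> 2" using Suc.prems D(4) card_Diff_subset[OF finite_subset[OF B(1) finB] B(1)] by simp
  then obtain x1 x2 where x12: "x1 \<in> B - D" "x2 \<in> B - D" "x1 \<noteq> x2"
    by (metis card_2_iff' card_le_Suc0_iff_eq finB finite_Diff not_less_eq_eq numeral_2_eq_2)
  obtain z1 where z1: "\<And>x. x \<in> B \<Longrightarrow> z1 \<odot> x = (if x = x1 then 1 else 0)"
    using exists_functional[OF B(3), where f = "\<lambda>x. if x = x1 then 1 else 0"] by blast
  obtain z2 where z2: "\<And>x. x \<in> B \<Longrightarrow> z2 \<odot> x = (if x = x2 then 1 else 0)"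
    using exists_functional[OF B(3), where f = "\<lambda>x. if x = x2 then 1 else 0"] by blast
  \<comment> \<open>Chosen so that no member \<open>\<eta> + t *s \<zeta>\<close> with
    \<open>t \<noteq> 0\<close> vanishes on all of \<open>X\<close>: at \<open>x2\<close> it takes
    the nonzero value of \<open>\<eta>\<close> in the first case and the value \<open>t\<close> in
    the second.\<close>
  define \<zeta> where "\<zeta> = (if \<eta> \<odot> x2 \<noteq> 0 then z1 else z2)"
  have \<zeta>D: "\<zeta> \<odot> x = 0" if "x \<in> D" for x
  proof -
    have "x \<in> B" "x \<noteq> x1" "x \<noteq> x2" using that x12 B(1) by auto
    then show ?thesis using z1[of x] z2[of x] by (simp add: \<zeta>_def)
  qed
  have \<zeta>0: "\<exists>x\<in>B. \<zeta> \<odot> x \<noteq> 0"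
  proof (rule bexI)
    show "\<zeta> \<odot> (if \<eta> \<odot> x2 \<noteq> 0 then x1 else x2) \<noteq> 0" using z1[of x1] z2[of x2] x12 by (simp add: \<zeta>_def)
  qed (use x12 in auto)
  have \<zeta>t: "\<exists>x\<in>B. (\<eta> + t *s \<zeta>) \<odot> x \<noteq> 0" if t: "t \<noteq> 0" for t
  proof -
    have "(\<eta> + t *s \<zeta>) \<odot> x2 \<noteq> 0"
      using z1[of x2] z2[of x2] x12 t by (cases "\<eta> \<odot> x2 \<noteq> 0") (auto simp: \<zeta>_def dotp_simps)
    then show ?thesis using x12 by blast
  qed
  obtain p where p: "\<And>t. poly p t = \<Phi> (\<lambda>j. (b(0 := \<eta>)) j + t *s (if j = 0 then \<zeta> else 0))"
    using polyfun_line[OF \<Phi>(1), of "b(0 := \<eta>)" "\<lambda>j. if j = 0 then \<zeta> else 0"] by blast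
  have upd: "(\<lambda>j. (b(0 := \<eta>)) j + t *s (if j = 0 then \<zeta> else 0)) = b(0 := \<eta> + t *s \<zeta>)" for t
    by (rule ext) simp
  have p: "poly p t = \<Phi> (b(0 := \<eta> + t *s \<zeta>))" for t using p[of t] unfolding upd .
  have p0: "poly p 0 \<noteq> 0" using D(1) by (simp add: p)
  then have "p \<noteq> 0" by auto
  \<comment> \<open>The finitely many forbidden members of the pencil. The point \<open>P\<close> is
    chosen off all of them, so the member through \<open>P\<close> is not forbidden.\<close>
  define R where "R = {t. poly p t = 0}"
  have finR: "finite R" unfolding R_def by (rule poly_roots_finite) fact
  have R0: "0 \<notin> R" using p0 by (simp add: R_def)
  let ?\<Xi> = "insert (b 1) (insert \<zeta> ((\<lambda>t. \<eta> + t *s \<zeta>) ` R))"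
  have "\<exists>P\<in>X. \<xi> \<odot> rp P \<noteq> 0" if xi: "\<xi> \<in> ?\<Xi>" for \<xi>
  proof -
    consider "\<xi> = b 1" | "\<xi> = \<zeta>" | t where "t \<in> R" "\<xi> = \<eta> + t *s \<zeta>" using xi by blast
    then have "\<xi> = b 1 \<or> (\<exists>x\<in>B. \<xi> \<odot> x \<noteq> 0)"
    proof cases
      case 3
      then have "t \<noteq> 0" using R0 by blast
      then show ?thesis using \<zeta>t 3(2) by simp
    qed (use \<zeta>0 in simp_all)
    then show ?thesis using b1 B(2) by blast
  qed
  then have "\<exists>P\<in>X. \<forall>\<xi>\<in>?\<Xi>. \<xi> \<odot> rp P \<noteq> 0" using irreducible_avoid[OF X, of ?\<Xi>] finR by blast
  then obtain P where P: "P \<in> X" "\<And>\<xi>. \<xi> \<in> ?\<Xi> \<Longrightarrow> \<xi> \<odot> rp P \<noteq> 0" by blast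
  define s where "s = - (\<eta> \<odot> rp P) / (\<zeta> \<odot> rp P)"
  have \<zeta>P: "\<zeta> \<odot> rp P \<noteq> 0" and b1P: "b 1 \<odot> rp P \<noteq> 0" using P(2) by auto
  have sP: "(\<eta> + s *s \<zeta>) \<odot> rp P = 0" using \<zeta>P by (simp add: s_def dotp_simps)
  then have "s \<notin> R" using P(2)[of "\<eta> + s *s \<zeta>"] by blast
  then have s: "\<Phi> (b(0 := \<eta> + s *s \<zeta>)) \<noteq> 0" by (simp add: R_def p)
  have "\<zeta> \<odot> x = 0" if "x \<in> vec.span D" for x
    using that by (induction rule: vec.span_induct_alt) (auto simp: dotp_simps \<zeta>D)
  then have notin: "rp P \<notin> vec.span D" using \<zeta>P by blast
  then have "vec.independent (insert (rp P) D)" using D(3) vec.independent_insertI by blast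
  moreover have "card (insert (rp P) D) = Suc r"
    using notin vec.span_base[of "rp P" D] D(4) finite_subset[OF B(1) finB] card_insert_disjoint[of D "rp P"] by blast
  moreover have "\<forall>x\<in>insert (rp P) D. (\<eta> + s *s \<zeta>) \<odot> x = 0 \<and> b 1 \<odot> x \<noteq> 0"
    using sP b1P D(5,6) \<zeta>D by (auto simp: dotp_simps)
  moreover have "insert (rp P) D \<subseteq> rp ` X" using P(1) D(2) by blast
  ultimately show ?case using s by blast
qed

lemma rp_inj: "X \<subseteq> proj_points \<Longrightarrow> inj_on rp X"
proof (rule inj_onI)
  fix P Q assume "X \<subseteq> proj_points" "P \<in> X" "Q \<in> X" "rp P = rp Q"
  then show "P = Q" using rp_eq_imp_eq[of P Q] rp(1)[of P] by auto
qed

text \<open>Induction on the degree: multiplication by \<open>b 0\<close> maps degree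
  \<open>d\<close> into degree \<open>Suc d\<close>. Let the hyperplane of \<open>b 0\<close> miss
  the old points and contain \<open>dim - 1\<close> independent new points of \<open>X\<close>. Then
  the multiples of \<open>b 0\<close> separate the old points, and the forms
  \<open>e * b 1 ^ d\<close> separate the new ones, so that many conditions are gained.\<close>

theorem irreducible_rank:
  fixes X :: "('k::alg_closed_field ^ 'v) set set"
  assumes X: "irreducible_subvariety X" and d: "d \<ge> 1"
  shows "\<exists>(b :: nat \<Rightarrow> 'k ^ 'v) A. A \<subseteq> X \<and> card A = d * (vec.dim (rp ` X) - 1) + 1 \<and> indep_on (Jf b d) A"
  using d
proof (induction d rule: nat_induct_at_least)
  case base
  have XP: "X \<subseteq> proj_points" using X zariski_closed_points by (auto simp: irreducible_subvariety_def)
  obtain P0 where P0: "P0 \<in> X" using X by (auto simp: irreducible_subvariety_def)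
  obtain B where B: "B \<subseteq> rp ` X" "vec.independent B" "rp ` X \<subseteq> vec.span B" "card B = vec.dim (rp ` X)"
    using vec.basis_exists by blast
  define A where "A = {P \<in> X. rp P \<in> B}"
  have rA: "rp ` A = B" using B(1) by (auto simp: A_def)
  have injA: "inj_on rp A" by (rule rp_inj) (use XP in \<open>auto simp: A_def\<close>)
  have finB: "finite B" using B(2) vec.finiteI_independent by blast
  then have finA: "finite A" using rA injA finite_imageD by blast
  have "vec.dim (rp ` X) \<noteq> 0"
  proof
    assume "vec.dim (rp ` X) = 0"
    then have "card B = 0" using B(4) by simp
    then have "B = {}" using finB by simp
    then show False using B(3) P0 rp(2) XP by auto
  qed
  moreover have "card A = vec.dim (rp ` X)" using B(4) card_image[OF injA] rA by simp
  ultimately have card: "card A = 1 * (vec.dim (rp ` X) - 1) + 1" by linarith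
  \<comment> \<open>In degree 1, \<open>Jf\<close> consists of all linear forms whatever
    \<open>b\<close> is, so the zero family serves.\<close>
  have "indep_on (Jf (\<lambda>_. 0) 1) A" unfolding indep_on_def
  proof (intro conjI ballI finA)
    fix P assume P: "P \<in> A"
    obtain e where e: "\<And>x. x \<in> B \<Longrightarrow> e \<odot> x = (if x = rp P then 1 else 0)"
      using exists_functional[OF B(2), where f = "\<lambda>x. if x = rp P then 1 else 0"] by blast
    show "\<exists>F\<in>Jf (\<lambda>_. 0) 1. ev F (rp P) \<noteq> 0 \<and> (\<forall>P'\<in>A - {P}. ev F (rp P') = 0)"
    proof (intro bexI[of _ "Lin e"] conjI ballI)
      show "ev (Lin e) (rp P) \<noteq> 0" using e[of "rp P"] P by (simp add: meval_Lin A_def)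
      fix P' assume P': "P' \<in> A - {P}"
      then have "rp P' \<noteq> rp P" using P injA by (auto simp: inj_on_def)
      then show "ev (Lin e) (rp P') = 0" using e[of "rp P'"] P' by (simp add: meval_Lin A_def)
    next
      show "Lin e \<in> Jf (\<lambda>_. 0) 1" unfolding Jf_def
        by (rule mpoly_vs.span_base) (rule CollectI, rule exI[of _ e], rule exI[of _ 0], rule exI[of _ 0], simp)
    qed
  qed
  moreover have "A \<subseteq> X" by (auto simp: A_def)
  ultimately show ?case using card by blast
next
  case (Suc d)
  let ?m = "vec.dim (rp ` X) - 1"
  have XP: "X \<subseteq> proj_points" using X zariski_closed_points by (auto simp: irreducible_subvariety_def)
  obtain P0 where P0: "P0 \<in> X" using X by (auto simp: irreducible_subvariety_def)
  have "vec.dim (rp ` X) \<noteq> 0"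
  proof
    assume "vec.dim (rp ` X) = 0"
    then have "rp ` X \<subseteq> {0}" by (simp only: vec.dim_eq_0)
    then show False using P0 rp(2) XP by auto
  qed
  then have m: "?m < vec.dim (rp ` X)" by linarith
  obtain b A where A: "A \<subseteq> X" "card A = d * ?m + 1" "indep_on (Jf b d) A" using Suc.IH by blast
  have finA: "finite A" using A(3) by (simp add: indep_on_def)
  obtain \<Phi> where \<Phi>: "polyfun \<Phi>" "\<Phi> b \<noteq> 0" "\<And>b. \<Phi> b \<noteq> 0 \<Longrightarrow> indep_on (Jf b d) A"
    using indep_on_open[OF A(3)] by blast
  have nz: "\<exists>b :: nat \<Rightarrow> 'k ^ 'v. b j \<odot> rp P \<noteq> 0" if P: "P \<in> X" for P j
  proof -
    obtain e where "e \<odot> rp P = 1" using exists_functional_separating[of "rp P" "{}"] rp(2)[of P] XP P by auto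
    then show ?thesis by (intro exI[of _ "\<lambda>_. e"]) simp
  qed
  \<comment> \<open>Asks that \<open>b 0\<close> vanish at no point of \<open>A\<close>, so that
    multiplication by it preserves independence there, and that \<open>b 1\<close> not vanish on all
    of \<open>X\<close>.\<close>
  define \<Psi> where "\<Psi> b = (\<Prod>P\<in>A. b 0 \<odot> rp P) * (b 1 \<odot> rp P0)" for b :: "nat \<Rightarrow> 'k ^ 'v"
  have \<Psi>p: "polyfun \<Psi>" unfolding \<Psi>_def by (intro polyfun_mult polyfun_prod polyfun_b0)
  have "\<exists>b :: nat \<Rightarrow> 'k ^ 'v. \<forall>P\<in>A. b 0 \<odot> rp P \<noteq> 0"
  proof (rule polyfun_prod_nonzero[OF finA])
    fix P assume "P \<in> A"
    then have "P \<in> X" using A(1) by blast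
    then show "\<exists>b :: nat \<Rightarrow> 'k ^ 'v. b 0 \<odot> rp P \<noteq> 0" by (rule nz)
  qed (rule polyfun_b0)
  then obtain b1 :: "nat \<Rightarrow> 'k ^ 'v" where b1: "(\<Prod>P\<in>A. b1 0 \<odot> rp P) \<noteq> 0" using finA by auto
  obtain b2 :: "nat \<Rightarrow> 'k ^ 'v" where b2: "b2 1 \<odot> rp P0 \<noteq> 0" using nz[OF P0] by blast
  have pp: "polyfun (\<lambda>b :: nat \<Rightarrow> 'k ^ 'v. \<Prod>P\<in>A. b 0 \<odot> rp P)" by (rule polyfun_prod) (rule polyfun_b0)
  obtain b3 :: "nat \<Rightarrow> 'k ^ 'v" where b3: "(\<Prod>P\<in>A. b3 0 \<odot> rp P) \<noteq> 0" "b3 1 \<odot> rp P0 \<noteq> 0"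
    by (rule polyfun_mult_nonzero[where b = b1 and c = b2, OF pp polyfun_b0[of 1 "rp P0"]]) (use b1 b2 in auto)
  then have "\<Psi> b3 \<noteq> 0" by (simp add: \<Psi>_def)
  then obtain b4 where b4: "\<Phi> b4 \<noteq> 0" "\<Psi> b4 \<noteq> 0"
    using polyfun_mult_nonzero[OF \<Phi>(1) \<Psi>p \<Phi>(2)] by blast
  have "\<exists>P\<in>X. b4 1 \<odot> rp P \<noteq> 0" using b4(2) P0 by (auto simp: \<Psi>_def)
  then obtain \<eta> D where D: "\<Phi> (b4(0 := \<eta>)) * \<Psi> (b4(0 := \<eta>)) \<noteq> 0" "D \<subseteq> rp ` X" "vec.independent D" "card D = ?m"
     "\<And>x. x \<in> D \<Longrightarrow> \<eta> \<odot> x = 0" "\<And>x. x \<in> D \<Longrightarrow> b4 1 \<odot> x \<noteq> 0"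
    using spanned_hyperplane[OF X polyfun_mult[OF \<Phi>(1) \<Psi>p], of b4 ?m] b4 m by auto
  let ?b = "b4(0 := \<eta>)"
  define Y where "Y = {P \<in> X. rp P \<in> D}"
  have rY: "rp ` Y = D" using D(2) by (auto simp: Y_def)
  have injY: "inj_on rp Y" by (rule rp_inj) (use XP in \<open>auto simp: Y_def\<close>)
  have cardY: "card Y = ?m" using card_image[OF injY] rY D(4) by simp
  have finY: "finite Y" using rY injY finite_imageD D(3) vec.finiteI_independent by metis
  have A0: "\<eta> \<odot> rp P \<noteq> 0" if "P \<in> A" for P using D(1) that finA by (auto simp: \<Psi>_def)
  have Y0: "\<eta> \<odot> rp P = 0" "b4 1 \<odot> rp P \<noteq> 0" if "P \<in> Y" for P using D(5,6) that by (auto simp: Y_def)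
  have disj: "A \<inter> Y = {}" using A0 Y0 by blast
  have "indep_on (Jf ?b d) A" using \<Phi>(3) D(1) by simp
  then obtain F where F: "\<And>P. P \<in> A \<Longrightarrow> F P \<in> Jf ?b d"
    "\<And>P P'. P \<in> A \<Longrightarrow> P' \<in> A \<Longrightarrow> ev (F P) (rp P') = (if P' = P then 1 else 0)"
    using indep_on_dual[OF subspace_Jf] by blast
  define H where "H P = Lin \<eta> * F P" for P
  have HJ: "H P \<in> Jf ?b (Suc d)" if "P \<in> A" for P
    using Jf_mult_Lin[OF F(1)[OF that]] by (simp add: H_def)
  have HA: "ev (H P) (rp P') = (if P' = P then \<eta> \<odot> rp P' else 0)" if "P \<in> A" "P' \<in> A" for P P'
    using F(2)[OF that] by (simp add: H_def meval_simps meval_Lin)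
  have HY: "ev (H P) (rp P') = 0" if "P' \<in> Y" for P P'
    using Y0 that by (simp add: H_def meval_simps meval_Lin)
  have "indep_on (Jf ?b (Suc d)) (A \<union> Y)" unfolding indep_on_def
  proof (intro conjI ballI)
    show "finite (A \<union> Y)" using finA finY by simp
    fix P assume "P \<in> A \<union> Y"
    then consider "P \<in> A" | "P \<in> Y" by blast
    then show "\<exists>F\<in>Jf ?b (Suc d). ev F (rp P) \<noteq> 0 \<and> (\<forall>P'\<in>A \<union> Y - {P}. ev F (rp P') = 0)"
    proof cases
      case 1
      have "ev (H P) (rp P) \<noteq> 0" using HA[OF 1 1] A0[OF 1] by simp
      moreover have "ev (H P) (rp P') = 0" if P': "P' \<in> A \<union> Y - {P}" for P'
      proof (cases "P' \<in> A")
        case True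
        then show ?thesis using HA[OF 1 True] P' by simp
      qed (use HY P' in blast)
      ultimately show ?thesis using HJ[OF 1] by blast
    next
      case 2
      obtain e where e: "\<And>x. x \<in> D \<Longrightarrow> e \<odot> x = (if x = rp P then 1 else 0)"
        using exists_functional[OF D(3), where f = "\<lambda>x. if x = rp P then 1 else 0"] by blast
      define G where "G = Lin e * (Lin (?b 0) ^ 0 * Lin (?b 1) ^ d)"
      have "G \<in> {Lin w * (Lin (?b 0) ^ i * Lin (?b 1) ^ j) |w i j. Suc (i + j) = Suc d}"
        unfolding G_def by (rule CollectI, rule exI[of _ e], rule exI[of _ 0], rule exI[of _ d]) simp
      then have GJ: "G \<in> Jf ?b (Suc d)" unfolding Jf_def by (rule mpoly_vs.span_base)
      have evG: "ev G x = (e \<odot> x) * (b4 1 \<odot> x) ^ d" for x by (simp add: G_def meval_simps meval_Lin)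
      \<comment> \<open>Multiples of the \<open>H Q\<close>, which vanish on \<open>Y\<close>,
        cancel the values of \<open>G\<close> on \<open>A\<close> without changing those on
        \<open>Y\<close>.\<close>
      define K where "K = G - (\<Sum>Q\<in>A. Const (ev G (rp Q) / (\<eta> \<odot> rp Q)) * H Q)"
      have KJ: "K \<in> Jf ?b (Suc d)" unfolding K_def
        by (intro mpoly_vs.subspace_diff mpoly_vs.subspace_sum mpoly_vs.subspace_scale subspace_Jf GJ HJ)
      have KA: "ev K (rp P') = 0" if P': "P' \<in> A" for P'
      proof -
        have "(\<Sum>Q\<in>A. ev G (rp Q) / (\<eta> \<odot> rp Q) * ev (H Q) (rp P')) = (\<Sum>Q\<in>A. if Q = P' then ev G (rp P') else 0)"
          by (rule sum.cong) (use HA P' A0 in auto)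
        then show ?thesis using P' finA by (simp add: K_def meval_simps)
      qed
      have KY: "ev K (rp P') = ev G (rp P')" if "P' \<in> Y" for P'
        using HY[OF that] by (simp add: K_def meval_simps)
      have "ev K (rp P) \<noteq> 0" using KY[OF 2] e[of "rp P"] Y0[OF 2] 2 by (simp add: evG Y_def)
      moreover have "ev K (rp P') = 0" if "P' \<in> A \<union> Y - {P}" for P'
      proof (cases "P' \<in> A")
        case False
        then have P': "P' \<in> Y" "P' \<noteq> P" using that by auto
        then have "rp P' \<noteq> rp P" using 2 injY by (auto simp: inj_on_def)
        then show ?thesis using KY[OF P'(1)] e[of "rp P'"] P'(1) by (simp add: evG Y_def)
      qed (rule KA)
      ultimately show ?thesis using KJ by blast
    qed
  qed
  moreover have "A \<union> Y \<subseteq> X" using A(1) by (auto simp: Y_def)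
  moreover have "card (A \<union> Y) = Suc d * ?m + 1"
    using card_Un_disjoint[OF finA finY disj] A(2) cardY by simp
  ultimately show ?case by blast
qed

lemma generic_indep_on:
  fixes b :: "nat \<Rightarrow> 'k::alg_closed_field ^ 'v"
  assumes "indep_on (Jf b d) A" "2 \<le> CARD('v)"
  shows "generic 2 (\<lambda>b. indep_on (Jf b d) A)"
proof -
  obtain \<Phi> where \<Phi>: "polyfun \<Phi>" "\<Phi> b \<noteq> 0" "\<And>b. \<Phi> b \<noteq> 0 \<Longrightarrow> indep_on (Jf b d) A"
    using indep_on_open[OF assms(1)] by blast
  show ?thesis by (rule generic_mono[OF generic_nonzero[OF \<Phi>(1,2) assms(2)]]) (rule \<Phi>(3))
qed

text \<open>The linear span of \<open>X\<close> contains \<open>U \<inter> X\<close>, so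
  independence of \<open>U\<close> bounds it by the \<open>lin_bound\<close> of the span, and
  \<open>irreducible_rank\<close> shows that \<open>X\<close> itself imposes at least that many
  conditions.\<close>

lemma quot_dim_irreducible:
  fixes X :: "('k::alg_closed_field ^ 'v) set set"
  assumes X: "irreducible_subvariety X" and d: "d \<ge> 1" and U: "C_indep d U" and v: "2 \<le> CARD('v)"
  shows "generic 2 (\<lambda>b. card (U \<inter> X) \<le> quot_dim (Jf b d) (vanishing_ideal X \<inter> Jf b d))"
proof -
  have XP: "X \<subseteq> proj_points" using X zariski_closed_points by (auto simp: irreducible_subvariety_def)
  obtain P0 where P0: "P0 \<in> X" using X by (auto simp: irreducible_subvariety_def)
  let ?W = "vec.span (rp ` X)"
  obtain b :: "nat \<Rightarrow> 'k ^ 'v" and A where A: "A \<subseteq> X" "card A = d * (vec.dim (rp ` X) - 1) + 1" "indep_on (Jf b d) A"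
    using irreducible_rank[OF X d] by blast
  have "rp P0 \<in> ?W" "rp P0 \<noteq> 0" using P0 XP rp by (auto intro: vec.span_base)
  then have "?W \<noteq> {0}" by blast
  then have "card (U \<inter> proj_set ?W) \<le> lin_bound d ?W" using U unfolding C_indep_def by simp
  moreover have "U \<inter> X \<subseteq> U \<inter> proj_set ?W"
    using proj_set_iff[of ?W] XP by (auto intro: vec.span_base)
  then have "card (U \<inter> X) \<le> card (U \<inter> proj_set ?W)" using U by (intro card_mono) (auto simp: C_indep_def)
  ultimately have le: "card (U \<inter> X) \<le> card A" using A(2) by (simp add: lin_bound_def)
  show ?thesis
  proof (rule generic_mono[OF generic_indep_on[OF A(3) v]])
    fix b :: "nat \<Rightarrow> 'k ^ 'v" assume "indep_on (Jf b d) A"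
    then show "card (U \<inter> X) \<le> quot_dim (Jf b d) (vanishing_ideal X \<inter> Jf b d)"
      using quot_dim_basis[OF subspace_Jf Jf_subset_hom_part XP, of b d] A(1) le by (metis order_trans)
  qed
qed

section \<open>Twisted global sections\<close>

text \<open>The bound is an integer: a negative one forces the zero polynomial, as for a twist
  without sections.\<close>

definition degle :: "'k::comm_ring_1 poly \<Rightarrow> int \<Rightarrow> bool" where
  "degle p k \<longleftrightarrow> (\<forall>i. coeff p i \<noteq> 0 \<longrightarrow> int i \<le> k)"

lemma degle_0 [simp]: "degle 0 k"
  by (simp add: degle_def)

lemma degle_add: "degle p k \<Longrightarrow> degle q k \<Longrightarrow> degle (p + q) k"
  unfolding degle_def by (metis add.right_neutral add_0 coeff_add)

lemma degle_smult: "degle p k \<Longrightarrow> degle (smult c p) k"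
  unfolding degle_def coeff_smult by (metis mult_zero_right)

lemma degle_mono: "degle p k \<Longrightarrow> k \<le> l \<Longrightarrow> degle p l"
  unfolding degle_def by force

lemma degle_mult:
  assumes "degle p k" "degle q l"
  shows "degle (p * q) (k + l)"
  unfolding degle_def
proof (intro allI impI)
  fix i assume "coeff (p * q) i \<noteq> 0"
  then obtain j where "j \<le> i" "coeff p j * coeff q (i - j) \<noteq> 0"
    unfolding coeff_mult by (meson atMost_iff sum.not_neutral_contains_not_neutral)
  moreover from this have "coeff p j \<noteq> 0" "coeff q (i - j) \<noteq> 0" by auto
  ultimately have "int j \<le> k" "int (i - j) \<le> l" using assms unfolding degle_def by blast+
  then show "int i \<le> k + l" using \<open>j \<le> i\<close> by linarith
qed

lemma degle_nat: "degle p (int k) \<longleftrightarrow> degree p \<le> k"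
proof
  assume d: "degle p (int k)"
  show "degree p \<le> k"
  proof (rule degree_le, intro allI impI)
    fix i assume i: "k < i"
    show "coeff p i = 0"
    proof (rule ccontr)
      assume "coeff p i \<noteq> 0"
      then have "int i \<le> int k" using d unfolding degle_def by blast
      then show False using i by simp
    qed
  qed
next
  assume d: "degree p \<le> k"
  show "degle p (int k)" unfolding degle_def
  proof (intro allI impI)
    fix i assume "coeff p i \<noteq> 0"
    then have "i \<le> degree p" by (rule le_degree)
    then show "int i \<le> int k" using d by simp
  qed
qed

lemma degle_monom_mult_iff: "degle (monom 1 e * p) (int e + k) \<longleftrightarrow> degle p k"
proof
  assume d: "degle (monom 1 e * p) (int e + k)"
  show "degle p k" unfolding degle_def
  proof (intro allI impI)
    fix i assume "coeff p i \<noteq> 0"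
    then have "coeff (monom 1 e * p) (e + i) \<noteq> 0" by (simp add: coeff_monom_mult)
    then have "int (e + i) \<le> int e + k" using d unfolding degle_def by blast
    then show "int i \<le> k" by simp
  qed
next
  assume "degle p k"
  moreover have "degle (monom 1 e :: 'a poly) (int e)" by (simp add: degle_nat degree_monom_le)
  ultimately show "degle (monom 1 e * p) (int e + k)" by (rule degle_mult[rotated])
qed

section \<open>Localisations of graded modules and their operations\<close>

lemma smul_simps:
  "smul r (m + m') = smul r m + smul r m'" "smul r (m - m') = smul r m - smul r m'"
  "smul r (smul s m) = smul (r * s) m" "smul (1 :: 's::comm_ring_1) m = m"
  by (simp_all add: smul_def fun_eq_iff algebra_simps)

locale graded_pres =
  fixes M :: "int \<Rightarrow> ('x \<Rightarrow> ('v::finite, 'k::field) mpoly) set" and N :: "('x \<Rightarrow> ('v, 'k) mpoly) set"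
  assumes M_add: "m \<in> M j \<Longrightarrow> m' \<in> M j \<Longrightarrow> m + m' \<in> M j"
    and M_smul: "r \<in> hom_part i \<Longrightarrow> m \<in> M j \<Longrightarrow> smul r m \<in> M (i + j)"
    and N_subspace: "fun_mod.subspace N"
begin

lemma M_diff: "m \<in> M j \<Longrightarrow> m' \<in> M j \<Longrightarrow> m - m' \<in> M j"
proof -
  assume m: "m \<in> M j" "m' \<in> M j"
  have "smul (Const (- 1)) m' \<in> M j" using M_smul[OF hom_part_Const m(2)] by simp
  moreover have "m - m' = m + smul (Const (- 1)) m'" by (simp add: smul_def Const_minus fun_eq_iff)
  ultimately show ?thesis using M_add[OF m(1)] by metis
qed

lemma N_add: "m \<in> N \<Longrightarrow> m' \<in> N \<Longrightarrow> m + m' \<in> N"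
  and N_smul: "m \<in> N \<Longrightarrow> smul r m \<in> N" and N_0: "0 \<in> N"
  using N_subspace fun_mod.subspace_add fun_mod.subspace_scale fun_mod.subspace_0 by blast+

lemma fracs_smul:
  assumes "(m, k) \<in> fracs M e" "r \<in> hom_part (int (l * e))"
  shows "(smul r m, l + k) \<in> fracs M e"
  using M_smul[OF assms(2), of m "int (k * e)"] assms(1) by (simp add: fracs_def distrib_right)

lemma power_hom: "f \<in> hom_part (int e) \<Longrightarrow> f ^ k \<in> hom_part (int (k * e))"
  using hom_part_power[of f "int e" k] by simp

lemma frac_eq_refl: "x \<in> fracs M e \<Longrightarrow> (x, x) \<in> frac_eq M N e f"
  unfolding frac_eq_def using N_0 by (auto simp: smul_def zero_fun_def intro!: exI[of _ 0])

lemma frac_eqI: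
  "(m, k) \<in> fracs M e \<Longrightarrow> (m', k') \<in> fracs M e \<Longrightarrow>
    smul (f ^ j) (smul (f ^ k') m - smul (f ^ k) m') \<in> N \<Longrightarrow> ((m, k), (m', k')) \<in> frac_eq M N e f"
  unfolding frac_eq_def by blast

lemma frac_eqE:
  assumes "((m, k), (m', k')) \<in> frac_eq M N e f"
  obtains j where "(m, k) \<in> fracs M e" "(m', k') \<in> fracs M e"
    "smul (f ^ j) (smul (f ^ k') m - smul (f ^ k) m') \<in> N"
  using assms unfolding frac_eq_def by blast

lemma N_cong: "m \<in> N \<Longrightarrow> m = m' \<Longrightarrow> m' \<in> N"
  by simp

lemma equiv_frac_eq: "equiv (fracs M e) (frac_eq M N e f)"
proof (rule equivI)
  show "frac_eq M N e f \<subseteq> fracs M e \<times> fracs M e" unfolding frac_eq_def by auto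
  show "refl_on (fracs M e) (frac_eq M N e f)"
    by (rule refl_onI) (use frac_eq_refl in auto)
  show "sym (frac_eq M N e f)"
  proof (rule symI)
    fix x y assume xy: "(x, y) \<in> frac_eq M N e f"
    obtain m k m' k' where x: "x = (m, k)" "y = (m', k')" by (cases x, cases y)
    obtain j where j: "(m, k) \<in> fracs M e" "(m', k') \<in> fracs M e"
      "smul (f ^ j) (smul (f ^ k') m - smul (f ^ k) m') \<in> N" using xy unfolding x by (rule frac_eqE)
    have "smul (- 1) (smul (f ^ j) (smul (f ^ k') m - smul (f ^ k) m')) \<in> N" by (rule N_smul[OF j(3)])
    then have "smul (f ^ j) (smul (f ^ k) m' - smul (f ^ k') m) \<in> N"
      by (rule N_cong) (simp add: smul_def fun_eq_iff algebra_simps)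
    then show "(y, x) \<in> frac_eq M N e f" unfolding x by (rule frac_eqI[OF j(2,1)])
  qed
  show "trans (frac_eq M N e f)"
  proof (rule transI)
    fix x y z assume xy: "(x, y) \<in> frac_eq M N e f" and yz: "(y, z) \<in> frac_eq M N e f"
    obtain m k m' k' m'' k'' where x: "x = (m, k)" "y = (m', k')" "z = (m'', k'')" by (cases x, cases y, cases z)
    obtain j where j: "(m, k) \<in> fracs M e" "(m', k') \<in> fracs M e"
      "smul (f ^ j) (smul (f ^ k') m - smul (f ^ k) m') \<in> N" using xy unfolding x by (rule frac_eqE)
    obtain i where i: "(m', k') \<in> fracs M e" "(m'', k'') \<in> fracs M e"
      "smul (f ^ i) (smul (f ^ k'') m' - smul (f ^ k') m'') \<in> N" using yz unfolding x by (rule frac_eqE)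
    have "smul (f ^ (i + k'')) (smul (f ^ j) (smul (f ^ k') m - smul (f ^ k) m')) +
        smul (f ^ (j + k)) (smul (f ^ i) (smul (f ^ k'') m' - smul (f ^ k') m'')) \<in> N"
      by (intro N_add N_smul j i)
    then have "smul (f ^ (i + j + k')) (smul (f ^ k'') m - smul (f ^ k) m'') \<in> N"
      by (rule N_cong) (simp add: smul_def fun_eq_iff algebra_simps power_add)
    then show "(x, z) \<in> frac_eq M N e f" unfolding x by (rule frac_eqI[OF j(1) i(2)])
  qed
qed

abbreviation cls :: "nat \<Rightarrow> ('v, 'k) mpoly \<Rightarrow> ('x \<Rightarrow> ('v, 'k) mpoly) \<times> nat \<Rightarrow> (('x \<Rightarrow> ('v, 'k) mpoly) \<times> nat) set" where
  "cls e f x \<equiv> frac_eq M N e f `` {x}"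

lemma cls_eq_iff:
  assumes "(m, k) \<in> fracs M e" "(m', k') \<in> fracs M e"
  shows "cls e f (m, k) = cls e f (m', k') \<longleftrightarrow> (\<exists>j. smul (f ^ j) (smul (f ^ k') m - smul (f ^ k) m') \<in> N)"
  using eq_equiv_class_iff[OF equiv_frac_eq assms] assms by (auto simp: frac_eq_def)

lemma sectionsE:
  assumes "s \<in> sections M N e f"
  obtains m k where "(m, k) \<in> fracs M e" "s = cls e f (m, k)"
  using assms unfolding sections_def by (metis prod.collapse quotientE)

lemma cls_sections: "x \<in> fracs M e \<Longrightarrow> cls e f x \<in> sections M N e f"
  unfolding sections_def by (rule quotientI)

text \<open>Operations on classes are unions over representatives; once the choice of representative
  is irrelevant, such a union is any one of its members.\<close>

lemma UN_const_cls:
  assumes x: "x \<in> fracs M e" and g: "\<And>y. (x, y) \<in> frac_eq M N e f \<Longrightarrow> g y = S"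
  shows "(\<Union>y\<in>cls e f x. g y) = S"
  using g frac_eq_refl[OF x] by blast

lemma sec_restrict_cls:
  assumes f: "f \<in> hom_part (int e)" and g: "g \<in> hom_part (int e')" and mk: "(m, k) \<in> fracs M e"
  shows "(smul (g ^ k) m, k) \<in> fracs M (e + e')"
    "sec_restrict M N e f e' g (cls e f (m, k)) = cls (e + e') (f * g) (smul (g ^ k) m, k)"
proof -
  have fr: "(smul (g ^ k) m, k) \<in> fracs M (e + e')" if "(m, k) \<in> fracs M e" for m k
    using M_smul[OF power_hom[OF g, of k], of m "int (k * e)"] that by (simp add: fracs_def algebra_simps)
  show "(smul (g ^ k) m, k) \<in> fracs M (e + e')" by (rule fr[OF mk])
  show "sec_restrict M N e f e' g (cls e f (m, k)) = cls (e + e') (f * g) (smul (g ^ k) m, k)"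
    unfolding sec_restrict_def
  proof (rule UN_const_cls[OF mk])
    fix y assume y: "((m, k), y) \<in> frac_eq M N e f"
    obtain m1 k1 where y': "y = (m1, k1)" by (cases y)
    obtain j where j: "(m1, k1) \<in> fracs M e" "smul (f ^ j) (smul (f ^ k1) m - smul (f ^ k) m1) \<in> N"
      using y unfolding y' by (blast elim: frac_eqE)
    have "smul (g ^ (j + k + k1)) (smul (f ^ j) (smul (f ^ k1) m - smul (f ^ k) m1)) \<in> N" by (rule N_smul[OF j(2)])
    then have "smul ((f * g) ^ j) (smul ((f * g) ^ k1) (smul (g ^ k) m) - smul ((f * g) ^ k) (smul (g ^ k1) m1)) \<in> N"
      by (rule N_cong) (simp add: smul_def fun_eq_iff algebra_simps power_add power_mult_distrib)
    then have "cls (e + e') (f * g) (smul (g ^ k) m, k) = cls (e + e') (f * g) (smul (g ^ k1) m1, k1)"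
      using cls_eq_iff[OF fr[OF mk] fr[OF j(1)]] by blast
    then show "(case y of (m, k) \<Rightarrow> cls (e + e') (f * g) (smul (g ^ k) m, k)) = cls (e + e') (f * g) (smul (g ^ k) m, k)"
      by (simp add: y')
  qed
qed

lemma sec_scale_cls:
  assumes f: "f \<in> hom_part (int e)" and r: "r \<in> hom_part (int (l * e))" and mk: "(m, k) \<in> fracs M e"
  shows "sec_scale M N e f r l (cls e f (m, k)) = cls e f (smul r m, l + k)"
  unfolding sec_scale_def
proof (rule UN_const_cls[OF mk])
  fix y assume y: "((m, k), y) \<in> frac_eq M N e f"
  obtain m1 k1 where y': "y = (m1, k1)" by (cases y)
  obtain j where j: "(m1, k1) \<in> fracs M e" "smul (f ^ j) (smul (f ^ k1) m - smul (f ^ k) m1) \<in> N"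
    using y unfolding y' by (blast elim: frac_eqE)
  have "smul (f ^ l * r) (smul (f ^ j) (smul (f ^ k1) m - smul (f ^ k) m1)) \<in> N" by (rule N_smul[OF j(2)])
  then have "smul (f ^ j) (smul (f ^ (l + k1)) (smul r m) - smul (f ^ (l + k)) (smul r m1)) \<in> N"
    by (rule N_cong) (simp add: smul_def fun_eq_iff algebra_simps power_add)
  then have "cls e f (smul r m, l + k) = cls e f (smul r m1, l + k1)"
    using cls_eq_iff[OF fracs_smul[OF mk r] fracs_smul[OF j(1) r]] by blast
  then show "(case y of (m, k) \<Rightarrow> cls e f (smul r m, l + k)) = cls e f (smul r m, l + k)"
    by (simp add: y')
qed

lemma sec_add_cls:
  assumes f: "f \<in> hom_part (int e)" and mk: "(m, k) \<in> fracs M e" and mk': "(m', k') \<in> fracs M e"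
  shows "(smul (f ^ k') m + smul (f ^ k) m', k + k') \<in> fracs M e"
    "sec_add M N e f (cls e f (m, k)) (cls e f (m', k')) = cls e f (smul (f ^ k') m + smul (f ^ k) m', k + k')"
proof -
  have fr: "(smul (f ^ k') m + smul (f ^ k) m', k + k') \<in> fracs M e"
    if "(m, k) \<in> fracs M e" "(m', k') \<in> fracs M e" for m k m' k'
    using fracs_smul[OF that(1) power_hom[OF f, of k']] fracs_smul[OF that(2) power_hom[OF f, of k]] M_add
    by (simp add: fracs_def algebra_simps)
  show "(smul (f ^ k') m + smul (f ^ k) m', k + k') \<in> fracs M e" by (rule fr[OF mk mk'])
  let ?S = "cls e f (smul (f ^ k') m + smul (f ^ k) m', k + k')"
  have cong: "cls e f (smul (f ^ k1') m1 + smul (f ^ k1) m1', k1 + k1') = ?S"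
    if rel: "((m, k), (m1, k1)) \<in> frac_eq M N e f" "((m', k'), (m1', k1')) \<in> frac_eq M N e f" for m1 k1 m1' k1'
  proof -
    obtain j where j: "(m1, k1) \<in> fracs M e" "smul (f ^ j) (smul (f ^ k1) m - smul (f ^ k) m1) \<in> N"
      using rel(1) by (blast elim: frac_eqE)
    obtain i where i: "(m1', k1') \<in> fracs M e" "smul (f ^ i) (smul (f ^ k1') m' - smul (f ^ k') m1') \<in> N"
      using rel(2) by (blast elim: frac_eqE)
    have "smul (f ^ (i + k' + k1')) (smul (f ^ j) (smul (f ^ k1) m - smul (f ^ k) m1)) +
        smul (f ^ (j + k + k1)) (smul (f ^ i) (smul (f ^ k1') m' - smul (f ^ k') m1')) \<in> N"
      by (intro N_add N_smul j i)
    then have "smul (f ^ (i + j)) (smul (f ^ (k1 + k1')) (smul (f ^ k') m + smul (f ^ k) m') -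
        smul (f ^ (k + k')) (smul (f ^ k1') m1 + smul (f ^ k1) m1')) \<in> N"
      by (rule N_cong) (simp add: smul_def fun_eq_iff algebra_simps power_add)
    then show ?thesis using cls_eq_iff[OF fr[OF mk mk'] fr[OF j(1) i(1)]] by blast
  qed
  have in1: "(\<Union>(m1', k1')\<in>cls e f (m', k'). cls e f (smul (f ^ k1') m1 + smul (f ^ k1) m1', k1 + k1')) = ?S"
    if rel1: "((m, k), (m1, k1)) \<in> frac_eq M N e f" for m1 k1
  proof (rule UN_const_cls[OF mk'])
    fix y assume y: "((m', k'), y) \<in> frac_eq M N e f"
    obtain m2 k2 where y': "y = (m2, k2)" by (cases y)
    show "(case y of (m1', k1') \<Rightarrow> cls e f (smul (f ^ k1') m1 + smul (f ^ k1) m1', k1 + k1')) = ?S"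
      unfolding y' prod.case by (rule cong[OF rel1 y[unfolded y']])
  qed
  show "sec_add M N e f (cls e f (m, k)) (cls e f (m', k')) = ?S"
    unfolding sec_add_def
  proof (rule UN_const_cls[OF mk])
    fix y assume y: "((m, k), y) \<in> frac_eq M N e f"
    obtain m2 k2 where y': "y = (m2, k2)" by (cases y)
    show "(case y of (m1, k1) \<Rightarrow> \<Union>(m1', k1')\<in>cls e f (m', k'). cls e f (smul (f ^ k1') m1 + smul (f ^ k1) m1', k1 + k1')) = ?S"
      unfolding y' prod.case by (rule in1[OF y[unfolded y']])
  qed
qed

end

text \<open>In the models of this locale, \<open>U\<close> and \<open>V\<close> are linear forms restricting to coordinates
  of the line \<open>L\<close>, and \<open>res\<close> is restriction to \<open>L\<close> followed by \<open>U = 1\<close>. The sections on \<open>D\<^sub>+(U)\<close>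
  are \<open>Bd\<close> modulo the multiples of \<open>eps\<close>.\<close>

locale sheaf_model = graded_pres M N
  for M :: "int \<Rightarrow> ('x \<Rightarrow> ('v::finite, 'k::field) mpoly) set" and N +
  fixes U V :: "('v, 'k) mpoly" and res :: "('v, 'k) mpoly \<Rightarrow> 'k poly"
    and \<rho> :: "('x \<Rightarrow> ('v, 'k) mpoly) \<Rightarrow> 'y \<Rightarrow> 'k poly"
    and a :: "'y \<Rightarrow> int" and Bd :: "('y \<Rightarrow> 'k poly) set" and eps :: "'y \<Rightarrow> 'k poly" and N0 :: nat
  assumes U: "U \<in> hom_part 1" and V: "V \<in> hom_part 1"
    and res_mult: "res (f * g) = res f * res g" and res_U: "res U = 1" and res_V: "res V = [:0, 1:]"
    and res_Const: "res (Const c) = [:c:]"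
    and rho_add: "\<rho> (m + m') y = \<rho> m y + \<rho> m' y" and rho_smul: "\<rho> (smul r m) y = res r * \<rho> m y"
    and rho_deg: "m \<in> M (int k) \<Longrightarrow> degle (\<rho> m y) (int k - a y)"
    and rho_Bd: "m \<in> M (int k) \<Longrightarrow> \<rho> m \<in> Bd"
    and N_I: "m \<in> M (int k) \<Longrightarrow> \<forall>y. \<rho> m y = q * eps y \<Longrightarrow> smul (U ^ N0) m \<in> N \<and> smul (V ^ N0) m \<in> N"
    and N_D: "m \<in> N \<Longrightarrow> \<exists>q. \<forall>y. \<rho> m y = q * eps y"
    and lift: "p \<in> Bd \<Longrightarrow> \<forall>y. degle (p y) (int k - a y) \<Longrightarrow>
      (\<exists>m\<in>M (int (k + N0)). \<rho> m = p) \<and> (\<exists>m\<in>M (int (k + N0)). \<forall>y. \<rho> m y = monom 1 N0 * p y)"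
    and eps_deg: "degle (eps y) (1 - a y)"
    and Bd_add: "p \<in> Bd \<Longrightarrow> p' \<in> Bd \<Longrightarrow> (\<lambda>y. p y + p' y) \<in> Bd"
    and Bd_mult: "p \<in> Bd \<Longrightarrow> (\<lambda>y. q * p y) \<in> Bd"
    and Bd_eps: "eps \<in> Bd"
begin

lemma res_1: "res 1 = 1"
  using res_Const[of 1] by simp

lemma res_U_power: "res (U ^ k) = 1"
  by (induction k) (simp_all add: res_1 res_mult res_U)

lemma res_V_power: "res (V ^ k) = monom 1 k"
  by (induction k) (simp_all add: res_1 res_mult res_V monom_Suc)

lemma rho_diff: "\<rho> (m - m') y = \<rho> m y - \<rho> m' y"
proof -
  have "\<rho> m y = \<rho> (m - m' + m') y" by simp
  then show ?thesis unfolding rho_add by simp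
qed

lemma fracs_1: "(m, k) \<in> fracs M 1 \<longleftrightarrow> m \<in> M (int k)"
  by (simp add: fracs_def)

lemma U1: "U \<in> hom_part (int 1)" and V1: "V \<in> hom_part (int 1)"
  using U V by simp_all

lemma UV: "U * V \<in> hom_part (int (1 + 1))"
  using hom_part_mult[OF U V] by simp

text \<open>\<open>p\<close> is the fraction \<open>m / U ^ k\<close> after setting
  \<open>U = 1\<close>, determined up to multiples of \<open>eps\<close>.\<close>

definition value_of :: "(('x \<Rightarrow> ('v, 'k) mpoly) \<times> nat) set \<Rightarrow> ('y \<Rightarrow> 'k poly) \<Rightarrow> bool" where
  "value_of s p \<longleftrightarrow> (\<exists>m k q. m \<in> M (int k) \<and> s = cls 1 U (m, k) \<and> (\<forall>y. \<rho> m y - p y = q * eps y))"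

text \<open>The global sections of the \<open>j\<close>-th twist, dehomogenised by
  \<open>U = 1\<close> and before multiples of \<open>eps\<close> are divided out.\<close>

definition T :: "nat \<Rightarrow> ('y \<Rightarrow> 'k poly) set" where
  "T j = {p \<in> Bd. \<forall>y. degle (p y) (int j - a y)}"

text \<open>Sections \<open>s\<close> on \<open>D\<^sub>+(U)\<close> and \<open>t\<close> on \<open>D\<^sub>+(V)\<close> with \<open>U\<^sup>j s = V\<^sup>j t\<close> on \<open>D\<^sub>+(U V)\<close>, that is, global
  sections of the \<open>j\<close>-th twist.\<close>

definition glue :: "nat \<Rightarrow> (('x \<Rightarrow> ('v, 'k) mpoly) \<times> nat) set \<Rightarrow> (('x \<Rightarrow> ('v, 'k) mpoly) \<times> nat) set \<Rightarrow> bool" where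
  "glue j s t \<longleftrightarrow> s \<in> sections M N 1 U \<and> t \<in> sections M N 1 V \<and>
    sec_restrict M N 1 U 1 V s = sec_scale M N (1 + 1) (U * V) (V ^ (2 * j)) j (sec_restrict M N 1 V 1 U t)"

lemma value_of_sections: "value_of s p \<Longrightarrow> s \<in> sections M N 1 U"
  unfolding value_of_def by (auto simp: fracs_def intro!: cls_sections)

lemma value_of_unique:
  assumes "value_of s p" "value_of s p'"
  shows "\<exists>q. \<forall>y. p y - p' y = q * eps y"
proof -
  obtain m k q where m: "m \<in> M (int k)" "s = cls 1 U (m, k)" "\<And>y. \<rho> m y - p y = q * eps y"
    using assms(1) unfolding value_of_def by blast
  obtain m' k' q' where m': "m' \<in> M (int k')" "s = cls 1 U (m', k')" "\<And>y. \<rho> m' y - p' y = q' * eps y"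
    using assms(2) unfolding value_of_def by blast
  obtain j where "smul (U ^ j) (smul (U ^ k') m - smul (U ^ k) m') \<in> N"
    using cls_eq_iff[of m k 1 m' k' U] m m' fracs_1 by auto
  from N_D[OF this] obtain q'' where "\<And>y. \<rho> m y - \<rho> m' y = q'' * eps y"
    by (auto simp: rho_smul rho_diff res_U_power)
  then have "p y - p' y = (q'' - q + q') * eps y" for y
    using m(3)[of y] m'(3)[of y] by (simp add: algebra_simps)
  then show ?thesis by blast
qed

lemma value_of_inj:
  assumes "value_of s p" "value_of s' p'" "\<forall>y. p y - p' y = r * eps y"
  shows "s = s'"
proof -
  obtain m k q where m: "m \<in> M (int k)" "s = cls 1 U (m, k)" "\<And>y. \<rho> m y - p y = q * eps y"
    using assms(1) unfolding value_of_def by blast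
  obtain m' k' q' where m': "m' \<in> M (int k')" "s' = cls 1 U (m', k')" "\<And>y. \<rho> m' y - p' y = q' * eps y"
    using assms(2) unfolding value_of_def by blast
  let ?d = "smul (U ^ k') m - smul (U ^ k) m'"
  have "smul (U ^ k') m \<in> M (int (k + k'))" "smul (U ^ k) m' \<in> M (int (k + k'))"
    using M_smul[OF hom_part_power1[OF U] m(1), of k'] M_smul[OF hom_part_power1[OF U] m'(1), of k] by (simp_all add: add.commute)
  then have d: "?d \<in> M (int (k + k'))" by (rule M_diff)
  have "\<rho> ?d y = (q - q' + r) * eps y" for y
    using m(3)[of y] m'(3)[of y] assms(3) by (simp add: rho_diff rho_smul res_U_power algebra_simps)
  then have "smul (U ^ N0) ?d \<in> N" using N_I[OF d] by blast
  then show ?thesis using cls_eq_iff[of m k 1 m' k' U] m m' fracs_1 by auto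
qed

lemma value_of_add:
  assumes "value_of s p" "value_of s' p'"
  shows "value_of (sec_add M N 1 U s s') (\<lambda>y. p y + p' y)"
proof -
  obtain m k q where m: "m \<in> M (int k)" "s = cls 1 U (m, k)" "\<And>y. \<rho> m y - p y = q * eps y"
    using assms(1) unfolding value_of_def by blast
  obtain m' k' q' where m': "m' \<in> M (int k')" "s' = cls 1 U (m', k')" "\<And>y. \<rho> m' y - p' y = q' * eps y"
    using assms(2) unfolding value_of_def by blast
  let ?d = "smul (U ^ k') m + smul (U ^ k) m'"
  have mk: "(m, k) \<in> fracs M 1" "(m', k') \<in> fracs M 1" using m m' fracs_1 by auto
  have "?d \<in> M (int (k + k'))" using sec_add_cls(1)[OF U1 mk] fracs_1 by blast
  moreover have "sec_add M N 1 U s s' = cls 1 U (?d, k + k')" using sec_add_cls(2)[OF U1 mk] m(2) m'(2) by simp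
  moreover have "\<rho> ?d y - (p y + p' y) = (q + q') * eps y" for y
  proof -
    have "\<rho> ?d y - (p y + p' y) = (\<rho> m y - p y) + (\<rho> m' y - p' y)" by (simp add: rho_add rho_smul res_U_power)
    then show ?thesis using m(3) m'(3) by (simp add: distrib_right)
  qed
  ultimately show ?thesis unfolding value_of_def by blast
qed

lemma value_of_scale:
  assumes "value_of s p"
  shows "value_of (sec_scale M N 1 U (Const c) 0 s) (\<lambda>y. smult c (p y))"
proof -
  obtain m k q where m: "m \<in> M (int k)" "s = cls 1 U (m, k)" "\<And>y. \<rho> m y - p y = q * eps y"
    using assms(1) unfolding value_of_def by blast
  have mk: "(m, k) \<in> fracs M 1" using m fracs_1 by auto
  have c: "Const c \<in> hom_part (int (0 * 1))" using hom_part_Const by simp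
  have "smul (Const c) m \<in> M (int k)" using M_smul[OF hom_part_Const m(1)] by simp
  moreover have "sec_scale M N 1 U (Const c) 0 s = cls 1 U (smul (Const c) m, k)"
    using sec_scale_cls[OF U1 c mk] m(2) by simp
  moreover have "\<rho> (smul (Const c) m) y - smult c (p y) = smult c q * eps y" for y
    using m(3)[of y] by (simp add: rho_smul res_Const flip: smult_diff_right)
  ultimately show ?thesis unfolding value_of_def by blast
qed

text \<open>With \<open>K = j + N0\<close>, the lift of \<open>p\<close> over \<open>U ^ K\<close>
  and the lift of \<open>monom 1 N0 * p\<close> over \<open>V ^ K\<close> give the two local
  sections: the surplus factor cancels against the denominator and leaves exactly the j-th power
  required by the twist.\<close>

lemma T_glue:
  assumes p: "p \<in> T j"
  shows "\<exists>s t. value_of s p \<and> glue j s t"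
proof -
  define K where "K = j + N0"
  obtain m where m: "m \<in> M (int K)" "\<rho> m = p" using lift p unfolding T_def K_def by blast
  obtain m' where m': "m' \<in> M (int K)" "\<And>y. \<rho> m' y = monom 1 N0 * p y" using lift p unfolding T_def K_def by blast
  have mk: "(m, K) \<in> fracs M 1" "(m', K) \<in> fracs M 1" using m m' fracs_1 by auto
  let ?s = "cls 1 U (m, K)" and ?t = "cls 1 V (m', K)"
  have V2: "V ^ (2 * j) \<in> hom_part (int (j * (1 + 1)))" using hom_part_power1[OF V, of "2 * j"] by (simp add: mult.commute)
  have rs: "(smul (V ^ K) m, K) \<in> fracs M (1 + 1)"
    "sec_restrict M N 1 U 1 V ?s = cls (1 + 1) (U * V) (smul (V ^ K) m, K)"
    using sec_restrict_cls[OF U1 V1 mk(1)] by blast+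
  have rt: "(smul (U ^ K) m', K) \<in> fracs M (1 + 1)"
    "sec_restrict M N 1 V 1 U ?t = cls (1 + 1) (U * V) (smul (U ^ K) m', K)"
    using sec_restrict_cls[OF V1 U1 mk(2)] by (simp_all only: mult.commute[of V U])
  have rt2: "(smul (V ^ (2 * j)) (smul (U ^ K) m'), j + K) \<in> fracs M (1 + 1)"
    "sec_scale M N (1 + 1) (U * V) (V ^ (2 * j)) j (sec_restrict M N 1 V 1 U ?t) =
      cls (1 + 1) (U * V) (smul (V ^ (2 * j)) (smul (U ^ K) m'), j + K)"
    using fracs_smul[OF rt(1) V2] sec_scale_cls[OF UV V2 rt(1)] rt(2) by simp_all
  let ?d = "smul ((U * V) ^ (j + K)) (smul (V ^ K) m) - smul ((U * V) ^ K) (smul (V ^ (2 * j)) (smul (U ^ K) m'))"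
  have "?d \<in> M (int (2 * j + 4 * K))"
  proof (rule M_diff)
    have "U ^ (j + K) * V ^ (j + K + K) \<in> hom_part (int (2 * j + 3 * K))"
      using hom_part_mult[OF hom_part_power1[OF U] hom_part_power1[OF V], of "j + K" "j + K + K"] by (simp add: algebra_simps)
    from M_smul[OF this m(1)] have "smul (U ^ (j + K) * V ^ (j + K + K)) m \<in> M (int (2 * j + 4 * K))" by (simp add: add.commute)
    then show "smul ((U * V) ^ (j + K)) (smul (V ^ K) m) \<in> M (int (2 * j + 4 * K))"
      by (simp only: smul_simps(3) power_mult_distrib power_add mult_ac)
    have "U ^ (K + K) * V ^ (K + 2 * j) \<in> hom_part (int (2 * j + 3 * K))"
      using hom_part_mult[OF hom_part_power1[OF U] hom_part_power1[OF V], of "K + K" "K + 2 * j"] by (simp add: algebra_simps)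
    from M_smul[OF this m'(1)] have "smul (U ^ (K + K) * V ^ (K + 2 * j)) m' \<in> M (int (2 * j + 4 * K))" by (simp add: add.commute)
    then show "smul ((U * V) ^ K) (smul (V ^ (2 * j)) (smul (U ^ K) m')) \<in> M (int (2 * j + 4 * K))"
      by (simp only: smul_simps(3) power_mult_distrib power_add mult_ac)
  qed
  moreover have "\<rho> ?d y = 0 * eps y" for y
  proof -
    have "\<rho> ?d y = monom 1 (j + K) * (monom 1 K * p y) - monom 1 K * (monom 1 (2 * j) * (monom 1 N0 * p y))"
      by (simp add: rho_diff rho_smul res_mult power_mult_distrib res_U_power res_V_power m(2) m'(2))
    then show ?thesis by (simp add: mult.assoc[symmetric] mult_monom K_def mult_2 add_ac)
  qed
  ultimately have "smul (V ^ N0) ?d \<in> N" using N_I by blast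
  then have "smul (U ^ N0) (smul (V ^ N0) ?d) \<in> N" by (rule N_smul)
  then have "smul ((U * V) ^ N0) ?d \<in> N" by (simp only: smul_simps(3) power_mult_distrib)
  then have "glue j ?s ?t" unfolding glue_def rs(2) rt2(2) cls_eq_iff[OF rs(1) rt2(1)]
    using cls_sections mk by blast
  moreover have "value_of ?s p" unfolding value_of_def using m by (intro exI[of _ m] exI[of _ K] exI[of _ 0]) auto
  ultimately show ?thesis by blast
qed

text \<open>A section on the chart of \<open>U\<close> has arbitrarily large degree; the bound is
  inherited from its partner on the chart of \<open>V\<close> through the gluing relation.\<close>

lemma glue_T:
  assumes g: "glue j s t"
  shows "\<exists>p\<in>T j. value_of s p"
proof -
  obtain m k where m: "(m, k) \<in> fracs M 1" "s = cls 1 U (m, k)" using g unfolding glue_def by (metis sectionsE)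
  obtain m' k' where m': "(m', k') \<in> fracs M 1" "t = cls 1 V (m', k')" using g unfolding glue_def by (metis sectionsE)
  have mM: "m \<in> M (int k)" "m' \<in> M (int k')" using m m' fracs_1 by auto
  have V2: "V ^ (2 * j) \<in> hom_part (int (j * (1 + 1)))" using hom_part_power1[OF V, of "2 * j"] by (simp add: mult.commute)
  have rs: "(smul (V ^ k) m, k) \<in> fracs M (1 + 1)"
    "sec_restrict M N 1 U 1 V s = cls (1 + 1) (U * V) (smul (V ^ k) m, k)"
    using sec_restrict_cls[OF U1 V1 m(1)] m(2) by simp_all
  have rt: "(smul (U ^ k') m', k') \<in> fracs M (1 + 1)"
    "sec_restrict M N 1 V 1 U t = cls (1 + 1) (U * V) (smul (U ^ k') m', k')"
    using sec_restrict_cls[OF V1 U1 m'(1)] m'(2) by (simp_all only: mult.commute[of V U])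
  have rt2: "(smul (V ^ (2 * j)) (smul (U ^ k') m'), j + k') \<in> fracs M (1 + 1)"
    "sec_scale M N (1 + 1) (U * V) (V ^ (2 * j)) j (sec_restrict M N 1 V 1 U t) =
      cls (1 + 1) (U * V) (smul (V ^ (2 * j)) (smul (U ^ k') m'), j + k')"
    using fracs_smul[OF rt(1) V2] sec_scale_cls[OF UV V2 rt(1)] rt(2) by simp_all
  obtain i where "smul ((U * V) ^ i) (smul ((U * V) ^ (j + k')) (smul (V ^ k) m) -
      smul ((U * V) ^ k) (smul (V ^ (2 * j)) (smul (U ^ k') m'))) \<in> N"
    using g unfolding glue_def rs(2) rt2(2) cls_eq_iff[OF rs(1) rt2(1)] by blast
  from N_D[OF this] obtain q where q0: "\<And>y. \<rho> (smul ((U * V) ^ i) (smul ((U * V) ^ (j + k')) (smul (V ^ k) m) -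
      smul ((U * V) ^ k) (smul (V ^ (2 * j)) (smul (U ^ k') m')))) y = q * eps y" by blast
  define e1 where "e1 = i + j + k + k'"
  define e2 where "e2 = i + k + 2 * j"
  have q: "monom 1 e1 * \<rho> m y - monom 1 e2 * \<rho> m' y = q * eps y" for y
    using q0[of y] by (simp add: rho_diff rho_smul res_mult power_mult_distrib res_U_power res_V_power e1_def e2_def
        mult.assoc[symmetric] mult_monom right_diff_distrib add_ac)
  \<comment> \<open>The quotient is absorbed into the value of \<open>s\<close>, which is defined
    only modulo \<open>eps\<close>. The remainder has degree below \<open>e1\<close>, and its
    product with \<open>eps y\<close> obeys the required bound.\<close>
  define q1 where "q1 = q div monom 1 e1"
  define r where "r = q mod monom 1 e1"
  have qr: "q = monom 1 e1 * q1 + r" by (simp add: q1_def r_def)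
  have r: "degle r (int e1 - 1)"
  proof (cases "r = 0")
    case False
    have "degree r < degree (monom 1 e1 :: 'k poly)" using degree_mod_less[of "monom 1 e1" q] False by (auto simp: r_def)
    then have "degree r < e1" by (simp add: degree_monom_eq)
    moreover from this have "degle r (int (e1 - 1))" unfolding degle_nat by linarith
    ultimately show ?thesis by (elim degle_mono) simp
  qed simp
  define p where "p y = \<rho> m y - q1 * eps y" for y
  have pe: "monom 1 e1 * p y = monom 1 e2 * \<rho> m' y + r * eps y" for y
    using q[of y] by (simp add: p_def qr algebra_simps)
  have "degle (p y) (int j - a y)" for y
  proof -
    have "degle (monom 1 e2 * \<rho> m' y) (int e2 + (int k' - a y))"
      unfolding degle_monom_mult_iff by (rule rho_deg[OF mM(2)])
    moreover have "int e2 + (int k' - a y) = int e1 + (int j - a y)" by (simp add: e1_def e2_def)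
    moreover have "degle (r * eps y) ((int e1 - 1) + (1 - a y))" by (rule degle_mult[OF r eps_deg])
    then have "degle (r * eps y) (int e1 + (int j - a y))" by (rule degle_mono) simp
    ultimately have "degle (monom 1 e1 * p y) (int e1 + (int j - a y))" unfolding pe by (simp add: degle_add)
    then show ?thesis by (simp only: degle_monom_mult_iff)
  qed
  moreover have "p \<in> Bd"
  proof -
    have "(\<lambda>y. \<rho> m y + (- q1) * eps y) \<in> Bd" by (rule Bd_add[OF rho_Bd[OF mM(1)] Bd_mult[OF Bd_eps]])
    then show ?thesis by (simp add: p_def[abs_def])
  qed
  ultimately have "p \<in> T j" by (simp add: T_def)
  moreover have "value_of s p" unfolding value_of_def
    using mM(1) m(2) by (intro exI[of _ m], intro exI[of _ k], intro exI[of _ q1]) (simp add: p_def)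
  ultimately show ?thesis by blast
qed

lemma T_add: "p \<in> T j \<Longrightarrow> p' \<in> T j \<Longrightarrow> (\<lambda>y. p y + p' y) \<in> T j"
  unfolding T_def using Bd_add degle_add by blast

lemma T_scale: "p \<in> T j \<Longrightarrow> (\<lambda>y. smult c (p y)) \<in> T j"
  unfolding T_def using Bd_mult[of p "[:c:]"] degle_smult by auto

lemma T_0: "(\<lambda>y. 0) \<in> T j"
  unfolding T_def using Bd_mult[OF Bd_eps, of 0] by simp

end

text \<open>Only the isomorphism over the open sets of \<open>U\<close>, \<open>V\<close> and
  \<open>U * V\<close> is used. Compatibility with restriction and scaling makes it preserve glued
  pairs, hence twisted global sections. Values in the second model are exact, those in the first
  only modulo \<open>eps\<close>, which yields the kernel.\<close>

theorem sheaf_iso_twisted_sections: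
  assumes m1: "sheaf_model M N U V res \<rho> a Bd eps N0"
    and m2: "sheaf_model M' N' U V res \<rho>' a' Bd' (\<lambda>_. 0) N0'"
    and iso: "sheaf_iso M N M' N'"
    and T: "T = sheaf_model.T a Bd j" and T': "T' = sheaf_model.T a' Bd' j"
  shows "\<exists>\<Psi>. (\<forall>p\<in>T. \<Psi> p \<in> T') \<and> T' \<subseteq> \<Psi> ` T \<and>
    (\<forall>p\<in>T. \<forall>p'\<in>T. \<Psi> (\<lambda>y. p y + p' y) = (\<lambda>y. \<Psi> p y + \<Psi> p' y)) \<and>
    (\<forall>p\<in>T. \<forall>c. \<Psi> (\<lambda>y. smult c (p y)) = (\<lambda>y. smult c (\<Psi> p y))) \<and>
    (\<forall>p\<in>T. \<Psi> p = (\<lambda>y. 0) \<longleftrightarrow> (\<exists>q. \<forall>y. p y = q * eps y))"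
proof -
  interpret A: sheaf_model M N U V res \<rho> a Bd eps N0 by (rule m1)
  interpret B: sheaf_model M' N' U V res \<rho>' a' Bd' "\<lambda>_. 0" N0' by (rule m2)
  have TA: "T = A.T j" and TB: "T' = B.T j" using T T' by simp_all
  obtain \<phi> where \<phi>: "\<forall>e>0. \<forall>f\<in>hom_part (int e).
     bij_betw (\<phi> e f) (sections M N e f) (sections M' N' e f) \<and>
     (\<forall>s\<in>sections M N e f. \<forall>t\<in>sections M N e f.
        \<phi> e f (sec_add M N e f s t) = sec_add M' N' e f (\<phi> e f s) (\<phi> e f t)) \<and>
     (\<forall>s\<in>sections M N e f. \<forall>l. \<forall>r\<in>hom_part (int (l * e)).
        \<phi> e f (sec_scale M N e f r l s) = sec_scale M' N' e f r l (\<phi> e f s)) \<and>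
     (\<forall>s\<in>sections M N e f. \<forall>e'. \<forall>g\<in>hom_part (int e').
        \<phi> (e + e') (f * g) (sec_restrict M N e f e' g s) =
        sec_restrict M' N' e f e' g (\<phi> e f s))"
    using iso[unfolded sheaf_iso_def] ..
  note \<phi> = \<phi>[THEN spec, THEN mp, THEN bspec]
  have bij: "bij_betw (\<phi> e f) (sections M N e f) (sections M' N' e f)" if "e > 0" "f \<in> hom_part (int e)" for e f
    using \<phi>[OF that] by (rule conjunct1)
  have add: "\<phi> e f (sec_add M N e f s t) = sec_add M' N' e f (\<phi> e f s) (\<phi> e f t)"
    if "e > 0" "f \<in> hom_part (int e)" "s \<in> sections M N e f" "t \<in> sections M N e f" for e f s t
    using \<phi>[OF that(1,2), THEN conjunct2, THEN conjunct1] that(3,4) by blast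
  have scale: "\<phi> e f (sec_scale M N e f r l s) = sec_scale M' N' e f r l (\<phi> e f s)"
    if "e > 0" "f \<in> hom_part (int e)" "s \<in> sections M N e f" "r \<in> hom_part (int (l * e))" for e f s r l
    using \<phi>[OF that(1,2), THEN conjunct2, THEN conjunct2, THEN conjunct1] that(3,4) by blast
  have restrict: "\<phi> (e + e') (f * g) (sec_restrict M N e f e' g s) = sec_restrict M' N' e f e' g (\<phi> e f s)"
    if "e > 0" "f \<in> hom_part (int e)" "s \<in> sections M N e f" "g \<in> hom_part (int e')" for e f s e' g
    using \<phi>[OF that(1,2), THEN conjunct2, THEN conjunct2, THEN conjunct2] that(3,4) by blast
  have V2: "V ^ (2 * j) \<in> hom_part (int (j * (1 + 1)))" using hom_part_power1[OF A.V, of "2 * j"] by (simp add: mult.commute)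
  have glue_iff: "A.glue j s t \<longleftrightarrow> B.glue j (\<phi> 1 U s) (\<phi> 1 V t)"
    if s: "s \<in> sections M N 1 U" and t: "t \<in> sections M N 1 V" for s t
  proof -
    have s': "\<phi> 1 U s \<in> sections M' N' 1 U" "\<phi> 1 V t \<in> sections M' N' 1 V"
      using bij[of 1 U] bij[of 1 V] A.U1 A.V1 s t by (auto simp: bij_betw_def)
    obtain m k where m: "(m, k) \<in> fracs M 1" "s = A.cls 1 U (m, k)" using s A.sectionsE by blast
    obtain m' k' where m': "(m', k') \<in> fracs M 1" "t = A.cls 1 V (m', k')" using t A.sectionsE by blast
    let ?rs = "sec_restrict M N 1 U 1 V s" and ?rt = "sec_restrict M N 1 V 1 U t"
    let ?st = "sec_scale M N (1 + 1) (U * V) (V ^ (2 * j)) j ?rt"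
    have rs: "?rs \<in> sections M N (1 + 1) (U * V)"
      using A.sec_restrict_cls[OF A.U1 A.V1 m(1)] m(2) A.cls_sections by simp
    have rt0: "(smul (U ^ k') m', k') \<in> fracs M (1 + 1)" "?rt = A.cls (1 + 1) (U * V) (smul (U ^ k') m', k')"
      using A.sec_restrict_cls[OF A.V1 A.U1 m'(1)] m'(2) by (simp_all only: mult.commute[of V U])
    then have rt: "?rt \<in> sections M N (1 + 1) (U * V)" using A.cls_sections by simp
    have st: "?st \<in> sections M N (1 + 1) (U * V)"
      using A.sec_scale_cls[OF A.UV V2 rt0(1)] A.fracs_smul[OF rt0(1) V2] rt0(2) A.cls_sections by simp
    have e1: "\<phi> (1 + 1) (U * V) ?rs = sec_restrict M' N' 1 U 1 V (\<phi> 1 U s)"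
      using restrict[OF _ A.U1 s A.V1] by simp
    have "\<phi> (1 + 1) (V * U) ?rt = sec_restrict M' N' 1 V 1 U (\<phi> 1 V t)"
      using restrict[OF _ A.V1 t A.U1] by simp
    then have e2: "\<phi> (1 + 1) (U * V) ?rt = sec_restrict M' N' 1 V 1 U (\<phi> 1 V t)"
      by (simp only: mult.commute[of V U])
    have e3: "\<phi> (1 + 1) (U * V) ?st = sec_scale M' N' (1 + 1) (U * V) (V ^ (2 * j)) j (sec_restrict M' N' 1 V 1 U (\<phi> 1 V t))"
      using scale[OF _ A.UV rt V2] e2 by simp
    have "?rs = ?st \<longleftrightarrow> \<phi> (1 + 1) (U * V) ?rs = \<phi> (1 + 1) (U * V) ?st"
      using inj_on_eq_iff[OF bij_betw_imp_inj_on[OF bij[OF _ A.UV]] rs st] by simp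
    then show ?thesis unfolding A.glue_def B.glue_def e1 e3 using s t s' by blast
  qed
  \<comment> \<open>Relates the values of corresponding sections. It is total on both sides by
    \<open>T_glue\<close> and \<open>glue_T\<close>, and single-valued because the second model has
    no indeterminacy.\<close>
  define R where "R p p' \<longleftrightarrow> p \<in> T \<and> p' \<in> T' \<and> (\<exists>s. A.value_of s p \<and> B.value_of (\<phi> 1 U s) p')" for p p'
  have total: "\<exists>p'. R p p'" if p: "p \<in> T" for p
  proof -
    obtain s t where st: "A.value_of s p" "A.glue j s t" using A.T_glue p TA by blast
    then have "s \<in> sections M N 1 U" "t \<in> sections M N 1 V" by (auto simp: A.glue_def)
    then have "B.glue j (\<phi> 1 U s) (\<phi> 1 V t)" using glue_iff st by blast
    then show ?thesis using B.glue_T TB st(1) p unfolding R_def by blast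
  qed
  have surj: "\<exists>p. R p p'" if p': "p' \<in> T'" for p'
  proof -
    obtain s' t' where st: "B.value_of s' p'" "B.glue j s' t'" using B.T_glue p' TB by blast
    then have "s' \<in> \<phi> 1 U ` sections M N 1 U" "t' \<in> \<phi> 1 V ` sections M N 1 V"
      unfolding bij_betw_imp_surj_on[OF bij[OF zero_less_one A.U1]] bij_betw_imp_surj_on[OF bij[OF zero_less_one A.V1]]
      by (simp_all only: B.glue_def)
    then obtain s t where s: "s \<in> sections M N 1 U" "s' = \<phi> 1 U s" "t \<in> sections M N 1 V" "t' = \<phi> 1 V t"
      by (elim imageE)
    then have "A.glue j s t" using glue_iff st by blast
    then show ?thesis using A.glue_T TA st(1) p' s unfolding R_def by blast
  qed
  have determined: "p1' = p2' \<longleftrightarrow> (\<exists>q. \<forall>y. p1 y - p2 y = q * eps y)" if R: "R p1 p1'" "R p2 p2'" for p1 p2 p1' p2'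
  proof -
    obtain s1 where s1: "A.value_of s1 p1" "B.value_of (\<phi> 1 U s1) p1'" using R unfolding R_def by blast
    obtain s2 where s2: "A.value_of s2 p2" "B.value_of (\<phi> 1 U s2) p2'" using R unfolding R_def by blast
    have sec: "s1 \<in> sections M N 1 U" "s2 \<in> sections M N 1 U" using s1 s2 A.value_of_sections by blast+
    have "(\<exists>q. \<forall>y. p1 y - p2 y = q * eps y) \<longleftrightarrow> s1 = s2"
      using A.value_of_inj[OF s1(1) s2(1)] A.value_of_unique s1(1) s2(1) by blast
    moreover have "s1 = s2 \<longleftrightarrow> \<phi> 1 U s1 = \<phi> 1 U s2"
      using inj_on_eq_iff[OF bij_betw_imp_inj_on[OF bij[OF zero_less_one A.U1]] sec] by simp
    moreover have "p1' = p2' \<longleftrightarrow> \<phi> 1 U s1 = \<phi> 1 U s2"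
    proof
      assume "p1' = p2'"
      then have "\<forall>y. p1' y - p2' y = 0 * 0" by simp
      then show "\<phi> 1 U s1 = \<phi> 1 U s2" by (rule B.value_of_inj[OF s1(2) s2(2)])
    next
      assume e: "\<phi> 1 U s1 = \<phi> 1 U s2"
      obtain q where "\<forall>y. p1' y - p2' y = q * 0" using B.value_of_unique[OF s1(2) s2(2)[folded e]] by blast
      then show "p1' = p2'" by (intro ext) simp
    qed
    ultimately show ?thesis by blast
  qed
  have R_unique: "p1' = p2'" if "R p p1'" "R p p2'" for p p1' p2'
    unfolding determined[OF that] by (intro exI[of _ 0]) simp
  have R_add: "R (\<lambda>y. p1 y + p2 y) (\<lambda>y. p1' y + p2' y)" if R: "R p1 p1'" "R p2 p2'" for p1 p2 p1' p2'
  proof -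
    obtain s1 where s1: "A.value_of s1 p1" "B.value_of (\<phi> 1 U s1) p1'" using R unfolding R_def by blast
    obtain s2 where s2: "A.value_of s2 p2" "B.value_of (\<phi> 1 U s2) p2'" using R unfolding R_def by blast
    have "\<phi> 1 U (sec_add M N 1 U s1 s2) = sec_add M' N' 1 U (\<phi> 1 U s1) (\<phi> 1 U s2)"
      using add[OF _ A.U1] A.value_of_sections s1 s2 by simp
    then have "B.value_of (\<phi> 1 U (sec_add M N 1 U s1 s2)) (\<lambda>y. p1' y + p2' y)"
      using B.value_of_add[OF s1(2) s2(2)] by simp
    then show ?thesis using A.value_of_add[OF s1(1) s2(1)] R A.T_add B.T_add TA TB unfolding R_def by blast
  qed
  have R_scale: "R (\<lambda>y. smult c (p y)) (\<lambda>y. smult c (p' y))" if R: "R p p'" for c p p'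
  proof -
    obtain s where s: "A.value_of s p" "B.value_of (\<phi> 1 U s) p'" using R unfolding R_def by blast
    have "\<phi> 1 U (sec_scale M N 1 U (Const c) 0 s) = sec_scale M' N' 1 U (Const c) 0 (\<phi> 1 U s)"
      by (rule scale[OF zero_less_one A.U1 A.value_of_sections[OF s(1)]]) (simp add: hom_part_Const)
    then have "B.value_of (\<phi> 1 U (sec_scale M N 1 U (Const c) 0 s)) (\<lambda>y. smult c (p' y))"
      using B.value_of_scale[OF s(2)] by simp
    then show ?thesis using A.value_of_scale[OF s(1)] R A.T_scale B.T_scale TA TB unfolding R_def by blast
  qed
  define \<Psi> where "\<Psi> p = (SOME p'. R p p')" for p
  have R\<Psi>: "R p (\<Psi> p)" if "p \<in> T" for p unfolding \<Psi>_def using total[OF that] by (rule someI_ex)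
  have \<Psi>_eq: "\<Psi> p = p'" if "R p p'" for p p' using R_unique that R\<Psi>[of p] that unfolding R_def by blast
  have "R (\<lambda>y. smult 0 (0 :: 'c poly)) (\<lambda>y. smult 0 (\<Psi> (\<lambda>y. 0) y))" using R_scale[OF R\<Psi>] A.T_0 TA by blast
  then have R0: "R (\<lambda>y. 0) (\<lambda>y. 0)" by simp
  show ?thesis
  proof (intro exI[of _ \<Psi>] conjI ballI allI)
    show "\<Psi> p \<in> T'" if "p \<in> T" for p using R\<Psi>[OF that] by (simp add: R_def)
    show "T' \<subseteq> \<Psi> ` T"
    proof
      fix p' assume "p' \<in> T'"
      then obtain p where "R p p'" using surj by blast
      then show "p' \<in> \<Psi> ` T" using \<Psi>_eq unfolding R_def by blast
    qed
    show "\<Psi> (\<lambda>y. p y + p' y) = (\<lambda>y. \<Psi> p y + \<Psi> p' y)" if "p \<in> T" "p' \<in> T" for p p'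
      by (rule \<Psi>_eq[OF R_add[OF R\<Psi>[OF that(1)] R\<Psi>[OF that(2)]]])
    show "\<Psi> (\<lambda>y. smult c (p y)) = (\<lambda>y. smult c (\<Psi> p y))" if "p \<in> T" for p c
      by (rule \<Psi>_eq[OF R_scale[OF R\<Psi>[OF that]]])
    show "\<Psi> p = (\<lambda>y. 0) \<longleftrightarrow> (\<exists>q. \<forall>y. p y = q * eps y)" if "p \<in> T" for p
      using determined[OF R\<Psi>[OF that] R0] by simp
  qed
qed

section \<open>Derivations as vector fields\<close>

declare One_nat_def [simp del]

lemma partial_deriv_superset:
  assumes "finite A" "Poly_Mapping.keys f \<subseteq> A"
  shows "partial_deriv i f = (\<Sum>m\<in>A. Poly_Mapping.single (m - Poly_Mapping.single i 1)
        (of_nat (Poly_Mapping.lookup m i) * Poly_Mapping.lookup f m))"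
  unfolding partial_deriv_def
  by (rule sum.mono_neutral_left) (use assms in \<open>auto simp: in_keys_iff\<close>)

lemma partial_deriv_add: "partial_deriv i (f + g) = partial_deriv i f + partial_deriv i g"
proof -
  let ?A = "Poly_Mapping.keys f \<union> Poly_Mapping.keys g"
  have "partial_deriv i (f + g) = (\<Sum>m\<in>?A. Poly_Mapping.single (m - Poly_Mapping.single i 1)
        (of_nat (Poly_Mapping.lookup m i) * Poly_Mapping.lookup (f + g) m))"
    by (rule partial_deriv_superset) (auto simp: keys_add)
  also have "\<dots> = partial_deriv i f + partial_deriv i g"
    by (simp add: partial_deriv_superset[of ?A f] partial_deriv_superset[of ?A g] lookup_add
        distrib_left single_add sum.distrib)
  finally show ?thesis .
qed

lemma partial_deriv_0 [simp]: "partial_deriv i 0 = 0"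
  by (simp add: partial_deriv_def)

lemma partial_deriv_sum: "partial_deriv i (\<Sum>x\<in>A. f x) = (\<Sum>x\<in>A. partial_deriv i (f x))"
  by (induction A rule: infinite_finite_induct) (simp_all add: partial_deriv_add)

lemma partial_deriv_single: "partial_deriv i (Poly_Mapping.single m c) =
    Poly_Mapping.single (m - Poly_Mapping.single i 1) (of_nat (Poly_Mapping.lookup m i) * c)"
  by (cases "c = 0") (simp_all add: partial_deriv_def)

lemma partial_deriv_Const: "partial_deriv i (Const c) = 0"
  by (simp add: Const_def partial_deriv_single)

lemma partial_deriv_Var: "partial_deriv i (Var j) = (if i = j then 1 else 0)"
  by (simp add: Var_def partial_deriv_single lookup_single)

lemma minus_single_add:
  fixes m n :: "'v \<Rightarrow>\<^sub>0 nat"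
  assumes "Poly_Mapping.lookup n i \<noteq> 0"
  shows "m + (n - Poly_Mapping.single i 1) = (m + n) - Poly_Mapping.single i 1"
  by (rule poly_mapping_eqI) (use assms in \<open>auto simp: lookup_add lookup_minus lookup_single when_def\<close>)

lemma partial_deriv_mult: "partial_deriv i (f * g) = f * partial_deriv i g + g * partial_deriv i f"
proof -
  let ?s = "\<lambda>f m. Poly_Mapping.single m (Poly_Mapping.lookup f m)"
  have single: "partial_deriv i (Poly_Mapping.single m a * Poly_Mapping.single n b) =
      Poly_Mapping.single m a * partial_deriv i (Poly_Mapping.single n b) +
      Poly_Mapping.single n b * partial_deriv i (Poly_Mapping.single m a)" for m n and a b :: 'b
  proof -
    \<comment> \<open>When the exponent is 0, subtraction of exponents is truncated, but then the
      coefficient is 0 too.\<close>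
    have 1: "Poly_Mapping.single (m + (n - Poly_Mapping.single i 1)) (of_nat (Poly_Mapping.lookup n i) * (a * b)) =
        Poly_Mapping.single (m + n - Poly_Mapping.single i 1) (of_nat (Poly_Mapping.lookup n i) * (a * b))"
      by (cases "Poly_Mapping.lookup n i = 0") (simp_all add: minus_single_add)
    have 2: "Poly_Mapping.single (n + (m - Poly_Mapping.single i 1)) (of_nat (Poly_Mapping.lookup m i) * (a * b)) =
        Poly_Mapping.single (m + n - Poly_Mapping.single i 1) (of_nat (Poly_Mapping.lookup m i) * (a * b))"
      by (cases "Poly_Mapping.lookup m i = 0") (simp_all add: minus_single_add add.commute)
    have "partial_deriv i (Poly_Mapping.single m a * Poly_Mapping.single n b) =
        Poly_Mapping.single (m + n - Poly_Mapping.single i 1) (of_nat (Poly_Mapping.lookup n i) * (a * b)) +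
        Poly_Mapping.single (m + n - Poly_Mapping.single i 1) (of_nat (Poly_Mapping.lookup m i) * (a * b))"
      by (simp add: mult_single partial_deriv_single lookup_add distrib_right add.commute flip: single_add)
    then show ?thesis unfolding partial_deriv_single mult_single 1[symmetric] 2[symmetric]
      by (simp add: mult_ac)
  qed
  have "partial_deriv i ((\<Sum>m\<in>Poly_Mapping.keys f. ?s f m) * (\<Sum>n\<in>Poly_Mapping.keys g. ?s g n)) =
     (\<Sum>m\<in>Poly_Mapping.keys f. ?s f m) * partial_deriv i (\<Sum>n\<in>Poly_Mapping.keys g. ?s g n) +
     (\<Sum>n\<in>Poly_Mapping.keys g. ?s g n) * partial_deriv i (\<Sum>m\<in>Poly_Mapping.keys f. ?s f m)"
    unfolding sum_product partial_deriv_sum single sum.distrib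
    by (subst (4) sum.swap) (rule refl)
  then show ?thesis using poly_mapping_sum_single[of f] poly_mapping_sum_single[of g] by simp
qed

definition vfield :: "('v::finite \<Rightarrow> ('v, 'k::comm_ring_1) mpoly) \<Rightarrow> ('v, 'k) mpoly \<Rightarrow> ('v, 'k) mpoly" where
  "vfield F = (\<lambda>g. \<Sum>i\<in>UNIV. F i * partial_deriv i g)"

lemma vfield_Var [simp]: "vfield F (Var j) = F j"
proof -
  have "vfield F (Var j) = (\<Sum>i\<in>UNIV. if i = j then F i else 0)"
    unfolding vfield_def by (rule sum.cong) (auto simp: partial_deriv_Var)
  then show ?thesis by simp
qed

lemma derivation_vfield: "derivation (vfield F)"
  by (auto simp: derivation_def vfield_def partial_deriv_add partial_deriv_mult partial_deriv_Const
      algebra_simps sum.distrib sum_distrib_left)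

lemma derivation_Const: "derivation \<theta> \<Longrightarrow> \<theta> (Const c) = 0"
proof -
  assume d: "derivation \<theta>"
  then have "\<theta> (1 * 1) = 1 * \<theta> 1 + 1 * \<theta> 1" unfolding derivation_def by blast
  then have "\<theta> 1 = 0" by simp
  moreover have "\<theta> (Const c * 1) = Const c * \<theta> 1" using d unfolding derivation_def by blast
  ultimately show ?thesis by simp
qed

lemma derivation_eq_vfield:
  assumes "derivation \<theta>"
  shows "\<theta> = vfield (\<lambda>i. \<theta> (Var i))"
proof
  let ?\<eta> = "vfield (\<lambda>i. \<theta> (Var i))"
  have \<eta>: "derivation ?\<eta>" by (rule derivation_vfield)
  show "\<theta> f = ?\<eta> f" for f
  proof (induction f rule: mpoly_induct)
    case (Const c)
    show ?case using derivation_Const assms \<eta> by metis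
  next
    case (add f g)
    then show ?case using assms \<eta> unfolding derivation_def by metis
  next
    case (mult f g)
    then show ?case using assms \<eta> unfolding derivation_def by metis
  qed simp
qed

lemma vfield_add: "vfield F + vfield G = vfield (\<lambda>l. F l + G l)"
  and vfield_smul: "smul r (vfield F) = vfield (\<lambda>l. r * F l)"
  by (simp_all add: vfield_def fun_eq_iff smul_def algebra_simps sum.distrib sum_distrib_left)

lemma vfield_sum: "(\<Sum>x\<in>A. vfield (F x)) = vfield (\<lambda>l. \<Sum>x\<in>A. F x l)"
proof (induction A rule: infinite_finite_induct)
  case (insert x A)
  then show ?case by (simp add: vfield_add)
qed (simp_all add: vfield_def zero_fun_def)

lemma vfield_Lin: "vfield F (Lin w) = (\<Sum>i\<in>UNIV. Const (w $ i) * F i)"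
proof -
  have d: "derivation (vfield F)" by (rule derivation_vfield)
  have 0: "vfield F 0 = 0" using derivation_Const[OF d, of 0] by simp
  have a: "vfield F (f + g) = vfield F f + vfield F g" and s: "vfield F (Const c * f) = Const c * vfield F f" for f g c
    using d unfolding derivation_def by blast+
  have "vfield F (\<Sum>i\<in>A. Const (w $ i) * Var i) = (\<Sum>i\<in>A. Const (w $ i) * F i)" for A
  proof (induction A rule: infinite_finite_induct)
    case (insert x A)
    have "vfield F (Const (w $ x) * Var x + (\<Sum>i\<in>A. Const (w $ i) * Var i)) =
        Const (w $ x) * vfield F (Var x) + vfield F (\<Sum>i\<in>A. Const (w $ i) * Var i)"
      by (simp only: a s)
    then show ?case using insert by simp
  qed (simp_all add: 0)
  then show ?thesis by (simp add: Lin_def)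
qed

lemma euler_vfield: "euler_derivation = vfield Var"
  by (rule ext) (simp add: euler_derivation_def vfield_def)

lemma vanishing_ideal_add: "f \<in> vanishing_ideal X \<Longrightarrow> g \<in> vanishing_ideal X \<Longrightarrow> f + g \<in> vanishing_ideal X"
  and vanishing_ideal_mult: "f \<in> vanishing_ideal X \<Longrightarrow> h * f \<in> vanishing_ideal X"
  and vanishing_ideal_0: "0 \<in> vanishing_ideal X"
  by (auto simp: vanishing_ideal_def vanishes_at_def meval_simps)

text \<open>The case of a single equation in \<open>vanishing_ideal_perp\<close>; with one
  generator, membership is divisibility.\<close>

lemma vanishing_ideal_hyperplane:
  fixes P :: "('k::alg_closed_field ^ 'v) set"
  assumes P: "P \<in> proj_points" and v: "1 < CARD('v)"
  shows "f \<in> vanishing_ideal (dual_hyperplane P) \<longleftrightarrow> Lin (rp P) dvd f"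
proof -
  let ?b = "\<lambda>_ :: nat. rp P"
  have "dual_hyperplane P = proj_set (perp 1 ?b)"
  proof -
    have "(\<forall>c\<in>P. \<forall>y\<in>M. c \<odot> y = 0) \<longleftrightarrow> (\<forall>y\<in>M. rp P \<odot> y = 0)" for M
      using rp(1)[OF P] proj_point_iff[OF P] by (auto simp: dotp_simps)
    then show ?thesis by (auto simp: dual_hyperplane_def proj_set_def perp_def dotp_def)
  qed
  moreover have "frame 1 ?b" using rp(2)[OF P] by (simp add: frame_def' One_nat_def)
  ultimately have "f \<in> vanishing_ideal (dual_hyperplane P) \<longleftrightarrow> (\<exists>g. f = (\<Sum>j<(1 :: nat). g j * Lin (rp P)))"
    using vanishing_ideal_perp[of 1 ?b f] v by (simp only:)
  also have "\<dots> \<longleftrightarrow> (\<exists>g. f = g * Lin (rp P))" by (auto simp: One_nat_def)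
  finally show ?thesis by (auto simp: dvd_def mult.commute)
qed

text \<open>By the Leibniz rule a principal ideal is preserved as soon as its generator is sent into
  it, and the image of \<open>Lin (rp P)\<close> is the sum on the right.\<close>

lemma vfield_log_iff:
  fixes Z :: "('k::alg_closed_field ^ 'v) set set"
  assumes Z: "Z \<subseteq> proj_points" and v: "1 < CARD('v)"
  shows "vfield F \<in> log_derivations (dual_arrangement Z) \<longleftrightarrow> (\<forall>P\<in>Z. Lin (rp P) dvd (\<Sum>i\<in>UNIV. Const (rp P $ i) * F i))"
proof -
  have "vfield F ` vanishing_ideal (dual_hyperplane P) \<subseteq> vanishing_ideal (dual_hyperplane P) \<longleftrightarrow>
    Lin (rp P) dvd (\<Sum>i\<in>UNIV. Const (rp P $ i) * F i)" if P: "P \<in> Z" for P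
  proof -
    have I: "f \<in> vanishing_ideal (dual_hyperplane P) \<longleftrightarrow> Lin (rp P) dvd f" for f :: "('v, 'k) mpoly"
      using vanishing_ideal_hyperplane[OF _ v] P Z by blast
    show ?thesis
    proof
      assume "vfield F ` vanishing_ideal (dual_hyperplane P) \<subseteq> vanishing_ideal (dual_hyperplane P)"
      moreover have "Lin (rp P) \<in> vanishing_ideal (dual_hyperplane P)" by (simp add: I)
      ultimately have "vfield F (Lin (rp P)) \<in> vanishing_ideal (dual_hyperplane P)" by (rule subsetD[OF _ imageI])
      then show "Lin (rp P) dvd (\<Sum>i\<in>UNIV. Const (rp P $ i) * F i)" by (simp add: I vfield_Lin)
    next
      assume d: "Lin (rp P) dvd (\<Sum>i\<in>UNIV. Const (rp P $ i) * F i)"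
      show "vfield F ` vanishing_ideal (dual_hyperplane P) \<subseteq> vanishing_ideal (dual_hyperplane P)"
      proof clarify
        fix f assume "f \<in> vanishing_ideal (dual_hyperplane P)"
        then obtain g where g: "f = Lin (rp P) * g" by (auto simp: I dvd_def)
        have "vfield F f = Lin (rp P) * vfield F g + g * vfield F (Lin (rp P))"
          unfolding g using derivation_vfield[of F] unfolding derivation_def by blast
        then show "vfield F f \<in> vanishing_ideal (dual_hyperplane P)" using d by (simp add: I vfield_Lin)
      qed
    qed
  qed
  then show ?thesis by (auto simp: log_derivations_def derivation_vfield dual_arrangement_def)
qed

lemma vfield_hom_iff: "(\<forall>l\<in>hom_part 1. vfield F l \<in> hom_part j) \<longleftrightarrow> (\<forall>i. F i \<in> hom_part j)"
proof
  assume "\<forall>l\<in>hom_part 1. vfield F l \<in> hom_part j"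
  then show "\<forall>i. F i \<in> hom_part j" using hom_part_Var vfield_Var by metis
next
  assume F: "\<forall>i. F i \<in> hom_part j"
  show "\<forall>l\<in>hom_part 1. vfield F l \<in> hom_part j"
  proof
    fix l :: "('a, 'b) mpoly" assume "l \<in> hom_part 1"
    then obtain w where "l = Lin w" by (rule hom_part_1_Lin)
    then show "vfield F l \<in> hom_part j" using F by (simp add: vfield_Lin hom_part_sum hom_part_scale)
  qed
qed

lemma log_part_vfield:
  assumes "m \<in> log_derivations_part A j"
  shows "m = vfield (\<lambda>i. m (Var i))"
  using assms derivation_eq_vfield by (auto simp: log_derivations_part_def log_derivations_def)

section \<open>Restriction to a general line\<close>

locale general_line =
  fixes b :: "nat \<Rightarrow> 'k::alg_closed_field ^ 'v" and e :: "nat \<Rightarrow> 'k ^ 'v"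
  assumes fr: "frame 2 b" and dual: "\<And>i j. i < 2 \<Longrightarrow> j < 2 \<Longrightarrow> e i \<odot> b j = (if i = j then 1 else 0)"
begin

definition L :: "('k ^ 'v) set" where "L = vec.span (b ` {..<2})"
definition I :: "('v, 'k) mpoly set" where "I = vanishing_ideal (proj_set L)"
definition res :: "('v, 'k) mpoly \<Rightarrow> 'k poly" where
  "res f = geval (\<lambda>c. [:c:]) (\<lambda>i. [:b 0 $ i, b 1 $ i:]) f"
abbreviation U where "U \<equiv> Lin (e 0)"
abbreviation V where "V \<equiv> Lin (e 1)"

lemma dual01: "e 0 \<odot> b 0 = 1" "e 0 \<odot> b 1 = 0" "e 1 \<odot> b 0 = 0" "e 1 \<odot> b 1 = 1"
  using dual[of 0 0] dual[of 0 1] dual[of 1 0] dual[of 1 1] by simp_all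

lemmas res_simps = geval_simps[OF is_ring_hom_const_poly, of "\<lambda>i. [:b 0 $ i, b 1 $ i:]", folded res_def]

lemma res_0 [simp]: "res 0 = 0"
  by (simp add: res_def geval_def)

lemma poly_res: "poly (res f) t = ev f (b 0 + t *s b 1)"
proof -
  have "($) (b 0 + t *s b 1) = (\<lambda>i. poly [:b 0 $ i, b 1 $ i:] t)" by (simp add: fun_eq_iff)
  then show ?thesis by (simp only: res_def poly_geval)
qed

lemma res_Lin: "res (Lin w) = [:w \<odot> b 0, w \<odot> b 1:]"
proof -
  have "(\<Sum>i\<in>X. [:f i, g i:]) = [:\<Sum>i\<in>X. f i, \<Sum>i\<in>X. g i:]" for f g :: "'v \<Rightarrow> 'k" and X
    by (induction X rule: infinite_finite_induct) simp_all
  then show ?thesis by (simp add: Lin_def res_simps dotp_def mult.commute)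
qed

lemma res_U: "res U = 1" and res_V: "res V = [:0, 1:]"
  by (simp_all add: res_Lin dual01 one_pCons)

lemma res_U_power: "res (U ^ k) = 1" and res_V_power: "res (V ^ k) = monom 1 k"
  by (simp_all add: res_simps res_U res_V monom_altdef)

lemma L_iff: "x \<in> L \<longleftrightarrow> (\<exists>s t. x = s *s b 0 + t *s b 1)"
proof -
  have "b ` {..<2} = {b 0, b 1}" by (auto simp: numeral_2_eq_2 lessThan_Suc One_nat_def)
  then have "L = {x. \<exists>s. x - s *s b 0 \<in> vec.span {b 1}}" by (simp only: L_def vec.span_insert[of "b 0" "{b 1}"])
  then have "x \<in> L \<longleftrightarrow> (\<exists>s t. x - s *s b 0 = t *s b 1)" by (auto simp: vec.span_singleton)
  then show ?thesis by (simp add: diff_eq_eq add.commute)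
qed

lemma subspace_L: "vec.subspace L"
  by (simp add: L_def)

lemma b1_L: "b 1 \<in> L" and b0_L: "b 0 \<in> L"
  unfolding L_def by (auto intro: vec.span_base)

lemma b1_nz: "b 1 \<noteq> 0"
  using dual01 by auto

lemma I_iff: "f \<in> I \<longleftrightarrow> (\<forall>x\<in>L. ev f x = 0)"
proof
  have "L \<noteq> {0}" using b1_L b1_nz by blast
  then show "\<forall>x\<in>L. ev f x = 0" if "f \<in> I"
    using ev_vanishing_subspace[OF subspace_L] that unfolding I_def by blast
qed (auto simp: I_def vanishing_ideal_proj_set[OF subspace_L])

lemma res_I: "f \<in> I \<Longrightarrow> res f = 0"
proof (rule poly_zero_infinite)
  fix t assume "f \<in> I"
  moreover have "b 0 + t *s b 1 \<in> L" using L_iff[of "b 0 + t *s b 1"] by (metis vec.scale_one)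
  ultimately show "poly (res f) t = 0" by (simp add: poly_res I_iff)
qed

lemma line_vanish:
  fixes f :: "('v, 'k) mpoly"
  assumes "\<And>t. t \<noteq> 0 \<Longrightarrow> ev f (x + t *s y) = 0"
  shows "ev f x = 0"
proof -
  define p where "p = geval (\<lambda>c. [:c:]) (\<lambda>i. [:x $ i, y $ i:]) f"
  have p: "poly p t = ev f (x + t *s y)" for t
  proof -
    have "($) (x + t *s y) = (\<lambda>i. poly [:x $ i, y $ i:] t)" by (simp add: fun_eq_iff)
    then show ?thesis by (simp only: p_def poly_geval)
  qed
  have "p * [:0, 1:] = 0" by (rule poly_zero_infinite) (use p assms in \<open>auto simp: mult_eq_0_iff\<close>)
  then have "p = 0" by simp
  then show ?thesis using p[of 0] by simp
qed

text \<open>Homogeneity carries vanishing from the chart to all vectors with nonzero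
  \<open>b 0\<close> component; the remaining multiples of \<open>b 1\<close> are reached along
  lines by \<open>line_vanish\<close>.\<close>

lemma res_zero_hom:
  assumes f: "f \<in> hom_part j" and r: "res f = 0"
  shows "f \<in> I"
proof (cases "j < 0")
  case True
  then have "f = 0" using f by (simp add: hom_part_neg)
  then show ?thesis by (simp add: I_def vanishing_ideal_0)
next
  case False
  then have f: "f \<in> hom_part (int (nat j))" using f by simp
  have nz: "ev f (s *s b 0 + t *s b 1) = 0" if "s \<noteq> 0" for s t
  proof -
    have e: "s *s b 0 + t *s b 1 = s *s (b 0 + (t / s) *s b 1)" using that by (simp add: vec.scale_right_distrib)
    have "ev f (s *s b 0 + t *s b 1) = s ^ nat j * ev f (b 0 + (t / s) *s b 1)" unfolding e by (rule ev_hom_scale[OF f])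
    then show ?thesis using poly_res[of f "t / s"] r by simp
  qed
  have "ev f (t *s b 1) = 0" for t
    by (rule line_vanish[of _ _ "b 0"]) (use nz in \<open>simp add: add.commute\<close>)
  then have "ev f (s *s b 0 + t *s b 1) = 0" for s t using nz by (cases "s = 0") simp_all
  then show ?thesis unfolding I_iff by (auto simp: L_iff)
qed

lemma I_mult: "f \<in> I \<Longrightarrow> h * f \<in> I" and I_add: "f \<in> I \<Longrightarrow> g \<in> I \<Longrightarrow> f + g \<in> I" and I_0: "0 \<in> I"
  unfolding I_def by (simp_all add: vanishing_ideal_mult vanishing_ideal_add vanishing_ideal_0)

text \<open>Homogenisation in degree \<open>k\<close> with respect to \<open>U\<close>, the inverse
  of \<open>res\<close> on binary forms.\<close>

definition form :: "nat \<Rightarrow> 'k poly \<Rightarrow> ('v, 'k) mpoly" where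
  "form k p = (\<Sum>i\<le>k. Const (coeff p i) * (U ^ (k - i) * V ^ i))"

lemma form_hom: "form k p \<in> hom_part (int k)"
  unfolding form_def
proof (intro hom_part_sum hom_part_scale)
  fix i assume "i \<in> {..k}"
  then show "U ^ (k - i) * V ^ i \<in> hom_part (int k)" using hom_part_Lin_powers[of "e 0" "k - i" "e 1" i] by simp
qed

lemma res_form: "degree p \<le> k \<Longrightarrow> res (form k p) = p"
proof -
  assume d: "degree p \<le> k"
  have "res (form k p) = (\<Sum>i\<le>k. smult (coeff p i) (monom 1 i))"
    unfolding form_def res_simps res_U res_V
    by (rule sum.cong) (simp_all add: monom_altdef)
  also have "\<dots> = p" using poly_as_sum_of_monoms'[OF d] by (simp add: smult_monom)
  finally show ?thesis .
qed

lemma res_degle: "f \<in> hom_part (int k) \<Longrightarrow> degle (res f) (int k)"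
  unfolding degle_nat res_def by (rule degree_geval_hom)

text \<open>The Euler field along the chart: component \<open>i\<close> is coordinate
  \<open>i\<close> of \<open>b 0 + t *s b 1\<close>.\<close>

definition eps :: "'v \<Rightarrow> 'k poly" where "eps i = [:b 0 $ i, b 1 $ i:]"

lemma res_Var: "res (Var i) = eps i"
  by (simp add: res_simps eps_def)

lemma eps_nz: "\<exists>i. b 1 $ i \<noteq> 0"
  using b1_nz by (auto simp: vec_eq_iff)

text \<open>Since \<open>b 1\<close> is nonzero, some \<open>eps i\<close> has degree exactly 1, so
  multiplication by it raises the degree by 1.\<close>

lemma degle_eps_iff:
  assumes "\<forall>i. degle (q * eps i) (int k)"
  shows "q = 0 \<or> degree q < k"
proof (rule disjCI)
  assume d: "\<not> degree q < k"
  obtain i where i: "b 1 $ i \<noteq> 0" using eps_nz by blast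
  show "q = 0"
  proof (rule ccontr)
    assume "q \<noteq> 0"
    then have "degree (q * eps i) = degree q + 1" using i by (subst degree_mult_eq) (auto simp: eps_def)
    moreover have "degree (q * eps i) \<le> k" using assms by (simp add: degle_nat)
    ultimately show False using d by simp
  qed
qed

end

text \<open>\<open>Zb\<close> says that each hyperplane of the arrangement meets the line in one
  point of the chart, and \<open>ZZ\<close> that different hyperplanes meet it in different
  points.\<close>

locale general_line_arrangement = general_line b e for b :: "nat \<Rightarrow> 'k::alg_closed_field ^ 'v" and e +
  fixes Z :: "('k ^ 'v) set set"
  assumes v: "1 < CARD('v)" and Z: "finite Z" "Z \<subseteq> proj_points" "Z \<noteq> {}"
    and Zb: "P \<in> Z \<Longrightarrow> rp P \<odot> b 1 \<noteq> 0"
    and ZZ: "P \<in> Z \<Longrightarrow> P' \<in> Z \<Longrightarrow> P \<noteq> P' \<Longrightarrow> (rp P \<odot> b 0) * (rp P' \<odot> b 1) \<noteq> (rp P \<odot> b 1) * (rp P' \<odot> b 0)"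
begin

abbreviation A where "A \<equiv> dual_arrangement Z"

text \<open>The parameter at which the hyperplane dual to \<open>P\<close> meets the line.\<close>

definition \<tau> :: "('k ^ 'v) set \<Rightarrow> 'k" where "\<tau> P = - (rp P \<odot> b 0) / (rp P \<odot> b 1)"

text \<open>The degree of the products \<open>others P\<close>. Their restrictions span the binary
  forms of this degree, so the powers \<open>U ^ N0\<close> and \<open>V ^ N0\<close> can both be
  expressed by them modulo \<open>I\<close>.\<close>

definition N0 :: nat where "N0 = card Z - 1"

text \<open>The image of the linear form of \<open>P\<close> under the vector field with
  coefficients \<open>F\<close>.\<close>

definition contr :: "('k ^ 'v) set \<Rightarrow> ('v \<Rightarrow> ('v, 'k) mpoly) \<Rightarrow> ('v, 'k) mpoly" where
  "contr P F = (\<Sum>i\<in>UNIV. Const (rp P $ i) * F i)"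

definition others :: "('k ^ 'v) set \<Rightarrow> ('v, 'k) mpoly" where
  "others P = (\<Prod>P'\<in>Z - {P}. Lin (rp P'))"

text \<open>Tangency to each hyperplane at its point on the line, the trace that a logarithmic
  derivation leaves on the chart.\<close>

definition Bd :: "('v \<Rightarrow> 'k poly) set" where
  "Bd = {p. \<forall>P\<in>Z. (\<Sum>i\<in>UNIV. rp P $ i * poly (p i) (\<tau> P)) = 0}"

lemma tau_zero: "P \<in> Z \<Longrightarrow> rp P \<odot> b 0 + \<tau> P * (rp P \<odot> b 1) = 0"
  using Zb by (simp add: \<tau>_def)

lemma poly_res_Lin_tau: "P \<in> Z \<Longrightarrow> poly (res (Lin (rp P))) (\<tau> P) = 0"
  using tau_zero by (simp add: res_Lin)

lemma tau_other: "P \<in> Z \<Longrightarrow> P' \<in> Z \<Longrightarrow> P \<noteq> P' \<Longrightarrow> rp P' \<odot> b 0 + \<tau> P * (rp P' \<odot> b 1) \<noteq> 0"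
proof
  assume P: "P \<in> Z" "P' \<in> Z" "P \<noteq> P'" and z: "rp P' \<odot> b 0 + \<tau> P * (rp P' \<odot> b 1) = 0"
  then have "(rp P \<odot> b 1) * (rp P' \<odot> b 0) = (rp P \<odot> b 0) * (rp P' \<odot> b 1)"
    using Zb[OF P(1)] by (simp add: \<tau>_def field_simps)
  then show False using ZZ[OF P] by simp
qed

lemma tau_inj: "inj_on \<tau> Z"
proof (rule inj_onI, rule ccontr)
  fix P P' assume P: "P \<in> Z" "P' \<in> Z" "\<tau> P = \<tau> P'" "P \<noteq> P'"
  then show False using tau_other[OF P(1,2,4)] tau_zero[OF P(2)] by simp
qed

lemma log_iff: "vfield F \<in> log_derivations A \<longleftrightarrow> (\<forall>P\<in>Z. Lin (rp P) dvd contr P F)"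
  unfolding contr_def by (rule vfield_log_iff[OF Z(2) v])

lemma log_part_iff: "vfield F \<in> log_derivations_part A j \<longleftrightarrow> (\<forall>P\<in>Z. Lin (rp P) dvd contr P F) \<and> (\<forall>i. F i \<in> hom_part j)"
  unfolding log_derivations_part_def using log_iff vfield_hom_iff by blast

lemma others_hom: "P \<in> Z \<Longrightarrow> others P \<in> hom_part (int N0)"
  using hom_part_prod[of "Z - {P}" "\<lambda>P. Lin (rp P)", OF hom_part_Lin] Z(1) by (simp add: others_def N0_def)

lemma others_dvd: "P' \<in> Z \<Longrightarrow> P' \<noteq> P \<Longrightarrow> Lin (rp P') dvd others P"
  unfolding others_def using Z(1) by (intro dvd_prodI) auto

lemma contr_mult: "contr P (\<lambda>i. g * F i) = g * contr P F"
  by (simp add: contr_def sum_distrib_left mult.left_commute)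

lemma contr_diff: "contr P (\<lambda>i. F i - G i) = contr P F - contr P G"
  by (simp add: contr_def right_diff_distrib sum_subtractf)

lemma contr_sum: "contr P (\<lambda>i. \<Sum>x\<in>X. F x i) = (\<Sum>x\<in>X. contr P (F x))"
  unfolding contr_def by (subst sum.swap) (simp add: sum_distrib_left)

lemma contr_Const: "contr P (\<lambda>i. Const (w $ i)) = Const (rp P \<odot> w)"
proof -
  have "(Const (\<Sum>i\<in>X. f i) :: ('v, 'k) mpoly) = (\<Sum>i\<in>X. Const (f i))" for f :: "'v \<Rightarrow> 'k" and X
    by (induction X rule: infinite_finite_induct) (simp_all add: Const_add)
  then show ?thesis by (simp add: contr_def dotp_def Const_mult)
qed

text \<open>The \<open>others P\<close> restrict to multiples of the Lagrange basis for the points \<open>\<tau> P\<close>.\<close>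

lemma others_span:
  assumes G: "G \<in> hom_part (int N0)"
  obtains c where "G - (\<Sum>P\<in>Z. Const (c P) * others P) \<in> I"
proof -
  define c where "c P = poly (res G) (\<tau> P) / poly (res (others P)) (\<tau> P)" for P
  let ?D = "G - (\<Sum>P\<in>Z. Const (c P) * others P)"
  have D: "?D \<in> hom_part (int N0)"
    by (intro hom_part_diff G hom_part_sum hom_part_scale others_hom)
  have nz: "poly (res (others P)) (\<tau> P) \<noteq> 0" if P: "P \<in> Z" for P
    using Z(1) tau_other[OF P] P by (auto simp: others_def res_simps poly_prod res_Lin mult.commute)
  have z: "poly (res (others P')) (\<tau> P) = 0" if P: "P \<in> Z" "P' \<in> Z" "P' \<noteq> P" for P P'
  proof -
    obtain h where "others P' = Lin (rp P) * h" using others_dvd[of P P'] P by (auto simp: dvd_def)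
    then show ?thesis using poly_res_Lin_tau[OF P(1)] by (simp add: res_simps)
  qed
  have roots: "poly (res ?D) (\<tau> P) = 0" if P: "P \<in> Z" for P
  proof -
    have "(\<Sum>P'\<in>Z. c P' * poly (res (others P')) (\<tau> P)) = (\<Sum>P'\<in>Z. if P' = P then poly (res G) (\<tau> P) else 0)"
      by (rule sum.cong) (use z[OF P] nz[OF P] in \<open>auto simp: c_def\<close>)
    then show ?thesis using P Z(1) by (simp add: res_simps poly_sum)
  qed
  have "res ?D = 0"
  proof (rule ccontr)
    \<comment> \<open>A nonzero polynomial of degree at most \<open>card Z - 1\<close> cannot have
      the \<open>card Z\<close> roots \<open>\<tau> P\<close>.\<close>
    assume nz: "res ?D \<noteq> 0"
    have "card Z = card (\<tau> ` Z)" by (simp add: card_image[OF tau_inj])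
    also have "\<dots> \<le> card {t. poly (res ?D) t = 0}"
      by (rule card_mono) (use roots nz in \<open>auto intro: poly_roots_finite\<close>)
    also have "\<dots> \<le> degree (res ?D)" by (rule card_poly_roots_bound[OF nz])
    also have "\<dots> \<le> N0" using res_degle[OF D] by (simp only: degle_nat)
    finally have "card Z \<le> card Z - 1" by (simp only: N0_def)
    moreover have "card Z > 0" using Z by (simp add: card_gt_0_iff)
    ultimately show False by linarith
  qed
  then have "?D \<in> I" by (rule res_zero_hom[OF D])
  then show thesis by (rule that)
qed

definition w :: "('k ^ 'v) set \<Rightarrow> 'k ^ 'v" where "w P = (SOME w. rp P \<odot> w = 1)"

lemma w: "P \<in> Z \<Longrightarrow> rp P \<odot> w P = 1"
proof -
  assume P: "P \<in> Z"
  then have "rp P \<noteq> 0" using rp(2) Z(2) by blast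
  then obtain x where "x \<odot> rp P = 1" using exists_functional_separating[of "rp P" "{}"] by auto
  then have "\<exists>w. rp P \<odot> w = 1" by (auto simp: dotp_commute)
  then show ?thesis unfolding w_def by (rule someI_ex)
qed

abbreviation N where "N \<equiv> D0_restrict_rel A I"

lemma N_subspace: "fun_mod.subspace N"
  by (simp add: D0_restrict_rel_def)

lemma N_base: "g \<in> I \<Longrightarrow> \<theta> \<in> log_derivations A \<Longrightarrow> smul g \<theta> \<in> N"
  unfolding D0_restrict_rel_def by (rule fun_mod.span_base) blast

lemma N_euler: "smul g euler_derivation \<in> N"
  unfolding D0_restrict_rel_def by (intro fun_mod.span_scale fun_mod.span_base) blast

text \<open>The factor \<open>others P\<close> makes any field logarithmic away from the hyperplane
  of \<open>P\<close>. There, fields annihilating the linear form of \<open>P\<close> and multiples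
  of that form are logarithmic, and these suffice to write the field with coefficients in
  \<open>I\<close>.\<close>

lemma N_others:
  assumes P: "P \<in> Z" and F: "\<And>i. F i \<in> I" "vfield F \<in> log_derivations A"
  shows "smul (others P) (vfield F) \<in> N"
proof -
  let ?g = "others P" and ?c = "rp P"
  obtain h where h: "contr P F = Lin ?c * h" using F(2) P unfolding log_iff dvd_def by blast
  have contrI: "contr P F \<in> I"
    unfolding I_iff contr_def using F(1) by (auto simp: meval_simps I_iff)
  \<comment> \<open>The linear form of \<open>P\<close> vanishes on the line only at multiples of
    one vector, so vanishing of the product passes to \<open>h\<close> by
    \<open>line_vanish\<close>.\<close>
  have hI: "h \<in> I" unfolding I_iff
  proof
    fix x assume x: "x \<in> L"
    have nz: "ev h y = 0" if "y \<in> L" "?c \<odot> y \<noteq> 0" for y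
    proof -
      have "ev (Lin ?c * h) y = 0" using contrI that(1) unfolding h I_iff by blast
      then show ?thesis using that(2) by (simp add: meval_simps meval_Lin)
    qed
    show "ev h x = 0"
    proof (cases "?c \<odot> x = 0")
      case True
      show ?thesis
      proof (rule line_vanish[of _ _ "b 1"])
        fix t :: 'k assume t: "t \<noteq> 0"
        have "x + t *s b 1 \<in> L" using x b1_L subspace_L by (simp add: vec.subspace_add vec.subspace_scale)
        moreover have "?c \<odot> (x + t *s b 1) \<noteq> 0" using True Zb[OF P] t by (simp add: dotp_simps)
        ultimately show "ev h (x + t *s b 1) = 0" by (rule nz)
      qed
    qed (rule nz[OF x])
  qed
  \<comment> \<open>\<open>G1 i\<close> is the coordinate field corrected along \<open>w P\<close>
    so that it annihilates the linear form of \<open>P\<close>. \<open>G2\<close> restores the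
    component along \<open>w P\<close>, which \<open>h\<close> makes divisible by that form.\<close>
  define G1 where "G1 i = (\<lambda>l. ?g * ((if l = i then 1 else 0) - Const (?c $ i) * Const (w P $ l)))" for i
  define G2 where "G2 = (\<lambda>l. (?g * Lin ?c) * Const (w P $ l))"
  have "vfield (G1 i) \<in> log_derivations A" for i
    unfolding log_iff
  proof
    fix P' assume P': "P' \<in> Z"
    have "contr P' (\<lambda>l. if l = i then 1 else 0) = Const (rp P' $ i)"
      by (simp add: contr_def if_distrib cong: if_cong)
    then have c: "contr P' (G1 i) = ?g * (Const (rp P' $ i) - Const (?c $ i) * Const (rp P' \<odot> w P))"
      unfolding G1_def contr_mult contr_diff contr_Const by simp
    show "Lin (rp P') dvd contr P' (G1 i)"
    proof (cases "P' = P")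
      case True
      then show ?thesis unfolding c using w[OF P] by simp
    next
      case False
      then show ?thesis unfolding c using others_dvd[OF P', of P] by simp
    qed
  qed
  then have 1: "smul (F i) (vfield (G1 i)) \<in> N" for i using N_base F(1) by blast
  have "vfield G2 \<in> log_derivations A"
    unfolding log_iff
  proof
    fix P' assume P': "P' \<in> Z"
    have c: "contr P' G2 = (?g * Lin ?c) * Const (rp P' \<odot> w P)" unfolding G2_def contr_mult contr_Const ..
    show "Lin (rp P') dvd contr P' G2"
      unfolding c using others_dvd[OF P', of P] by (cases "P' = P") (auto intro: dvd_mult2)
  qed
  then have 2: "smul h (vfield G2) \<in> N" using N_base hI by blast
  have "(\<Sum>i\<in>UNIV. smul (F i) (vfield (G1 i))) + smul h (vfield G2) \<in> N"
    using 1 2 N_subspace by (intro fun_mod.subspace_add fun_mod.subspace_sum)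
  moreover have "(\<Sum>i\<in>UNIV. smul (F i) (vfield (G1 i))) + smul h (vfield G2) = smul ?g (vfield F)"
    unfolding vfield_smul vfield_sum vfield_add
  proof (rule arg_cong[where f = vfield], rule ext)
    fix l
    have "(\<Sum>i\<in>UNIV. F i * G1 i l) = (\<Sum>i\<in>UNIV. (if i = l then ?g * F i else 0) - ?g * Const (w P $ l) * (Const (?c $ i) * F i))"
      by (rule sum.cong) (auto simp: G1_def algebra_simps)
    also have "\<dots> = ?g * F l - ?g * Const (w P $ l) * contr P F"
      by (simp add: sum_subtractf contr_def sum_distrib_left)
    finally show "(\<Sum>i\<in>UNIV. F i * G1 i l) + h * G2 l = ?g * F l"
      by (simp add: h G2_def algebra_simps)
  qed
  ultimately show ?thesis by simp
qed

lemma N_form: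
  assumes G: "G \<in> hom_part (int N0)" and F: "\<And>i. F i \<in> I" "vfield F \<in> log_derivations A"
  shows "smul G (vfield F) \<in> N"
proof -
  obtain c where c: "G - (\<Sum>P\<in>Z. Const (c P) * others P) \<in> I" using others_span[OF G] by blast
  have "smul (G - (\<Sum>P\<in>Z. Const (c P) * others P)) (vfield F) + (\<Sum>P\<in>Z. smul (Const (c P)) (smul (others P) (vfield F))) \<in> N"
    by (intro fun_mod.subspace_add[OF N_subspace] fun_mod.subspace_sum[OF N_subspace] fun_mod.subspace_scale[OF N_subspace] N_base c F N_others)
  moreover have "smul (G - (\<Sum>P\<in>Z. Const (c P) * others P)) (vfield F) + (\<Sum>P\<in>Z. smul (Const (c P)) (smul (others P) (vfield F))) = smul G (vfield F)"
    unfolding vfield_smul vfield_sum vfield_add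
    by (rule arg_cong[where f = vfield], rule ext) (simp add: algebra_simps sum_distrib_left)
  ultimately show ?thesis by simp
qed

text \<open>A form \<open>Q\<close> of degree \<open>k - 1\<close> restricts to \<open>q\<close>.
  Subtracting \<open>Q\<close> times the Euler derivation leaves a logarithmic field whose
  coefficients vanish on the line, to which \<open>N_form\<close> applies.\<close>

lemma N_I:
  assumes m: "m \<in> log_derivations_part A (int k)" and q: "\<forall>i. res (m (Var i)) = q * eps i" and G: "G \<in> hom_part (int N0)"
  shows "smul G m \<in> N"
proof -
  define F where "F i = m (Var i)" for i
  have mF: "m = vfield F" unfolding F_def[abs_def] by (rule log_part_vfield[OF m])
  have F: "\<And>P. P \<in> Z \<Longrightarrow> Lin (rp P) dvd contr P F" "\<And>i. F i \<in> hom_part (int k)"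
    using m unfolding mF log_part_iff by blast+
  have "\<forall>i. degle (q * eps i) (int k)" using q res_degle[OF F(2)] unfolding F_def by metis
  then have dq: "q = 0 \<or> degree q < k" by (rule degle_eps_iff)
  define Q where "Q = (if q = 0 then 0 else form (k - 1) q)"
  have Q: "res Q = q" using dq by (auto simp: Q_def res_form)
  have QV: "Q * Var i \<in> hom_part (int k)" for i
  proof (cases "q = 0")
    case False
    then have "int (k - 1) + 1 = int k" using dq by auto
    then show ?thesis using hom_part_mult[OF form_hom hom_part_Var, of "k - 1" q i] False by (simp add: Q_def)
  qed (simp add: Q_def)
  define F' where "F' i = F i - Q * Var i" for i
  have "F' i \<in> hom_part (int k)" for i unfolding F'_def by (intro hom_part_diff F QV)
  moreover have "res (F' i) = 0" for i unfolding F'_def F_def res_simps(3,8) res_Var Q using q by simp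
  ultimately have F'I: "F' i \<in> I" for i using res_zero_hom by blast
  have "vfield F' \<in> log_derivations A"
    unfolding log_iff
  proof
    fix P assume P: "P \<in> Z"
    have "contr P Var = Lin (rp P)" by (simp add: contr_def Lin_def)
    then have "contr P F' = contr P F - Q * Lin (rp P)" unfolding F'_def[abs_def] contr_diff contr_mult by simp
    then show "Lin (rp P) dvd contr P F'" using F(1)[OF P] by simp
  qed
  then have "smul G (vfield F') \<in> N" using N_form[OF G, of F', OF F'I] by blast
  then have "smul G (vfield F') + smul (G * Q) euler_derivation \<in> N"
    using N_euler by (rule fun_mod.subspace_add[OF N_subspace])
  moreover have "smul G (vfield F') + smul (G * Q) euler_derivation = smul G m"
    unfolding mF euler_vfield vfield_smul vfield_add
    by (rule arg_cong[where f = vfield], rule ext) (simp add: F'_def algebra_simps)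
  ultimately show ?thesis by simp
qed

lemma N_D: "m \<in> N \<Longrightarrow> \<exists>q. \<forall>i. res (m (Var i)) = q * eps i"
  unfolding D0_restrict_rel_def
proof (induction rule: fun_mod.span_induct_alt)
  case base
  show ?case by (rule exI[of _ 0]) (simp add: zero_fun_def)
next
  case (step c x y)
  obtain q where q: "\<forall>i. res (y (Var i)) = q * eps i" using step by blast
  have "\<exists>r. \<forall>i. res (x (Var i)) = r * eps i"
  proof (cases "x = euler_derivation")
    case True
    then show ?thesis by (intro exI[of _ 1]) (simp add: euler_vfield res_Var)
  next
    case False
    then obtain g \<theta> where "x = smul g \<theta>" "g \<in> I" using step(1) by blast
    then show ?thesis by (intro exI[of _ 0]) (simp add: smul_def res_simps res_I)
  qed
  then obtain r where r: "\<forall>i. res (x (Var i)) = r * eps i" ..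
  show ?case by (rule exI[of _ "res c * r + q"]) (simp add: smul_def res_simps q r algebra_simps)
qed

text \<open>The homogenised field \<open>f\<close> need not be logarithmic off the line. For each
  \<open>P\<close> it becomes tangent to its hyperplane after a correction along \<open>w P\<close>
  that restricts to zero, and multiplication by \<open>others P\<close> takes care of the other
  hyperplanes. Summing with the coefficients of \<open>G\<close> restores the factor
  \<open>res G\<close>.\<close>

lemma lift_form:
  assumes p: "p \<in> Bd" "\<forall>i. degle (p i) (int k)" and G: "G \<in> hom_part (int N0)"
  shows "\<exists>m\<in>log_derivations_part A (int (k + N0)). \<forall>i. res (m (Var i)) = res G * p i"
proof -
  define f where "f i = form k (p i)" for i
  have fh: "f i \<in> hom_part (int k)" for i unfolding f_def by (rule form_hom)
  have fr: "res (f i) = p i" for i unfolding f_def using p(2) by (simp add: res_form degle_nat)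
  have "\<exists>h. Lin (rp P) * h \<in> hom_part (int k) \<and> res (contr P f) = res (Lin (rp P) * h)" if P: "P \<in> Z" for P
  proof -
    have ch: "contr P f \<in> hom_part (int k)" unfolding contr_def by (intro hom_part_sum hom_part_scale fh)
    have rc: "res (contr P f) = (\<Sum>i\<in>UNIV. smult (rp P $ i) (p i))" by (simp add: contr_def res_simps fr)
    \<comment> \<open>The tangency condition says exactly that the contraction is divisible by the
      linear form of \<open>P\<close> on the line; the quotient is homogenised to
      \<open>h\<close>.\<close>
    have "poly (res (contr P f)) (\<tau> P) = 0" using p(1) P by (simp add: rc poly_sum Bd_def)
    then obtain H where H: "res (contr P f) = [:- \<tau> P, 1:] * H" by (metis poly_eq_0_iff_dvd dvdE)
    have RL: "res (Lin (rp P)) = smult (rp P \<odot> b 1) [:- \<tau> P, 1:]"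
      using Zb[OF P] by (simp add: res_Lin \<tau>_def)
    show ?thesis
    proof (cases "H = 0")
      case True
      then show ?thesis using H by (intro exI[of _ 0]) simp
    next
      case False
      have "degree (res (contr P f)) = 1 + degree H" unfolding H using False by (subst degree_mult_eq) auto
      moreover have "degree (res (contr P f)) \<le> k" using res_degle[OF ch] by (simp add: degle_nat)
      ultimately have k: "Suc (degree H) \<le> k" by simp
      let ?H = "smult (inverse (rp P \<odot> b 1)) H"
      let ?h = "form (k - 1) ?H"
      have "res ?h = ?H" by (rule res_form) (use k in auto)
      moreover have "smult (rp P \<odot> b 1) [:- \<tau> P, 1:] * ?H = [:- \<tau> P, 1:] * H"
        unfolding mult_smult_left mult_smult_right smult_smult using Zb[OF P] by simp
      ultimately have "res (contr P f) = res (Lin (rp P) * ?h)" by (simp only: res_simps RL H)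
      moreover have "1 + int (k - 1) = int k" using k by simp
      then have "Lin (rp P) * ?h \<in> hom_part (int k)" using hom_part_mult[OF hom_part_Lin form_hom, of "rp P" "k - 1" ?H] by simp
      ultimately show ?thesis by blast
    qed
  qed
  then obtain h where h: "\<And>P. P \<in> Z \<Longrightarrow> Lin (rp P) * h P \<in> hom_part (int k)" "\<And>P. P \<in> Z \<Longrightarrow> res (contr P f) = res (Lin (rp P) * h P)"
    by metis
  obtain c where c: "G - (\<Sum>P\<in>Z. Const (c P) * others P) \<in> I" using others_span[OF G] by blast
  define F where "F P l = Const (c P) * others P * (f l - (contr P f - Lin (rp P) * h P) * Const (w P $ l))" for P l
  define m where "m = vfield (\<lambda>l. \<Sum>P\<in>Z. F P l)"
  have ch: "contr P f - Lin (rp P) * h P \<in> hom_part (int k)" if "P \<in> Z" for P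
    unfolding contr_def by (intro hom_part_diff hom_part_sum hom_part_scale fh h that)
  have Fh: "F P l \<in> hom_part (int (k + N0))" if P: "P \<in> Z" for P l
  proof -
    have "Const (c P) * others P \<in> hom_part (int N0)" by (intro hom_part_scale others_hom P)
    moreover have "(contr P f - Lin (rp P) * h P) * Const (w P $ l) \<in> hom_part (int k)"
      using hom_part_mult[OF ch[OF P] hom_part_Const, of "w P $ l"] by simp
    then have "f l - (contr P f - Lin (rp P) * h P) * Const (w P $ l) \<in> hom_part (int k)" by (intro hom_part_diff fh)
    ultimately have "F P l \<in> hom_part (int N0 + int k)" unfolding F_def by (rule hom_part_mult)
    then show ?thesis by (simp add: add.commute)
  qed
  have cF: "contr P' (F P) = Const (c P) * others P * (contr P' f - (contr P f - Lin (rp P) * h P) * Const (rp P' \<odot> w P))" for P P'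
    unfolding F_def[abs_def] contr_mult contr_diff contr_Const ..
  have "Lin (rp P') dvd contr P' (F P)" if P: "P \<in> Z" "P' \<in> Z" for P P'
  proof (cases "P' = P")
    case True
    then have "contr P' (F P) = Lin (rp P') * (Const (c P) * others P * h P)"
      unfolding cF using w[OF P(1)] by (simp add: algebra_simps)
    then show ?thesis by simp
  next
    case False
    then have "Lin (rp P') dvd others P" using others_dvd P by blast
    then show ?thesis unfolding cF by (metis dvd_mult dvd_mult2)
  qed
  then have "m \<in> log_derivations_part A (int (k + N0))"
    unfolding m_def log_part_iff contr_sum using Fh by (auto intro!: dvd_sum hom_part_sum)
  moreover have "res (m (Var l)) = res G * p l" for l
  proof -
    have "res (F P l) = res (Const (c P) * others P) * p l" if "P \<in> Z" for P
    proof -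
      have "res (contr P f - Lin (rp P) * h P) = 0" using h(2)[OF that] by (simp only: res_simps diff_self)
      then show ?thesis unfolding F_def by (simp add: res_simps(3,8) fr)
    qed
    then have "res (m (Var l)) = (\<Sum>P\<in>Z. res (Const (c P) * others P)) * p l"
      by (simp add: m_def res_simps(2) sum_distrib_right)
    moreover have "res G = (\<Sum>P\<in>Z. res (Const (c P) * others P))"
      using res_I[OF c] by (simp add: res_simps(2,8))
    ultimately show ?thesis by simp
  qed
  ultimately show ?thesis by blast
qed

lemma log_derivations_add: "m \<in> log_derivations A \<Longrightarrow> m' \<in> log_derivations A \<Longrightarrow> m + m' \<in> log_derivations A"
  and log_derivations_smul: "m \<in> log_derivations A \<Longrightarrow> smul r m \<in> log_derivations A"
  by (auto simp: log_derivations_def derivation_def smul_def algebra_simps image_subset_iff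
      intro: vanishing_ideal_add vanishing_ideal_mult)

theorem sheaf_model_log_derivations:
  "sheaf_model (log_derivations_part A) N U V res (\<lambda>m i. res (m (Var i))) (\<lambda>_. 0) Bd eps N0"
proof
  show "m + m' \<in> log_derivations_part A j" if "m \<in> log_derivations_part A j" "m' \<in> log_derivations_part A j" for m m' j
    using that log_derivations_add by (auto simp: log_derivations_part_def hom_part_add)
  show "smul r m \<in> log_derivations_part A (i + j)" if "r \<in> hom_part i" "m \<in> log_derivations_part A j" for r m i j
  proof -
    have "smul r m \<in> log_derivations A" using that(2) log_derivations_smul by (simp add: log_derivations_part_def)
    then show ?thesis using that hom_part_mult[OF that(1)] by (simp add: log_derivations_part_def smul_def)
  qed
  show "fun_mod.subspace N" by (rule N_subspace)
  show "U \<in> hom_part 1" "V \<in> hom_part 1" by (rule hom_part_Lin)+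
  show "res (f * g) = res f * res g" for f g by (simp add: res_simps)
  show "res U = 1" "res V = [:0, 1:]" by (rule res_U, rule res_V)
  show "res (Const c) = [:c:]" for c by (simp add: res_simps)
  show "res ((m + m') (Var y)) = res (m (Var y)) + res (m' (Var y))" for m m' y by (simp add: res_simps)
  show "res (smul r m (Var y)) = res r * res (m (Var y))" for r m y by (simp add: smul_def res_simps)
  show "degle (res (m (Var y))) (int k - 0)" if "m \<in> log_derivations_part A (int k)" for m k y
    using that hom_part_Var[of y] res_degle unfolding log_derivations_part_def by auto
  show "(\<lambda>i. res (m (Var i))) \<in> Bd" if m: "m \<in> log_derivations_part A (int k)" for m k
    unfolding Bd_def
  proof (intro CollectI ballI)
    fix P assume P: "P \<in> Z"
    have "vfield (\<lambda>i. m (Var i)) \<in> log_derivations_part A (int k)" using m log_part_vfield[OF m] by simp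
    then obtain h where h: "contr P (\<lambda>i. m (Var i)) = Lin (rp P) * h" using P unfolding log_part_iff dvd_def by blast
    have "(\<Sum>i\<in>UNIV. rp P $ i * poly (res (m (Var i))) (\<tau> P)) = poly (res (contr P (\<lambda>i. m (Var i)))) (\<tau> P)"
      by (simp add: contr_def res_simps poly_sum)
    also have "\<dots> = 0" unfolding h using poly_res_Lin_tau[OF P] by (simp add: res_simps)
    finally show "(\<Sum>i\<in>UNIV. rp P $ i * poly (res (m (Var i))) (\<tau> P)) = 0" .
  qed
  show "smul (U ^ N0) m \<in> N \<and> smul (V ^ N0) m \<in> N"
    if "m \<in> log_derivations_part A (int k)" "\<forall>y. res (m (Var y)) = q * eps y" for m k q
    using N_I[OF that] hom_part_power1[OF hom_part_Lin] by blast
  show "\<exists>q. \<forall>y. res (m (Var y)) = q * eps y" if "m \<in> N" for m by (rule N_D[OF that])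
  show "(\<exists>m\<in>log_derivations_part A (int (k + N0)). (\<lambda>i. res (m (Var i))) = p) \<and>
      (\<exists>m\<in>log_derivations_part A (int (k + N0)). \<forall>y. res (m (Var y)) = monom 1 N0 * p y)"
    if p: "p \<in> Bd" "\<forall>y. degle (p y) (int k - 0)" for p k
  proof
    have p': "\<forall>y. degle (p y) (int k)" using p(2) by simp
    show "\<exists>m\<in>log_derivations_part A (int (k + N0)). (\<lambda>i. res (m (Var i))) = p"
      using lift_form[OF p(1) p' hom_part_power1[OF hom_part_Lin, of "e 0"]] by (simp add: res_U_power fun_eq_iff)
    show "\<exists>m\<in>log_derivations_part A (int (k + N0)). \<forall>y. res (m (Var y)) = monom 1 N0 * p y"
      using lift_form[OF p(1) p' hom_part_power1[OF hom_part_Lin, of "e 1"]] by (simp add: res_V_power)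
  qed
  show "degle (eps y) (1 - 0)" for y
    using degle_nat[of "eps y" 1] by (simp add: eps_def)
  show "(\<lambda>y. p y + p' y) \<in> Bd" if "p \<in> Bd" "p' \<in> Bd" for p p'
    using that by (simp add: Bd_def distrib_left sum.distrib)
  show "(\<lambda>y. q * p y) \<in> Bd" if "p \<in> Bd" for p q
  proof -
    have "(\<Sum>i\<in>UNIV. rp P $ i * poly (q * p i) (\<tau> P)) = poly q (\<tau> P) * (\<Sum>i\<in>UNIV. rp P $ i * poly (p i) (\<tau> P))" for P
      by (simp add: sum_distrib_left mult.left_commute)
    then show ?thesis using that by (simp add: Bd_def)
  qed
  show "eps \<in> Bd"
    unfolding Bd_def
  proof (intro CollectI ballI)
    fix P assume P: "P \<in> Z"
    have "(\<Sum>i\<in>UNIV. rp P $ i * poly (eps i) (\<tau> P)) = rp P \<odot> b 0 + \<tau> P * (rp P \<odot> b 1)"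
      by (simp add: eps_def dotp_def algebra_simps sum.distrib sum_distrib_left)
    then show "(\<Sum>i\<in>UNIV. rp P $ i * poly (eps i) (\<tau> P)) = 0" using tau_zero[OF P] by simp
  qed
qed

end

context general_line
begin

text \<open>On a free module fields lift by homogenising each component, so no auxiliary factor
  (\<open>N0 = 0\<close>) and no indeterminacy (\<open>eps = 0\<close>) occur.\<close>

theorem sheaf_model_twist:
  "sheaf_model (twist_sum J a) (twist_rel J I) U V res (\<lambda>h i. if i \<in> J then res (h i) else 0) a
     {p. \<forall>i. i \<notin> J \<longrightarrow> p i = 0} (\<lambda>_. 0) 0"
proof
  show "m + m' \<in> twist_sum J a j" if "m \<in> twist_sum J a j" "m' \<in> twist_sum J a j" for m m' j
    using that by (auto simp: twist_sum_def hom_part_add)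
  show "smul r m \<in> twist_sum J a (i + j)" if "r \<in> hom_part i" "m \<in> twist_sum J a j" for r m i j
    using that hom_part_mult[OF that(1)] by (auto simp: twist_sum_def smul_def add_diff_eq[symmetric])
  show "fun_mod.subspace (twist_rel J I)"
    unfolding fun_mod.subspace_def by (auto simp: twist_rel_def smul_def I_0 I_add I_mult)
  show "U \<in> hom_part 1" "V \<in> hom_part 1" by (rule hom_part_Lin)+
  show "res (f * g) = res f * res g" for f g by (simp add: res_simps)
  show "res U = 1" "res V = [:0, 1:]" by (rule res_U, rule res_V)
  show "res (Const c) = [:c:]" for c by (simp add: res_simps)
  show "(if y \<in> J then res ((m + m') y) else 0) = (if y \<in> J then res (m y) else 0) + (if y \<in> J then res (m' y) else 0)" for m m' y
    by (simp add: res_simps)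
  show "(if y \<in> J then res (smul r m y) else 0) = res r * (if y \<in> J then res (m y) else 0)" for r m y
    by (simp add: smul_def res_simps)
  show "degle (if y \<in> J then res (m y) else 0) (int k - a y)" if m: "m \<in> twist_sum J a (int k)" for m k y
  proof (cases "y \<in> J")
    case True
    then have my: "m y \<in> hom_part (int k - a y)" using m by (simp add: twist_sum_def)
    show ?thesis
    proof (cases "int k - a y < 0")
      case True
      then have "m y = 0" using my by (simp add: hom_part_neg)
      then show ?thesis by simp
    next
      case False
      then obtain l where l: "int k - a y = int l" by (metis not_less zero_le_imp_eq_int)
      then show ?thesis using True my res_degle by simp
    qed
  qed simp
  show "(\<lambda>i. if i \<in> J then res (m i) else 0) \<in> {p. \<forall>i. i \<notin> J \<longrightarrow> p i = 0}" for m by simp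
  show "smul (U ^ 0) m \<in> twist_rel J I \<and> smul (V ^ 0) m \<in> twist_rel J I"
    if m: "m \<in> twist_sum J a (int k)" and q: "\<forall>y. (if y \<in> J then res (m y) else 0) = q * 0" for m k q
  proof -
    have "m y \<in> I" if "y \<in> J" for y
    proof (rule res_zero_hom)
      show "m y \<in> hom_part (int k - a y)" using m that by (simp add: twist_sum_def)
      show "res (m y) = 0" using q that by (metis mult_zero_right)
    qed
    then have "m \<in> twist_rel J I" using m by (auto simp: twist_rel_def twist_sum_def)
    then show ?thesis by (simp add: smul_def)
  qed
  show "\<exists>q. \<forall>y. (if y \<in> J then res (m y) else 0) = q * 0" if "m \<in> twist_rel J I" for m
    using that by (auto simp: twist_rel_def res_I)
  show "(\<exists>m\<in>twist_sum J a (int (k + 0)). (\<lambda>i. if i \<in> J then res (m i) else 0) = p) \<and>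
      (\<exists>m\<in>twist_sum J a (int (k + 0)). \<forall>y. (if y \<in> J then res (m y) else 0) = monom 1 0 * p y)"
    if p: "p \<in> {p. \<forall>i. i \<notin> J \<longrightarrow> p i = 0}" "\<forall>y. degle (p y) (int k - a y)" for p k
  proof -
    define m where "m i = (if i \<in> J \<and> int k - a i \<ge> 0 then form (nat (int k - a i)) (p i) else 0)" for i
    have "m \<in> twist_sum J a (int k)" unfolding twist_sum_def
    proof (intro CollectI conjI ballI allI impI)
      fix i
      show "m i \<in> hom_part (int k - a i)" using form_hom[of "nat (int k - a i)" "p i"] by (cases "a i \<le> int k") (simp_all add: m_def)
      show "i \<notin> J \<Longrightarrow> m i = 0" by (simp add: m_def)
    qed
    moreover have "(if i \<in> J then res (m i) else 0) = p i" for i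
    proof (cases "i \<in> J")
      case True
      show ?thesis
      proof (cases "int k - a i \<ge> 0")
        case True
        then have "degree (p i) \<le> nat (int k - a i)" using p(2) by (metis degle_nat int_nat_eq)
        then show ?thesis using \<open>i \<in> J\<close> True by (simp add: m_def res_form)
      next
        case False
        have "p i = 0"
        proof (rule ccontr)
          assume "p i \<noteq> 0"
          then have "coeff (p i) (degree (p i)) \<noteq> 0" by simp
          then have "int (degree (p i)) \<le> int k - a i" using p(2) unfolding degle_def by blast
          then show False using False by simp
        qed
        then show ?thesis using True False by (simp add: m_def)
      qed
    qed (use p in simp)
    then have "(\<lambda>i. if i \<in> J then res (m i) else 0) = p" "\<forall>i. (if i \<in> J then res (m i) else 0) = monom 1 0 * p i"
      by (simp_all only: fun_eq_iff monom_0 one_pCons[symmetric] mult_1_left simp_thms)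
    ultimately show ?thesis unfolding add_0_right by blast
  qed
  show "degle (0 :: 'k poly) (1 - a y)" for y by simp
  show "(\<lambda>y. p y + p' y) \<in> {p. \<forall>i. i \<notin> J \<longrightarrow> p i = 0}"
    if "p \<in> {p. \<forall>i. i \<notin> J \<longrightarrow> p i = 0}" "p' \<in> {p. \<forall>i. i \<notin> J \<longrightarrow> p i = 0}" for p p' :: "nat \<Rightarrow> 'k poly"
    using that by simp
  show "(\<lambda>y. q * p y) \<in> {p. \<forall>i. i \<notin> J \<longrightarrow> p i = 0}"
    if "p \<in> {p. \<forall>i. i \<notin> J \<longrightarrow> p i = 0}" for p :: "nat \<Rightarrow> 'k poly" and q
    using that by simp
  show "(\<lambda>_. 0) \<in> {p :: nat \<Rightarrow> 'k poly. \<forall>i. i \<notin> J \<longrightarrow> p i = 0}" by simp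
qed

end

section \<open>Dimension count\<close>

definition pscale :: "'k::field \<Rightarrow> ('y \<Rightarrow> 'k poly) \<Rightarrow> 'y \<Rightarrow> 'k poly" where
  "pscale c p = (\<lambda>y. smult c (p y))"

interpretation pv: vector_space "pscale :: 'k::field \<Rightarrow> ('y \<Rightarrow> 'k poly) \<Rightarrow> 'y \<Rightarrow> 'k poly"
  by standard (simp_all add: pscale_def fun_eq_iff smult_add_right smult_add_left)

declare pv.scale_scale [simp del]

text \<open>Rank-nullity for a map that is linear on \<open>T\<close> only; nothing is known about
  the transported map outside its subspace.\<close>

lemma dim_kernel_image:
  fixes f :: "('y \<Rightarrow> 'k::field poly) \<Rightarrow> 'z \<Rightarrow> 'k poly"
  assumes T: "pv.subspace T" and S: "finite S" "T \<subseteq> pv.span S"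
    and add: "\<And>p q. p \<in> T \<Longrightarrow> q \<in> T \<Longrightarrow> f (p + q) = f p + f q"
    and scale: "\<And>c p. p \<in> T \<Longrightarrow> f (pscale c p) = pscale c (f p)"
  shows "pv.dim T = pv.dim {p \<in> T. f p = 0} + pv.dim (f ` T)"
proof -
  let ?K = "{p \<in> T. f p = 0}"
  have f0: "f 0 = 0" using scale[OF pv.subspace_0[OF T], of 0] by simp
  have sum: "f (\<Sum>x\<in>X. g x) = (\<Sum>x\<in>X. f (g x))" if "\<And>x. x \<in> X \<Longrightarrow> g x \<in> T" for g :: "_ \<Rightarrow> 'y \<Rightarrow> 'k poly" and X
    using that
  proof (induction X rule: infinite_finite_induct)
    case (insert x X)
    then have "f (g x + sum g X) = f (g x) + f (sum g X)" by (intro add pv.subspace_sum[OF T]) auto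
    moreover have "f (sum g X) = (\<Sum>x\<in>X. f (g x))" using insert by blast
    ultimately show ?case by (simp only: sum.insert[OF insert(1,2)])
  qed (simp_all add: f0)
  have K: "pv.subspace ?K"
    unfolding pv.subspace_def using T add scale f0 by (auto simp: pv.subspace_0 pv.subspace_add pv.subspace_scale)
  obtain E where E: "E \<subseteq> ?K" "pv.independent E" "?K \<subseteq> pv.span E" using pv.maximal_independent_subset[of ?K] by blast
  have "E \<subseteq> T" using E by blast
  then obtain B where B: "E \<subseteq> B" "B \<subseteq> T" "pv.independent B" "T \<subseteq> pv.span B"
    using pv.maximal_independent_subset_extend[OF _ E(2)] by metis
  have finB: "finite B" using pv.independent_span_bound[OF S(1) B(3)] B(2) S(2) by blast
  define D where "D = B - E"
  have finD: "finite D" and finE: "finite E" and DT: "D \<subseteq> T" and BDE: "B = D \<union> E" "D \<inter> E = {}"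
    using finB finite_subset[OF B(1)] B by (auto simp: D_def)
  have DTs: "(\<Sum>d\<in>D. pscale (u d) d) \<in> T" for u
    by (intro pv.subspace_sum[OF T] pv.subspace_scale[OF T]) (use DT in blast)
  have fD: "f (\<Sum>d\<in>D. pscale (u d) d) = (\<Sum>d\<in>D. pscale (u d) (f d))" for u
  proof -
    have "f (\<Sum>d\<in>D. pscale (u d) d) = (\<Sum>d\<in>D. f (pscale (u d) d))"
      by (rule sum) (use DT pv.subspace_scale[OF T] in blast)
    also have "\<dots> = (\<Sum>d\<in>D. pscale (u d) (f d))" by (rule sum.cong) (use DT scale in auto)
    finally show ?thesis .
  qed
  have key: "u d = 0" if u: "(\<Sum>d\<in>D. pscale (u d) (f d)) = 0" and d: "d \<in> D" for u d
  proof -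
    have "(\<Sum>d\<in>D. pscale (u d) d) \<in> ?K" using fD[of u] u DTs by simp
    then have "(\<Sum>d\<in>D. pscale (u d) d) \<in> pv.span E" using E by blast
    then obtain v where v: "(\<Sum>d\<in>D. pscale (u d) d) = (\<Sum>x\<in>E. pscale (v x) x)"
      unfolding pv.span_finite[OF finE] by blast
    define w where "w x = (if x \<in> D then u x else - v x)" for x
    have "(\<Sum>x\<in>B. pscale (w x) x) = (\<Sum>x\<in>D. pscale (w x) x) + (\<Sum>x\<in>E. pscale (w x) x)"
      unfolding BDE(1) by (rule sum.union_disjoint[OF finD finE BDE(2)])
    also have "(\<Sum>x\<in>D. pscale (w x) x) = (\<Sum>d\<in>D. pscale (u d) d)" by (rule sum.cong) (auto simp: w_def)
    also have "(\<Sum>x\<in>E. pscale (w x) x) = (\<Sum>x\<in>E. - pscale (v x) x)"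
      by (rule sum.cong) (use BDE(2) in \<open>auto simp: w_def pv.scale_minus_left\<close>)
    finally have "(\<Sum>x\<in>B. pscale (w x) x) = 0" by (simp add: v sum_negf zero_fun_def)
    then have "w d = 0" using pv.independentD[OF B(3) finB subset_refl] d BDE(1) by blast
    then show ?thesis using d by (simp add: w_def)
  qed
  have inj: "inj_on f D"
  proof (rule inj_onI, rule ccontr)
    fix x y assume xy: "x \<in> D" "y \<in> D" "f x = f y" "x \<noteq> y"
    define u where "u z = (if z = x then 1 else if z = y then - 1 else 0 :: 'k)" for z
    have "(\<Sum>z\<in>D. pscale (u z) (f z)) = (\<Sum>z\<in>D. (if z = x then f z else 0) + (if z = y then - f z else 0))"
      by (rule sum.cong) (use xy in \<open>auto simp: u_def pv.scale_minus_left\<close>)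
    also have "\<dots> = 0" using xy finD by (simp add: sum.distrib)
    finally have "u x = 0" using key xy(1) by blast
    then show False by (simp add: u_def)
  qed
  have "pv.independent (f ` D)"
  proof
    assume "pv.dependent (f ` D)"
    then obtain u d where "d \<in> D" "u (f d) \<noteq> 0" "(\<Sum>v\<in>f ` D. pscale (u v) v) = 0"
      using finD by (auto simp: pv.dependent_finite)
    then show False using key[of "\<lambda>d. u (f d)" d] by (simp add: sum.reindex[OF inj])
  qed
  moreover have "f ` T \<subseteq> pv.span (f ` D)"
  proof
    fix y assume "y \<in> f ` T"
    then obtain x where x: "x \<in> T" "y = f x" by blast
    then have "x \<in> pv.span B" using B by blast
    then obtain u where u: "x = (\<Sum>v\<in>B. pscale (u v) v)" unfolding pv.span_finite[OF finB] by blast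
    have uE: "(\<Sum>v\<in>E. pscale (u v) v) \<in> ?K"
      by (intro pv.subspace_sum[OF K] pv.subspace_scale[OF K]) (use E in blast)
    have "x = (\<Sum>v\<in>D. pscale (u v) v) + (\<Sum>v\<in>E. pscale (u v) v)"
      unfolding u BDE(1) by (rule sum.union_disjoint[OF finD finE BDE(2)])
    then have "y = (\<Sum>d\<in>D. pscale (u d) (f d))"
      using add[OF DTs, of "\<Sum>v\<in>E. pscale (u v) v" u] uE x(2) fD by simp
    then show "y \<in> pv.span (f ` D)"
      by (simp add: pv.span_sum pv.span_scale pv.span_base)
  qed
  moreover have "f ` D \<subseteq> f ` T" using DT by blast
  ultimately have "pv.dim (f ` T) = card (f ` D)" by (metis pv.basis_card_eq_dim)
  also have "\<dots> = card D" by (rule card_image[OF inj])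
  finally have "pv.dim (f ` T) = card D" .
  moreover have "pv.dim ?K = card E" by (rule pv.basis_card_eq_dim[symmetric, OF E(1,3,2)])
  moreover have "pv.dim T = card B" by (rule pv.basis_card_eq_dim[symmetric, OF B(2,4,3)])
  moreover have "card B = card D + card E" unfolding BDE(1) by (rule card_Un_disjoint[OF finD finE BDE(2)])
  ultimately show ?thesis by simp
qed

text \<open>Dehomogenised sections of a direct sum of line bundles of degrees \<open>k y\<close> on
  the projective line; a negative degree contributes nothing.\<close>

definition Box :: "'y set \<Rightarrow> ('y \<Rightarrow> int) \<Rightarrow> ('y \<Rightarrow> 'k::field poly) set" where
  "Box Y k = {p. (\<forall>y\<in>Y. degle (p y) (k y)) \<and> (\<forall>y. y \<notin> Y \<longrightarrow> p y = 0)}"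

lemma Box_basis:
  fixes k :: "'y \<Rightarrow> int"
  assumes Y: "finite Y"
  shows "\<exists>B :: ('y \<Rightarrow> 'k::field poly) set. finite B \<and> Box Y k \<subseteq> pv.span B" (is ?fin)
    and "pv.dim (Box Y k :: ('y \<Rightarrow> 'k poly) set) = (\<Sum>y\<in>Y. nat (k y + 1))" (is ?dim)
proof -
  define S where "S = Sigma Y (\<lambda>y. {i. int i \<le> k y})"
  have iv: "{i. int i \<le> l} = {..<nat (l + 1)}" for l by auto
  define g :: "'y \<times> nat \<Rightarrow> 'y \<Rightarrow> 'k poly" where "g = (\<lambda>(y, i) y'. if y' = y then monom 1 i else 0)"
  have finS: "finite S" using Y by (simp add: S_def iv)
  have coeff_g: "coeff (g s y) i = (if s = (y, i) then 1 else 0)" for s y i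
    by (cases s) (auto simp: g_def)
  have inj: "inj_on g S"
  proof (rule inj_onI)
    fix s s' assume "g s = g s'"
    then have "coeff (g s (fst s)) (snd s) = coeff (g s' (fst s)) (snd s)" by simp
    then show "s = s'" by (simp add: coeff_g split: if_splits)
  qed
  have coeff_sum': "coeff ((\<Sum>s\<in>S. pscale (u s) (g s)) y) i = (if (y, i) \<in> S then u (y, i) else 0)" for u y i
  proof -
    have "(\<Sum>s\<in>X. pscale (u s) (g s)) y = (\<Sum>s\<in>X. smult (u s) (g s y))" for X
      by (induction X rule: infinite_finite_induct) (simp_all add: pscale_def)
    then have "coeff ((\<Sum>s\<in>S. pscale (u s) (g s)) y) i = (\<Sum>s\<in>S. if s = (y, i) then u s else 0)"
      by (simp add: coeff_sum coeff_g if_distrib cong: if_cong)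
    then show ?thesis using finS by simp
  qed
  have sub: "g ` S \<subseteq> Box Y k"
  proof
    fix p assume "p \<in> g ` S"
    then obtain y i where yi: "y \<in> Y" "int i \<le> k y" "p = g (y, i)" by (auto simp: S_def)
    then show "p \<in> Box Y k" by (auto simp: Box_def degle_def coeff_g g_def)
  qed
  have ind: "pv.independent (g ` S)"
  proof
    assume "pv.dependent (g ` S)"
    then obtain u s where s: "s \<in> S" "u (g s) \<noteq> 0" "(\<Sum>v\<in>g ` S. pscale (u v) v) = 0"
      using finS by (auto simp: pv.dependent_finite)
    then have "(\<Sum>s\<in>S. pscale (u (g s)) (g s)) = 0" by (simp add: sum.reindex[OF inj])
    then have "coeff ((\<Sum>s\<in>S. pscale (u (g s)) (g s)) (fst s)) (snd s) = 0" by simp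
    then show False unfolding coeff_sum' using s by simp
  qed
  have span: "Box Y k \<subseteq> pv.span (g ` S)"
  proof
    fix p :: "'y \<Rightarrow> 'k poly" assume p: "p \<in> Box Y k"
    have "p = (\<Sum>s\<in>S. pscale (coeff (p (fst s)) (snd s)) (g s))"
    proof (rule ext, rule poly_eqI)
      fix y i
      have "coeff (p y) i = 0" if "(y, i) \<notin> S"
      proof (rule ccontr)
        assume nz: "coeff (p y) i \<noteq> 0"
        then have "y \<in> Y" using p by (auto simp: Box_def)
        then have "int i \<le> k y" using p nz by (auto simp: Box_def degle_def)
        then show False using that \<open>y \<in> Y\<close> by (auto simp: S_def)
      qed
      then show "coeff (p y) i = coeff ((\<Sum>s\<in>S. pscale (coeff (p (fst s)) (snd s)) (g s)) y) i"
        unfolding coeff_sum' by simp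
    qed
    moreover have "(\<Sum>s\<in>S. pscale (coeff (p (fst s)) (snd s)) (g s)) \<in> pv.span (g ` S)"
      by (intro pv.span_sum pv.span_scale pv.span_base) blast
    ultimately show "p \<in> pv.span (g ` S)" by metis
  qed
  show ?fin using span finS by blast
  have "pv.dim (Box Y k :: ('y \<Rightarrow> 'k poly) set) = card (g ` S)"
    by (rule pv.basis_card_eq_dim[symmetric, OF sub span ind])
  also have "\<dots> = card S" by (rule card_image[OF inj])
  also have "\<dots> = (\<Sum>y\<in>Y. nat (k y + 1))" using Y by (simp add: S_def iv)
  finally show ?dim .
qed

lemma subspace_Box: "pv.subspace (Box Y k)"
  unfolding pv.subspace_def by (auto simp: Box_def pscale_def degle_add degle_smult)

context general_line_arrangement
begin

text \<open>The form \<open>\<Sum> x\<^sub>i g\<^sub>i(x \<odot> b 1, - x \<odot> b 0)\<close>, where the binary forms \<open>g\<^sub>i\<close> of degree \<open>d - 1\<close>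
  are the homogenised \<open>p i\<close>. Its value at a point of \<open>Z\<close> is the obstruction to extending \<open>p\<close>
  to a logarithmic derivation.\<close>

definition pform :: "nat \<Rightarrow> ('v \<Rightarrow> 'k poly) \<Rightarrow> ('v, 'k) mpoly" where
  "pform j p = (\<Sum>i\<in>UNIV. Var i * (\<Sum>t\<le>j. Const (coeff (p i) t) * ((- Lin (b 0)) ^ t * Lin (b 1) ^ (j - t))))"

definition ev_at :: "('k ^ 'v) set \<Rightarrow> ('v \<Rightarrow> 'k poly) \<Rightarrow> 'k" where
  "ev_at P p = (\<Sum>i\<in>UNIV. rp P $ i * poly (p i) (\<tau> P))"

lemma ev_pform:
  assumes P: "P \<in> Z" and p: "\<forall>i. degle (p i) (int j)"
  shows "ev (pform j p) (rp P) = (rp P \<odot> b 1) ^ j * ev_at P p"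
proof -
  let ?\<beta> = "rp P \<odot> b 1" and ?\<alpha> = "- (rp P \<odot> b 0)"
  \<comment> \<open>The two arguments of the binary forms at \<open>rp P\<close> are proportional to
    \<open>(1, \<tau> P)\<close>, so the homogenised polynomials are evaluated at
    \<open>\<tau> P\<close> up to the factor \<open>?\<beta> ^ j\<close>.\<close>
  have a: "?\<alpha> = \<tau> P * ?\<beta>" using Zb[OF P] by (simp add: \<tau>_def)
  have "(\<Sum>t\<le>j. coeff (p i) t * (?\<alpha> ^ t * ?\<beta> ^ (j - t))) = ?\<beta> ^ j * poly (p i) (\<tau> P)" for i
  proof -
    have "poly (p i) (\<tau> P) = (\<Sum>t\<le>j. coeff (p i) t * \<tau> P ^ t)"
    proof -
      have "degree (p i) \<le> j" using p by (simp add: degle_nat)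
      from poly_as_sum_of_monoms'[OF this] have "poly (p i) (\<tau> P) = poly (\<Sum>t\<le>j. monom (coeff (p i) t) t) (\<tau> P)" by simp
      then show ?thesis by (simp add: poly_sum poly_monom)
    qed
    moreover have "?\<alpha> ^ t * ?\<beta> ^ (j - t) = ?\<beta> ^ j * \<tau> P ^ t" if "t \<le> j" for t
    proof -
      have "?\<beta> ^ j = ?\<beta> ^ t * ?\<beta> ^ (j - t)" using that by (simp flip: power_add)
      then show ?thesis unfolding a by (simp add: power_mult_distrib)
    qed
    ultimately show ?thesis by (simp add: sum_distrib_left mult.left_commute)
  qed
  moreover have "ev (pform j p) (rp P) = (\<Sum>i\<in>UNIV. rp P $ i * (\<Sum>t\<le>j. coeff (p i) t * (?\<alpha> ^ t * ?\<beta> ^ (j - t))))"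
    unfolding pform_def meval_simps meval_Lin dotp_commute[of "b _" "rp P"] ..
  ultimately show ?thesis by (simp only: ev_at_def sum_distrib_left mult.left_commute)
qed

lemma pform_Jf: "pform j p \<in> Jf b (Suc j)"
  unfolding pform_def sum_distrib_left
proof (intro mpoly_vs.subspace_sum subspace_Jf)
  fix i t assume t: "t \<in> {..j}"
  have "Lin (axis i 1) * (Lin (b 0) ^ t * Lin (b 1) ^ (j - t)) \<in> Jf b (Suc j)"
    unfolding Jf_def
  proof (rule mpoly_vs.span_base)
    have "Suc (t + (j - t)) = Suc j" using t by simp
    then show "Lin (axis i 1) * (Lin (b 0) ^ t * Lin (b 1) ^ (j - t)) \<in> {Lin w * (Lin (b 0) ^ i * Lin (b 1) ^ k) |w i k. Suc (i + k) = Suc j}"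
      by blast
  qed
  then have "Const (coeff (p i) t * (- 1) ^ t) * (Lin (axis i 1) * (Lin (b 0) ^ t * Lin (b 1) ^ (j - t))) \<in> Jf b (Suc j)"
    by (rule mpoly_vs.subspace_scale[OF subspace_Jf])
  moreover have "(- Lin (b 0)) ^ t = Const ((- 1) ^ t) * Lin (b 0) ^ t"
    by (cases "even t") (simp_all add: Const_minus power_minus_odd)
  ultimately show "Var i * (Const (coeff (p i) t) * ((- Lin (b 0)) ^ t * Lin (b 1) ^ (j - t))) \<in> Jf b (Suc j)"
    by (simp add: Lin_axis Const_mult mult_ac)
qed

lemma Jf_pform:
  assumes "F \<in> Jf b (Suc j)"
  shows "\<exists>p. (\<forall>i. degle (p i) (int j)) \<and> (\<forall>P\<in>Z. ev F (rp P) = (rp P \<odot> b 1) ^ j * ev_at P p)"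
  using assms unfolding Jf_def
proof (induction rule: mpoly_vs.span_induct_alt)
  case base
  show ?case by (rule exI[of _ "\<lambda>_. 0"]) (simp add: ev_at_def)
next
  case (step c x y)
  then obtain w s t where x: "x = Lin w * (Lin (b 0) ^ s * Lin (b 1) ^ t)" "Suc (s + t) = Suc j" by blast
  obtain p where p: "\<forall>i. degle (p i) (int j)" "\<forall>P\<in>Z. ev y (rp P) = (rp P \<odot> b 1) ^ j * ev_at P p" using step(2) by blast
  \<comment> \<open>The sign compensates for the substitution of \<open>- Lin (b 0)\<close> in the
    homogenisation.\<close>
  define p' where "p' i = monom (c * w $ i * (- 1) ^ s) s + p i" for i
  have "degle (p' i) (int j)" for i
  proof -
    have "degree (monom (c * w $ i * (- 1) ^ s) s) \<le> j" using x(2) degree_monom_le[of "c * w $ i * (- 1) ^ s" s] by linarith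
    then show ?thesis unfolding p'_def by (intro degle_add) (use p(1) in \<open>simp_all add: degle_nat\<close>)
  qed
  moreover have "ev (Const c * x + y) (rp P) = (rp P \<odot> b 1) ^ j * ev_at P p'" if P: "P \<in> Z" for P
  proof -
    let ?\<beta> = "rp P \<odot> b 1"
    have a: "rp P \<odot> b 0 = - 1 * \<tau> P * ?\<beta>" using Zb[OF P] by (simp add: \<tau>_def)
    have "ev_at P p' = (\<Sum>i\<in>UNIV. rp P $ i * (c * w $ i * (- 1) ^ s * \<tau> P ^ s)) + ev_at P p"
      by (simp add: ev_at_def p'_def poly_monom distrib_left sum.distrib)
    also have "(\<Sum>i\<in>UNIV. rp P $ i * (c * w $ i * (- 1) ^ s * \<tau> P ^ s)) = c * (w \<odot> rp P) * ((- 1) ^ s * \<tau> P ^ s)"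
      by (simp add: dotp_def sum_distrib_left sum_distrib_right mult_ac)
    finally have 1: "ev_at P p' = c * (w \<odot> rp P) * ((- 1) ^ s * \<tau> P ^ s) + ev_at P p" .
    have "ev x (rp P) = (w \<odot> rp P) * ((rp P \<odot> b 0) ^ s * ?\<beta> ^ t)"
      by (simp add: x(1) meval_simps meval_Lin dotp_commute[of _ "rp P"])
    also have "(rp P \<odot> b 0) ^ s * ?\<beta> ^ t = ?\<beta> ^ j * ((- 1) ^ s * \<tau> P ^ s)"
    proof -
      have "?\<beta> ^ j = ?\<beta> ^ s * ?\<beta> ^ t" using x(2) by (simp flip: power_add)
      moreover have "(rp P \<odot> b 0) ^ s = (- 1) ^ s * \<tau> P ^ s * ?\<beta> ^ s" unfolding a power_mult_distrib ..
      ultimately show ?thesis by (simp only: mult_ac)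
    qed
    finally have 2: "ev x (rp P) = (w \<odot> rp P) * (?\<beta> ^ j * ((- 1) ^ s * \<tau> P ^ s))" .
    have "ev y (rp P) = ?\<beta> ^ j * ev_at P p" using p(2) P by blast
    then show ?thesis by (simp add: meval_simps 1 2 algebra_simps)
  qed
  ultimately show ?case by blast
qed

text \<open>Rank-nullity relates four spaces: all tuples of degree at most \<open>j\<close>, the
  tangent ones among them, the Euler multiples, and the sections of the split bundle. The tangent
  ones have codimension \<open>card X\<close>; modulo the Euler multiples they become the
  sections.\<close>

lemma dim_T:
  assumes X: "X \<subseteq> Z" "indep_on (Jf b (Suc j)) X"
    and max: "\<And>F. F \<in> Jf b (Suc j) \<Longrightarrow> (\<And>P. P \<in> X \<Longrightarrow> ev F (rp P) = 0) \<Longrightarrow> (\<forall>P\<in>Z. ev F (rp P) = 0)"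
    and iso: "sheaf_iso (log_derivations_part (dual_arrangement Z)) (D0_restrict_rel (dual_arrangement Z) I)
      (twist_sum J a) (twist_rel J I)" and J: "finite J"
  shows "(\<Sum>i\<in>J. nat (int j - a i + 1)) + card X + j = CARD('v) * Suc j"
proof -
  let ?P = "Box UNIV (\<lambda>_. int j) :: ('v \<Rightarrow> 'k poly) set"
  let ?T = "{p \<in> Bd. \<forall>y. degle (p y) (int j - 0)}"
  let ?T' = "Box J (\<lambda>i. int j - a i) :: (nat \<Rightarrow> 'k poly) set"
  interpret D: sheaf_model "log_derivations_part (dual_arrangement Z)" N U V res "\<lambda>m i. res (m (Var i))" "\<lambda>_. 0" Bd eps N0
    by (rule sheaf_model_log_derivations)
  interpret W: sheaf_model "twist_sum J a" "twist_rel J I" U V res "\<lambda>h i. if i \<in> J then res (h i) else 0" a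
     "{p. \<forall>i. i \<notin> J \<longrightarrow> p i = 0}" "\<lambda>_. 0" 0 by (rule sheaf_model_twist)
  have finA: "finite X" using X by (simp add: indep_on_def)
  have T_eq: "?T = D.T j" by (simp add: D.T_def)
  have T'_eq: "?T' = W.T j" by (auto simp: W.T_def Box_def) 
  obtain \<Psi> where \<Psi>: "\<forall>p\<in>?T. \<Psi> p \<in> ?T'" "?T' \<subseteq> \<Psi> ` ?T"
    "\<forall>p\<in>?T. \<forall>p'\<in>?T. \<Psi> (\<lambda>y. p y + p' y) = (\<lambda>y. \<Psi> p y + \<Psi> p' y)"
    "\<forall>p\<in>?T. \<forall>c. \<Psi> (\<lambda>y. smult c (p y)) = (\<lambda>y. smult c (\<Psi> p y))"
    "\<forall>p\<in>?T. \<Psi> p = (\<lambda>y. 0) \<longleftrightarrow> (\<exists>q. \<forall>y. p y = q * eps y)"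
    using sheaf_iso_twisted_sections[OF sheaf_model_log_derivations sheaf_model_twist iso T_eq T'_eq] by blast
  have TP: "?T \<subseteq> ?P" by (auto simp: Box_def)
  have T_iff: "p \<in> ?T \<longleftrightarrow> p \<in> ?P \<and> (\<forall>P\<in>Z. ev_at P p = 0)" for p by (auto simp: Box_def Bd_def ev_at_def)
  have ev_add: "ev_at P (p + q) = ev_at P p + ev_at P q" for P p q
    by (simp add: ev_at_def distrib_left sum.distrib)
  have ev_scale: "ev_at P (pscale c p) = c * ev_at P p" for P p c
    by (simp add: ev_at_def pscale_def sum_distrib_left mult.left_commute)
  have subT: "pv.subspace ?T"
  proof -
    have "?T = {p \<in> ?P. \<forall>P\<in>Z. ev_at P p = 0}" using T_iff by blast
    moreover have "ev_at P 0 = 0" for P by (simp add: ev_at_def)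
    moreover have PB: "pv.subspace ?P" by (rule subspace_Box)
    ultimately show ?thesis unfolding pv.subspace_def
      using pv.subspace_0[OF PB] pv.subspace_add[OF PB] pv.subspace_scale[OF PB]
      by (simp add: ev_add ev_scale)
  qed
  have "\<exists>S. finite S \<and> ?P \<subseteq> pv.span S" by (rule Box_basis(1)) simp
  then obtain S where S: "finite S" "?P \<subseteq> pv.span S" by blast

  have 1: "pv.dim ?T = pv.dim {p \<in> ?T. \<Psi> p = 0} + pv.dim ?T'"
  proof -
    have "pv.dim ?T = pv.dim {p \<in> ?T. \<Psi> p = 0} + pv.dim (\<Psi> ` ?T)"
    proof (rule dim_kernel_image[OF subT S(1)])
      show "?T \<subseteq> pv.span S" using TP S(2) by blast
      show "\<Psi> (p + q) = \<Psi> p + \<Psi> q" if "p \<in> ?T" "q \<in> ?T" for p q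
        using \<Psi>(3) that by (simp add: plus_fun_def)
      show "\<Psi> (pscale c p) = pscale c (\<Psi> p)" if "p \<in> ?T" for c p
        using \<Psi>(4) that by (simp add: pscale_def)
    qed
    moreover have "\<Psi> ` ?T = ?T'" using \<Psi>(1,2) by blast
    ultimately show ?thesis by simp
  qed

  \<comment> \<open>The kernel consists of the \<open>q * eps\<close> with
    \<open>degree q < j\<close>, and \<open>q\<close> is determined by its multiple because some
    \<open>eps i\<close> is nonzero.\<close>
  have 2: "pv.dim {p \<in> ?T. \<Psi> p = 0} = j"
  proof -
    let ?B = "Box {()} (\<lambda>_. int j - 1) :: (unit \<Rightarrow> 'k poly) set"
    define f where "f q = (\<lambda>i. q () * eps i)" for q :: "unit \<Rightarrow> 'k poly"
    have "\<exists>S'. finite S' \<and> ?B \<subseteq> pv.span S'" by (rule Box_basis(1)) simp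
    then obtain S' where S': "finite S'" "?B \<subseteq> pv.span S'" by blast
    have "pv.dim ?B = pv.dim {q \<in> ?B. f q = 0} + pv.dim (f ` ?B)"
      by (rule dim_kernel_image[OF subspace_Box S'])
        (simp_all add: f_def fun_eq_iff pscale_def distrib_right)
    moreover have "pv.dim ?B = j" using Box_basis(2)[of "{()}" "\<lambda>_. int j - 1"] by simp
    moreover have "{q \<in> ?B. f q = 0} \<subseteq> {0}"
    proof clarify
      fix q :: "unit \<Rightarrow> 'k poly" assume "f q = 0"
      moreover obtain i where "b 1 $ i \<noteq> 0" using eps_nz by blast
      ultimately have "q () * eps i = 0" "eps i \<noteq> 0" by (auto simp: f_def fun_eq_iff eps_def)
      then show "q = 0" by (simp add: fun_eq_iff)
    qed
    then have "pv.dim {q \<in> ?B. f q = 0} \<le> card ({} :: (unit \<Rightarrow> 'k poly) set)"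
      by (intro pv.dim_le_card) (simp_all add: pv.span_empty)
    moreover have "f ` ?B = {p \<in> ?T. \<Psi> p = 0}"
    proof
      have degB: "degle (q ()) (int j - 1)" if "q \<in> ?B" for q using that by (simp add: Box_def)
      show "f ` ?B \<subseteq> {p \<in> ?T. \<Psi> p = 0}"
      proof
        fix p assume "p \<in> f ` ?B"
        then obtain q where q: "q \<in> ?B" "p = f q" by blast
        have "p \<in> Bd" unfolding q(2) f_def by (rule D.Bd_mult[OF D.Bd_eps])
        moreover have "degle (p i) (int j)" for i
          using degle_mult[OF degB[OF q(1)] D.eps_deg[of i]] by (simp add: q(2) f_def)
        ultimately have pT: "p \<in> ?T" by simp
        moreover have "\<exists>q. \<forall>y. p y = q * eps y" using q(2) by (auto simp: f_def)
        then have "\<Psi> p = (\<lambda>y. 0)" using \<Psi>(5) pT by blast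
        ultimately show "p \<in> {p \<in> ?T. \<Psi> p = 0}" by (simp add: zero_fun_def)
      qed
      show "{p \<in> ?T. \<Psi> p = 0} \<subseteq> f ` ?B"
      proof
        fix p assume p: "p \<in> {p \<in> ?T. \<Psi> p = 0}"
        then have "p \<in> ?T" "\<Psi> p = (\<lambda>y. 0)" by (simp_all add: zero_fun_def)
        then obtain q where q: "\<forall>y. p y = q * eps y" using \<Psi>(5) by blast
        have "\<forall>i. degle (q * eps i) (int j)" using p q by auto
        then have dq: "q = 0 \<or> degree q < j" by (rule degle_eps_iff)
        have "degle q (int j - 1)"
        proof (cases "q = 0")
          case False
          then have "degle q (int (j - 1))" unfolding degle_nat using dq by auto
          then show ?thesis using dq False by (elim degle_mono) auto
        qed simp
        then have "(\<lambda>_. q) \<in> ?B" by (simp add: Box_def)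
        moreover have "p = f (\<lambda>_. q)" using q by (simp add: f_def fun_eq_iff)
        ultimately show "p \<in> f ` ?B" by blast
      qed
    qed
    ultimately show ?thesis by simp
  qed

  have 3: "pv.dim ?P = pv.dim ?T + card X"
  proof -
    \<comment> \<open>Values are stored as constant polynomials so that the same vector space
      structure applies. Independence of \<open>X\<close> makes \<open>f\<close> surjective, and
      maximality of the conditions makes its kernel the tangent tuples.\<close>
    define f where "f p = (\<lambda>P. if P \<in> X then [:ev_at P p:] else 0)" for p
    have "pv.dim ?P = pv.dim {p \<in> ?P. f p = 0} + pv.dim (f ` ?P)"
      by (rule dim_kernel_image[OF subspace_Box S])
        (simp_all add: f_def fun_eq_iff ev_add ev_scale[unfolded pscale_def] pscale_def)
    moreover have "{p \<in> ?P. f p = 0} = ?T"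
    proof -
      have "(\<forall>P\<in>Z. ev_at P p = 0) \<longleftrightarrow> f p = 0" if p: "p \<in> ?P" for p
      proof
        assume "\<forall>P\<in>Z. ev_at P p = 0"
        then show "f p = 0" using X(1) by (auto simp: f_def fun_eq_iff)
      next
        assume f: "f p = 0"
        have dp: "\<forall>i. degle (p i) (int j)" using p by (simp add: Box_def)
        have "ev (pform j p) (rp P) = 0" if "P \<in> X" for P
        proof -
          have "f p P = 0" using f by simp
          then have "ev_at P p = 0" using that by (simp add: f_def)
          then show ?thesis using ev_pform[OF _ dp] that X(1) by auto
        qed
        then have z: "\<forall>P\<in>Z. ev (pform j p) (rp P) = 0" using max[OF pform_Jf] by blast
        show "\<forall>P\<in>Z. ev_at P p = 0"
        proof
          fix P assume P: "P \<in> Z"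
          then have "(rp P \<odot> b 1) ^ j * ev_at P p = 0" using z ev_pform[OF P dp] by simp
          then show "ev_at P p = 0" using Zb[OF P] by simp
        qed
      qed
      then show ?thesis using T_iff by blast
    qed
    moreover have "f ` ?P = Box X (\<lambda>_. 0)"
    proof
      show "f ` ?P \<subseteq> Box X (\<lambda>_. 0)" by (auto simp: f_def Box_def degle_def coeff_pCons split: nat.splits)
      show "Box X (\<lambda>_. 0) \<subseteq> f ` ?P"
      proof
        fix h :: "('k ^ 'v) set \<Rightarrow> 'k poly" assume h: "h \<in> Box X (\<lambda>_. 0)"
        obtain F where F: "\<And>P. P \<in> X \<Longrightarrow> F P \<in> Jf b (Suc j)"
          "\<And>P P'. P \<in> X \<Longrightarrow> P' \<in> X \<Longrightarrow> ev (F P) (rp P') = (if P' = P then 1 else 0)"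
          using indep_on_dual[OF subspace_Jf X(2)] by blast
        define G where "G = (\<Sum>P\<in>X. Const ((rp P \<odot> b 1) ^ j * coeff (h P) 0) * F P)"
        have "G \<in> Jf b (Suc j)" unfolding G_def
          by (intro mpoly_vs.subspace_sum mpoly_vs.subspace_scale subspace_Jf F)
        then obtain p where p: "\<forall>i. degle (p i) (int j)" "\<forall>P\<in>Z. ev G (rp P) = (rp P \<odot> b 1) ^ j * ev_at P p"
          using Jf_pform by blast
        have evp: "ev_at P p = coeff (h P) 0" if P: "P \<in> X" for P
        proof -
          have "ev G (rp P) = (\<Sum>P'\<in>X. if P' = P then (rp P' \<odot> b 1) ^ j * coeff (h P') 0 else 0)"
            unfolding G_def meval_simps(2) by (rule sum.cong) (use F P in \<open>auto simp: meval_simps\<close>)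
          then have "ev G (rp P) = (rp P \<odot> b 1) ^ j * coeff (h P) 0" using P finA by simp
          moreover have "ev G (rp P) = (rp P \<odot> b 1) ^ j * ev_at P p" "rp P \<odot> b 1 \<noteq> 0" using p(2) P X(1) Zb by auto
          ultimately show ?thesis by simp
        qed
        have "f p = h"
        proof
          fix P
          show "f p P = h P"
          proof (cases "P \<in> X")
            case True
            then have "degle (h P) (int 0)" using h by (simp add: Box_def)
            then have "degree (h P) = 0" by (simp only: degle_nat)
            then have "h P = [:coeff (h P) 0:]" by (metis degree_0_id)
            then show ?thesis using True evp by (simp add: f_def)
          qed (use h in \<open>simp add: f_def Box_def\<close>)
        qed
        moreover have "p \<in> ?P" using p(1) by (simp add: Box_def)
        ultimately show "h \<in> f ` ?P" by blast
      qed
    qed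
    moreover have "pv.dim (Box X (\<lambda>_. 0) :: (('k ^ 'v) set \<Rightarrow> 'k poly) set) = card X"
      using Box_basis(2)[OF finA, of "\<lambda>_. 0"] by simp
    ultimately show ?thesis by simp
  qed
  have 4: "pv.dim ?P = CARD('v) * Suc j"
    using Box_basis(2)[of "UNIV :: 'v set" "\<lambda>_. int j"] by (simp add: nat_add_distrib)
  have "pv.dim ?T' = (\<Sum>i\<in>J. nat (int j - a i + 1))" by (rule Box_basis(2)[OF J])
  then show ?thesis using 1 2 3 4 by simp
qed

end

section \<open>The inequality and its equality case\<close>

lemma generic_True: "2 \<le> CARD('v) \<Longrightarrow> generic 2 (\<lambda>b :: nat \<Rightarrow> 'k::alg_closed_field ^ 'v. True)"
  using generic_nonzero[where \<Phi> = "\<lambda>b. 1" and r = 2, OF polyfun_const] by (rule generic_mono) auto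

lemma general_subspace_conj:
  fixes P Q :: "('k::alg_closed_field ^ 'v) set \<Rightarrow> bool"
  shows "general_subspace r P \<Longrightarrow> general_subspace r Q \<Longrightarrow> general_subspace r (\<lambda>W. P W \<and> Q W)"
  unfolding general_subspace_generic by (rule generic_conj)

lemma general_subspace_ball:
  fixes P :: "'i \<Rightarrow> ('k::alg_closed_field ^ 'v) set \<Rightarrow> bool"
  shows "finite A \<Longrightarrow> (\<And>i. i \<in> A \<Longrightarrow> general_subspace r (P i)) \<Longrightarrow> A \<noteq> {} \<Longrightarrow>
    general_subspace r (\<lambda>W. \<forall>i\<in>A. P i W)"
  unfolding general_subspace_generic by (rule generic_ball)

lemma generic_dotp_nonzero:
  fixes x :: "'k::alg_closed_field ^ 'v"
  assumes "x \<noteq> 0" "2 \<le> CARD('v)"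
  shows "generic 2 (\<lambda>b. b i \<odot> x \<noteq> 0)"
proof -
  obtain e where "e \<odot> x = 1" using exists_functional_separating[of x "{}"] assms(1) by auto
  then show ?thesis using generic_nonzero[OF polyfun_b0[of i x], of "\<lambda>_. e"] assms(2) by simp
qed

text \<open>Both conditions are nonvanishing of polynomials in \<open>b\<close>. Distinct points
  have independent coordinate vectors, so functionals can be chosen to make the 2 by 2 determinant
  nonzero.\<close>

lemma generic_line_arrangement:
  fixes Z :: "('k::alg_closed_field ^ 'v) set set"
  assumes Z: "finite Z" "Z \<subseteq> proj_points" "Z \<noteq> {}" and v: "2 \<le> CARD('v)"
  shows "generic 2 (\<lambda>b. \<exists>e. general_line_arrangement b e Z)"
proof -
  let ?d = "\<lambda>P P' b. (rp P \<odot> b 0) * (rp P' \<odot> b 1) - (rp P \<odot> b 1) * (rp P' \<odot> b (0 :: nat))"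
  have "generic 2 (\<lambda>b. \<forall>P\<in>Z. b 1 \<odot> rp P \<noteq> 0)"
    using Z rp(2) by (intro generic_ball generic_dotp_nonzero v) auto
  moreover have "generic 2 (\<lambda>b. \<forall>x\<in>Z \<times> Z. fst x \<noteq> snd x \<longrightarrow> ?d (fst x) (snd x) b \<noteq> 0)"
  proof (rule generic_ball)
    show "finite (Z \<times> Z)" "Z \<times> Z \<noteq> {}" using Z by auto
    fix x assume "x \<in> Z \<times> Z"
    then obtain P P' where x: "x = (P, P')" "P \<in> Z" "P' \<in> Z" by blast
    show "generic 2 (\<lambda>b. fst x \<noteq> snd x \<longrightarrow> ?d (fst x) (snd x) b \<noteq> 0)"
    proof (cases "P = P'")
      case True
      have "generic 2 (\<lambda>b :: nat \<Rightarrow> 'k ^ 'v. True)" by (rule generic_True[OF v])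
      then show ?thesis by (rule generic_mono) (simp add: x True)
    next
      case False
      have PP: "P \<in> proj_points" "P' \<in> proj_points" using x Z by auto
      have "rp P \<notin> vec.span {rp P'}"
      proof
        assume "rp P \<in> vec.span {rp P'}"
        then have "rp P \<in> P'" using rp(3)[OF PP(2)] by simp
        then show False using rp_eq_imp_eq[OF PP(2,1)] False by simp
      qed
      then obtain e0 where e0: "e0 \<odot> rp P = 1" "e0 \<odot> rp P' = 0" using exists_functional_separating[of "rp P" "{rp P'}"] by auto
      obtain e1 where e1: "e1 \<odot> rp P' = 1" using exists_functional_separating[of "rp P'" "{}"] rp(2)[OF PP(2)] by auto
      have "polyfun (?d P P')" by (intro polyfun_diff polyfun_mult polyfun_dotp polyfun_const polyfun_coord)
      moreover have "?d P P' (\<lambda>j. if j = 0 then e0 else e1) \<noteq> 0" using e0 e1 by (simp add: dotp_commute[of "rp _"])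
      ultimately have "generic 2 (\<lambda>b. ?d P P' b \<noteq> 0)" using v by (rule generic_nonzero)
      then show ?thesis by (rule generic_mono) (simp add: x)
    qed
  qed
  ultimately have "generic 2 (\<lambda>b. (\<forall>P\<in>Z. b 1 \<odot> rp P \<noteq> 0) \<and> (\<forall>x\<in>Z \<times> Z. fst x \<noteq> snd x \<longrightarrow> ?d (fst x) (snd x) b \<noteq> 0))"
    by (rule generic_conj)
  then show ?thesis
  proof (rule generic_mono)
    fix b :: "nat \<Rightarrow> 'k ^ 'v"
    assume fr: "frame 2 b" and b: "(\<forall>P\<in>Z. b 1 \<odot> rp P \<noteq> 0) \<and> (\<forall>x\<in>Z \<times> Z. fst x \<noteq> snd x \<longrightarrow> ?d (fst x) (snd x) b \<noteq> 0)"
    obtain e :: "nat \<Rightarrow> 'k ^ 'v" where "\<And>i j. i < 2 \<Longrightarrow> j < 2 \<Longrightarrow> e i \<odot> b j = (if i = j then 1 else 0)" using frame_dual[OF fr] by blast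
    then have "general_line_arrangement b e Z"
      using fr b Z v by unfold_locales (auto simp: dotp_commute[of "rp _"])
    then show "\<exists>e. general_line_arrangement b e Z" by (rule exI[where x = e])
  qed
qed

text \<open>\<open>card A\<close> is the generic rank r: \<open>A\<close> is independent for some
  frame, hence for a general one, and largest among all sets independent for any frame.\<close>

locale duality =
  fixes Z :: "('k::alg_closed_field ^ 'v) set set" and d :: nat and A
  assumes v: "2 < CARD('v)" and d: "d \<ge> 1" and Z: "finite Z" "Z \<subseteq> proj_points" "Z \<noteq> {}"
    and A: "A \<subseteq> Z" "\<exists>b. indep_on (Jf b d) A"
    and A_max: "A' \<subseteq> Z \<Longrightarrow> indep_on (Jf b d) A' \<Longrightarrow> card A' \<le> card A"
begin

lemma finA: "finite A"
  using A(1) Z(1) finite_subset by blast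

lemma v2: "2 \<le> CARD('v)"
  using v by simp

lemma generic_A: "generic 2 (\<lambda>b. indep_on (Jf b d) A)"
  using A(2) generic_indep_on[OF _ v2] by blast

lemma A_basis:
  assumes b: "indep_on (Jf b d) A" and F: "F \<in> Jf b d" "\<And>P. P \<in> A \<Longrightarrow> ev F (rp P) = 0"
  shows "\<forall>P\<in>Z. ev F (rp P) = 0"
proof (rule ccontr)
  assume "\<not> ?thesis"
  then obtain P where P: "P \<in> Z" "ev F (rp P) \<noteq> 0" by blast
  then have "card (insert P A) \<le> card A"
    using indep_on_insert[OF subspace_Jf b F P(2)] A(1) by (intro A_max) auto
  moreover have "P \<notin> A" using P F(2) by blast
  ultimately show False using finA by simp
qed

lemma splitting_sum:
  fixes a :: "nat \<Rightarrow> int"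
  assumes "has_splitting_type (dual_arrangement Z) a"
  shows "(\<Sum>i=1..CARD('v) - 1. max 0 (int d - a i)) = int ((CARD('v) - 1) * d) + 1 - int (card A)"
proof -
  let ?iso = "\<lambda>L. sheaf_iso (log_derivations_part (dual_arrangement Z)) (D0_restrict_rel (dual_arrangement Z) (vanishing_ideal (proj_set L)))
         (twist_sum {1..CARD('v) - 1} a) (twist_rel {1..CARD('v) - 1} (vanishing_ideal (proj_set L)))"
  have "generic 2 (\<lambda>b. ?iso (vec.span (b ` {..<2})))"
    using assms unfolding has_splitting_type_def general_subspace_generic by blast
  then have "generic 2 (\<lambda>b. ?iso (vec.span (b ` {..<2})) \<and> (\<exists>e. general_line_arrangement b e Z) \<and> indep_on (Jf b d) A)"
    by (intro generic_conj generic_line_arrangement generic_A Z v2)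
  then obtain b e where b: "?iso (vec.span (b ` {..<2}))" "general_line_arrangement b e Z" "indep_on (Jf b d) A"
    using generic_ex by blast
  interpret general_line_arrangement b e Z by (rule b(2))
  obtain j where j: "d = Suc j" using d by (cases d) auto
  obtain n where n: "CARD('v) = Suc n" using v by (cases "CARD('v)") auto
  have sum: "(\<Sum>i=1..CARD('v) - 1. nat (int j - a i + 1)) + card A + j = CARD('v) * Suc j"
    by (rule dim_T) (use A(1) b A_basis in \<open>simp_all add: j I_def L_def\<close>)
  \<comment> \<open>With \<open>d = Suc j\<close>, truncation by \<open>nat\<close> becomes the
    maximum with 0.\<close>
  have "(\<Sum>i=1..CARD('v) - 1. max 0 (int d - a i)) = int (\<Sum>i=1..CARD('v) - 1. nat (int j - a i + 1))"
    unfolding int_sum by (rule sum.cong) (simp_all add: j max_def)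
  moreover have "int (\<Sum>i=1..CARD('v) - 1. nat (int j - a i + 1)) = int ((CARD('v) - 1) * d) + 1 - int (card A)"
    using arg_cong[OF sum, of int] unfolding of_nat_add of_nat_mult by (simp add: j n algebra_simps)
  ultimately show ?thesis by simp
qed

lemma generic_meets:
  fixes H :: "('k ^ 'v) set set"
  assumes "finite H" "\<And>W. W \<in> H \<Longrightarrow> vec.subspace W \<and> W \<noteq> {0}"
  shows "generic 2 (\<lambda>b. \<forall>W\<in>H. \<exists>x\<in>W. b 0 \<odot> x \<noteq> 0)"
proof (cases "H = {}")
  case True
  then show ?thesis using generic_True[OF v2] by simp
next
  case False
  show ?thesis
  proof (rule generic_ball[OF assms(1) _ False])
    fix W assume "W \<in> H"
    then obtain x where x: "x \<in> W" "x \<noteq> 0" using assms(2) vec.subspace_0 by blast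
    show "generic 2 (\<lambda>b. \<exists>x\<in>W. b 0 \<odot> x \<noteq> 0)"
      by (rule generic_mono[OF generic_dotp_nonzero[OF x(2) v2]]) (use x(1) in blast)
  qed
qed

text \<open>The bound for \<open>W\<close> needs a frame whose \<open>b 0\<close> does not vanish on
  \<open>W\<close>. Both this and the independence of \<open>A\<close> are generic, so one frame has
  both properties.\<close>

lemma C_indep_A: "C_indep d A"
  unfolding C_indep_def
proof (intro conjI allI impI finA)
  fix W :: "('k ^ 'v) set" assume W: "vec.subspace W \<and> W \<noteq> {0}"
  obtain b where b: "indep_on (Jf b d) A" "\<forall>W\<in>{W}. \<exists>x\<in>W. b 0 \<odot> x \<noteq> 0"
    using generic_ex[OF generic_conj[OF generic_A generic_meets[of "{W}"]]] W by auto
  then obtain x where "x \<in> W" "b 0 \<odot> x \<noteq> 0" by blast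
  then show "card (A \<inter> proj_set W) \<le> lin_bound d W"
    using indep_on_linear_card_le[of W x b d "A \<inter> proj_set W"] indep_on_subset[OF b(1)] W by simp
qed

lemma card_A_le_Ex_C: "card A \<le> Ex_C Z d"
proof -
  obtain H where H: "finite H" "\<And>W. W \<in> H \<Longrightarrow> vec.subspace W \<and> W \<noteq> {0}" "Z \<subseteq> (\<Union>W\<in>H. proj_set W)"
    "Ex_C Z d = (\<Sum>W\<in>H. lin_bound d W)" using Ex_C_attained[OF Z(2)] by metis
  have "card A \<le> card (\<Union>W\<in>H. A \<inter> proj_set W)"
    by (rule card_mono) (use H A(1) finA in auto)
  also have "\<dots> \<le> (\<Sum>W\<in>H. card (A \<inter> proj_set W))" by (rule card_UN_le[OF H(1)])
  also have "\<dots> \<le> (\<Sum>W\<in>H. lin_bound d W)"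
    by (rule sum_mono) (use C_indep_A H(2) in \<open>auto simp: C_indep_def\<close>)
  finally show ?thesis using H(4) by simp
qed

abbreviation IQ :: "('k ^ 'v) set \<Rightarrow> ('v, 'k) mpoly set" where "IQ Q \<equiv> ideal_power (vanishing_ideal (proj_set Q)) (d - 1)"

lemma IQ_perp: "frame 2 b \<Longrightarrow> IQ (perp 2 b) \<inter> hom_part (int d) = Jf b d"
  by (rule ideal_power_eq_Jf[OF _ v d])

lemma general_Q:
  assumes "generic 2 (\<lambda>b. P (Jf b d))"
  shows "general_subspace (CARD('v) - 2) (\<lambda>Q. P (IQ Q \<inter> hom_part (int d)))"
  by (rule general_subspace_perp[OF _ v2], rule generic_mono[OF assms]) (simp add: IQ_perp)

lemma vanishing_Jf_iff:
  fixes X :: "('k ^ 'v) set set"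
  assumes "X \<subseteq> proj_points" "F \<in> Jf b d"
  shows "F \<in> vanishing_ideal X \<longleftrightarrow> (\<forall>P\<in>X. ev F (rp P) = 0)"
proof -
  have F: "F \<in> hom_part (int d)" using subsetD[OF Jf_subset_hom_part assms(2)] .
  have "vanishes_at F P \<longleftrightarrow> ev F (rp P) = 0" if "P \<in> X" for P
    using vanishes_at_hom[OF _ F, of P] that assms(1) by blast
  then show ?thesis by (simp add: vanishing_ideal_def)
qed

lemma strict_imp_very_unexpected:
  assumes strict: "card A < Ex_C Z d"
  shows "very_unexpected Z d"
proof -
  obtain U where U: "A \<subseteq> U" "U \<subseteq> Z" "C_indep d U" "Ex_C Z d \<le> card U"
    using C_indep_maximal[OF Z(1,2) A(1) C_indep_A] by blast
  have UP: "U \<subseteq> proj_points" and finU: "finite U" using U(2) Z finite_subset by auto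
  have I: "generic 2 (\<lambda>b. vanishing_ideal Z \<inter> Jf b d = vanishing_ideal U \<inter> Jf b d)"
  proof (rule generic_mono[OF generic_A])
    fix b :: "nat \<Rightarrow> 'k ^ 'v" assume b: "indep_on (Jf b d) A"
    have "F \<in> vanishing_ideal Z \<longleftrightarrow> F \<in> vanishing_ideal U" if F: "F \<in> Jf b d" for F
      using A_basis[OF b F] U(1,2) unfolding vanishing_Jf_iff[OF Z(2) F] vanishing_Jf_iff[OF UP F] by blast
    then show "vanishing_ideal Z \<inter> Jf b d = vanishing_ideal U \<inter> Jf b d" by blast
  qed
  have III: "generic 2 (\<lambda>b. quot_dim (Jf b d) (vanishing_ideal U \<inter> Jf b d) <
      quot_dim (hom_part (int d)) (vanishing_ideal U \<inter> hom_part (int d)))"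
  \<comment> \<open>No genericity is involved: for every frame the rank of \<open>U\<close> on
    \<open>Jf b d\<close> is at most \<open>card A\<close>, while on all forms of degree
    \<open>d\<close> the points of \<open>U\<close> are independent.\<close>
  proof (rule generic_mono[OF generic_True[OF v2]])
    fix b :: "nat \<Rightarrow> 'k ^ 'v"
    obtain B where B: "B \<subseteq> U" "indep_on (Jf b d) B" "quot_dim (Jf b d) (vanishing_ideal U \<inter> Jf b d) = card B"
      using quot_dim_basis[OF subspace_Jf Jf_subset_hom_part UP, of b d] by metis
    have "card B \<le> card A" using A_max B(1,2) U(2) by blast
    moreover obtain C where C: "C \<subseteq> U" "indep_on (hom_part (int d)) C"
      "quot_dim (hom_part (int d)) (vanishing_ideal U \<inter> hom_part (int d)) = card C"
      "\<And>B. B \<subseteq> U \<Longrightarrow> indep_on (hom_part (int d)) B \<Longrightarrow> card B \<le> card C"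
      by (rule quot_dim_basis[where J = "hom_part (int d)" and d = d, OF subspace_hom_part subset_refl UP]) (erule that; blast)
    have "card U \<le> card C" using C(4) C_indep_imp_indep_on[OF U(3) UP] by blast
    ultimately show "quot_dim (Jf b d) (vanishing_ideal U \<inter> Jf b d) <
        quot_dim (hom_part (int d)) (vanishing_ideal U \<inter> hom_part (int d))"
      using B(3) C(3) strict U(4) by simp
  qed
  show ?thesis unfolding very_unexpected_def Let_def Int_assoc
  proof (intro exI[of _ U] conjI U(2) allI impI)
    show "general_subspace (CARD('v) - 2) (\<lambda>Q. vanishing_ideal Z \<inter> (IQ Q \<inter> hom_part (int d)) = vanishing_ideal U \<inter> (IQ Q \<inter> hom_part (int d)))"
      by (rule general_Q[OF I])
    show "general_subspace (CARD('v) - 2) (\<lambda>Q. quot_dim (IQ Q \<inter> hom_part (int d)) (vanishing_ideal U \<inter> (IQ Q \<inter> hom_part (int d))) <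
        quot_dim (hom_part (int d)) (vanishing_ideal U \<inter> hom_part (int d)))"
      by (rule general_Q[OF III])
    fix X :: "('k ^ 'v) set set" assume X: "irreducible_subvariety X"
    show "general_subspace (CARD('v) - 2) (\<lambda>Q. card (U \<inter> X) \<le> quot_dim (IQ Q \<inter> hom_part (int d)) (vanishing_ideal X \<inter> (IQ Q \<inter> hom_part (int d))))"
      by (rule general_Q[OF quot_dim_irreducible[OF X d U(3) v2]])
  qed
qed

lemma very_unexpected_imp_strict:
  assumes vu: "very_unexpected Z d"
  shows "card A < Ex_C Z d"
proof (rule ccontr)
  assume "\<not> card A < Ex_C Z d"
  then have le: "Ex_C Z d \<le> card A" by simp
  obtain H where H: "finite H" "\<And>W. W \<in> H \<Longrightarrow> vec.subspace W \<and> W \<noteq> {0}" "Z \<subseteq> (\<Union>W\<in>H. proj_set W)"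
    "Ex_C Z d = (\<Sum>W\<in>H. lin_bound d W)" using Ex_C_attained[OF Z(2)] by metis
  have H0: "H \<noteq> {}" using H(3) Z(3) by blast
  let ?m = "CARD('v) - 2"
  let ?J = "\<lambda>Q. IQ Q \<inter> hom_part (int d)"
  obtain U where U: "U \<subseteq> Z"
    and I: "general_subspace ?m (\<lambda>Q. vanishing_ideal Z \<inter> ?J Q = vanishing_ideal U \<inter> ?J Q)"
    and II: "\<And>X. irreducible_subvariety X \<Longrightarrow> general_subspace ?m (\<lambda>Q. card (U \<inter> X) \<le> quot_dim (?J Q) (vanishing_ideal X \<inter> ?J Q))"
    and III: "general_subspace ?m (\<lambda>Q. quot_dim (?J Q) (vanishing_ideal U \<inter> ?J Q) < quot_dim (hom_part (int d)) (vanishing_ideal U \<inter> hom_part (int d)))"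
    using vu unfolding very_unexpected_def Let_def Int_assoc by blast
  \<comment> \<open>The open set in the second condition varies with the variety, but only the
    finitely many members of the optimal covering are needed.\<close>
  have II': "general_subspace ?m (\<lambda>Q. \<forall>W\<in>H. card (U \<inter> proj_set W) \<le> quot_dim (?J Q) (vanishing_ideal (proj_set W) \<inter> ?J Q))"
    using H(2) by (intro general_subspace_ball[OF H(1) _ H0] II irreducible_proj_set) auto
  have "generic 2 (\<lambda>b. indep_on (Jf b d) A \<and> (\<forall>W\<in>H. \<exists>x\<in>W. b 0 \<odot> x \<noteq> 0))"
    by (intro generic_conj generic_A generic_meets H(1,2))
  \<comment> \<open>To pass from frames to \<open>Q\<close> the property must depend on the
    annihilator alone, so the frame is hidden behind an existential quantifier.\<close>
  then have "generic 2 (\<lambda>b. \<exists>c. frame 2 c \<and> perp 2 b = perp 2 c \<and> indep_on (Jf c d) A \<and> (\<forall>W\<in>H. \<exists>x\<in>W. c 0 \<odot> x \<noteq> 0))"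
    by (rule generic_mono) blast
  then have IV: "general_subspace ?m (\<lambda>Q. \<exists>c. frame 2 c \<and> Q = perp 2 c \<and> indep_on (Jf c d) A \<and> (\<forall>W\<in>H. \<exists>x\<in>W. c 0 \<odot> x \<noteq> 0))"
    by (rule general_subspace_perp[OF _ v2])
  obtain Q where Q: "vanishing_ideal Z \<inter> ?J Q = vanishing_ideal U \<inter> ?J Q"
    "\<forall>W\<in>H. card (U \<inter> proj_set W) \<le> quot_dim (?J Q) (vanishing_ideal (proj_set W) \<inter> ?J Q)"
    "quot_dim (?J Q) (vanishing_ideal U \<inter> ?J Q) < quot_dim (hom_part (int d)) (vanishing_ideal U \<inter> hom_part (int d))"
    "\<exists>c. frame 2 c \<and> Q = perp 2 c \<and> indep_on (Jf c d) A \<and> (\<forall>W\<in>H. \<exists>x\<in>W. c 0 \<odot> x \<noteq> 0)"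
    using generic_ex[OF general_subspace_conj[OF I general_subspace_conj[OF II' general_subspace_conj[OF III IV]], unfolded general_subspace_generic]]
    by blast
  obtain c where c: "frame 2 c" "Q = perp 2 c" "indep_on (Jf c d) A" "\<forall>W\<in>H. \<exists>x\<in>W. c 0 \<odot> x \<noteq> 0"
    using Q(4) by blast
  have "?J Q = Jf c d" unfolding c(2) by (rule IQ_perp[OF c(1)])
  note Q' = Q(1-3)[unfolded this]
  have UP: "U \<subseteq> proj_points" and finU: "finite U" using U Z finite_subset by auto
  have "card U \<le> card (\<Union>W\<in>H. U \<inter> proj_set W)" by (rule card_mono) (use H U finU in auto)
  also have "\<dots> \<le> (\<Sum>W\<in>H. card (U \<inter> proj_set W))" by (rule card_UN_le[OF H(1)])
  also have "\<dots> \<le> (\<Sum>W\<in>H. lin_bound d W)"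
  proof (rule sum_mono)
    fix W assume W: "W \<in> H"
    have WP: "proj_set W \<subseteq> proj_points" by (auto simp: proj_set_def)
    obtain B where B: "B \<subseteq> proj_set W" "indep_on (Jf c d) B" "quot_dim (Jf c d) (vanishing_ideal (proj_set W) \<inter> Jf c d) = card B"
      using quot_dim_basis[OF subspace_Jf Jf_subset_hom_part WP, of c d] by metis
    obtain x where x: "x \<in> W" "c 0 \<odot> x \<noteq> 0" using c(4) W by blast
    have "card B \<le> lin_bound d W" by (rule indep_on_linear_card_le[OF _ x B(2,1)]) (use H(2)[OF W] in blast)
    then show "card (U \<inter> proj_set W) \<le> lin_bound d W" using Q'(2) W B(3) by fastforce
  qed
  finally have UA: "card U \<le> card A" using H(4) le by simp
  obtain C where C: "C \<subseteq> U" "quot_dim (hom_part (int d)) (vanishing_ideal U \<inter> hom_part (int d)) = card C"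
    using quot_dim_basis[OF subspace_hom_part subset_refl UP, of d] by metis
  obtain B where B: "B \<subseteq> Z" "indep_on (Jf c d) B" "quot_dim (Jf c d) (vanishing_ideal Z \<inter> Jf c d) = card B"
    "\<And>B'. B' \<subseteq> Z \<Longrightarrow> indep_on (Jf c d) B' \<Longrightarrow> card B' \<le> card B"
    by (rule quot_dim_basis[OF subspace_Jf Jf_subset_hom_part Z(2), of c d]) (erule that; blast)
  have "card A \<le> card B" using B(4) A(1) c(3) by blast
  also have "\<dots> < card C" using Q'(3) B(3) C(2) Q'(1) by simp
  also have "\<dots> \<le> card U" by (rule card_mono[OF finU C(1)])
  finally show False using UA by simp
qed

end

lemma duality_exists:
  fixes Z :: "('k::alg_closed_field ^ 'v) set set"
  assumes "2 < CARD('v)" "d \<ge> 1" "finite Z" "Z \<subseteq> proj_points" "Z \<noteq> {}"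
  obtains A where "duality Z d A"
proof -
  let ?P = "\<lambda>A. A \<subseteq> Z \<and> (\<exists>b :: nat \<Rightarrow> 'k ^ 'v. indep_on (Jf b d) A)"
  have "\<exists>A. ?P A \<and> (\<forall>A'. ?P A' \<longrightarrow> card A' \<le> card A)"
    by (rule ex_has_greatest_nat[of ?P "{}" card "Suc (card Z)"])
      (use assms in \<open>auto simp: indep_on_empty less_Suc_eq_le intro: card_mono\<close>)
  then obtain A where "?P A" "\<And>A'. ?P A' \<Longrightarrow> card A' \<le> card A" by blast
  then have "duality Z d A" using assms by unfold_locales blast+
  then show thesis by (rule that)
qed

theorem theorem5p27:
  fixes Z :: "('k::alg_closed_field ^ 'v::finite) set set"
    and a :: "nat \<Rightarrow> int" and n d :: nat
  assumes "n \<ge> 2" and "CARD('v) = n + 1"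
    and "Z \<subseteq> proj_points" and "finite Z" and "Z \<noteq> {}"
    and "has_splitting_type (dual_arrangement Z) a"
    and "d \<ge> 1"
  shows "(\<Sum>i=1..n. max 0 (int d - a i)) \<ge> int (n * d) + 1 - int (Ex_C Z d) \<and>
    ((\<Sum>i=1..n. max 0 (int d - a i)) > int (n * d) + 1 - int (Ex_C Z d) \<longleftrightarrow> very_unexpected Z d)"
proof -
  have "2 < CARD('v)" using assms(1,2) by simp
  then obtain A where "duality Z d A" using duality_exists assms(3-5,7) by blast
  then interpret duality Z d A .
  have "(\<Sum>i=1..n. max 0 (int d - a i)) = int (n * d) + 1 - int (card A)"
    using splitting_sum[OF assms(6)] assms(2) by simp
  moreover have "card A < Ex_C Z d \<longleftrightarrow> very_unexpected Z d"
    using strict_imp_very_unexpected very_unexpected_imp_strict by blast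
  ultimately show ?thesis using card_A_le_Ex_C by auto
qed

end
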